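(* Let $*\in\{\leq,\triangleleft\}$. (1) If $L$ is a solvable $\mathbb{Z}$-Lie algebra of dimension $n\leq3$, then $\zeta_{L(\mathbb{F}_p)}^{*}(s)$ is PORC. (2) There exists a solvable $\mathbb{Z}$-Lie algebra $L$ of dimension $n=4$ such that $\zeta_{L(\mathbb{F}_p)}^{*}(s)$ is non-PORC.
   Context: A $\mathbb{Z}$-Lie algebra is assumed to be free and finitely generated as a $\mathbb{Z}$-module; its dimension is its rank. For a prime $p$, $L(\mathbb{F}_p)=L\otimes_{\mathbb{Z}}\mathbb{F}_p$, and $\zeta^{*}_{L(\mathbb{F}_p)}(s)=\sum_{i=0}^{n}a^{*}_{p^i}(L(\mathbb{F}_p))\,p^{-is}$, where $a^{\leq}_{p^i}$ (respectively $a^{\triangleleft}_{p^i}$) is the number of Lie subalgebras (respectively ideals) of codimension $i$ over $\mathbb{F}_p$. $\zeta_{L(\mathbb{F}_p)}^{*}(s)$ is called PORC (Polynomial On Residue Classes) if there exist a fixed positive integer $N$ and polynomials $W_i(X,Y)\in\mathbb{Q}[X,Y]$ for $i\in\{0,1,\dots,N-1\}$ such that for every prime $p$, if $p\equiv i \bmod N$ then $\zeta_{L(\mathbb{F}_p)}^{*}(s)=W_i(p,p^{-s})$. It is called non-PORC if there is no such $N$. *)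

theory Defs
  imports
    "HOL-Algebra.Module"
    "HOL-Algebra.IntRing"
    "HOL-Algebra.Generated_Groups"
    "HOL-Algebra.Free_Abelian_Groups"
    "HOL-Number_Theory.Residues"
    "HOL-Computational_Algebra.Polynomial"
    "HOL-Analysis.Complex_Transcendental"
begin

(* The multiplicative fields mult and one inherited from the record of rings play no role. *)
record ('a, 'b) lie_alg = "('a, 'b) module" +
  bracket :: "'b \<Rightarrow> 'b \<Rightarrow> 'b"

locale lie_algebra = Module.module R L
  for R :: "('a, 'r) ring_scheme" (structure) and L :: "('a, 'b, 'm) lie_alg_scheme" (structure) +
  assumes bracket_closed:
      "\<lbrakk>x \<in> carrier L; y \<in> carrier L\<rbrakk> \<Longrightarrow> bracket L x y \<in> carrier L"
    and bracket_add_left: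
      "\<lbrakk>x \<in> carrier L; y \<in> carrier L; z \<in> carrier L\<rbrakk> \<Longrightarrow>
        bracket L (x \<oplus>\<^bsub>L\<^esub> y) z = bracket L x z \<oplus>\<^bsub>L\<^esub> bracket L y z"
    and bracket_add_right:
      "\<lbrakk>x \<in> carrier L; y \<in> carrier L; z \<in> carrier L\<rbrakk> \<Longrightarrow>
        bracket L x (y \<oplus>\<^bsub>L\<^esub> z) = bracket L x y \<oplus>\<^bsub>L\<^esub> bracket L x z"
    and bracket_smult_left:
      "\<lbrakk>a \<in> carrier R; x \<in> carrier L; y \<in> carrier L\<rbrakk> \<Longrightarrow>
        bracket L (a \<odot>\<^bsub>L\<^esub> x) y = a \<odot>\<^bsub>L\<^esub> bracket L x y"
    and bracket_smult_right:
      "\<lbrakk>a \<in> carrier R; x \<in> carrier L; y \<in> carrier L\<rbrakk> \<Longrightarrow>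
        bracket L x (a \<odot>\<^bsub>L\<^esub> y) = a \<odot>\<^bsub>L\<^esub> bracket L x y"
    and bracket_self:
      "x \<in> carrier L \<Longrightarrow> bracket L x x = \<zero>\<^bsub>L\<^esub>"
    and jacobi:
      "\<lbrakk>x \<in> carrier L; y \<in> carrier L; z \<in> carrier L\<rbrakk> \<Longrightarrow>
        bracket L x (bracket L y z) \<oplus>\<^bsub>L\<^esub> bracket L y (bracket L z x)
          \<oplus>\<^bsub>L\<^esub> bracket L z (bracket L x y) = \<zero>\<^bsub>L\<^esub>"

(* Only finite bases are considered. Coefficient families are extensional (undefined off B), so
   that uniqueness of the family is uniqueness of its values on B. *)
definition is_basis :: "('a, 'r) ring_scheme \<Rightarrow> ('a, 'b, 'm) module_scheme \<Rightarrow> 'b set \<Rightarrow> bool" where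
  "is_basis R M B \<longleftrightarrow> finite B \<and> B \<subseteq> carrier M \<and>
     (\<forall>x\<in>carrier M. \<exists>!c. c \<in> B \<rightarrow>\<^sub>E carrier R \<and> x = (\<Oplus>\<^bsub>M\<^esub>b\<in>B. c b \<odot>\<^bsub>M\<^esub> b))"

(* Meaningful only if a finite basis exists; the common cardinality of all bases
   when R is a nontrivial commutative ring. *)
definition module_rank :: "('a, 'r) ring_scheme \<Rightarrow> ('a, 'b, 'm) module_scheme \<Rightarrow> nat" where
  "module_rank R M = (THE n. \<exists>B. is_basis R M B \<and> card B = n)"

definition Z_lie_algebra :: "(int, 'b, 'm) lie_alg_scheme \<Rightarrow> bool" where
  "Z_lie_algebra L \<longleftrightarrow> lie_algebra \<Z> L \<and> (\<exists>B. is_basis \<Z> L B)"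

definition commutator_submodule ::
    "('a, 'r) ring_scheme \<Rightarrow> ('a, 'b, 'm) lie_alg_scheme \<Rightarrow> 'b set \<Rightarrow> 'b set \<Rightarrow> 'b set" where
  "commutator_submodule R L A B =
     \<Inter>{H. submodule H R L \<and> (\<forall>x\<in>A. \<forall>y\<in>B. bracket L x y \<in> H)}"

primrec derived_series ::
    "('a, 'r) ring_scheme \<Rightarrow> ('a, 'b, 'm) lie_alg_scheme \<Rightarrow> nat \<Rightarrow> 'b set" where
  "derived_series R L 0 = carrier L"
| "derived_series R L (Suc k) =
     commutator_submodule R L (derived_series R L k) (derived_series R L k)"

definition lie_solvable :: "('a, 'r) ring_scheme \<Rightarrow> ('a, 'b, 'm) lie_alg_scheme \<Rightarrow> bool" where
  "lie_solvable R L \<longleftrightarrow> (\<exists>k. derived_series R L k = {\<zero>\<^bsub>L\<^esub>})"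

(* The tensor product over the integers of a Z-Lie algebra L and a commutative ring S, as an
   S-Lie algebra: the free abelian group on the pairs (x, a), standing for the tensor of x and a,
   modulo the biadditivity relations. These already imply the relation identifying (k x, a) with
   (x, k a) for an integer k. *)
definition tensor_free ::
    "(int, 'b, 'm) lie_alg_scheme \<Rightarrow> ('c, 's) ring_scheme \<Rightarrow> ('b \<times> 'c \<Rightarrow>\<^sub>0 int) monoid" where
  "tensor_free L S = free_Abelian_group (carrier L \<times> carrier S)"

definition tensor_rel ::
    "(int, 'b, 'm) lie_alg_scheme \<Rightarrow> ('c, 's) ring_scheme \<Rightarrow> ('b \<times> 'c \<Rightarrow>\<^sub>0 int) set" where
  "tensor_rel L S = generate (tensor_free L S)
     ({frag_of (x \<oplus>\<^bsub>L\<^esub> y, a) - frag_of (x, a) - frag_of (y, a) | x y a.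
         x \<in> carrier L \<and> y \<in> carrier L \<and> a \<in> carrier S}
      \<union> {frag_of (x, a \<oplus>\<^bsub>S\<^esub> b) - frag_of (x, a) - frag_of (x, b) | x a b.
         x \<in> carrier L \<and> a \<in> carrier S \<and> b \<in> carrier S})"

definition tensor_free_smult ::
    "('c, 's) ring_scheme \<Rightarrow> 'c \<Rightarrow> ('b \<times> 'c \<Rightarrow>\<^sub>0 int) \<Rightarrow> ('b \<times> 'c \<Rightarrow>\<^sub>0 int)" where
  "tensor_free_smult S c u = frag_extend (\<lambda>(x, a). frag_of (x, c \<otimes>\<^bsub>S\<^esub> a)) u"

definition tensor_free_bracket ::
    "(int, 'b, 'm) lie_alg_scheme \<Rightarrow> ('c, 's) ring_scheme \<Rightarrow>
      ('b \<times> 'c \<Rightarrow>\<^sub>0 int) \<Rightarrow> ('b \<times> 'c \<Rightarrow>\<^sub>0 int) \<Rightarrow> ('b \<times> 'c \<Rightarrow>\<^sub>0 int)" where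
  "tensor_free_bracket L S u v =
     frag_extend (\<lambda>(x, a). frag_extend (\<lambda>(y, b). frag_of (bracket L x y, a \<otimes>\<^bsub>S\<^esub> b)) v) u"

(* The unions below are over representatives of cosets, as for the product in FactRing. *)
definition lie_tensor ::
    "(int, 'b, 'm) lie_alg_scheme \<Rightarrow> ('c, 's) ring_scheme \<Rightarrow> ('c, ('b \<times> 'c \<Rightarrow>\<^sub>0 int) set) lie_alg" where
  "lie_tensor L S =
     (let F = tensor_free L S; K = tensor_rel L S in
       \<lparr>carrier = carrier (F Mod K),
        monoid.mult = undefined,
        one = undefined,
        ring.zero = \<one>\<^bsub>F Mod K\<^esub>,
        ring.add = monoid.mult (F Mod K),
        module.smult = (\<lambda>c X. \<Union>u\<in>X. K #>\<^bsub>F\<^esub> tensor_free_smult S c u),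
        bracket = (\<lambda>X Y. \<Union>u\<in>X. \<Union>v\<in>Y. K #>\<^bsub>F\<^esub> tensor_free_bracket L S u v)\<rparr>)"

definition lie_subalgebra ::
    "('a, 'r) ring_scheme \<Rightarrow> ('a, 'b, 'm) lie_alg_scheme \<Rightarrow> 'b set \<Rightarrow> bool" where
  "lie_subalgebra R L H \<longleftrightarrow> submodule H R L \<and> (\<forall>x\<in>H. \<forall>y\<in>H. bracket L x y \<in> H)"

definition lie_ideal ::
    "('a, 'r) ring_scheme \<Rightarrow> ('a, 'b, 'm) lie_alg_scheme \<Rightarrow> 'b set \<Rightarrow> bool" where
  "lie_ideal R L H \<longleftrightarrow> submodule H R L \<and> (\<forall>x\<in>carrier L. \<forall>y\<in>H. bracket L x y \<in> H)"

definition has_codim ::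
    "('a, 'r) ring_scheme \<Rightarrow> ('a, 'b, 'm) module_scheme \<Rightarrow> 'b set \<Rightarrow> nat \<Rightarrow> bool" where
  "has_codim R M H i \<longleftrightarrow> module_rank R M = module_rank R (M\<lparr>carrier := H\<rparr>) + i"

datatype substructure = Subalgebras | Ideals

primrec is_substructure ::
    "substructure \<Rightarrow> ('a, 'r) ring_scheme \<Rightarrow> ('a, 'b, 'm) lie_alg_scheme \<Rightarrow> 'b set \<Rightarrow> bool" where
  "is_substructure Subalgebras R L H = lie_subalgebra R L H"
| "is_substructure Ideals R L H = lie_ideal R L H"

definition count_codim ::
    "substructure \<Rightarrow> ('a, 'r) ring_scheme \<Rightarrow> ('a, 'b, 'm) lie_alg_scheme \<Rightarrow> nat \<Rightarrow> nat" where
  "count_codim star R L i = card {H. is_substructure star R L H \<and> has_codim R L H i}"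

definition zeta_Fp ::
    "substructure \<Rightarrow> (int, 'b, 'm) lie_alg_scheme \<Rightarrow> nat \<Rightarrow> complex \<Rightarrow> complex" where
  "zeta_Fp star L p s =
     (\<Sum>i\<le>module_rank \<Z> L.
        of_nat (count_codim star (residue_ring (int p)) (lie_tensor L (residue_ring (int p))) i)
          * of_nat p powr (- (of_nat i * s)))"

(* Q[X,Y] is represented as Q[X][Y]: the coefficients of W are polynomials in X. *)
definition eval_XY :: "rat poly poly \<Rightarrow> complex \<Rightarrow> complex \<Rightarrow> complex" where
  "eval_XY W x y = poly (map_poly (\<lambda>q. poly (map_poly of_rat q) x) W) y"

definition PORC :: "substructure \<Rightarrow> (int, 'b, 'm) lie_alg_scheme \<Rightarrow> bool" where
  "PORC star L \<longleftrightarrow>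
     (\<exists>N>0. \<exists>W :: nat \<Rightarrow> rat poly poly. \<forall>p :: nat. \<forall>i<N.
        Factorial_Ring.prime p \<and> [p = i] (mod N) \<longrightarrow>
          (\<forall>s. zeta_Fp star L p s = eval_XY (W i) (of_nat p) (of_nat p powr (- s))))"

end

(* A subspace of L(F_p) is the image of a unique lattice between p L and L, so the coefficients of the
   zeta function count such lattices that are closed under the bracket. A solvable L of rank 3 has a
   nonzero integral functional killing all brackets. From this one finds, in a sublattice of finite
   index, a basis e1, e2, e3 in which e2 and e3 commute and ad e1 maps their span to itself by an integral
   2x2 matrix D. For all large p the counts are then given by the numbers of zeros modulo p of the binary
   quadratic forms det(v, D v) and its transpose, that is, by the Legendre symbol of the discriminant,
   which depends only on a residue class of p.

   In rank 4 take the semidirect product of Z with Z^3, the generator acting by a matrix with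
   characteristic polynomial X^3 - 2. For p = 1 modulo 3 the number of subalgebras of codimension 1
   (of ideals of codimension 3) is 1 (is 0) exactly if 2 is not a cube modulo p. Every modulus N
   admits infinitely many primes p = 1 modulo 3 N of either kind, so PORC would force the count
   on the class of 1 to be a constant polynomial. The primes of either kind are found by elementary
   means, from norms in cyclotomic rings. *)
theory Submission
  imports Defs "HOL-Number_Theory.Pocklington" "HOL-Number_Theory.Quadratic_Reciprocity"
begin

section \<open>Subgroups of finite index and prime ideals\<close>

text \<open>The obstacle is the supply of primes for rank 4: both kinds are needed in the class of 1
  modulo an arbitrary \<open>N\<close>, which is a Chebotarev statement. It is reached by one
  element of a cyclotomic ring whose norm forces a suitable prime divisor. For cubes the element is
  1 - 2 v^3, modulo whose prime divisors 2 is visibly a cube. For noncubes it is A^2 + A B + B^2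
  with A = u^(3^(k+1)), B = (2 v^3)^(3^k) and u + v = 1. Away from 2, 3 and a chosen integer, a
  prime ideal containing it sees u^3 / (2 v^3) with order exactly 3^(k+1) in its residue field,
  while the norm is not 1 modulo 3^(k+2). So some prime ideal has an index q for which 3^(k+1) is
  the full power of 3 in q - 1, and there u^3 / (2 v^3), hence 2, is not a cube. That the residue
  characteristic is 1 modulo the part of \<open>N\<close> prime to 3 is read off from Frobenius
  fixing v. Finitely many unwanted primes are kept away by giving v a large integer factor. The
  cyclotomic ring is represented by integer polynomials modulo an ideal \<open>J0\<close>, and
  invariants are shown to be integers from traces of powers and bounded denominators.\<close>

definition add_subgroup :: "'a::ab_group_add set \<Rightarrow> bool" where
  "add_subgroup J \<longleftrightarrow> 0 \<in> J \<and> (\<forall>x\<in>J. \<forall>y\<in>J. x - y \<in> J)"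

definition add_coset :: "'a::ab_group_add set \<Rightarrow> 'a \<Rightarrow> 'a set" where
  "add_coset J x = {y. y - x \<in> J}"

definition index :: "'a::ab_group_add set \<Rightarrow> nat" where
  "index J = card (range (add_coset J))"

definition finite_index :: "'a::ab_group_add set \<Rightarrow> bool" where
  "finite_index J \<longleftrightarrow> finite (range (add_coset J))"

lemma add_subgroupI: "\<lbrakk>0 \<in> J; \<And>x y. \<lbrakk>x \<in> J; y \<in> J\<rbrakk> \<Longrightarrow> x - y \<in> J\<rbrakk> \<Longrightarrow> add_subgroup J"
  by (simp add: add_subgroup_def)

lemma add_subgroup_zero: "add_subgroup J \<Longrightarrow> 0 \<in> J"
  by (simp add: add_subgroup_def)

lemma add_subgroup_diff: "\<lbrakk>add_subgroup J; x \<in> J; y \<in> J\<rbrakk> \<Longrightarrow> x - y \<in> J"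
  by (simp add: add_subgroup_def)

lemma add_subgroup_uminus: "\<lbrakk>add_subgroup J; x \<in> J\<rbrakk> \<Longrightarrow> - x \<in> J"
  using add_subgroup_diff[of J 0 x] add_subgroup_zero[of J] by simp

lemma add_subgroup_add: "\<lbrakk>add_subgroup J; x \<in> J; y \<in> J\<rbrakk> \<Longrightarrow> x + y \<in> J"
  using add_subgroup_diff[of J x "-y"] add_subgroup_uminus[of J y] by simp

lemma add_coset_eq_iff: "add_subgroup J \<Longrightarrow> add_coset J x = add_coset J y \<longleftrightarrow> x - y \<in> J"
proof
  assume J: "add_subgroup J"
  assume "add_coset J x = add_coset J y"
  then have "x \<in> add_coset J y" using add_subgroup_zero[OF J] by (auto simp: add_coset_def)
  then show "x - y \<in> J" by (simp add: add_coset_def)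
next
  assume J: "add_subgroup J" and xy: "x - y \<in> J"
  have "z - x \<in> J \<longleftrightarrow> z - y \<in> J" for z
    using add_subgroup_add[OF J _ xy, of "z - x"] add_subgroup_diff[OF J _ xy, of "z - y"] by auto
  then show "add_coset J x = add_coset J y" by (auto simp: add_coset_def)
qed

lemma card_range_cong:
  assumes "\<And>x y. f x = f y \<longleftrightarrow> g x = g y"
  shows "card (range f) = card (range g)"
proof (rule bij_betw_same_card)
  show "bij_betw (\<lambda>c. g (inv_into UNIV f c)) (range f) (range g)"
  proof (rule bij_betw_imageI)
    show "inj_on (\<lambda>c. g (inv_into UNIV f c)) (range f)"
      by (rule inj_onI) (metis assms f_inv_into_f)
    have "g (inv_into UNIV f (f x)) = g x" for x using assms[of "inv_into UNIV f (f x)" x] f_inv_into_f[of "f x" f UNIV] by simp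
    then show "(\<lambda>c. g (inv_into UNIV f c)) ` range f = range g" by (simp add: image_image)
  qed
qed

text \<open>Every coset of \<open>J'\<close> is a union of cosets of \<open>J\<close>, and
  translation carries the cosets of \<open>J\<close> inside \<open>J'\<close> bijectively to those
  inside any other coset of \<open>J'\<close>. So all fibres of \<open>f\<close>, which sends a
  coset of \<open>J\<close> to the coset of \<open>J'\<close> around it, have the same size.\<close>

lemma index_tower:
  assumes J: "add_subgroup J" and J': "add_subgroup J'" and sub: "J \<subseteq> J'" and fin: "finite_index J"
  shows "finite_index J'" "index J = index J' * card (add_coset J ` J')"
proof -
  define f where "f = (\<lambda>c. add_coset J' (SOME x. c = add_coset J x))"
  have f: "f (add_coset J x) = add_coset J' x" for x
  proof -
    have "add_coset J x = add_coset J (SOME y. add_coset J x = add_coset J y)" by (rule someI) simp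
    then have "x - (SOME y. add_coset J x = add_coset J y) \<in> J'" 
      using sub by (auto simp: add_coset_eq_iff[OF J])
    then show ?thesis unfolding f_def using iffD2[OF add_coset_eq_iff[OF J']] by simp
  qed
  have img: "f ` range (add_coset J) = range (add_coset J')"
    by (auto simp: image_iff f)
  with fin show fin': "finite_index J'" unfolding finite_index_def by (metis finite_imageI)
  have fib: "card {c \<in> range (add_coset J). f c = d} = card (add_coset J ` J')" if "d \<in> range (add_coset J')" for d
  proof -
    obtain x where x: "d = add_coset J' x" using \<open>d \<in> range (add_coset J')\<close> by blast
    have "{c \<in> range (add_coset J). f c = d} = add_coset J ` ((+) x ` J')"
    proof (intro equalityI subsetI)
      fix c assume "c \<in> {c \<in> range (add_coset J). f c = d}"
      then obtain y where "c = add_coset J y" "add_coset J' y = add_coset J' x" by (auto simp: f x)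
      then have "c = add_coset J (x + (y - x))" "y - x \<in> J'" by (auto simp: add_coset_eq_iff[OF J'])
      then show "c \<in> add_coset J ` ((+) x ` J')" by blast
    next
      fix c assume "c \<in> add_coset J ` ((+) x ` J')"
      then obtain y where y: "y \<in> J'" "c = add_coset J (x + y)" by auto
      then have "add_coset J' (x + y) = add_coset J' x" by (simp add: add_coset_eq_iff[OF J'])
      with y show "c \<in> {c \<in> range (add_coset J). f c = d}" by (simp add: f x)
    qed
    moreover have "bij_betw (\<lambda>c. (+) x ` c) (add_coset J ` J') (add_coset J ` ((+) x ` J'))"
    proof (rule bij_betw_byWitness[where f' = "\<lambda>c. (+) (-x) ` c"])
      have *: "(+) a ` add_coset J y = add_coset J (a + y)" for a y
      proof -
        have "z \<in> (+) a ` add_coset J y \<longleftrightarrow> z - a \<in> add_coset J y" for z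
          by (auto simp: image_iff intro!: bexI[of _ "z - a"])
        then show ?thesis by (auto simp: add_coset_def algebra_simps)
      qed
      show "(\<lambda>c. (+) x ` c) ` add_coset J ` J' \<subseteq> add_coset J ` (+) x ` J'" by (auto simp: *)
      have "(+) (- x) ` add_coset J (x + y) = add_coset J y" for y using *[of "- x" "x + y"] by simp
      then show "(\<lambda>c. (+) (- x) ` c) ` add_coset J ` (+) x ` J' \<subseteq> add_coset J ` J'"
        by (simp only: image_image subset_refl)
    qed (auto simp: image_image)
    ultimately show ?thesis by (simp add: bij_betw_same_card)
  qed
  have "index J = (\<Sum>d\<in>range (add_coset J'). card {c \<in> range (add_coset J). f c = d})"
    unfolding index_def img[symmetric]
    using sum.group[of "range (add_coset J)" "f ` range (add_coset J)" f "\<lambda>_. 1::nat"] fin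
    by (simp add: finite_index_def)
  also have "\<dots> = index J' * card (add_coset J ` J')" using fib by (simp add: index_def)
  finally show "index J = index J' * card (add_coset J ` J')" .
qed

lemma index_pos: "finite_index J \<Longrightarrow> index J > 0"
  unfolding finite_index_def index_def by (metis card_gt_0_iff empty_is_image UNIV_not_empty)

lemma index_eq_1:
  assumes "add_subgroup J" "index J = 1" shows "J = UNIV"
proof -
  obtain c where "range (add_coset J) = {c}" using assms(2) unfolding index_def by (meson card_1_singletonE)
  then have "add_coset J x = c" for x by (metis rangeI singletonD)
  then have "add_coset J x = add_coset J 0" for x by simp
  then have "x \<in> J" for x using add_coset_eq_iff[OF assms(1), of x 0] by simp
  then show ?thesis by auto
qed

lemma index_UNIV: "index UNIV = 1" "finite_index UNIV"
  by (auto simp: index_def finite_index_def add_coset_def)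

section \<open>Ideals, adjunction of an element, colon ideals\<close>

definition is_ideal :: "'a::comm_ring_1 set \<Rightarrow> bool" where
  "is_ideal J \<longleftrightarrow> add_subgroup J \<and> (\<forall>x\<in>J. \<forall>r. r * x \<in> J)"

definition ideal_adjoin :: "'a::comm_ring_1 set \<Rightarrow> 'a \<Rightarrow> 'a set" where
  "ideal_adjoin J a = {x + r * a | x r. x \<in> J}"

text \<open>The colon ideal (J : a), that is, the annihilator of the class of \<open>a\<close>
  modulo \<open>J\<close>.\<close>

definition ideal_quot :: "'a::comm_ring_1 set \<Rightarrow> 'a \<Rightarrow> 'a set" where
  "ideal_quot J a = {y. y * a \<in> J}"

lemma is_ideal_subgroup: "is_ideal J \<Longrightarrow> add_subgroup J"
  by (simp add: is_ideal_def)

lemma is_ideal_mult: "\<lbrakk>is_ideal J; x \<in> J\<rbrakk> \<Longrightarrow> r * x \<in> J" "\<lbrakk>is_ideal J; x \<in> J\<rbrakk> \<Longrightarrow> x * r \<in> J"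
  by (auto simp: is_ideal_def mult.commute)

lemma is_ideal_adjoin: "is_ideal J \<Longrightarrow> is_ideal (ideal_adjoin J a)"
  unfolding is_ideal_def
proof (intro conjI add_subgroupI ballI allI)
  assume J: "add_subgroup J \<and> (\<forall>x\<in>J. \<forall>r. r * x \<in> J)"
  have "0 = 0 + 0 * a" by simp
  with J show "0 \<in> ideal_adjoin J a" unfolding ideal_adjoin_def using add_subgroup_zero by blast
  fix x y assume "x \<in> ideal_adjoin J a" "y \<in> ideal_adjoin J a"
  then obtain x' y' r s where "x' \<in> J" "y' \<in> J" "x = x' + r * a" "y = y' + s * a"
    unfolding ideal_adjoin_def by blast
  then have "x - y = (x' - y') + (r - s) * a" "x' - y' \<in> J" using J add_subgroup_diff
    by (auto simp: algebra_simps)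
  then show "x - y \<in> ideal_adjoin J a" unfolding ideal_adjoin_def by blast
next
  fix x r assume J: "add_subgroup J \<and> (\<forall>x\<in>J. \<forall>r. r * x \<in> J)" and "x \<in> ideal_adjoin J a"
  then obtain x' s where "x' \<in> J" "x = x' + s * a" unfolding ideal_adjoin_def by blast
  then have "r * x = r * x' + (r * s) * a" "r * x' \<in> J" using J by (auto simp: algebra_simps)
  then show "r * x \<in> ideal_adjoin J a" unfolding ideal_adjoin_def by blast
qed

lemma is_ideal_quot: "is_ideal J \<Longrightarrow> is_ideal (ideal_quot J a)"
  by (auto simp: is_ideal_def ideal_quot_def algebra_simps add_subgroup_def)

lemma subset_ideal_adjoin: "J \<subseteq> ideal_adjoin J a"
proof
  fix x assume "x \<in> J" then show "x \<in> ideal_adjoin J a"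
    unfolding ideal_adjoin_def by (intro CollectI exI[of _ x] exI[of _ 0]) simp
qed

lemma in_ideal_adjoin: "is_ideal J \<Longrightarrow> a \<in> ideal_adjoin J a"
  unfolding ideal_adjoin_def by (intro CollectI exI[of _ 0] exI[of _ 1]) (simp add: is_ideal_def add_subgroup_zero)

lemma subset_ideal_quot: "is_ideal J \<Longrightarrow> J \<subseteq> ideal_quot J a"
  by (auto simp: ideal_quot_def is_ideal_mult)

text \<open>Multiplication by \<open>a\<close> maps the ring onto (J + (a)) / J with kernel (J :
  a).\<close>

lemma index_adjoin:
  assumes J: "is_ideal J" and fin: "finite_index J"
  shows "index J = index (ideal_adjoin J a) * index (ideal_quot J a)"
proof -
  note sg = is_ideal_subgroup[OF J]
  have eq: "add_coset J ` ideal_adjoin J a = (\<lambda>y. add_coset J (y * a)) ` UNIV"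
  proof (intro equalityI subsetI)
    fix c assume "c \<in> add_coset J ` ideal_adjoin J a"
    then obtain x r where "x \<in> J" "c = add_coset J (x + r * a)" unfolding ideal_adjoin_def by blast
    then have "c = add_coset J (r * a)" by (simp add: add_coset_eq_iff[OF sg])
    then show "c \<in> (\<lambda>y. add_coset J (y * a)) ` UNIV" by blast
  next
    fix c assume "c \<in> (\<lambda>y. add_coset J (y * a)) ` UNIV"
    then show "c \<in> add_coset J ` ideal_adjoin J a"
      using in_ideal_adjoin[OF J] is_ideal_mult[OF is_ideal_adjoin[OF J]] by blast
  qed
  have "add_coset J (x * a) = add_coset J (y * a) \<longleftrightarrow> add_coset (ideal_quot J a) x = add_coset (ideal_quot J a) y" for x y
    by (simp only: add_coset_eq_iff[OF sg] add_coset_eq_iff[OF is_ideal_subgroup[OF is_ideal_quot[OF J]]] 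
, simp only: ideal_quot_def mem_Collect_eq left_diff_distrib)
  then have "card (range (\<lambda>y. add_coset J (y * a))) = card (range (add_coset (ideal_quot J a)))"
    by (rule card_range_cong)
  then show ?thesis
    using index_tower(2)[OF sg is_ideal_subgroup[OF is_ideal_adjoin[OF J]] subset_ideal_adjoin[of J a] fin]
    unfolding eq index_def by (simp only:)
qed

section \<open>Prime ideals of finite index\<close>

definition prime_ideal :: "'a::comm_ring_1 set \<Rightarrow> bool" where
  "prime_ideal P \<longleftrightarrow> is_ideal P \<and> 1 \<notin> P \<and> (\<forall>x y. x * y \<in> P \<longrightarrow> x \<in> P \<or> y \<in> P)"

text \<open>The index is a product of indices of prime ideals, as in a composition series.
  Modulus \<open>K = 0\<close> turns the statement into the existence of a prime ideal above a proper ideal.\<close>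

lemma index_cong_1:
  fixes J :: "'a::comm_ring_1 set"
  assumes "is_ideal J" "finite_index J"
    and "\<And>P. \<lbrakk>prime_ideal P; J \<subseteq> P; finite_index P\<rbrakk> \<Longrightarrow> [index P = 1] (mod K)"
  shows "[index J = 1] (mod K)"
  using assms
proof (induction "index J" arbitrary: J rule: less_induct)
  case less
  note J = less.prems(1) and fin = less.prems(2)
  show ?case
  proof (cases "J = UNIV")
    case True
    then show ?thesis by (simp add: index_UNIV)
  next
    case False
    then obtain a0 where "a0 \<notin> J" by auto
    \<comment> \<open>A colon ideal (J : b), b outside \<open>J\<close>, of least index is a maximal
      annihilator and therefore prime: an associated prime of the quotient by
      \<open>J\<close>.\<close>
    then obtain a where a: "a \<notin> J" "\<And>b. b \<notin> J \<Longrightarrow> index (ideal_quot J a) \<le> index (ideal_quot J b)"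
      using arg_min_nat_lemma[of "\<lambda>a. a \<notin> J" a0 "\<lambda>a. index (ideal_quot J a)"] by blast
    let ?P = "ideal_quot J a"
    have P: "is_ideal ?P" using is_ideal_quot[OF J] .
    have finq: "finite_index (ideal_quot J b)" for b
      using index_tower(1)[OF is_ideal_subgroup[OF J] is_ideal_subgroup[OF is_ideal_quot[OF J]] subset_ideal_quot[OF J] fin] .
    have one: "1 \<notin> ?P" using a(1) by (simp add: ideal_quot_def)
    have prime: "prime_ideal ?P" unfolding prime_ideal_def
    proof (intro conjI allI impI)
      fix x y assume xy: "x * y \<in> ?P"
      show "x \<in> ?P \<or> y \<in> ?P"
      proof (rule ccontr)
        assume "\<not> (x \<in> ?P \<or> y \<in> ?P)"
        then have n: "x \<notin> ?P" "y * a \<notin> J" by (auto simp: ideal_quot_def)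
        \<comment> \<open>With \<open>y * a\<close> outside \<open>J\<close>, the colon ideal (J : y
          a) contains \<open>?P\<close>, and by minimality its index is not smaller, so the two
          coincide; but \<open>x\<close> lies in the larger one.\<close>
        have sub: "?P \<subseteq> ideal_quot J (y * a)"
        proof
          fix z assume "z \<in> ?P"
          then have "y * (z * a) \<in> J" by (simp add: ideal_quot_def is_ideal_mult[OF J])
          then show "z \<in> ideal_quot J (y * a)" by (simp add: ideal_quot_def ac_simps)
        qed
        have x: "x \<in> ideal_quot J (y * a)" using xy by (simp add: ideal_quot_def mult.assoc)
        have t: "index ?P = index (ideal_quot J (y * a)) * card (add_coset ?P ` ideal_quot J (y * a))"
          by (rule index_tower(2)[OF is_ideal_subgroup[OF P] is_ideal_subgroup[OF is_ideal_quot[OF J]] sub finq])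
        have "card (add_coset ?P ` ideal_quot J (y * a)) \<le> 1"
        proof (rule ccontr)
          assume "\<not> ?thesis"
          then have "index (ideal_quot J (y * a)) * 2 \<le> index ?P" unfolding t by (intro mult_le_mono2) simp
          with a(2)[OF n(2)] index_pos[OF finq, of "y * a"] show False by simp
        qed
        moreover have "finite (add_coset ?P ` ideal_quot J (y * a))"
          using finq[of a] unfolding finite_index_def by (rule finite_subset[rotated]) auto
        moreover have "add_coset ?P x \<in> add_coset ?P ` ideal_quot J (y * a)" "add_coset ?P 0 \<in> add_coset ?P ` ideal_quot J (y * a)"
          using x add_subgroup_zero[OF is_ideal_subgroup[OF is_ideal_quot[OF J, of "y * a"]]] by auto
        ultimately have "add_coset ?P x = add_coset ?P 0"
          unfolding One_nat_def by (simp only: card_le_Suc0_iff_eq)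
        with n(1) show False by (simp add: add_coset_eq_iff[OF is_ideal_subgroup[OF P]])
      qed
    qed (use P one in auto)
    have ix: "index J = index (ideal_adjoin J a) * index ?P" by (rule index_adjoin[OF J fin])
    have "index ?P \<noteq> 1" using index_eq_1[OF is_ideal_subgroup[OF P]] one by auto
    moreover have "index ?P > 0" by (rule index_pos[OF finq])
    ultimately have "index ?P \<ge> 2" by simp
    have finad: "finite_index (ideal_adjoin J a)"
      by (rule index_tower(1)[OF is_ideal_subgroup[OF J] is_ideal_subgroup[OF is_ideal_adjoin[OF J]] subset_ideal_adjoin fin])
    have "index (ideal_adjoin J a) < index J" using ix \<open>index ?P \<ge> 2\<close> index_pos[OF finad] by simp
    then have "[index (ideal_adjoin J a) = 1] (mod K)"
      using less.hyps[OF _ is_ideal_adjoin[OF J] finad] less.prems(3) subset_ideal_adjoin by blast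
    moreover have "[index ?P = 1] (mod K)" using less.prems(3)[OF prime subset_ideal_quot[OF J] finq] .
    ultimately show ?thesis using cong_mult[of "index (ideal_adjoin J a)" 1 K "index ?P" 1] ix by simp
  qed
qed

text \<open>Adjoining the integer multiples of one element \<open>a\<close> outside \<open>J\<close>
  enlarges \<open>J\<close> by exactly \<open>p\<close> cosets, since k a lies in \<open>J\<close>
  only for k divisible by \<open>p\<close>. Induction on the index then peels off one factor
  \<open>p\<close> at a time.\<close>

lemma index_prime_power:
  fixes J :: "'a::comm_ring_1 set"
  assumes "add_subgroup J" "finite_index J" "prime p" "\<And>x. of_nat p * x \<in> J"
  shows "\<exists>e. index J = p ^ e"
  using assms
proof (induction "index J" arbitrary: J rule: less_induct)
  case less
  note J = less.prems(1) and fin = less.prems(2) and p = less.prems(3) and pJ = less.prems(4)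
  show ?case
  proof (cases "J = UNIV")
    case True
    then show ?thesis by (intro exI[of _ 0]) (simp add: index_UNIV)
  next
    case False
    then obtain a where a: "a \<notin> J" by auto
    define J' where "J' = {x + of_int k * a | x k. x \<in> J}"
    have J': "add_subgroup J'"
    proof (rule add_subgroupI)
      show "0 \<in> J'" unfolding J'_def
        by (intro CollectI exI[of _ 0] conjI) (auto simp: add_subgroup_zero[OF J])
      fix x y assume "x \<in> J'" "y \<in> J'"
      then obtain x' k y' l where "x' \<in> J" "y' \<in> J" "x = x' + of_int k * a" "y = y' + of_int l * a"
        unfolding J'_def by blast
      then have "x - y = (x' - y') + of_int (k - l) * a" "x' - y' \<in> J"
        using add_subgroup_diff[OF J] by (auto simp: algebra_simps)
      then show "x - y \<in> J'" unfolding J'_def by blast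
    qed
    have sub: "J \<subseteq> J'"
    proof
      fix x assume "x \<in> J"
      then show "x \<in> J'" unfolding J'_def by (intro CollectI exI[of _ x] exI[of _ 0]) simp
    qed
    have mult: "of_int k * x \<in> J" if "x \<in> J" for k x
    proof -
      have "of_nat n * x \<in> J" for n
        by (induction n) (use that add_subgroup_zero[OF J] add_subgroup_add[OF J] in \<open>auto simp: algebra_simps\<close>)
      then have *: "of_int (int n) * x \<in> J" for n by simp
      show ?thesis
      proof (cases "k \<ge> 0")
        case True
        with *[of "nat k"] show ?thesis by simp
      next
        case False
        with add_subgroup_uminus[OF J *[of "nat (- k)"]] show ?thesis by simp
      qed
    qed
    have key: "of_int k * a \<in> J \<longleftrightarrow> int p dvd k" for k
    proof
      assume "int p dvd k"
      then obtain l where "k = int p * l" by blast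
      then have "of_int k * a = of_nat p * (of_int l * a)" by (simp add: mult.assoc)
      then show "of_int k * a \<in> J" using pJ by simp
    next
      assume k: "of_int k * a \<in> J"
      show "int p dvd k"
      proof (rule ccontr)
        assume "\<not> int p dvd k"
        then have "coprime (int p) k" using p by (simp add: prime_imp_coprime)
        then obtain u w where "u * int p + w * k = 1" using bezout_int[of "int p" k] by auto
        then have "a = of_int (u * int p + w * k) * a" by simp
        also have "\<dots> = of_nat p * (of_int u * a) + of_int w * (of_int k * a)" by (simp add: algebra_simps)
        also have "\<dots> \<in> J" by (intro add_subgroup_add[OF J] pJ mult k)
        finally show False using a by simp
      qed
    qed
    have "add_coset J ` J' = (\<lambda>k. add_coset J (of_int k * a)) ` {0..<int p}"
    proof (intro equalityI subsetI)
      fix c assume "c \<in> add_coset J ` J'"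
      then obtain x k where "x \<in> J" "c = add_coset J (x + of_int k * a)" unfolding J'_def by blast
      then have c: "c = add_coset J (of_int k * a)" by (simp add: add_coset_eq_iff[OF J])
      have "of_int k * a - of_int (k mod int p) * a \<in> J"
        using iffD2[OF key[of "k - k mod int p"] dvd_minus_mod] by (simp only: of_int_diff left_diff_distrib)
      then have "c = add_coset J (of_int (k mod int p) * a)" using c by (simp add: add_coset_eq_iff[OF J])
      moreover have "k mod int p \<in> {0..<int p}" using prime_gt_0_nat[OF p] by simp
      ultimately show "c \<in> (\<lambda>k. add_coset J (of_int k * a)) ` {0..<int p}" by blast
    next
      fix c assume "c \<in> (\<lambda>k. add_coset J (of_int k * a)) ` {0..<int p}"
      then obtain k where "c = add_coset J (0 + of_int k * a)" by auto
      then show "c \<in> add_coset J ` J'" unfolding J'_def using add_subgroup_zero[OF J] by blast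
    qed
    moreover have "inj_on (\<lambda>k. add_coset J (of_int k * a)) {0..<int p}"
    proof (rule inj_onI)
      fix k l assume kl: "k \<in> {0..<int p}" "l \<in> {0..<int p}" and eq: "add_coset J (of_int k * a) = add_coset J (of_int l * a)"
      then have "int p dvd k - l" using key[of "k - l"] by (simp add: add_coset_eq_iff[OF J] algebra_simps)
      with kl show "k = l" using zdvd_imp_le[of "int p" "k - l"] zdvd_imp_le[of "int p" "l - k"]
        by (force simp: dvd_diff_commute)
    qed
    ultimately have "card (add_coset J ` J') = p" by (simp add: card_image)
    then have ix: "index J = index J' * p" using index_tower(2)[OF J J' sub fin] by simp
    have fin': "finite_index J'" using index_tower(1)[OF J J' sub fin] .
    have "index J' < index J" using ix index_pos[OF fin'] prime_gt_1_nat[OF p] by simp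
    then obtain e where "index J' = p ^ e" using less.hyps[OF _ J' fin' p] pJ sub by blast
    then show ?thesis using ix by (intro exI[of _ "Suc e"]) simp
  qed
qed

text \<open>Translation by \<open>x\<close> permutes the finitely many cosets. In the sum of
  \<open>x + rep c - rep (f c)\<close> over all cosets the representatives cancel and the index
  times \<open>x\<close> remains.\<close>

lemma index_mult_mem:
  fixes J :: "'a::comm_ring_1 set"
  assumes J: "add_subgroup J" and fin: "finite_index J"
  shows "of_nat (index J) * x \<in> J"
proof -
  let ?C = "range (add_coset J)"
  define rep where "rep c = (SOME y. c = add_coset J y)" for c
  have rep: "add_coset J (rep c) = c" if "c \<in> ?C" for c
    using someI_ex[of "\<lambda>y. c = add_coset J y"] that unfolding rep_def by auto
  define f where "f c = add_coset J (x + rep c)" for c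
  have "inj_on f ?C"
  proof (rule inj_onI)
    fix c d assume "c \<in> ?C" "d \<in> ?C" "f c = f d"
    then have "rep c - rep d \<in> J" by (simp add: f_def add_coset_eq_iff[OF J])
    then have "add_coset J (rep c) = add_coset J (rep d)" by (simp add: add_coset_eq_iff[OF J])
    with rep[OF \<open>c \<in> ?C\<close>] rep[OF \<open>d \<in> ?C\<close>] show "c = d" by metis
  qed
  moreover have "f ` ?C \<subseteq> ?C" by (auto simp: f_def)
  ultimately have bij: "bij_betw f ?C ?C"
    using fin by (simp add: finite_index_def bij_betw_def endo_inj_surj)
  have sumJ: "(\<And>c. c \<in> D \<Longrightarrow> g c \<in> J) \<Longrightarrow> sum g D \<in> J" for g :: "'a set \<Rightarrow> 'a" and D
    by (induction D rule: infinite_finite_induct) (auto simp: add_subgroup_zero[OF J] add_subgroup_add[OF J])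
  have "(\<Sum>c\<in>?C. (x + rep c) - rep (f c)) \<in> J"
  proof (rule sumJ)
    fix c assume "c \<in> ?C"
    have "add_coset J (rep (f c)) = add_coset J (x + rep c)" using rep[of "f c"] by (simp add: f_def)
    then show "x + rep c - rep (f c) \<in> J" using iffD1[OF add_coset_eq_iff[OF J], of "x + rep c"] by simp
  qed
  moreover have "(\<Sum>c\<in>?C. rep (f c)) = (\<Sum>c\<in>?C. rep c)"
    using sum.reindex_bij_betw[OF bij, of rep] by simp
  ultimately show ?thesis by (simp add: sum_subtractf sum.distrib index_def)
qed

text \<open>As in Fermat's little theorem, multiplication by \<open>x\<close> permutes the nonzero
  cosets; the product of the representatives can be cancelled because it avoids \<open>P\<close> by
  primality.\<close>

lemma prime_ideal_fermat:
  fixes P :: "'a::comm_ring_1 set"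
  assumes P: "prime_ideal P" and fin: "finite_index P" and x: "x \<notin> P"
  shows "x ^ (index P - 1) - 1 \<in> P"
proof -
  have I: "is_ideal P" and J: "add_subgroup P" and pr: "\<And>x y. x * y \<in> P \<Longrightarrow> x \<in> P \<or> y \<in> P" and one: "1 \<notin> P"
    using P by (auto simp: prime_ideal_def is_ideal_def)
  let ?C = "range (add_coset P) - {P}"
  have P0: "add_coset P 0 = P" by (simp add: add_coset_def)
  define rep where "rep c = (SOME y. c = add_coset P y)" for c
  have rep: "add_coset P (rep c) = c" if "c \<in> range (add_coset P)" for c
    using someI_ex[of "\<lambda>y. c = add_coset P y"] that unfolding rep_def by auto
  have mem: "add_coset P y \<in> ?C \<longleftrightarrow> y \<notin> P" for y
    using add_coset_eq_iff[OF J, of y 0] by (auto simp: P0)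
  have repn: "rep c \<notin> P" if "c \<in> ?C" for c using mem[of "rep c"] rep[of c] that by auto
  define f where "f c = add_coset P (x * rep c)" for c
  have finC: "finite ?C" using fin by (simp add: finite_index_def)
  have "inj_on f ?C"
  proof (rule inj_onI)
    fix c d assume cd: "c \<in> ?C" "d \<in> ?C" "f c = f d"
    then have "x * (rep c - rep d) \<in> P" by (simp add: f_def add_coset_eq_iff[OF J] algebra_simps)
    then have "rep c - rep d \<in> P" using pr x by blast
    then have "add_coset P (rep c) = add_coset P (rep d)" by (simp add: add_coset_eq_iff[OF J])
    with rep[of c] rep[of d] cd(1,2) show "c = d" by (metis DiffD1)
  qed
  moreover have "f ` ?C \<subseteq> ?C"
  proof
    fix d assume "d \<in> f ` ?C"
    then obtain c where c: "c \<in> ?C" "d = add_coset P (x * rep c)" by (auto simp: f_def)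
    then show "d \<in> ?C" using pr[of x "rep c"] x repn[OF c(1)] mem by auto
  qed
  ultimately have bij: "bij_betw f ?C ?C" using finC by (simp add: bij_betw_def endo_inj_surj)
  have prodJ: "prod g D - prod h D \<in> P" if "\<And>c. c \<in> D \<Longrightarrow> g c - h c \<in> P" for g h :: "'a set \<Rightarrow> 'a" and D
    using that
  proof (induction D rule: infinite_finite_induct)
    case (insert c D)
    have "g c * prod g D - h c * prod h D = (g c - h c) * prod g D + h c * (prod g D - prod h D)"
      by (simp add: algebra_simps)
    moreover have "\<dots> \<in> P" by (intro add_subgroup_add[OF J] is_ideal_mult[OF I] insert) auto
    ultimately show ?case using insert by simp
  qed (auto simp: add_subgroup_zero[OF J])
  have "(\<Prod>c\<in>?C. x * rep c) - (\<Prod>c\<in>?C. rep (f c)) \<in> P"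
  proof (rule prodJ)
    fix c assume "c \<in> ?C"
    have "add_coset P (rep (f c)) = add_coset P (x * rep c)" using rep[of "f c"] by (simp add: f_def)
    then show "x * rep c - rep (f c) \<in> P" using iffD1[OF add_coset_eq_iff[OF J], of "x * rep c"] by simp
  qed
  moreover have "(\<Prod>c\<in>?C. rep (f c)) = (\<Prod>c\<in>?C. rep c)"
    using prod.reindex_bij_betw[OF bij, of rep] by simp
  ultimately have "(x ^ card ?C - 1) * (\<Prod>c\<in>?C. rep c) \<in> P" by (simp add: prod.distrib algebra_simps)
  moreover have "(\<Prod>c\<in>D. rep c) \<notin> P" if "D \<subseteq> ?C" for D
    using finite_subset[OF that finC] that by (induction D rule: finite_induct) (use one repn pr in auto)
  ultimately have "x ^ card ?C - 1 \<in> P" using pr by blast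
  moreover have "card ?C = index P - 1" 
    unfolding index_def by (rule card_Diff_singleton) (metis P0 rangeI)
  ultimately show ?thesis by simp
qed

text \<open>Comparing powers of two elements outside a prime ideal avoids inverses modulo the ideal.\<close>

lemma power_agree_gcd:
  fixes P :: "'a::comm_ring_1 set"
  assumes P: "prime_ideal P" and a: "a \<notin> P" and b: "b \<notin> P"
    and "a ^ i - b ^ i \<in> P" "a ^ j - b ^ j \<in> P"
  shows "a ^ gcd i j - b ^ gcd i j \<in> P"
proof -
  have I: "is_ideal P" and J: "add_subgroup P" and pr: "\<And>x y. x * y \<in> P \<Longrightarrow> x \<in> P \<or> y \<in> P" and one: "1 \<notin> P"
    using P by (auto simp: prime_ideal_def is_ideal_def)
  have pow: "x ^ n \<notin> P" if "x \<notin> P" for x n by (induction n) (use one pr that in auto)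
  have powmult: "a ^ (n * c) - b ^ (n * c) \<in> P" if "a ^ n - b ^ n \<in> P" for n c
  proof -
    have "a ^ (n * c) - b ^ (n * c) = (a ^ n) ^ c - (b ^ n) ^ c" by (simp add: power_mult)
    also have "\<dots> = (a ^ n - b ^ n) * (\<Sum>i<c. (a ^ n) ^ i * (b ^ n) ^ (c - Suc i))"
      by (cases c) (simp_all only: power_0 diff_self power_diff_sumr2 mult_zero_right sum.lessThan_Suc lessThan_0 sum.empty, simp add: power_diff_sumr2 mult.commute)
    finally show ?thesis using that by (simp only: is_ideal_mult[OF I])
  qed
  show ?thesis using assms(4,5)
  proof (induction i j rule: gcd_nat_induct)
    case (base m)
    then show ?case by simp
  next
    case (step m n)
    let ?r = "m mod n" and ?k = "n * (m div n)"
    have m: "m = ?r + ?k" by simp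
    \<comment> \<open>Euclidean step: the powers agree at exponent \<open>m\<close> and at the
      multiple \<open>?k\<close> of \<open>n\<close>, and the factor a^?k, which is outside
      \<open>P\<close>, is cancelled to get agreement at the remainder.\<close>
    have "a ^ m - b ^ m = a ^ ?k * (a ^ ?r - b ^ ?r) + b ^ ?r * (a ^ ?k - b ^ ?k)"
      using power_add[of a ?r ?k] power_add[of b ?r ?k] unfolding mod_mult_div_eq by (simp add: algebra_simps)
    then have "a ^ ?k * (a ^ ?r - b ^ ?r) = (a ^ m - b ^ m) - b ^ ?r * (a ^ ?k - b ^ ?k)" by simp
    also have "\<dots> \<in> P" by (intro add_subgroup_diff[OF J] step.prems is_ideal_mult[OF I] powmult)
    finally have "a ^ ?r - b ^ ?r \<in> P" using pr pow[OF a] by blast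
    with step show ?case by (simp add: gcd_red_nat[of m n])
  qed
qed

section \<open>Cyclotomic integers\<close>

text \<open>Integer polynomials serve as representatives of cyclotomic integers; \<open>ev z\<close>
  is the ring homomorphism sending X to \<open>z\<close>.\<close>

definition ev :: "complex \<Rightarrow> int poly \<Rightarrow> complex" where
  "ev z x = poly (map_poly of_int x) z"

lemma ev_0 [simp]: "ev z 0 = 0" by (simp add: ev_def)

lemma ev_pCons [simp]: "ev z (pCons a q) = of_int a + z * ev z q"
  by (simp add: ev_def map_poly_pCons)

lemma ev_1 [simp]: "ev z 1 = 1" by (simp add: one_pCons)

lemma ev_add [simp]: "ev z (x + y) = ev z x + ev z y"
  by (induction x y rule: poly_induct2) (auto simp: algebra_simps)

lemma ev_smult [simp]: "ev z (smult a x) = of_int a * ev z x"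
  by (induction x) (auto simp: algebra_simps)

lemma ev_mult [simp]: "ev z (x * y) = ev z x * ev z y"
  by (induction x) (auto simp: algebra_simps)

lemma ev_uminus [simp]: "ev z (- x) = - ev z x"
  using ev_smult[of z "-1" x] by simp

lemma ev_diff [simp]: "ev z (x - y) = ev z x - ev z y"
  using ev_add[of z x "- y"] by simp

lemma ev_of_int [simp]: "ev z (of_int k) = of_int k"
  by (simp add: of_int_poly)

lemma ev_of_nat [simp]: "ev z (of_nat k) = of_nat k"
  by (simp add: of_nat_poly)

lemma ev_numeral [simp]: "ev z (numeral k) = numeral k"
  using ev_of_nat[of z "numeral k"] by simp

lemma ev_power [simp]: "ev z (x ^ n) = ev z x ^ n"
  by (induction n) auto

lemma ev_monom [simp]: "ev z (monom a n) = of_int a * z ^ n"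
  by (induction n) (auto simp: monom_0 monom_Suc)

lemma ev_sum [simp]: "ev z (sum f A) = (\<Sum>i\<in>A. ev z (f i))"
  by (induction A rule: infinite_finite_induct) auto

lemma ev_prod [simp]: "ev z (prod f A) = (\<Prod>i\<in>A. ev z (f i))"
  by (induction A rule: infinite_finite_induct) auto

text \<open>Lifts the Galois conjugation sending a root of unity to its s-th power to an
  endomorphism of the polynomial ring. It is defined for every \<open>s\<close>, so in particular
  for a prime, where it is compared with Frobenius.\<close>

definition subst_power :: "nat \<Rightarrow> int poly \<Rightarrow> int poly" where
  "subst_power s x = pcompose x (monom 1 s)"

lemma ev_subst_power [simp]: "ev z (subst_power s x) = ev (z ^ s) x"
  unfolding subst_power_def by (induction x) (auto simp: pcompose_pCons)

lemma subst_power_add: "subst_power s (x + y) = subst_power s x + subst_power s y"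
  by (simp add: subst_power_def pcompose_add)

lemma subst_power_diff: "subst_power s (x - y) = subst_power s x - subst_power s y"
  by (simp add: subst_power_def pcompose_diff)

lemma subst_power_mult: "subst_power s (x * y) = subst_power s x * subst_power s y"
  by (simp add: subst_power_def pcompose_mult)

section \<open>Roots of unity and Ramanujan sums\<close>

definition unity_root :: "nat \<Rightarrow> complex" where
  "unity_root m = cis (2 * pi / real m)"

lemma unity_root_power: "unity_root m ^ k = cis (2 * pi * real k / real m)"
  unfolding unity_root_def Complex.DeMoivre by (rule arg_cong[where f = cis]) simp

lemma norm_unity_root [simp]: "norm (unity_root m) = 1"
  by (simp add: unity_root_def)

lemma unity_root_nz [simp]: "unity_root m \<noteq> 0"
  by (simp add: unity_root_def)

lemma unity_root_power_self [simp]: "unity_root m ^ m = 1"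
  by (cases "m = 0") (auto simp: unity_root_power)

lemma unity_root_power_mod: "unity_root m ^ (k mod m) = unity_root m ^ k"
proof -
  have "unity_root m ^ k = unity_root m ^ (m * (k div m) + k mod m)" by simp
  also have "\<dots> = unity_root m ^ (k mod m)" unfolding power_add power_mult by simp
  finally show ?thesis ..
qed

lemma unity_root_power_eq_iff:
  assumes "m > 0" shows "unity_root m ^ a = unity_root m ^ b \<longleftrightarrow> a mod m = b mod m"
proof
  assume "a mod m = b mod m" then show "unity_root m ^ a = unity_root m ^ b"
    by (metis unity_root_power_mod)
next
  assume "unity_root m ^ a = unity_root m ^ b"
  then have "unity_root m ^ (a mod m) = unity_root m ^ (b mod m)" by (simp add: unity_root_power_mod)
  then show "a mod m = b mod m"
    using Complex.bij_betw_roots_unity[OF assms] assms unfolding unity_root_power bij_betw_def inj_on_def by simp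
qed

lemma unity_root_div:
  assumes "m > 0" "d dvd m" shows "unity_root m ^ d = unity_root (m div d)"
  using assms unfolding unity_root_power by (auto simp: unity_root_def elim!: dvdE intro!: arg_cong[where f = cis])

text \<open>For \<open>m = 1\<close> this is {0}, which is why the residue of the identity
  conjugation is written \<open>1 mod m\<close> below.\<close>

definition reduced_residues :: "nat \<Rightarrow> nat set" where
  "reduced_residues m = {s. s < m \<and> coprime s m}"

lemma finite_reduced_residues [simp]: "finite (reduced_residues m)"
  by (simp add: reduced_residues_def)

lemma sum_roots_Ints:
  assumes "z ^ m = (1::complex)" shows "(\<Sum>j<m. z ^ j) \<in> \<int>"
  using assms by (cases "z = 1") (auto simp: sum_gp_strict)

text \<open>The sum over all residues is geometric and equals 0 or \<open>m\<close>. Grouping the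
  residues by their gcd \<open>d\<close> with \<open>m\<close> splits it into the sums of the same
  kind for \<open>m div d\<close>, and induction isolates the term for d = 1.\<close>

lemma ramanujan_sum_Ints:
  assumes "m > 0" shows "(\<Sum>s\<in>reduced_residues m. unity_root m ^ (s * i)) \<in> \<int>"
  using assms
proof (induction m rule: less_induct)
  case (less m)
  have grp: "(\<Sum>j | j < m \<and> gcd j m = d. unity_root m ^ (j * i)) =
        (\<Sum>s\<in>reduced_residues (m div d). unity_root (m div d) ^ (s * i))" if d: "d dvd m" for d
  proof -
    have d0: "d > 0" using d less.prems by (auto intro: Nat.gr0I)
    obtain e where e: "m = d * e" using d by blast
    have "bij_betw (\<lambda>s. d * s) (reduced_residues (m div d)) {j. j < m \<and> gcd j m = d}"
    proof (rule bij_betw_imageI)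
      show "inj_on (\<lambda>s. d * s) (reduced_residues (m div d))" using d0 by (auto simp: inj_on_def)
      show "(\<lambda>s. d * s) ` reduced_residues (m div d) = {j. j < m \<and> gcd j m = d}"
      proof (intro equalityI subsetI)
        fix j assume "j \<in> (\<lambda>s. d * s) ` reduced_residues (m div d)"
        then obtain s where s: "j = d * s" "s < m div d" "coprime s (m div d)" unfolding reduced_residues_def by blast
        have md: "m div d = e" unfolding e using d0 by (rule nonzero_mult_div_cancel_left[OF less_imp_neq[THEN not_sym]])
        have "gcd j m = d * gcd s e" unfolding s(1) e by (rule gcd_mult_distrib_nat[symmetric])
        moreover have "gcd s e = 1" using s(3) unfolding md by (rule coprime_imp_gcd_eq_1)
        moreover have "j < m" unfolding s(1) e using s(2) d0 unfolding md by (simp only: mult_less_mono2)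
        ultimately show "j \<in> {j. j < m \<and> gcd j m = d}" by (simp only: mem_Collect_eq mult_1_right simp_thms)
      next
        fix j assume j: "j \<in> {j. j < m \<and> gcd j m = d}"
        then obtain s where s: "j = d * s" by (metis (mono_tags, lifting) gcd_dvd1 dvdE mem_Collect_eq)
        have "gcd (d * s) (d * e) = d" using j s e by simp
        then have "d * gcd s e = d * 1" unfolding gcd_mult_distrib_nat by (simp only: mult_1_right)
        moreover have "d \<noteq> 0" using d0 by (rule less_imp_neq[THEN not_sym])
        ultimately have g: "gcd s e = 1" unfolding mult_cancel1 by blast
        have md: "m div d = e" unfolding e using d0 by (rule nonzero_mult_div_cancel_left[OF less_imp_neq[THEN not_sym]])
        have "d * s < d * e" using j unfolding s e by blast
        then have "s < e" by (rule mult_less_cancel1[THEN iffD1, THEN conjunct2])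
        then have "s \<in> reduced_residues (m div d)" unfolding reduced_residues_def md
          using coprime_iff_gcd_eq_1[THEN iffD2, OF g] by blast
        then show "j \<in> (\<lambda>s. d * s) ` reduced_residues (m div d)" using s by blast
      qed
    qed
    then have "(\<Sum>j | j < m \<and> gcd j m = d. unity_root m ^ (j * i)) = (\<Sum>s\<in>reduced_residues (m div d). unity_root m ^ (d * s * i))"
      by (rule sum.reindex_bij_betw[symmetric])
    also have "\<dots> = (\<Sum>s\<in>reduced_residues (m div d). unity_root (m div d) ^ (s * i))"
      by (simp add: power_mult mult.assoc unity_root_div[OF less.prems d, symmetric])
    finally show ?thesis .
  qed
  have fin: "finite {d. d dvd m}" using less.prems by simp
  have "(\<Sum>j<m. unity_root m ^ (j * i)) = (\<Sum>d | d dvd m. \<Sum>j | j \<in> {..<m} \<and> gcd j m = d. unity_root m ^ (j * i))"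
    by (rule sum.group[symmetric]) (use fin in auto)
  also have "\<dots> = (\<Sum>d | d dvd m. \<Sum>s\<in>reduced_residues (m div d). unity_root (m div d) ^ (s * i))"
    by (rule sum.cong) (use grp in auto)
  also have "\<dots> = (\<Sum>s\<in>reduced_residues m. unity_root m ^ (s * i)) +
      (\<Sum>d\<in>{d. d dvd m} - {1}. \<Sum>s\<in>reduced_residues (m div d). unity_root (m div d) ^ (s * i))"
    using fin by (subst sum.remove[of _ 1]) auto
  finally have eq: "(\<Sum>s\<in>reduced_residues m. unity_root m ^ (s * i)) = (\<Sum>j<m. unity_root m ^ (j * i)) -
      (\<Sum>d\<in>{d. d dvd m} - {1}. \<Sum>s\<in>reduced_residues (m div d). unity_root (m div d) ^ (s * i))" by simp
  have "(\<Sum>j<m. unity_root m ^ (j * i)) = (\<Sum>j<m. (unity_root m ^ i) ^ j)"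
    by (simp add: power_mult[symmetric] mult.commute)
  also have "\<dots> \<in> \<int>" by (rule sum_roots_Ints) (metis power_mult mult.commute power_one unity_root_power_self)
  finally have 1: "(\<Sum>j<m. unity_root m ^ (j * i)) \<in> \<int>" .
  have "(\<Sum>s\<in>reduced_residues (m div d). unity_root (m div d) ^ (s * i)) \<in> \<int>" if "d \<in> {d. d dvd m} - {1}" for d
  proof (rule less.IH)
    have "d \<noteq> 0" "d \<noteq> 1" "d dvd m" using that less.prems by auto
    then show "m div d < m" "0 < m div d" using less.prems by (auto intro!: div_less_dividend simp: div_greater_zero_iff dvd_imp_le)
  qed
  then have 2: "(\<Sum>d\<in>{d. d dvd m} - {1}. \<Sum>s\<in>reduced_residues (m div d). unity_root (m div d) ^ (s * i)) \<in> \<int>"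
    by (rule Ints_sum)
  show ?case unfolding eq by (intro Ints_diff 1 2)
qed

text \<open>The number is rational, and in lowest terms a / b every power of \<open>b\<close>
  divides \<open>g\<close>. The power with exponent \<open>g\<close> already suffices: 2^g exceeds
  \<open>g\<close>, so b = 1.\<close>

lemma bounded_denominator_Ints:
  fixes x :: complex
  assumes g: "g > 0" and x: "\<And>n. of_nat g * x ^ n \<in> \<int>"
  shows "x \<in> \<int>"
proof -
  have "of_nat g * x \<in> \<int>" using x[of 1] by simp
  then obtain k where "of_nat g * x = of_int k" by (auto elim: Ints_cases)
  then have "x = of_int k / of_nat g" using g by (simp add: field_simps)
  then have "x \<in> \<rat>" by simp
  then obtain a b :: int where ab: "b > 0" "coprime a b" "x = of_int a / of_int b" by (rule Rats_cases')
  have "b ^ n dvd int g" for n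
  proof -
    obtain k where "of_nat g * x ^ n = of_int k" using x[of n] by (auto elim: Ints_cases)
    then have "(of_int (int g * a ^ n) :: complex) = of_int (k * b ^ n)"
      using ab by (simp add: power_divide field_simps)
    then have "int g * a ^ n = k * b ^ n" by (simp only: of_int_eq_iff)
    then have "b ^ n dvd int g * a ^ n" by simp
    moreover have "coprime (b ^ n) (a ^ n)" using ab(2) by (simp add: coprime_commute)
    ultimately show ?thesis by (simp add: coprime_dvd_mult_left_iff)
  qed
  then have le: "b ^ g \<le> int g" using g by (meson zdvd_imp_le of_nat_0_less_iff)
  have "b = 1"
  proof (rule ccontr)
    assume "b \<noteq> 1"
    then have "2 ^ g \<le> b ^ g" using ab(1) by (intro power_mono) auto
    moreover have "int g < 2 ^ g" by (metis of_nat_less_two_power)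
    ultimately show False using le by linarith
  qed
  then show ?thesis using ab(3) by simp
qed

section \<open>Trace, norm and integrality in the cyclotomic ring\<close>

locale cyclotomic =
  fixes m :: nat
  assumes m_pos: "m > 0"
begin

abbreviation \<rho> where "\<rho> \<equiv> unity_root m"

abbreviation G where "G \<equiv> reduced_residues m"

abbreviation g where "g \<equiv> card G"

lemma one_in_G: "1 mod m \<in> G"
  using m_pos by (simp add: reduced_residues_def)

lemma g_pos: "g > 0"
  using one_in_G by (simp add: card_gt_0_iff) blast

lemma mod_in_G: "coprime a m \<Longrightarrow> a mod m \<in> G"
  using m_pos by (simp add: reduced_residues_def)

lemma G_coprime: "s \<in> G \<Longrightarrow> coprime s m"
  by (simp add: reduced_residues_def)

lemma bij_mult_G:
  assumes t: "coprime t m" shows "bij_betw (\<lambda>s. t * s mod m) G G"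
proof -
  have "inj_on (\<lambda>s. t * s mod m) G"
  proof (rule inj_onI)
    fix a b assume ab: "a \<in> G" "b \<in> G" "t * a mod m = t * b mod m"
    then have "[t * a = t * b] (mod m)" by (simp add: cong_def)
    then have "[a = b] (mod m)" using t by (simp add: cong_mult_lcancel_nat)
    then show "a = b" using ab by (simp add: cong_def reduced_residues_def)
  qed
  moreover have "(\<lambda>s. t * s mod m) ` G \<subseteq> G" using t by (auto intro!: mod_in_G simp: G_coprime)
  ultimately show ?thesis by (simp add: bij_betw_def endo_inj_surj)
qed

definition Tr :: "int poly \<Rightarrow> complex" where "Tr x = (\<Sum>s\<in>G. ev (\<rho> ^ s) x)"

definition Nm :: "int poly \<Rightarrow> complex" where "Nm x = (\<Prod>s\<in>G. ev (\<rho> ^ s) x)"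

lemma Tr_Ints: "Tr x \<in> \<int>"
proof -
  have "(\<Sum>s\<in>G. \<rho> ^ (s * i) * ev (\<rho> ^ s) x) \<in> \<int>" for i
  proof (induction x arbitrary: i)
    case (pCons a q)
    have "(\<Sum>s\<in>G. \<rho> ^ (s * i) * ev (\<rho> ^ s) (pCons a q)) =
      of_int a * (\<Sum>s\<in>G. \<rho> ^ (s * i)) + (\<Sum>s\<in>G. \<rho> ^ (s * Suc i) * ev (\<rho> ^ s) q)"
      by (simp add: sum_distrib_left sum.distrib[symmetric] algebra_simps power_add)
    also have "\<dots> \<in> \<int>" by (intro Ints_add Ints_mult Ints_of_int ramanujan_sum_Ints[OF m_pos] pCons.IH)
    finally show ?case .
  qed simp
  from this[of 0] show ?thesis by (simp add: Tr_def)
qed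

text \<open>Galois descent by traces: if all conjugates of \<open>x\<close> equal \<open>c\<close>,
  then g c^n is the trace of x^n and hence an integer for every n, so \<open>c\<close> has bounded
  denominators.\<close>

lemma invariant_Ints:
  assumes "\<And>s. s \<in> G \<Longrightarrow> ev (\<rho> ^ s) x = c"
  shows "c \<in> \<int>"
proof (rule bounded_denominator_Ints[OF g_pos])
  fix n
  have "Tr (x ^ n) = of_nat g * c ^ n" using assms by (simp add: Tr_def)
  then show "of_nat g * c ^ n \<in> \<int>" using Tr_Ints[of "x ^ n"] by simp
qed

text \<open>Divisibility by an integer descends from the cyclotomic ring to the integers, because n
  / K is the common value of all conjugates of \<open>x\<close>.\<close>

lemma dvd_if_ev:
  assumes "\<And>s. s \<in> G \<Longrightarrow> ev (\<rho> ^ s) (of_int K * x) = of_int n" "K \<noteq> 0"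
  shows "K dvd n"
proof -
  have "(of_int n / of_int K :: complex) \<in> \<int>"
    by (rule invariant_Ints[of x]) (use assms in \<open>auto simp: field_simps\<close>)
  then obtain k where "(of_int n :: complex) = of_int k * of_int K" using assms(2) by (auto elim!: Ints_cases simp: field_simps)
  then have "n = k * K" by (metis of_int_eq_iff of_int_mult)
  then show ?thesis by simp
qed

definition conj_prod :: "int poly \<Rightarrow> int poly" where "conj_prod x = (\<Prod>s\<in>G. subst_power s x)"

lemma prod_conj: "coprime t m \<Longrightarrow> (\<Prod>s\<in>G. ev (\<rho> ^ (t * s)) x) = Nm x"
  using prod.reindex_bij_betw[OF bij_mult_G, of t "\<lambda>s. ev (\<rho> ^ s) x"] by (simp add: Nm_def unity_root_power_mod)

lemma sum_conj: "coprime t m \<Longrightarrow> (\<Sum>s\<in>G. ev (\<rho> ^ (t * s)) x) = Tr x"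
  using sum.reindex_bij_betw[OF bij_mult_G, of t "\<lambda>s. ev (\<rho> ^ s) x"] by (simp add: Tr_def unity_root_power_mod)

lemma ev_conj_prod: "t \<in> G \<Longrightarrow> ev (\<rho> ^ t) (conj_prod x) = Nm x"
  using prod_conj[OF G_coprime, of t x] by (simp add: conj_prod_def power_mult)

definition tr :: "int poly \<Rightarrow> int" where "tr x = (SOME k. Tr x = of_int k)"

definition nm :: "int poly \<Rightarrow> int" where "nm x = (SOME k. Nm x = of_int k)"

lemma tr: "of_int (tr x) = Tr x"
  unfolding tr_def by (metis (mono_tags, lifting) Ints_cases Tr_Ints someI_ex)

lemma nm: "of_int (nm x) = Nm x"
proof -
  have "Nm x \<in> \<int>" by (rule invariant_Ints[OF ev_conj_prod])
  then show ?thesis unfolding nm_def by (metis (mono_tags, lifting) Ints_cases someI_ex)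
qed

lemma nm_mult: "nm (x * y) = nm x * nm y"
proof -
  have "(of_int (nm (x * y)) :: complex) = of_int (nm x * nm y)"
    unfolding of_int_mult nm by (simp add: Nm_def prod.distrib)
  then show ?thesis by (simp only: of_int_eq_iff)
qed

lemma nm_subst: "coprime a m \<Longrightarrow> nm (subst_power a x) = nm x"
proof -
  assume "coprime a m"
  then have "(of_int (nm (subst_power a x)) :: complex) = of_int (nm x)"
    unfolding nm using prod_conj[of a x] by (simp add: Nm_def power_mult[symmetric] mult.commute)
  then show ?thesis by (simp only: of_int_eq_iff)
qed

lemma tr_subst: "coprime a m \<Longrightarrow> tr (subst_power a x) = tr x"
proof -
  assume "coprime a m"
  then have "(of_int (tr (subst_power a x)) :: complex) = of_int (tr x)"
    unfolding tr using sum_conj[of a x] by (simp add: Tr_def power_mult[symmetric] mult.commute)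
  then show ?thesis by (simp only: of_int_eq_iff)
qed

lemma tr_add: "tr (x + y) = tr x + tr y"
proof -
  have "(of_int (tr (x + y)) :: complex) = of_int (tr x + tr y)"
    unfolding of_int_add tr by (simp add: Tr_def sum.distrib)
  then show ?thesis by (simp only: of_int_eq_iff)
qed

lemma tr_mult_int: "tr (of_int k * x) = k * tr x"
proof -
  have "(of_int (tr (of_int k * x)) :: complex) = of_int (k * tr x)"
    unfolding of_int_mult tr by (simp add: Tr_def sum_distrib_left)
  then show ?thesis by (simp only: of_int_eq_iff)
qed

lemma nm_nz_iff: "nm x \<noteq> 0 \<longleftrightarrow> (\<forall>s\<in>G. ev (\<rho> ^ s) x \<noteq> 0)"
proof -
  have "nm x \<noteq> 0 \<longleftrightarrow> Nm x \<noteq> 0" by (metis nm of_int_eq_0_iff)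
  then show ?thesis by (simp add: Nm_def)
qed

text \<open>The quotient by \<open>J0\<close> is the ring generated by a primitive m-th root of
  unity. Asking for zeros at all conjugates makes stability under \<open>subst_power s\<close>, for
  s prime to \<open>m\<close>, immediate.\<close>

definition J0 :: "int poly set" where "J0 = {x. \<forall>s\<in>G. ev (\<rho> ^ s) x = 0}"

lemma J0_ideal: "is_ideal J0"
  by (auto simp: is_ideal_def J0_def add_subgroup_def)

lemma conj_prod_J0: "conj_prod x - of_int (nm x) \<in> J0"
  by (simp add: J0_def nm ev_conj_prod)

text \<open>An element divides its norm: the cofactor is the product of the conjugates other than
  the identity one.\<close>

lemma nm_cofactor: "\<exists>h. h * x - of_int (nm x) \<in> J0"
proof (intro exI)
  let ?h = "\<Prod>s\<in>G - {1 mod m}. subst_power s x"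
  have "ev (\<rho> ^ t) (?h * x) = Nm x" if t: "t \<in> G" for t
  proof -
    \<comment> \<open>For m = 1 the exponent is 0, but then the root is 1, so this substitution
      still acts as the identity on values.\<close>
    have "(\<rho> ^ t) ^ (1 mod m) = \<rho> ^ t"
      unfolding power_mult[symmetric] unity_root_power_eq_iff[OF m_pos] by (simp only: mod_mult_right_eq mult_1_right)
    then have "ev (\<rho> ^ t) (subst_power (1 mod m) x) = ev (\<rho> ^ t) x" by (simp only: ev_subst_power)
    then have "ev (\<rho> ^ t) (?h * x) = ev (\<rho> ^ t) (subst_power (1 mod m) x * ?h)" by (simp add: mult.commute)
    also have "subst_power (1 mod m) x * ?h = conj_prod x"
      unfolding conj_prod_def using one_in_G by (simp add: prod.remove)
    finally show ?thesis using ev_conj_prod[OF t] by simp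
  qed
  then show "?h * x - of_int (nm x) \<in> J0" by (simp add: J0_def nm)
qed

text \<open>The point is that one integer polynomial \<open>E\<close> works for all
  \<open>z\<close>. The coefficients of the cyclotomic polynomial thereby become values of a single
  \<open>E\<close> at every conjugate, the shape that \<open>invariant_Ints\<close> asks
  for.\<close>

lemma coeff_prod_linear:
  assumes "finite A"
  shows "\<exists>E. \<forall>z. coeff (\<Prod>s\<in>A. [:- (z ^ s), 1:]) i = ev z E"
  using assms
proof (induction A arbitrary: i rule: finite_induct)
  case empty
  show ?case by (intro exI[of _ "if i = 0 then 1 else 0"]) (simp add: coeff_1)
next
  case (insert a A)
  obtain E where E: "\<And>z. coeff (\<Prod>s\<in>A. [:- (z ^ s), 1:]) i = ev z E" using insert.IH by blast
  obtain E' where E': "\<And>z. coeff (\<Prod>s\<in>A. [:- (z ^ s), 1:]) (i - 1) = ev z E'" using insert.IH by blast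
  show ?case
  proof (intro exI allI)
    fix z
    show "coeff (\<Prod>s\<in>insert a A. [:- (z ^ s), 1:]) i = ev z (- monom 1 a * E + (if i = 0 then 0 else E'))"
      using insert.hyps E[of z] E'[of z] by (cases i) auto
  qed
qed

text \<open>\<open>F\<close> is the m-th cyclotomic polynomial, monic of degree \<open>g\<close>.
  Conjugation only permutes its linear factors, so each coefficient takes the same value at all
  conjugates and is an integer.\<close>

lemma cyclotomic_poly:
  obtains F where "F \<in> J0" "coeff F g = 1" "\<And>i. i > g \<Longrightarrow> coeff F i = 0"
proof -
  define \<Phi> where "\<Phi> = (\<Prod>s\<in>G. [:- (\<rho> ^ s), 1:])"
  have int: "coeff \<Phi> i \<in> \<int>" for i
  proof -
    obtain E where E: "\<And>z. coeff (\<Prod>s\<in>G. [:- (z ^ s), 1:]) i = ev z E"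
      using coeff_prod_linear[OF finite_reduced_residues] by blast
    show ?thesis
    proof (rule invariant_Ints[of E])
      fix t assume t: "t \<in> G"
      have "(\<Prod>s\<in>G. [:- ((\<rho> ^ t) ^ s), 1:]) = \<Phi>" unfolding \<Phi>_def
        using prod.reindex_bij_betw[OF bij_mult_G[OF G_coprime[OF t]], of "\<lambda>s. [:- (\<rho> ^ s), 1:]"]
        by (simp add: unity_root_power_mod power_mult)
      then show "ev (\<rho> ^ t) E = coeff \<Phi> i" using E[of "\<rho> ^ t"] by simp
    qed
  qed
  have deg: "degree \<Phi> = g" "lead_coeff \<Phi> = 1"
    unfolding \<Phi>_def by (subst degree_prod_eq_sum_degree) (auto simp: lead_coeff_prod)
  \<comment> \<open>The coefficients are integers inside the complex numbers; the floor of the real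
    part brings them back to the type of integers.\<close>
  define F where "F = map_poly (\<lambda>c. \<lfloor>Re c\<rfloor>) \<Phi>"
  have cF: "of_int (coeff F i) = coeff \<Phi> i" for i
    unfolding F_def using int[of i] by (auto simp: coeff_map_poly elim!: Ints_cases)
  have "map_poly of_int F = \<Phi>" by (rule poly_eqI) (simp add: coeff_map_poly cF)
  then have "ev z F = (\<Prod>s\<in>G. z - \<rho> ^ s)" for z unfolding ev_def \<Phi>_def by (simp add: poly_prod)
  then have "F \<in> J0" by (auto simp: J0_def)
  moreover have "coeff F g = 1"
  proof -
    have "(of_int (coeff F g) :: complex) = of_int 1" using cF[of g] deg by simp
    then show ?thesis by (simp only: of_int_eq_iff)
  qed
  moreover have "coeff F i = 0" if "i > g" for i
  proof -
    have "(of_int (coeff F i) :: complex) = of_int 0" using cF[of i] deg that by (simp add: coeff_eq_0)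
    then show ?thesis by (simp only: of_int_eq_iff)
  qed
  ultimately show ?thesis by (rule that)
qed

text \<open>Remainder modulo the monic \<open>F\<close>, by Horner's scheme: after a multiplication
  by X only the coefficient of index \<open>g\<close> has to be removed.\<close>

lemma reduce_degree: "\<exists>h'. (\<forall>i\<ge>g. coeff h' i = 0) \<and> h - h' \<in> J0"
proof -
  note J = is_ideal_subgroup[OF J0_ideal]
  obtain F where F: "F \<in> J0" "coeff F g = 1" "\<And>i. i > g \<Longrightarrow> coeff F i = 0"
    using cyclotomic_poly by blast
  show ?thesis
  proof (induction h)
    case 0
    then show ?case by (intro exI[of _ 0]) (simp add: add_subgroup_zero[OF J])
  next
    case (pCons a h)
    then obtain h' where h': "\<forall>i\<ge>g. coeff h' i = 0" "h - h' \<in> J0" by blast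
    let ?c = "coeff (pCons a h') g"
    let ?k = "pCons a h' - smult ?c F"
    have "coeff ?k i = 0" if "i \<ge> g" for i
    proof (cases "i = g")
      case False
      then have "i > g" using that by linarith
      then have "i = Suc (i - 1)" "i - 1 \<ge> g" by linarith+
      then obtain j where "i = Suc j" "j \<ge> g" by blast
      then show ?thesis using h' F(3)[of i] by simp
    qed (simp add: F(2))
    moreover have "pCons a h - ?k = [:0, 1:] * (h - h') + [:?c:] * F" by (simp add: algebra_simps)
    moreover have "\<dots> \<in> J0" by (intro add_subgroup_add[OF J] is_ideal_mult[OF J0_ideal] h' F)
    ultimately show ?case by metis
  qed
qed

text \<open>A nonzero polynomial of degree below \<open>g\<close> cannot vanish at the
  \<open>g\<close> distinct primitive roots.\<close>

lemma J0_small_degree: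
  assumes "x \<in> J0" "\<forall>i\<ge>g. coeff x i = 0" shows "x = 0"
proof (rule ccontr)
  assume "x \<noteq> 0"
  let ?p = "map_poly of_int x :: complex poly"
  have p0: "?p \<noteq> 0" using \<open>x \<noteq> 0\<close> by (simp add: poly_eq_iff coeff_map_poly)
  have "degree x < g" using assms(2) \<open>x \<noteq> 0\<close> by (metis leading_coeff_0_iff not_le)
  moreover have "degree ?p \<le> degree x" by (rule degree_le) (simp add: coeff_map_poly coeff_eq_0)
  ultimately have d: "degree ?p < g" by simp
  have "(\<lambda>s. \<rho> ^ s) ` G \<subseteq> {z. poly ?p z = 0}" using assms(1) by (auto simp: J0_def ev_def)
  then have "card ((\<lambda>s. \<rho> ^ s) ` G) \<le> card {z. poly ?p z = 0}" by (intro card_mono poly_roots_finite p0)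
  moreover have "inj_on (\<lambda>s. \<rho> ^ s) G"
    by (rule inj_onI) (auto simp: unity_root_power_eq_iff[OF m_pos] reduced_residues_def)
  ultimately have "g \<le> card {z. poly ?p z = 0}" by (simp add: card_image)
  also have "\<dots> \<le> degree ?p" by (rule card_poly_roots_bound[OF p0])
  finally show False using d by simp
qed

text \<open>Modulo \<open>J0\<close> every element has exactly one representative of degree below
  \<open>g\<close>, so the classes modulo \<open>n\<close> are counted by \<open>g\<close>
  coefficients, each taken modulo \<open>n\<close>.\<close>

lemma index_int:
  assumes "n \<noteq> 0"
  shows "finite_index (ideal_adjoin J0 (of_int n))" "index (ideal_adjoin J0 (of_int n)) = nat \<bar>n\<bar> ^ g"
proof -
  define J where "J = ideal_adjoin J0 (of_int n)"
  have J: "is_ideal J" unfolding J_def by (rule is_ideal_adjoin[OF J0_ideal])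
  note sg = is_ideal_subgroup[OF J]
  let ?F = "{..<g} \<rightarrow>\<^sub>E {..<nat \<bar>n\<bar>}"
  let ?p = "\<lambda>f. \<Sum>i<g. monom (int (f i)) i"
  have cp: "coeff (?p f) i = (if i < g then int (f i) else 0)" for f i
    by (simp add: coeff_sum) 
  have inj: "inj_on (\<lambda>f. add_coset J (?p f)) ?F"
  proof (rule inj_onI)
    fix f f' assume f: "f \<in> ?F" "f' \<in> ?F" and eq: "add_coset J (?p f) = add_coset J (?p f')"
    then have "?p f - ?p f' \<in> J" by (simp only: add_coset_eq_iff[OF sg])
    then obtain j r where jr: "j \<in> J0" "?p f - ?p f' = j + r * of_int n" unfolding J_def ideal_adjoin_def by blast
    obtain r' where r': "\<forall>i\<ge>g. coeff r' i = 0" "r - r' \<in> J0" using reduce_degree by blast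
    have "?p f - ?p f' - r' * of_int n = j + (r - r') * of_int n" using jr(2) by (simp add: algebra_simps)
    moreover have "\<dots> \<in> J0" by (intro add_subgroup_add[OF is_ideal_subgroup] is_ideal_mult J0_ideal jr r')
    moreover have "\<forall>i\<ge>g. coeff (?p f - ?p f' - r' * of_int n) i = 0"
      using r'(1) by (simp add: cp of_int_poly mult.commute)
    ultimately have z: "?p f - ?p f' - r' * of_int n = 0" using J0_small_degree by metis
    show "f = f'"
    proof (rule PiE_ext[OF f])
      fix i assume i: "i \<in> {..<g}"
      have "coeff (?p f - ?p f' - r' * of_int n) i = 0" using z by simp
      then have "int (f i) - int (f' i) = coeff r' i * n" using i by (simp add: cp of_int_poly mult.commute)
      then have "n dvd int (f i) - int (f' i)" by simp
      moreover have "\<bar>int (f i) - int (f' i)\<bar> < \<bar>n\<bar>" using f i by (force simp: PiE_def Pi_def)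
      ultimately show "f i = f' i" by (metis dvd_imp_le_int eq_iff_diff_eq_0 not_le of_nat_eq_iff)
    qed
  qed
  have surj: "(\<lambda>f. add_coset J (?p f)) ` ?F = range (add_coset J)"
  proof (intro equalityI subsetI)
    fix c assume "c \<in> range (add_coset J)"
    then obtain h where h: "c = add_coset J h" by blast
    obtain h' where h': "\<forall>i\<ge>g. coeff h' i = 0" "h - h' \<in> J0" using reduce_degree by blast
    define f where "f = (\<lambda>i\<in>{..<g}. nat (coeff h' i mod \<bar>n\<bar>))"
    have f: "f \<in> ?F" using assms by (auto simp: f_def nat_less_iff)
    define r where "r = (\<Sum>i<g. monom ((coeff h' i - coeff h' i mod \<bar>n\<bar>) div n) i)"
    have "h' = ?p f + r * of_int n"
    proof (rule poly_eqI)
      fix i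
      show "coeff h' i = coeff (?p f + r * of_int n) i"
      proof (cases "i < g")
        case True
        have "n dvd coeff h' i - coeff h' i mod \<bar>n\<bar>" by (metis abs_dvd_iff dvd_minus_mod)
        then show ?thesis using True assms
          by (simp add: cp of_int_poly r_def coeff_sum f_def mult.commute)
      next
        case False
        then show ?thesis using h'(1) by (simp add: cp of_int_poly r_def coeff_sum)
      qed
    qed
    then have "h - ?p f = (h - h') + r * of_int n" by simp
    then have "h - ?p f \<in> J" unfolding J_def ideal_adjoin_def using h'(2) by blast
    then have "c = add_coset J (?p f)" using h by (simp only: add_coset_eq_iff[OF sg])
    then show "c \<in> (\<lambda>f. add_coset J (?p f)) ` ?F" using f by blast
  qed auto
  show "finite_index (ideal_adjoin J0 (of_int n))" unfolding finite_index_def J_def[symmetric] surj[symmetric]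
    by (intro finite_imageI finite_PiE) auto
  have "index J = card ?F" unfolding index_def surj[symmetric] by (rule card_image[OF inj])
  then show "index (ideal_adjoin J0 (of_int n)) = nat \<bar>n\<bar> ^ g" unfolding J_def by (simp add: card_PiE)
qed

section \<open>The index of a principal ideal is the absolute norm\<close>

lemma adjoin_cong:
  assumes "is_ideal J" "x - y \<in> J" shows "ideal_adjoin J x = ideal_adjoin J y"
proof -
  have "ideal_adjoin J x \<subseteq> ideal_adjoin J y" if "x - y \<in> J" for x y
  proof
    fix z assume "z \<in> ideal_adjoin J x"
    then obtain j r where jr: "j \<in> J" "z = j + r * x" unfolding ideal_adjoin_def by blast
    then have "z = (j + r * (x - y)) + r * y" by (simp add: algebra_simps)
    moreover have "j + r * (x - y) \<in> J"
      by (intro add_subgroup_add[OF is_ideal_subgroup[OF assms(1)]] jr is_ideal_mult(1)[OF assms(1)] that)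
    ultimately show "z \<in> ideal_adjoin J y" unfolding ideal_adjoin_def by blast
  qed
  from this[OF assms(2)] this[of y x] show ?thesis
    using add_subgroup_uminus[OF is_ideal_subgroup[OF assms(1)] assms(2)] by simp
qed

lemma adjoin_subset: 
  assumes "is_ideal J" "J' \<subseteq> J" "x \<in> J" shows "ideal_adjoin J' x \<subseteq> J"
proof
  fix z assume "z \<in> ideal_adjoin J' x"
  then obtain j r where jr: "j \<in> J'" "z = j + r * x" unfolding ideal_adjoin_def by blast
  show "z \<in> J" unfolding jr(2)
    by (intro add_subgroup_add[OF is_ideal_subgroup[OF assms(1)]] subsetD[OF assms(2) jr(1)] is_ideal_mult(1)[OF assms(1)] assms(3))
qed

lemma nm_in_adjoin: "of_int (nm x) \<in> ideal_adjoin J0 x"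
proof -
  obtain h where "h * x - of_int (nm x) \<in> J0" using nm_cofactor by blast
  then have "- (h * x - of_int (nm x)) + h * x \<in> ideal_adjoin J0 x"
    unfolding ideal_adjoin_def using add_subgroup_uminus[OF is_ideal_subgroup[OF J0_ideal]] by blast
  then show ?thesis by simp
qed

lemma finite_index_adjoin:
  assumes "nm x \<noteq> 0" shows "finite_index (ideal_adjoin J0 x)"
  by (rule index_tower(1)[OF is_ideal_subgroup is_ideal_subgroup _ index_int(1)[OF assms]])
     (intro is_ideal_adjoin J0_ideal adjoin_subset subset_ideal_adjoin nm_in_adjoin)+

text \<open>For principal ideals the factorisation in \<open>index_adjoin\<close> is explicit:
  adjoining \<open>x\<close> to (x y) gives (x), and the colon ideal (x y : x) is (y) because no
  conjugate of \<open>x\<close> vanishes.\<close>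

lemma index_mult:
  assumes x: "nm x \<noteq> 0" and y: "nm y \<noteq> 0"
  shows "index (ideal_adjoin J0 (x * y)) = index (ideal_adjoin J0 x) * index (ideal_adjoin J0 y)"
proof -
  let ?J = "ideal_adjoin J0 (x * y)"
  have J: "is_ideal ?J" by (rule is_ideal_adjoin[OF J0_ideal])
  have fin: "finite_index ?J" by (rule finite_index_adjoin) (simp add: nm_mult x y)
  have "x * y \<in> ideal_adjoin J0 x" by (metis is_ideal_mult(2) in_ideal_adjoin is_ideal_adjoin J0_ideal)
  then have "ideal_adjoin ?J x = ideal_adjoin J0 x"
    by (intro equalityI adjoin_subset is_ideal_adjoin J0_ideal subset_ideal_adjoin in_ideal_adjoin order_trans[OF subset_ideal_adjoin subset_ideal_adjoin])
  moreover have "ideal_quot ?J x = ideal_adjoin J0 y"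
  proof (intro equalityI subsetI)
    fix z assume "z \<in> ideal_quot ?J x"
    then obtain j r where jr: "j \<in> J0" "z * x = j + r * (x * y)" unfolding ideal_quot_def ideal_adjoin_def by blast
    then have "x * (z - r * y) = j" by (simp add: algebra_simps)
    then have "x * (z - r * y) \<in> J0" using jr by simp
    then have "z - r * y \<in> J0" using x by (auto simp: J0_def nm_nz_iff)
    then have "(z - r * y) + r * y \<in> ideal_adjoin J0 y" unfolding ideal_adjoin_def by blast
    then show "z \<in> ideal_adjoin J0 y" by simp
  next
    fix z assume "z \<in> ideal_adjoin J0 y"
    then obtain j r where jr: "j \<in> J0" "z = j + r * y" unfolding ideal_adjoin_def by blast
    then have "z * x = j * x + r * (x * y)" "j * x \<in> J0" 
      by (simp_all add: is_ideal_mult[OF J0_ideal], simp add: algebra_simps)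
    then show "z \<in> ideal_quot ?J x" unfolding ideal_quot_def ideal_adjoin_def by blast
  qed
  ultimately show ?thesis using index_adjoin[OF J fin, of x] by simp
qed

text \<open>\<open>subst_power a\<close> induces an automorphism of the ring modulo
  \<open>J0\<close>, with inverse \<open>subst_power b\<close> for a b = 1 modulo \<open>m\<close>.
  On polynomials the two are inverse only up to \<open>J0\<close>, hence the explicit
  bookkeeping.\<close>

lemma index_subst:
  assumes a: "coprime a m"
  shows "index (ideal_adjoin J0 (subst_power a x)) = index (ideal_adjoin J0 x)"
proof -
  let ?J1 = "ideal_adjoin J0 x" and ?J2 = "ideal_adjoin J0 (subst_power a x)"
  note sg1 = is_ideal_subgroup[OF is_ideal_adjoin[OF J0_ideal], of x]
  note sg2 = is_ideal_subgroup[OF is_ideal_adjoin[OF J0_ideal], of "subst_power a x"]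
  obtain b where b: "[a * b = 1] (mod m)" using cong_solve_coprime_nat[OF a] by auto
  then have "coprime b m" by (metis cong_imp_coprime cong_sym coprime_1_left coprime_mult_left_iff)
  have J0s: "subst_power c y \<in> J0" if "y \<in> J0" "coprime c m" for c y
    unfolding J0_def
  proof (intro CollectI ballI)
    fix s assume s: "s \<in> G"
    then have "s * c mod m \<in> G" using that by (intro mod_in_G) (simp add: G_coprime)
    then have "ev (\<rho> ^ (s * c)) y = 0" using that(1) by (auto simp: J0_def) (metis unity_root_power_mod)
    then show "ev (\<rho> ^ s) (subst_power c y) = 0" by (simp add: power_mult)
  qed
  have ab: "subst_power a (subst_power b y) - y \<in> J0" "subst_power b (subst_power a y) - y \<in> J0" for y
  proof -
    have "\<rho> ^ (s * (a * b)) = \<rho> ^ s" for s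
      using cong_mult[OF cong_refl b, of s] unfolding unity_root_power_eq_iff[OF m_pos] by (simp add: cong_def)
    then show "subst_power a (subst_power b y) - y \<in> J0" "subst_power b (subst_power a y) - y \<in> J0" 
      by (simp_all add: J0_def power_mult[symmetric] mult.assoc mult.commute[of b a])
  qed
  have fwd: "subst_power c y \<in> ideal_adjoin J0 (subst_power c z)" if y: "y \<in> ideal_adjoin J0 z" and c: "coprime c m" for c y z
  proof -
    obtain j r where "j \<in> J0" "y = j + r * z" using y unfolding ideal_adjoin_def by blast
    then have "subst_power c y = subst_power c j + subst_power c r * subst_power c z" "subst_power c j \<in> J0"
      using J0s c by (auto simp: subst_power_add subst_power_mult)
    then show ?thesis unfolding ideal_adjoin_def by blast
  qed
  have bwd: "y \<in> ?J1" if "subst_power a y \<in> ?J2" for y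
  proof -
    have "subst_power b (subst_power a y) \<in> ideal_adjoin J0 (subst_power b (subst_power a x))"
      by (rule fwd[OF that \<open>coprime b m\<close>])
    then have "subst_power b (subst_power a y) \<in> ?J1" using adjoin_cong[OF J0_ideal ab(2)] by simp
    moreover have "subst_power b (subst_power a y) - y \<in> ?J1" using ab(2) subset_ideal_adjoin by blast
    ultimately have "subst_power b (subst_power a y) - (subst_power b (subst_power a y) - y) \<in> ?J1"
      by (rule add_subgroup_diff[OF sg1])
    then show ?thesis by simp
  qed
  have "add_coset ?J2 (subst_power a y) = add_coset ?J2 (subst_power a z) \<longleftrightarrow> add_coset ?J1 y = add_coset ?J1 z" for y z
    unfolding add_coset_eq_iff[OF sg1] add_coset_eq_iff[OF sg2] subst_power_diff[symmetric] using fwd a bwd by blast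
  then have "card (range (\<lambda>y. add_coset ?J2 (subst_power a y))) = card (range (add_coset ?J1))" by (rule card_range_cong)
  moreover have "range (\<lambda>y. add_coset ?J2 (subst_power a y)) = range (add_coset ?J2)"
  proof -
    have "add_coset ?J2 y = add_coset ?J2 (subst_power a (subst_power b y))" for y
      unfolding add_coset_eq_iff[OF sg2] using add_subgroup_uminus[OF sg2, of "subst_power a (subst_power b y) - y"]
         ab(1)[of y] subset_ideal_adjoin by force
    then show ?thesis by blast
  qed
  ultimately show ?thesis unfolding index_def by simp
qed

text \<open>All conjugates of \<open>x\<close> generate ideals of the same index and their product is \<open>nm x\<close>, an integer
  whose index is known; this replaces the identification of the index with a determinant.\<close>

lemma index_eq_norm:
  assumes x: "nm x \<noteq> 0" shows "index (ideal_adjoin J0 x) = nat \<bar>nm x\<bar>"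
proof -
  let ?i = "index (ideal_adjoin J0 x)"
  have "index (ideal_adjoin J0 (\<Prod>s\<in>A. subst_power s x)) = ?i ^ card A \<and> nm (\<Prod>s\<in>A. subst_power s x) \<noteq> 0"
    if "A \<subseteq> G" for A
    using finite_subset[OF that finite_reduced_residues] that
  proof (induction A rule: finite_induct)
    case empty
    have "nm 1 = 1"
    proof -
      have "(of_int (nm 1) :: complex) = of_int 1" unfolding nm by (simp add: Nm_def)
      then show ?thesis by (simp only: of_int_eq_iff)
    qed
    moreover have "ideal_adjoin J0 1 = UNIV" by (metis UNIV_eq_I in_ideal_adjoin is_ideal_adjoin is_ideal_mult(1) J0_ideal mult.right_neutral)
    ultimately show ?case by (simp add: index_UNIV)
  next
    case (insert s A)
    have "coprime s m" using insert.prems G_coprime by simp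
    then show ?case using insert x
      by (simp add: index_mult nm_mult nm_subst index_subst)
  qed
  from this[of G] have "index (ideal_adjoin J0 (conj_prod x)) = ?i ^ g" by (simp add: conj_prod_def)
  then have "?i ^ g = nat \<bar>nm x\<bar> ^ g"
    using adjoin_cong[OF J0_ideal conj_prod_J0] index_int(2)[OF x] by simp
  then show ?thesis using g_pos by (simp add: power_eq_iff_eq_base)
qed

end

section \<open>Cubic residue symbols\<close>

lemma prime_dvd_binomial_power:
  fixes x y :: "'a::comm_ring_1"
  assumes p: "prime p" shows "of_nat p dvd (x + y) ^ p - (x ^ p + y ^ p)"
proof -
  let ?f = "\<lambda>k. of_nat (p choose k) * x ^ k * y ^ (p - k)"
  have p0: "p > 0" using prime_gt_0_nat[OF p] .
  have "(x + y) ^ p = sum ?f {..p}" by (rule binomial_ring)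
  also have "{..p} = insert 0 (insert p {0<..<p})" using p0 by auto
  also have "sum ?f \<dots> = y ^ p + x ^ p + sum ?f {0<..<p}" using p0 by simp
  finally have eq: "(x + y) ^ p - (x ^ p + y ^ p) = sum ?f {0<..<p}" by simp
  have "of_nat p dvd ?f k" if k: "k \<in> {0<..<p}" for k
  proof -
    have "p dvd (p choose k)" by (rule dvd_choose_prime) (use k p in auto)
    then have "(of_nat p :: 'a) dvd of_nat (p choose k)" by (metis dvd_def of_nat_mult)
    then show ?thesis by (simp add: dvd_mult2)
  qed
  then show ?thesis unfolding eq by (rule dvd_sum)
qed

lemma int_fermat:
  assumes p: "prime p" shows "int p dvd a ^ p - a"
proof -
  let ?n = "nat (a mod int p)"
  have p0: "p > 0" using prime_gt_0_nat[OF p] .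
  have "[?n ^ p = ?n] (mod p)"
  proof (cases "p dvd ?n")
    case True
    then show ?thesis using p0 by (simp add: cong_def mod_eq_0_iff_dvd dvd_power_same dvd_imp_mod_0 dvd_trans[OF True dvd_power])
  next
    case False
    have "[?n ^ (p - 1) * ?n = 1 * ?n] (mod p)" by (intro cong_mult cong_refl fermat_theorem[OF p False])
    then show ?thesis using p0 by (simp add: power_eq_if[of ?n p] mult.commute)
  qed
  then have "[int (?n ^ p) = int ?n] (mod int p)" by (simp only: cong_int_iff)
  then have "[int ?n ^ p = int ?n] (mod int p)" by (simp only: of_nat_power)
  moreover have "int ?n = a mod int p" using p0 by simp
  ultimately have "[(a mod int p) ^ p = a mod int p] (mod int p)" by (simp only:)
  moreover have "[(a mod int p) ^ p = a ^ p] (mod int p)" by (intro cong_pow) simp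
  ultimately have "[a ^ p = a] (mod int p)" by (metis cong_def mod_mod_trivial)
  then show ?thesis by (simp add: cong_iff_dvd_diff)
qed

lemma int_fermat_1:
  assumes p: "prime p" and a: "\<not> int p dvd a" shows "int p dvd a ^ (p - 1) - 1"
proof -
  have "a ^ p - a = a * (a ^ (p - 1) - 1)"
    using prime_gt_0_nat[OF p] by (simp add: right_diff_distrib power_eq_if[of a p])
  then have "int p dvd a * (a ^ (p - 1) - 1)" using int_fermat[OF p, of a] by simp
  then show ?thesis using a p prime_dvd_mult_iff[of "int p"] by simp
qed

lemma subst_power_const [simp]: "subst_power s [:a:] = [:a:]"
  by (simp add: subst_power_def)

lemma subst_power_1 [simp]: "subst_power s 1 = 1"
  unfolding one_pCons by (rule subst_power_const)

lemma subst_power_of_int [simp]: "subst_power s (of_int a) = of_int a"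
  by (simp add: of_int_poly)

lemma subst_power_power: "subst_power s (x ^ n) = subst_power s x ^ n"
  by (induction n) (simp_all add: subst_power_mult)

text \<open>The p-th power map is additive modulo \<open>p\<close> and fixes integers modulo
  \<open>p\<close>, so it acts on polynomials as the substitution of X^p for X. This identifies
  Frobenius at any prime ideal above \<open>p\<close> with the conjugation attached to
  \<open>p\<close>.\<close>

lemma frobenius_dvd:
  assumes p: "prime p" shows "of_nat p dvd x ^ p - subst_power p x"
proof (induction x)
  case 0
  show ?case using prime_gt_0_nat[OF p] by (simp add: subst_power_def power_0_left)
next
  case (pCons a q)
  have p1: "pCons a q = [:a:] + [:0, 1:] * q" by simp
  have s: "subst_power p (pCons a q) = [:a:] + monom 1 p * subst_power p q"
    by (simp add: subst_power_def pcompose_pCons)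
  have X: "[:0, 1:] ^ p = (monom 1 p :: int poly)" by (simp add: monom_altdef)
  have a: "[:a:] ^ p = [:a ^ p:]" by (induction p) (auto simp: one_pCons)
  have "of_nat p dvd [:a ^ p - a:]" using int_fermat[OF p, of a] by (simp add: of_nat_poly)
  moreover have "of_nat p dvd ([:a:] + [:0, 1:] * q) ^ p - ([:a:] ^ p + ([:0, 1:] * q) ^ p)"
    by (rule prime_dvd_binomial_power[OF p])
  moreover have "of_nat p dvd monom 1 p * (q ^ p - subst_power p q)" using pCons.IH by (rule dvd_mult)
  ultimately have "of_nat p dvd (([:a:] + [:0, 1:] * q) ^ p - ([:a:] ^ p + ([:0, 1:] * q) ^ p)) + [:a ^ p - a:]
      + monom 1 p * (q ^ p - subst_power p q)" by (intro dvd_add)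
  also have "\<dots> = (pCons a q) ^ p - subst_power p (pCons a q)"
    unfolding s p1[symmetric] a power_mult_distrib X by (simp add: algebra_simps)
  finally show ?case .
qed

lemma cube_dvd_lift:
  fixes x y :: "'a::comm_ring_1"
  assumes "3 ^ Suc j dvd x - y" shows "3 ^ Suc (Suc j) dvd x ^ 3 - y ^ 3"
proof -
  obtain c where c: "x - y = 3 ^ Suc j * c" using assms by blast
  then have x: "x = y + 3 * (3 ^ j * c)" by (simp add: algebra_simps)
  have "x ^ 3 - y ^ 3 = 3 * (x - y) * (y ^ 2 + (x - y) * y + (3 ^ j * c) * (x - y))"
    unfolding x by (simp add: power2_eq_square power3_eq_cube algebra_simps)
  also have "3 * (x - y) = 3 ^ Suc (Suc j) * c" using c by simp
  finally show ?thesis by simp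
qed

lemma pow3_dvd_lift:
  fixes x y :: "'a::comm_ring_1"
  assumes "3 dvd x - y" shows "3 ^ Suc k dvd x ^ (3 ^ k) - y ^ (3 ^ k)"
proof (induction k)
  case (Suc k)
  from cube_dvd_lift[OF this] show ?case by (simp add: power_mult[symmetric] mult.commute)
qed (use assms in simp)

text \<open>The exact power of 3 matters: starting from 2 = -1 + 3, each cubing multiplies the
  deviation from -1 by 3 and keeps its cofactor at 1 modulo 3. This deviation is the only source of
  the nontrivial term in the norm computation below.\<close>

lemma two_power: "\<exists>u. (2::int) ^ (3 ^ k) = - 1 + 3 ^ Suc k * u \<and> [u = 1] (mod 3)"
proof (induction k)
  case 0
  show ?case by (intro exI[of _ 1]) simp
next
  case (Suc k)
  then obtain u where u: "(2::int) ^ (3 ^ k) = - 1 + 3 ^ Suc k * u" "[u = 1] (mod 3)" by blast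
  have "(2::int) ^ (3 ^ Suc k) = (- 1 + 3 ^ Suc k * u) ^ 3"
    unfolding u(1)[symmetric] by (simp add: power_mult[symmetric] mult.commute)
  also have "\<dots> = - 1 + 3 ^ Suc (Suc k) * (u + 3 * (3 ^ k * u\<^sup>2 * (- 1 + 3 ^ k * u)))"
    by (simp add: power2_eq_square power3_eq_cube algebra_simps)
  finally have "(2::int) ^ (3 ^ Suc k) = - 1 + 3 ^ Suc (Suc k) * (u + 3 * (3 ^ k * u\<^sup>2 * (- 1 + 3 ^ k * u)))" .
  moreover have "[u + 3 * (3 ^ k * u\<^sup>2 * (- 1 + 3 ^ k * u)) = 1] (mod 3)" using u(2) by (simp add: cong_def mod_add_eq)
  ultimately show ?case by blast
qed

lemma prod_dvd_diff:
  fixes f g :: "'b \<Rightarrow> 'a::comm_ring_1"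
  assumes "\<And>i. i \<in> A \<Longrightarrow> d dvd f i - g i" shows "d dvd prod f A - prod g A"
  using assms
proof (induction A rule: infinite_finite_induct)
  case (insert i A)
  have "f i * prod f A - g i * prod g A = (f i - g i) * prod f A + g i * (prod f A - prod g A)"
    by (simp add: algebra_simps)
  then show ?case using insert by simp
qed auto

text \<open>First-order expansion of a product. Two corrections together carry 3^(2 j + 2), which is
  divisible by 3^(j + 2), and the factors \<open>z i\<close> accompanying a single correction are 1
  modulo 3, so only the sum of the \<open>e i\<close> survives.\<close>

lemma prod_dvd_expand:
  fixes z e :: "'b \<Rightarrow> 'a::comm_ring_1"
  assumes "finite A" "\<And>i. i \<in> A \<Longrightarrow> 3 dvd z i - 1"
  shows "3 ^ Suc (Suc j) dvd (\<Prod>i\<in>A. z i - 3 ^ Suc j * e i) - ((\<Prod>i\<in>A. z i) - 3 ^ Suc j * (\<Sum>i\<in>A. e i))"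
  using assms
proof (induction A rule: finite_induct)
  case (insert i A)
  let ?P = "\<Prod>i\<in>A. z i - 3 ^ Suc j * e i" and ?Z = "\<Prod>i\<in>A. z i" and ?S = "\<Sum>i\<in>A. e i"
  let ?q = "3 ^ Suc j :: 'a"
  obtain w where w: "?P - (?Z - ?q * ?S) = 3 ^ Suc (Suc j) * w" using insert by (auto elim: dvdE)
  then have P: "?P = ?Z - ?q * ?S + 3 * ?q * w" by (simp add: algebra_simps)
  obtain c where c: "z i - 1 = 3 * c" using insert.prems by (auto elim: dvdE)
  then have zi: "z i = 1 + 3 * c" by (simp add: algebra_simps)
  have "3 dvd ?Z - (\<Prod>i\<in>A. 1)" by (rule prod_dvd_diff) (use insert.prems in auto)
  then obtain d where "?Z - 1 = 3 * d" by (auto elim: dvdE)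
  then have Z: "?Z = 1 + 3 * d" by (simp add: algebra_simps)
  have "(\<Prod>i\<in>insert i A. z i - ?q * e i) - ((\<Prod>i\<in>insert i A. z i) - ?q * (\<Sum>i\<in>insert i A. e i))
      = (z i - ?q * e i) * ?P - (z i * ?Z - ?q * (e i + ?S))" using insert.hyps by simp
  also have "\<dots> = 3 * ?q * (- c * ?S - e i * d + (3 ^ j * e i) * ?S + (z i - ?q * e i) * w)"
    unfolding P Z zi by (simp add: algebra_simps)
  also have "3 * ?q = 3 ^ Suc (Suc j)" by simp
  finally show ?case by simp
qed simp

lemma gcd_prime_power:
  fixes r :: nat
  assumes r: "prime r" and n: "\<not> r ^ Suc k dvd n" shows "gcd (r ^ Suc k) n dvd r ^ k"
proof -
  obtain j where j: "j \<le> Suc k" "gcd (r ^ Suc k) n = r ^ j"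
    using divides_primepow_nat[OF r, of "gcd (r ^ Suc k) n" "Suc k"] by auto
  then have "j \<noteq> Suc k" using n by (metis gcd_dvd2)
  then show ?thesis using j by (simp add: le_imp_power_dvd)
qed

section \<open>Congruences modulo an ideal and the residue characteristic\<close>

definition icong :: "'a::comm_ring_1 set \<Rightarrow> 'a \<Rightarrow> 'a \<Rightarrow> bool" where
  "icong P x y \<longleftrightarrow> x - y \<in> P"

lemma icong_refl [simp]: "is_ideal P \<Longrightarrow> icong P x x"
  by (simp add: icong_def add_subgroup_zero is_ideal_subgroup)

lemma icong_sym: "is_ideal P \<Longrightarrow> icong P x y \<Longrightarrow> icong P y x"
  using add_subgroup_uminus[OF is_ideal_subgroup, of P "x - y"] by (simp add: icong_def)

lemma icong_trans: "is_ideal P \<Longrightarrow> icong P x y \<Longrightarrow> icong P y z \<Longrightarrow> icong P x z"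
  using add_subgroup_add[OF is_ideal_subgroup, of P "x - y" "y - z"] by (simp add: icong_def)

lemma icong_mult:
  assumes "is_ideal P" "icong P x y" "icong P z w" shows "icong P (x * z) (y * w)"
proof -
  have "x * z - y * w = (x - y) * z + y * (z - w)" by (simp add: algebra_simps)
  also have "\<dots> \<in> P" using assms unfolding icong_def
    by (intro add_subgroup_add[OF is_ideal_subgroup] is_ideal_mult(2)[of P "x - y"] is_ideal_mult(1)[of P "z - w"]) auto
  finally show ?thesis by (simp add: icong_def)
qed

lemma icong_pow: "is_ideal P \<Longrightarrow> icong P x y \<Longrightarrow> icong P (x ^ n) (y ^ n)"
  by (induction n) (auto intro: icong_mult)

lemma prime_ideal_pow: "prime_ideal P \<Longrightarrow> x ^ n \<in> P \<Longrightarrow> x \<in> P"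
  by (induction n) (auto simp: prime_ideal_def)

text \<open>The index lies in \<open>P\<close>, so \<open>P\<close> contains a least positive
  integer \<open>p\<close>; it is prime because \<open>P\<close> is, and the index is a power of it
  because \<open>P\<close> contains all multiples of \<open>p\<close>.\<close>

lemma prime_ideal_char:
  fixes P :: "'a::comm_ring_1 set"
  assumes P: "prime_ideal P" and fin: "finite_index P"
  obtains p e where "prime p" "\<And>n. of_int n \<in> P \<longleftrightarrow> int p dvd n" "index P = p ^ e"
proof -
  have I: "is_ideal P" and J: "add_subgroup P" and pr: "\<And>x y. x * y \<in> P \<Longrightarrow> x \<in> P \<or> y \<in> P" and one: "1 \<notin> P"
    using P by (auto simp: prime_ideal_def is_ideal_def)
  have ex: "\<exists>n>0. (of_nat n :: 'a) \<in> P"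
    using index_mult_mem[OF J fin, of 1] index_pos[OF fin] by auto
  define p where "p = (LEAST n. n > 0 \<and> (of_nat n :: 'a) \<in> P)"
  have p: "p > 0" "of_nat p \<in> P" using LeastI_ex[OF ex] by (auto simp: p_def)
  have min: "p \<le> n" if "n > 0" "of_nat n \<in> P" for n unfolding p_def by (rule Least_le) (use that in auto)
  have "p \<noteq> 1" using p one by auto
  have "prime p" unfolding prime_nat_iff
  proof (intro conjI allI impI)
    show "1 < p" using p \<open>p \<noteq> 1\<close> by simp
    fix d assume "d dvd p"
    then obtain c where c: "p = d * c" by blast
    then have "of_nat d \<in> P \<or> of_nat c \<in> P" using pr[of "of_nat d" "of_nat c"] p(2) by simp
    moreover have "d > 0" "c > 0" using c p(1) by auto
    ultimately have "p \<le> d \<or> p \<le> c" using min by blast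
    then show "d = 1 \<or> d = p"
    proof
      assume "p \<le> d" then show ?thesis using \<open>d dvd p\<close> p(1) by (auto dest: dvd_imp_le)
    next
      assume "p \<le> c" then show ?thesis using c \<open>c > 0\<close> \<open>d > 0\<close> by simp
    qed
  qed
  moreover have "of_int n \<in> P \<longleftrightarrow> int p dvd n" for n
  proof
    assume n: "of_int n \<in> P"
    have "(of_int (n mod int p) :: 'a) = of_int n - of_int (n div int p) * of_nat p"
      unfolding minus_div_mult_eq_mod[of n "int p", symmetric] by (simp only: of_int_diff of_int_mult of_int_of_nat_eq)
    also have "\<dots> \<in> P" by (intro add_subgroup_diff[OF J] n is_ideal_mult(1)[OF I] p)
    finally have "of_int (n mod int p) \<in> P" .
    moreover have b: "0 \<le> n mod int p" "n mod int p < int p" using p(1) by auto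
    ultimately have "of_nat (nat (n mod int p)) \<in> P" by simp
    then have "\<not> nat (n mod int p) > 0" using min[of "nat (n mod int p)"] b by linarith
    then have "n mod int p = 0" using b by simp
    then show "int p dvd n" by (simp add: dvd_eq_mod_eq_0)
  next
    assume "int p dvd n"
    then obtain c where "n = int p * c" by blast
    then have "(of_int n :: 'a) = of_nat p * of_int c" by simp
    then show "of_int n \<in> P" using is_ideal_mult(2)[OF I p(2)] by simp
  qed
  moreover obtain e where "index P = p ^ e"
    using index_prime_power[OF J fin \<open>prime p\<close>] is_ideal_mult(2)[OF I p(2)] by blast
  ultimately show ?thesis by (rule that)
qed

section \<open>Norm congruences modulo powers of 3\<close>

context cyclotomic
begin

lemma nm_cong:
  assumes "of_int K dvd x - y" "K \<noteq> 0" shows "K dvd nm x - nm y"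
proof -
  obtain c where c: "x - y = of_int K * c" using assms(1) by blast
  have "of_int K dvd conj_prod x - conj_prod y" unfolding conj_prod_def
  proof (rule prod_dvd_diff)
    fix s
    have "subst_power s x - subst_power s y = of_int K * subst_power s c"
      unfolding subst_power_diff[symmetric] c subst_power_mult by simp
    then show "of_int K dvd subst_power s x - subst_power s y" by simp
  qed
  then obtain h where h: "conj_prod x - conj_prod y = of_int K * h" by blast
  show ?thesis
  proof (rule dvd_if_ev[OF _ assms(2)])
    fix s assume "s \<in> G"
    then show "ev (\<rho> ^ s) (of_int K * h) = of_int (nm x - nm y)"
      unfolding h[symmetric] by (simp only: ev_diff ev_conj_prod of_int_diff nm)
  qed
qed

lemma tr_cong:
  assumes "of_int K dvd x - y" shows "K dvd tr x - tr y"
proof -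
  obtain c where "x - y = of_int K * c" using assms by blast
  then have "x = of_int K * c + y" by (simp add: algebra_simps)
  then show ?thesis by (simp add: tr_add tr_mult_int)
qed

text \<open>At an element congruent to 1 modulo 3 the derivative of the norm is the trace:
  \<open>prod_dvd_expand\<close> applied to the product of all conjugates.\<close>

lemma nm_perturb:
  assumes "3 dvd z - 1"
  shows "3 ^ Suc (Suc j) dvd nm (z - 3 ^ Suc j * e) - (nm z - 3 ^ Suc j * tr e)"
proof -
  have sub3: "subst_power s (3 ^ i * x) = 3 ^ i * subst_power s x" for s i x
    unfolding subst_power_mult subst_power_power using subst_power_of_int[of s 3] by simp
  have "3 ^ Suc (Suc j) dvd (\<Prod>s\<in>G. subst_power s z - 3 ^ Suc j * subst_power s e) 
      - ((\<Prod>s\<in>G. subst_power s z) - 3 ^ Suc j * (\<Sum>s\<in>G. subst_power s e))"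
  proof (rule prod_dvd_expand)
    fix s
    obtain c where "z - 1 = 3 * c" using assms by blast
    then have "subst_power s (z - 1) = 3 * subst_power s c" using sub3[of s 1 c] by simp
    then show "3 dvd subst_power s z - 1" by (simp add: subst_power_diff)
  qed simp
  then obtain h where h: "(\<Prod>s\<in>G. subst_power s z - 3 ^ Suc j * subst_power s e) 
      - ((\<Prod>s\<in>G. subst_power s z) - 3 ^ Suc j * (\<Sum>s\<in>G. subst_power s e)) = 3 ^ Suc (Suc j) * h" by blast
  show ?thesis
  proof (rule dvd_if_ev[of _ h])
    fix t assume t: "t \<in> G"
    have "(\<Prod>s\<in>G. subst_power s z - 3 ^ Suc j * subst_power s e) = conj_prod (z - 3 ^ Suc j * e)"
      unfolding conj_prod_def subst_power_diff sub3 ..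
    moreover have "ev (\<rho> ^ t) (\<Sum>s\<in>G. subst_power s e) = Tr e"
      using sum_conj[OF G_coprime[OF t], of e] by (simp add: power_mult)
    moreover have "(\<Prod>s\<in>G. subst_power s z) = conj_prod z" by (simp add: conj_prod_def)
    ultimately have "ev (\<rho> ^ t) (3 ^ Suc (Suc j) * h) = Nm (z - 3 ^ Suc j * e) - (Nm z - 3 ^ Suc j * Tr e)"
      unfolding h[symmetric] using ev_conj_prod[OF t] by simp
    then show "ev (\<rho> ^ t) (of_int (3 ^ Suc (Suc j)) * h) = of_int (nm (z - 3 ^ Suc j * e) - (nm z - 3 ^ Suc j * tr e))"
      by (simp add: nm tr)
  qed simp
qed

text \<open>\<open>C\<close> is the quotient of A^3 - B^3 by A - B, and the norms of these two are
  compared modulo 3^(k+2). With Z = u^(3^(k+1)) + v^(3^(k+1)), the Frobenius congruences turn A^3 -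
  B^3 into the conjugate \<open>subst_power 3 Z\<close>, whose norm is \<open>nm Z\<close>. But A -
  B is Z - 3^(k+1) w v^(3^(k+1)), with norm \<open>nm Z\<close> minus 3^(k+1) times a trace
  \<open>T\<close> prime to 3. So the quotient of the norms cannot be 1.\<close>

lemma norm_not_cong_1:
  assumes m3: "coprime 3 m" and v: "\<not> 3 dvd tr v" and uv: "u = 1 - v"
    and A: "A = u ^ (3 ^ Suc k)" and B: "B = (2 * v ^ 3) ^ (3 ^ k)" and C: "C = A\<^sup>2 + A * B + B\<^sup>2"
  shows "\<not> 3 ^ Suc (Suc k) dvd nm C - 1" "3 dvd nm C - 1"
proof -
  define Z where "Z = u ^ (3 ^ Suc k) + v ^ (3 ^ Suc k)"
  have frob: "3 dvd x ^ 3 - subst_power 3 x" for x using frobenius_dvd[of 3 x] by simp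
  have fr: "3 ^ Suc i dvd x ^ (3 ^ Suc i) - (subst_power 3 x) ^ (3 ^ i)" for x i
    using pow3_dvd_lift[OF frob, of i x] by (simp add: power_mult[symmetric])
  have c3: "3 ^ i dvd nm x - nm y" if "3 ^ i dvd x - y" for x y i
    using nm_cong[of "3 ^ i" x y] that by simp
  obtain w where w: "(2::int) ^ (3 ^ k) = - 1 + 3 ^ Suc k * w" "[w = 1] (mod 3)" using two_power by blast
  obtain w' where w': "(2::int) ^ (3 ^ Suc k) = - 1 + 3 ^ Suc (Suc k) * w'" using two_power by blast
  have two: "(2::int poly) ^ (3 ^ k) = - 1 + 3 ^ Suc k * of_int w" "(2::int poly) ^ (3 ^ Suc k) = - 1 + 3 ^ Suc (Suc k) * of_int w'"
    using arg_cong[OF w(1), of "of_int :: int \<Rightarrow> int poly"] arg_cong[OF w', of "of_int :: int \<Rightarrow> int poly"] by simp_all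
  have B': "B = (- 1 + 3 ^ Suc k * of_int w) * v ^ (3 ^ Suc k)"
    unfolding B power_mult_distrib two(1) by (simp add: power_mult[symmetric])
  have AB: "A - B = Z - 3 ^ Suc k * (of_int w * v ^ (3 ^ Suc k))"
    unfolding A B' Z_def by (simp add: algebra_simps)
  have A3: "A ^ 3 = u ^ (3 ^ Suc (Suc k))" unfolding A by (simp add: power_mult[symmetric] mult.commute)
  have B3: "B ^ 3 = (- 1 + 3 ^ Suc (Suc k) * of_int w') * v ^ (3 ^ Suc (Suc k))"
  proof -
    have "B ^ 3 = 2 ^ (3 ^ Suc k) * v ^ (3 ^ Suc (Suc k))"
      unfolding B power_mult_distrib by (simp add: power_mult[symmetric] mult.commute)
    then show ?thesis unfolding two(2) .
  qed
  have Zs: "subst_power 3 Z = (subst_power 3 u) ^ (3 ^ Suc k) + (subst_power 3 v) ^ (3 ^ Suc k)"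
    by (simp only: Z_def subst_power_add subst_power_power)
  have "3 ^ Suc (Suc k) dvd (A ^ 3 - B ^ 3) - subst_power 3 Z"
  proof -
    have "3 ^ Suc (Suc k) dvd (u ^ (3 ^ Suc (Suc k)) - (subst_power 3 u) ^ (3 ^ Suc k))
       + (v ^ (3 ^ Suc (Suc k)) - (subst_power 3 v) ^ (3 ^ Suc k)) - 3 ^ Suc (Suc k) * (of_int w' * v ^ (3 ^ Suc (Suc k)))"
      by (intro dvd_add dvd_diff fr dvd_triv_left)
    moreover have "\<dots> = (A ^ 3 - B ^ 3) - subst_power 3 Z" unfolding A3 B3 Zs by (simp add: algebra_simps)
    ultimately show ?thesis by (simp only:)
  qed
  from c3[OF this] have n1: "3 ^ Suc (Suc k) dvd nm (A ^ 3 - B ^ 3) - nm Z"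
    using m3 by (simp add: nm_subst)
  have "A ^ 3 - B ^ 3 = C * (A - B)" unfolding C by (simp add: power2_eq_square power3_eq_cube algebra_simps)
  then have n2: "nm (A ^ 3 - B ^ 3) = nm C * nm (A - B)" by (simp add: nm_mult)
  \<comment> \<open>The relation u + v = 1 persists modulo 3 when both summands are cubed, since
    cubing is additive modulo 3.\<close>
  have Z1: "3 dvd Z - 1"
  proof -
    have "3 dvd u ^ (3 ^ i) + v ^ (3 ^ i) - 1" for i
    proof (induction i)
      case (Suc i)
      let ?a = "u ^ (3 ^ i)" and ?b = "v ^ (3 ^ i)"
      from Suc obtain c where "?a + ?b - 1 = 3 * c" by blast
      then have a: "?a = 1 + 3 * c - ?b" by (simp add: algebra_simps)
      have "?a ^ 3 + ?b ^ 3 - 1 = 3 * (c * 3 + 9 * c^2 + 9 * c^3 - ?b * (1 + 3 * c)^2 + ?b^2 * (1 + 3 * c))"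
        unfolding a by (simp add: power2_eq_square power3_eq_cube algebra_simps)
      then have "3 dvd ?a ^ 3 + ?b ^ 3 - 1" by (simp only: dvd_triv_left)
      moreover have "x ^ (3 ^ Suc i) = (x ^ (3 ^ i)) ^ 3" for x :: "int poly"
        by (simp add: power_mult[symmetric] mult.commute)
      ultimately show ?case by (simp only:)
    qed (simp add: uv)
    then show ?thesis unfolding Z_def .
  qed
  have nZ: "3 dvd nm Z - 1"
  proof -
    have "nm 1 = 1"
    proof -
      have "(of_int (nm 1) :: complex) = of_int 1" unfolding nm by (simp add: Nm_def)
      then show ?thesis by (simp only: of_int_eq_iff)
    qed
    then show ?thesis using c3[of 1 Z 1] Z1 by simp
  qed
  define T where "T = tr (of_int w * v ^ (3 ^ Suc k))"
  have n3: "3 ^ Suc (Suc k) dvd nm (A - B) - (nm Z - 3 ^ Suc k * T)"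
    unfolding AB T_def by (rule nm_perturb[OF Z1])
  \<comment> \<open>Modulo 3 cubing is a conjugation and leaves traces unchanged, so the trace of
    every v^(3^i) agrees with that of \<open>v\<close>; the factor \<open>w\<close> is 1 modulo
    3.\<close>
  have T: "\<not> 3 dvd T"
  proof -
    have "3 dvd tr (v ^ (3 ^ i)) - tr v" for i
    proof (induction i)
      case (Suc i)
      have "3 dvd tr ((v ^ (3 ^ i)) ^ 3) - tr (subst_power 3 (v ^ (3 ^ i)))"
        using tr_cong[of 3] frob by simp
      then have "3 dvd (tr ((v ^ (3 ^ i)) ^ 3) - tr (v ^ (3 ^ i))) + (tr (v ^ (3 ^ i)) - tr v)"
        using Suc m3 by (intro dvd_add) (simp_all add: tr_subst)
      then show ?case by (simp add: power_mult[symmetric] mult.commute)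
    qed simp
    then have "3 dvd tr (v ^ (3 ^ Suc k)) - tr v" .
    moreover have "3 dvd w - 1" using w(2) by (simp add: cong_iff_dvd_diff)
    ultimately have "3 dvd w * (tr (v ^ (3 ^ Suc k)) - tr v) + (w - 1) * tr v" by (intro dvd_add) simp_all
    moreover have "T - tr v = w * (tr (v ^ (3 ^ Suc k)) - tr v) + (w - 1) * tr v"
      unfolding T_def tr_mult_int by (simp add: algebra_simps)
    ultimately have "3 dvd T - tr v" by simp
    then show ?thesis using v by (metis dvd_diff_right_iff)
  qed
  have key: "3 ^ Suc (Suc k) dvd nm C * (nm Z - 3 ^ Suc k * T) - nm Z"
  proof -
    have "3 ^ Suc (Suc k) dvd (nm (A ^ 3 - B ^ 3) - nm Z) - nm C * (nm (A - B) - (nm Z - 3 ^ Suc k * T))"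
      by (intro dvd_diff n1 dvd_mult n3)
    then show ?thesis unfolding n2 by (simp add: algebra_simps)
  qed
  show "3 dvd nm C - 1"
  proof -
    have h1: "3 dvd nm C * (nm Z - 3 ^ Suc k * T) - nm Z" by (rule dvd_trans[OF _ key]) simp
    have h2: "3 dvd nm C * (3 ^ Suc k * T)" by simp
    have "3 dvd (nm C * (nm Z - 3 ^ Suc k * T) - nm Z) + nm C * (3 ^ Suc k * T) - (nm C - 1) * (nm Z - 1)" 
      by (rule dvd_diff[OF dvd_add[OF h1 h2] dvd_mult[OF nZ]])
    moreover have "\<dots> = (nm C - 1)" by (simp add: algebra_simps)
    ultimately show ?thesis by simp
  qed
  show "\<not> 3 ^ Suc (Suc k) dvd nm C - 1"
  proof
    assume h: "3 ^ Suc (Suc k) dvd nm C - 1"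
    have "3 ^ Suc (Suc k) dvd (nm C - 1) * (nm Z - 3 ^ Suc k * T) - (nm C * (nm Z - 3 ^ Suc k * T) - nm Z)"
      by (rule dvd_diff[OF dvd_mult2[OF h] key])
    moreover have "\<dots> = 3 ^ Suc k * T" by (simp add: algebra_simps)
    ultimately have "3 ^ Suc k * 3 dvd 3 ^ Suc k * T" by (simp add: mult.commute)
    then have "3 dvd T" by (subst (asm) dvd_mult_cancel_left) simp
    then show False using T by simp
  qed
qed

end

section \<open>Primes modulo which 2 is or is not a cube\<close>

lemma finite_subsingleton:
  assumes "\<And>x y. x \<in> A \<Longrightarrow> y \<in> A \<Longrightarrow> x = y" shows "finite A"
proof (cases "A = {}")
  case False
  then obtain a where "a \<in> A" by blast
  then have "A \<subseteq> {a}" using assms by blast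
  then show ?thesis by (rule finite_subset) simp
qed simp

lemma is_ideal_pow: "\<lbrakk>is_ideal P; x \<in> P; n > 0\<rbrakk> \<Longrightarrow> x ^ n \<in> P"
  by (cases n) (auto intro: is_ideal_mult(2))

text \<open>Write 2 as the i-th power of a primitive root. Then 2^n = 1 means that 3 n divides i n,
  so 3 divides i.\<close>

lemma cube_root_two_if_power:
  assumes p: "prime p" and n: "p - 1 = 3 * n" and two: "[2 ^ n = (1::nat)] (mod p)"
  shows "\<exists>x::int. [x ^ 3 = 2] (mod int p)"
proof -
  have n0: "n > 0" using prime_gt_1_nat[OF p] n by (cases n) auto
  then have p4: "p > 3" using n by linarith
  obtain a where a: "a \<in> {1..p - 1}" "{1..p - 1} = {a ^ i mod p | i. i \<in> UNIV}"
    using residue_prime_mult_group_has_gen[OF p] by blast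
  have "\<not> p dvd a" using a(1) by (auto dest: dvd_imp_le)
  then have "[a ^ (p - 1) = 1] (mod p)" by (rule fermat_theorem[OF p])
  then have d: "ord p a dvd p - 1" by (simp only: ord_divides)
  have "coprime p a" using p \<open>\<not> p dvd a\<close> by (rule prime_imp_coprime)
  then have d0: "ord p a > 0" by simp
  have "{1..p - 1} \<subseteq> (\<lambda>i. a ^ i mod p) ` {..<ord p a}"
  proof
    fix y assume "y \<in> {1..p - 1}"
    then obtain i where y: "y = a ^ i mod p" using a(2) by blast
    have "[a ^ (ord p a * (i div ord p a)) * a ^ (i mod ord p a) = 1 * a ^ (i mod ord p a)] (mod p)"
      by (intro cong_mult cong_refl) (simp add: ord_divides del: One_nat_def)
    then have "y = a ^ (i mod ord p a) mod p" unfolding y by (simp add: power_add[symmetric] cong_def)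
    then show "y \<in> (\<lambda>i. a ^ i mod p) ` {..<ord p a}" using d0 by auto
  qed
  from surj_card_le[OF _ this] have "p - 1 \<le> ord p a" by simp
  then have o: "ord p a = 3 * n" using d n p4 by (auto dest: dvd_imp_le)
  have "2 \<in> {1..p - 1}" using p4 by auto
  then obtain i where i: "2 = a ^ i mod p" using a(2) by blast
  then have i2: "[a ^ i = 2] (mod p)" using p4 by (simp add: cong_def)
  have "[a ^ (i * n) = 1] (mod p)" unfolding power_mult by (rule cong_trans[OF cong_pow[OF i2] two])
  then have "3 * n dvd i * n" by (simp only: ord_divides o)
  then have "3 dvd i" using n0 by simp
  then obtain j where "i = j * 3" by (metis dvd_def mult.commute)
  then have "[(a ^ j) ^ 3 = 2] (mod p)" using i2 by (simp add: power_mult)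
  then have "[int ((a ^ j) ^ 3) = int 2] (mod int p)" by (simp only: cong_int_iff)
  then show ?thesis by (intro exI[of _ "int (a ^ j)"]) simp
qed

section \<open>Splitting of a prime read off from an ideal above it\<close>

context cyclotomic
begin

text \<open>If Frobenius fixes \<open>t\<close> modulo \<open>P\<close>, then \<open>P\<close>
  contains the difference between \<open>t\<close> and its conjugate attached to
  \<open>p mod m\<close>, hence also the norm of that difference. Separation leaves only the
  identity conjugation.\<close>

lemma cong_one_if_separated:
  assumes P: "prime_ideal P" "J0 \<subseteq> P" and p: "prime p" "of_nat p \<in> P" and m: "of_nat m \<notin> P"
    and sep: "\<And>s. s \<in> G \<Longrightarrow> s \<noteq> 1 mod m \<Longrightarrow> of_int (nm (subst_power s t - t)) \<notin> P"
    and t: "subst_power p t - t \<in> P"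
  shows "[p = 1] (mod m)"
proof -
  have I: "is_ideal P" using P by (simp add: prime_ideal_def)
  note J = is_ideal_subgroup[OF I]
  have "\<not> p dvd m"
  proof
    assume "p dvd m"
    then obtain c where "m = p * c" by blast
    then have "(of_nat m :: int poly) = of_nat p * of_nat c" by simp
    then show False using m is_ideal_mult(2)[OF I p(2), of "of_nat c"] by simp
  qed
  then have cop: "coprime p m" using p(1) by (simp add: prime_imp_coprime)
  have "subst_power (p mod m) t - subst_power p t \<in> J0"
  proof -
    have "(\<rho> ^ s) ^ (p mod m) = (\<rho> ^ s) ^ p" for s
      unfolding power_mult[symmetric] unity_root_power_eq_iff[OF m_pos] by (simp only: mod_mult_right_eq)
    then show ?thesis by (simp add: J0_def)
  qed
  then have "(subst_power (p mod m) t - subst_power p t) + (subst_power p t - t) \<in> P"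
    using P(2) t by (intro add_subgroup_add[OF J]) auto
  then have e: "subst_power (p mod m) t - t \<in> P" by simp
  obtain h where h: "h * (subst_power (p mod m) t - t) - of_int (nm (subst_power (p mod m) t - t)) \<in> J0"
    using nm_cofactor by blast
  have "h * (subst_power (p mod m) t - t) - (h * (subst_power (p mod m) t - t) - of_int (nm (subst_power (p mod m) t - t))) \<in> P"
    by (intro add_subgroup_diff[OF J] is_ideal_mult(1)[OF I] e subsetD[OF P(2)] h)
  then have "of_int (nm (subst_power (p mod m) t - t)) \<in> P" by simp
  then have "p mod m = 1 mod m" using sep[OF mod_in_G[OF cop]] by blast
  then show ?thesis by (simp add: cong_def)
qed

text \<open>Put a = u^3 and b = 2 v^3. Membership of A^2 + A B + B^2 gives a / b order exactly
  3^(k+1) in the residue field with q elements, and by \<open>idx\<close> this is the full power of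
  3 in q - 1. So a / b is not a cube there, and neither is 2. The remaining work brings this down
  from q to the characteristic p and shows that p is 1 modulo \<open>m\<close>.\<close>

lemma noncube_from_ideal:
  assumes P: "prime_ideal P" "J0 \<subseteq> P" "finite_index P" and uv: "u = 1 - v"
    and A: "A = u ^ (3 ^ Suc k)" and B: "B = (2 * v ^ 3) ^ (3 ^ k)" and C: "A\<^sup>2 + A * B + B\<^sup>2 \<in> P"
    and idx: "\<not> [index P = 1] (mod 3 ^ Suc (Suc k))"
    and nP: "3 \<notin> P" "2 \<notin> P" "of_int Q \<notin> P" "of_nat m \<notin> P" and v: "v = of_int Q * t"
    and sep: "\<And>s. s \<in> G \<Longrightarrow> s \<noteq> 1 mod m \<Longrightarrow> of_int (nm (subst_power s t - t)) \<notin> P"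
  shows "\<exists>p. prime p \<and> of_nat p \<in> P \<and> [p = 1] (mod 3 ^ Suc k) \<and> [p = 1] (mod m) \<and> \<not> (\<exists>x::int. [x ^ 3 = 2] (mod int p))"
proof -
  have I: "is_ideal P" and pr: "\<And>x y. x * y \<in> P \<Longrightarrow> x \<in> P \<or> y \<in> P" and one: "1 \<notin> P"
    using P by (auto simp: prime_ideal_def)
  note J = is_ideal_subgroup[OF I] and ppow = prime_ideal_pow[OF P(1)]
  have zero: "0 \<in> P" using add_subgroup_zero[OF J] .
  define a where "a = u ^ 3"
  define b where "b = 2 * v ^ 3"
  have vP: "v \<notin> P"
  proof
    assume "v \<in> P"
    then have "B \<in> P" unfolding B by (intro is_ideal_pow[OF I] is_ideal_mult(1)[OF I]) auto
    then have "A\<^sup>2 + A * B + B\<^sup>2 - (A + B) * B \<in> P" by (intro add_subgroup_diff[OF J] C is_ideal_mult(1)[OF I])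
    then have "A\<^sup>2 \<in> P" by (simp add: algebra_simps power2_eq_square)
    then have "u \<in> P" unfolding A using ppow by blast
    then have "u + v \<in> P" using \<open>v \<in> P\<close> by (rule add_subgroup_add[OF J])
    then show False using one by (simp add: uv)
  qed
  then have bP: "b \<notin> P" unfolding b_def using pr[of 2 "v ^ 3"] ppow[of v 3] nP by blast
  have A': "A = a ^ (3 ^ k)" "B = b ^ (3 ^ k)" unfolding A B a_def b_def by (simp_all add: power_mult[symmetric])
  have uP: "u \<notin> P"
  proof
    assume "u \<in> P"
    then have "A \<in> P" unfolding A by (intro is_ideal_pow[OF I]) auto
    then have "A\<^sup>2 + A * B + B\<^sup>2 - (A + B) * A \<in> P" by (intro add_subgroup_diff[OF J] C is_ideal_mult(1)[OF I])
    then have "B\<^sup>2 \<in> P" by (simp add: algebra_simps power2_eq_square)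
    then show False using ppow bP A'(2) by blast
  qed
  then have aP: "a \<notin> P" unfolding a_def using ppow by blast
  have AP: "A \<notin> P" using A' ppow aP by blast
  have agree: "a ^ (3 ^ Suc k) - b ^ (3 ^ Suc k) \<in> P"
  proof -
    have "(A - B) * (A\<^sup>2 + A * B + B\<^sup>2) \<in> P" by (rule is_ideal_mult(1)[OF I C])
    moreover have "(A - B) * (A\<^sup>2 + A * B + B\<^sup>2) = A ^ 3 - B ^ 3" by (simp add: power2_eq_square power3_eq_cube algebra_simps)
    ultimately show ?thesis unfolding A' by (simp add: power_mult[symmetric] mult.commute)
  qed
  have dis: "a ^ (3 ^ k) - b ^ (3 ^ k) \<notin> P"
  proof
    assume "a ^ (3 ^ k) - b ^ (3 ^ k) \<in> P"
    then have AB: "A - B \<in> P" by (simp add: A')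
    have "A\<^sup>2 + A * B + B\<^sup>2 + (2 * A + B) * (A - B) \<in> P"
      by (intro add_subgroup_add[OF J] C is_ideal_mult(1)[OF I] AB)
    then have "3 * A\<^sup>2 \<in> P" by (simp add: algebra_simps power2_eq_square)
    then show False using pr[of 3 "A\<^sup>2"] ppow[of A 2] nP AP by blast
  qed
  have dis_gcd: "\<not> a ^ d - b ^ d \<in> P" if "d dvd 3 ^ k" for d
  proof
    assume "a ^ d - b ^ d \<in> P"
    then have "icong P (a ^ d) (b ^ d)" by (simp add: icong_def)
    from icong_pow[OF I this] have "icong P ((a ^ d) ^ (3 ^ k div d)) ((b ^ d) ^ (3 ^ k div d))" .
    then show False using that dis by (simp add: power_mult[symmetric] icong_def)
  qed
  \<comment> \<open>If the order condition failed, agreement at \<open>n\<close> and at 3^(k+1)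
    would give agreement at their gcd, a divisor of 3^k, where \<open>dis_gcd\<close> excludes
    it.\<close>
  have no_agree: "3 ^ Suc k dvd n" if "a ^ n - b ^ n \<in> P" for n
    using power_agree_gcd[OF P(1) aP bP agree that] dis_gcd gcd_prime_power[of 3 k n] by auto
  define q where "q = index P"
  have fer: "icong P (x ^ (q - 1)) 1" if "x \<notin> P" for x
    using prime_ideal_fermat[OF P(1,3) that] by (simp add: icong_def q_def)
  have agr: "x ^ n - y ^ n \<in> P" if "icong P (x ^ n) 1" "icong P (y ^ n) 1" for x y n
    using icong_trans[OF I that(1) icong_sym[OF I that(2)]] by (simp add: icong_def)
  have q3: "3 ^ Suc k dvd q - 1" using no_agree agr fer aP bP by blast
  obtain p e where p: "prime p" "\<And>n. of_int n \<in> P \<longleftrightarrow> int p dvd n" "q = p ^ e"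
    using prime_ideal_char[OF P(1,3)] unfolding q_def by metis
  have pP: "of_nat p \<in> P" using p(2)[of "int p"] by simp
  have q_pos: "q \<ge> 1" using index_pos[OF P(3)] by (simp add: q_def)
  have nq: "\<not> 3 ^ Suc (Suc k) dvd q - 1"
    using idx q_pos unfolding q_def[symmetric] by (metis cong_altdef_nat cong_sym)
  have p2: "\<not> p dvd 2" using p(2)[of 2] nP(2) int_dvd_int_iff[of p 2] by simp
  have two: "icong P (2 ^ (p - 1)) 1"
  proof -
    have "int p dvd 2 ^ (p - 1) - 1" by (rule int_fermat_1[OF p(1)]) (use p(2)[of 2] nP in simp)
    then show ?thesis using p(2)[of "2 ^ (p - 1) - 1"] by (simp add: icong_def)
  qed
  obtain n1 where n1: "q - 1 = 3 * n1" using q3 by (metis dvd_def dvd_trans dvd_triv_left power_Suc)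
  have n1k: "\<not> 3 ^ Suc k dvd n1" using nq unfolding n1 by simp
  \<comment> \<open>\<open>n1\<close> is (q - 1) / 3. If 2^n1 were 1, then b^n1 = 2^n1 v^(q-1) and
    a^n1 = u^(q-1) would both be 1, and 3^(k+1) would divide \<open>n1\<close>.\<close>
  have two_n1: "\<not> icong P (2 ^ n1) 1"
  proof
    assume 2: "icong P (2 ^ n1) 1"
    have "icong P (2 ^ n1 * v ^ (q - 1)) (1 * 1)" by (intro icong_mult I 2 fer vP)
    moreover have "b ^ n1 = 2 ^ n1 * v ^ (q - 1)" unfolding b_def n1 power_mult power_mult_distrib ..
    ultimately have "icong P (b ^ n1) 1" by simp
    moreover have "icong P (a ^ n1) 1" using fer[OF uP] unfolding a_def n1 power_mult .
    ultimately show False using no_agree[OF agr] n1k by blast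
  qed
  \<comment> \<open>\<open>S\<close> is (q - 1) / (p - 1). It is prime to 3, because 2^(p-1) = 1
    while 2^((q-1)/3) is not 1; so all factors 3 of q - 1 already sit in p - 1.\<close>
  define S where "S = (\<Sum>i<e. p ^ i)"
  have qS: "q - 1 = (p - 1) * S"
  proof -
    have p1: "p \<ge> 1" using prime_gt_0_nat[OF p(1)] by simp
    have "int (q - 1) = int p ^ e - 1" using q_pos by (simp add: p(3))
    also have "\<dots> = (int p - 1) * (\<Sum>i<e. int p ^ i)" by (rule power_diff_1_eq)
    also have "\<dots> = int ((p - 1) * S)" using p1 by (simp add: S_def)
    finally show ?thesis by (simp only: of_nat_eq_iff)
  qed
  have S3: "\<not> 3 dvd S"
  proof
    assume "3 dvd S"
    then obtain S' where "S = 3 * S'" by blast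
    then have "n1 = (p - 1) * S'" using qS n1 by simp
    then have "icong P (2 ^ n1) 1" using icong_pow[OF I two, of S'] by (simp add: power_mult)
    then show False using two_n1 by simp
  qed
  then have cop: "coprime (3 ^ Suc k) S" by (simp add: prime_imp_coprime)
  have p3: "3 ^ Suc k dvd p - 1" using q3 unfolding qS using cop by (simp add: coprime_dvd_mult_left_iff del: power_Suc)
  obtain n2 where n2: "p - 1 = 3 * n2" using p3 by (metis dvd_def dvd_trans dvd_triv_left power_Suc)
  have n12: "n1 = n2 * S" using n1 qS n2 by simp
  have noncube: "\<not> (\<exists>x::int. [x ^ 3 = 2] (mod int p))"
  proof
    assume "\<exists>x::int. [x ^ 3 = 2] (mod int p)"
    then obtain x :: int where x: "[x ^ 3 = 2] (mod int p)" by blast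
    have "\<not> int p dvd x"
    proof
      assume "int p dvd x"
      then have "int p dvd x ^ 3" by (simp add: dvd_power_same dvd_trans[OF _ dvd_power])
      then have "int p dvd 2" using x by (metis cong_dvd_iff)
      then show False using p(2)[of 2] nP by simp
    qed
    then have "int p dvd x ^ (p - 1) - 1" by (rule int_fermat_1[OF p(1)])
    moreover have "[x ^ (p - 1) = 2 ^ n2] (mod int p)" using cong_pow[OF x, of n2] unfolding n2 power_mult .
    ultimately have "int p dvd 2 ^ n2 - 1" by (metis cong_iff_dvd_diff cong_sym cong_trans)
    then have "icong P (2 ^ n2) 1" using p(2)[of "2 ^ n2 - 1"] by (simp add: icong_def)
    then have "icong P (2 ^ n1) 1" using icong_pow[OF I, of "2 ^ n2" 1 S] by (simp add: n12 power_mult)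
    then show False using two_n1 by simp
  qed
  \<comment> \<open>Frobenius fixes the ratio u / v: its (p-1)-th power becomes 1 after raising to
    the power 3, and also after raising to the power \<open>S\<close>, and these exponents are
    coprime.\<close>
  have uvp: "u ^ (p - 1) - v ^ (p - 1) \<in> P"
  proof -
    have "icong P (a ^ (p - 1)) (b ^ (p - 1))"
    proof -
      obtain c where "p - 1 = 3 ^ Suc k * c" using p3 by blast
      then show ?thesis using icong_pow[OF I, of "a ^ (3 ^ Suc k)" "b ^ (3 ^ Suc k)" c] agree
        by (simp add: power_mult icong_def del: power_Suc)
    qed
    moreover have "icong P (b ^ (p - 1)) (1 * v ^ (3 * (p - 1)))"
      unfolding b_def power_mult_distrib power_mult[symmetric] by (intro icong_mult I two icong_refl)
    ultimately have "icong P (u ^ (3 * (p - 1))) (v ^ (3 * (p - 1)))"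
      using icong_trans[OF I] by (simp add: a_def power_mult[symmetric])
    then have e1: "u ^ (3 * (p - 1)) - v ^ (3 * (p - 1)) \<in> P" unfolding icong_def .
    have "q - 1 = S * (p - 1)" unfolding qS by (rule mult.commute)
    then have e2: "u ^ (S * (p - 1)) - v ^ (S * (p - 1)) \<in> P" using agr[OF fer[OF uP] fer[OF vP]] by (simp only:)
    from power_agree_gcd[OF P(1) uP vP e1 e2]
    have "u ^ gcd (3 * (p - 1)) (S * (p - 1)) - v ^ gcd (3 * (p - 1)) (S * (p - 1)) \<in> P" .
    moreover have "gcd (3 * (p - 1)) (S * (p - 1)) = p - 1"
    proof -
      have "gcd (3 * (p - 1)) (S * (p - 1)) = (p - 1) * gcd 3 S" by (metis gcd_mult_distrib_nat mult.commute)
      moreover have "coprime 3 S" using S3 by (simp add: prime_imp_coprime)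
      ultimately show ?thesis by simp
    qed
    ultimately show ?thesis by simp
  qed
  have frobP: "icong P (x ^ p) (subst_power p x)" for x
  proof -
    obtain c where "x ^ p - subst_power p x = of_nat p * c" using frobenius_dvd[OF p(1), of x] by blast
    then show ?thesis using is_ideal_mult(2)[OF I pP] by (simp add: icong_def)
  qed
  \<comment> \<open>Because u + v = 1, fixing the ratio is fixing v: with \<open>?w\<close> for the
    image of v, the relation v u^p = u v^p reads v (1 - w) = (1 - v) w.\<close>
  have "subst_power p v - v \<in> P"
  proof -
    let ?w = "subst_power p v"
    have pp: "x ^ p = x * x ^ (p - 1)" for x :: "int poly" using prime_gt_0_nat[OF p(1)] by (simp add: power_eq_if)
    have "icong P (u * v * u ^ (p - 1)) (u * v * v ^ (p - 1))" using uvp by (intro icong_mult I icong_refl) (simp add: icong_def)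
    then have "icong P (v * u ^ p) (u * v ^ p)" by (simp add: pp ac_simps)
    moreover have "icong P (v * u ^ p) (v * (1 - ?w))" "icong P (u * v ^ p) (u * ?w)"
      using frobP[of u] frobP[of v] by (auto intro!: icong_mult I icong_refl simp: uv subst_power_diff)
    ultimately have "icong P (v * (1 - ?w)) (u * ?w)" using icong_trans[OF I] icong_sym[OF I] by blast
    then have "v - ?w \<in> P" by (simp add: icong_def uv algebra_simps)
    then show ?thesis using add_subgroup_uminus[OF J, of "v - ?w"] by simp
  qed
  then have "of_int Q * (subst_power p t - t) \<in> P" by (simp add: v subst_power_mult algebra_simps)
  then have tP: "subst_power p t - t \<in> P" using pr nP by blast
  have "[p = 1] (mod m)" by (rule cong_one_if_separated[OF P(1,2) p(1) pP nP(4) sep tP])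
  moreover have "[p = 1] (mod 3 ^ Suc k)" using p3 prime_gt_0_nat[OF p(1)]
    by (metis One_nat_def Suc_leI cong_altdef_nat cong_sym)
  ultimately show ?thesis using p(1) pP noncube by blast
qed

text \<open>By orthogonality of characters, the traces of the powers X^i, weighted with the (-i)-th
  powers of any one conjugate root, add up to \<open>m\<close>. Were all these traces divisible by
  3, so would \<open>m\<close> be, in the cyclotomic ring and hence in the integers.\<close>

lemma exists_trace_not_dvd_3:
  assumes "\<not> 3 dvd m" shows "\<exists>i. \<not> 3 dvd tr (monom 1 i)"
proof (rule ccontr)
  assume "\<not> (\<exists>i. \<not> 3 dvd tr (monom 1 i))"
  then have tr3: "tr (monom 1 i) = 3 * (tr (monom 1 i) div 3)" for i by simp
  \<comment> \<open>At an m-th root of unity the exponent \<open>i * (m - 1)\<close> acts as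
    -i.\<close>
  define h :: "int poly" where "h = (\<Sum>i<m. of_int (tr (monom 1 i) div 3) * monom 1 (i * (m - 1)))"
  have "ev (\<rho> ^ t) (of_int 3 * h) = of_int (int m)" if t: "t \<in> G" for t
  proof -
    have "ev (\<rho> ^ t) (of_int 3 * h) = (\<Sum>i<m. of_int (3 * (tr (monom 1 i) div 3)) * (\<rho> ^ t) ^ (i * (m - 1)))"
      by (simp add: h_def sum_distrib_left mult.assoc)
    also have "\<dots> = (\<Sum>i<m. Tr (monom 1 i) * (\<rho> ^ t) ^ (i * (m - 1)))" by (simp only: tr3[symmetric] tr)
    also have "\<dots> = (\<Sum>i<m. \<Sum>s\<in>G. (\<rho> ^ (s + t * (m - 1))) ^ i)"
      by (simp add: Tr_def sum_distrib_right power_add power_mult_distrib power_mult[symmetric] ac_simps)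
    also have "\<dots> = (\<Sum>s\<in>G. \<Sum>i<m. (\<rho> ^ (s + t * (m - 1))) ^ i)" by (rule sum.swap)
    also have "\<dots> = (\<Sum>s\<in>G. if s = t then of_nat m else 0)"
    proof (rule sum.cong[OF refl])
      fix s assume s: "s \<in> G"
      have iff: "\<rho> ^ (s + t * (m - 1)) = 1 \<longleftrightarrow> s = t"
      proof -
        have "\<rho> ^ (s + t * (m - 1)) * \<rho> ^ t = \<rho> ^ s * (\<rho> ^ m) ^ t"
        proof -
          have "s + t * (m - 1) + t = s + m * t" using m_pos by (cases m) (simp_all add: algebra_simps)
          then show ?thesis by (simp only: power_add[symmetric] power_mult[symmetric])
        qed
        then have "\<rho> ^ (s + t * (m - 1)) = 1 \<longleftrightarrow> \<rho> ^ s = \<rho> ^ t" by (auto simp: field_simps)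
        also have "\<dots> \<longleftrightarrow> s = t" using s t by (auto simp: unity_root_power_eq_iff[OF m_pos] reduced_residues_def)
        finally show ?thesis .
      qed
      show "(\<Sum>i<m. (\<rho> ^ (s + t * (m - 1))) ^ i) = (if s = t then of_nat m else 0)"
      proof (cases "s = t")
        case True
        then show ?thesis using iff by simp
      next
        case False
        have "(\<rho> ^ (s + t * (m - 1))) ^ m = 1" by (metis power_mult mult.commute power_one unity_root_power_self)
        then show ?thesis using iff False by (simp add: sum_gp_strict)
      qed
    qed
    also have "\<dots> = of_nat m" using t by simp
    finally show ?thesis by simp
  qed
  moreover have "(3::int) \<noteq> 0" by simp
  ultimately have "3 dvd int m" by (rule dvd_if_ev)
  then show False using assms by presburger
qed

text \<open>Adding 3 c X to X^i leaves the trace unchanged modulo 3, while any two given conjugates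
  of the sum coincide for at most one \<open>c\<close>. A generic \<open>c\<close> therefore
  separates all conjugates.\<close>

lemma exists_separating:
  assumes "\<not> 3 dvd m"
  obtains t where "\<not> 3 dvd tr t" "\<And>s. s \<in> G \<Longrightarrow> s \<noteq> 1 mod m \<Longrightarrow> nm (subst_power s t - t) \<noteq> 0"
proof -
  obtain i where i: "\<not> 3 dvd tr (monom 1 i)" using exists_trace_not_dvd_3[OF assms] by blast
  define T :: "nat \<Rightarrow> int poly" where "T c = monom 1 i + of_int (3 * int c) * monom 1 1" for c :: nat
  let ?bad = "\<lambda>x y. {c. ev (\<rho> ^ x) (T c) = ev (\<rho> ^ y) (T c)}"
  have "finite (\<Union>x\<in>G. \<Union>y\<in>G - {x}. ?bad x y)"
  proof (intro finite_UN_I finite_reduced_residues finite_Diff)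
    fix x y assume xy: "x \<in> G" "y \<in> G - {x}"
    then have ne: "\<rho> ^ x \<noteq> \<rho> ^ y" by (auto simp: unity_root_power_eq_iff[OF m_pos] reduced_residues_def)
    have "c = d" if "c \<in> ?bad x y" "d \<in> ?bad x y" for c d
    proof -
      have "3 * of_nat c * (\<rho> ^ x - \<rho> ^ y) = (\<rho> ^ y) ^ i - (\<rho> ^ x) ^ i" "3 * of_nat d * (\<rho> ^ x - \<rho> ^ y) = (\<rho> ^ y) ^ i - (\<rho> ^ x) ^ i"
        using that by (simp_all add: T_def algebra_simps)
      then have "(3 * of_nat c) * (\<rho> ^ x - \<rho> ^ y) = (3 * of_nat d) * (\<rho> ^ x - \<rho> ^ y)" by simp
      then have "3 * of_nat c = (3 * of_nat d :: complex)" using ne by (metis mult_right_cancel right_minus_eq)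
      then have "(of_nat c :: complex) = of_nat d" by simp
      then show ?thesis by (simp only: of_nat_eq_iff)
    qed
    then show "finite (?bad x y)" by (rule finite_subsingleton)
  qed
  then obtain c where c: "c \<notin> (\<Union>x\<in>G. \<Union>y\<in>G - {x}. ?bad x y)" by (meson ex_new_if_finite infinite_UNIV_nat)
  then have c': "ev (\<rho> ^ x) (T c) \<noteq> ev (\<rho> ^ y) (T c)" if "x \<in> G" "y \<in> G" "x \<noteq> y" for x y
    using that by simp
  show ?thesis
  proof (rule that[of "T c"])
    have "tr (T c) = tr (monom 1 i) + 3 * (int c * tr (monom 1 1))" unfolding T_def tr_add tr_mult_int by simp
    moreover have "\<not> 3 dvd x + 3 * y" if "\<not> 3 dvd x" for x y :: int using that by presburger
    ultimately show "\<not> 3 dvd tr (T c)" using i by (simp only:)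
  next
    fix s assume s: "s \<in> G" "s \<noteq> 1 mod m"
    show "nm (subst_power s (T c) - T c) \<noteq> 0" unfolding nm_nz_iff
    proof
      fix x assume x: "x \<in> G"
      have y: "x * s mod m \<in> G" using x s by (intro mod_in_G) (simp add: G_coprime)
      have ne: "x * s mod m \<noteq> x"
      proof
        assume "x * s mod m = x"
        then have "[x * s = x * 1] (mod m)" using x by (simp add: cong_def reduced_residues_def)
        then have "[s = 1] (mod m)" using G_coprime[OF x] by (simp only: cong_mult_lcancel_nat)
        then show False using s by (simp add: cong_def reduced_residues_def)
      qed
      from c'[OF y x ne] have "ev (\<rho> ^ (x * s mod m)) (T c) \<noteq> ev (\<rho> ^ x) (T c)" .
      then show "ev (\<rho> ^ x) (subst_power s (T c) - T c) \<noteq> 0"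
        unfolding unity_root_power_mod ev_diff ev_subst_power power_mult[symmetric] by simp
    qed
  qed
qed

end

text \<open>\<open>N\<close> is split as 3^k m because the two factors are reached differently: the
  powers of 3 through the order of an element, the part \<open>m\<close> through the splitting of
  the prime in the m-th cyclotomic ring.\<close>

theorem noncube_primes:
  assumes N: "N > 0"
  shows "\<exists>p>p0. prime p \<and> [p = 1] (mod N) \<and> [p = 1] (mod 3) \<and> \<not> (\<exists>x::int. [x ^ 3 = 2] (mod int p))"
proof -
  define k where "k = multiplicity 3 N"
  obtain m where m: "N = 3 ^ k * m" "\<not> 3 dvd m"
    using multiplicity_decompose'[of N 3] N unfolding k_def by auto
  have "m > 0" using m(2) by (auto intro: Nat.gr0I)
  then interpret cyclotomic m by unfold_locales
  have cop: "coprime 3 m" using m(2) by (simp add: prime_imp_coprime)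
  obtain t where t: "\<not> 3 dvd tr t" "\<And>s. s \<in> G \<Longrightarrow> s \<noteq> 1 mod m \<Longrightarrow> nm (subst_power s t - t) \<noteq> 0"
    using exists_separating[OF m(2)] by blast
  define \<delta> where "\<delta> = (\<Prod>s\<in>G - {1 mod m}. nm (subst_power s t - t))"
  \<comment> \<open>\<open>X\<close> collects what the prime ideal must avoid: 2, the primes up to
    \<open>p0\<close>, the divisors of \<open>m\<close>, and the differences of conjugates of
    \<open>t\<close>. Only its part \<open>Q\<close> prime to 3 will multiply \<open>t\<close>, so
    that the trace of \<open>v\<close> stays prime to 3; the prime 3 is excluded by
    \<open>nm C\<close> being 1 modulo 3.\<close>
  define X where "X = 2 * fact p0 * int m * \<delta>"
  have "\<delta> \<noteq> 0" unfolding \<delta>_def using t(2) by simp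
  then have X0: "X \<noteq> 0" using \<open>m > 0\<close> by (simp add: X_def)
  obtain Q where Q: "X = 3 ^ multiplicity 3 X * Q" "\<not> 3 dvd Q"
    using multiplicity_decompose'[of X 3] X0 by auto
  define v where "v = of_int Q * t"
  define u where "u = 1 - v"
  define A where "A = u ^ (3 ^ Suc k)"
  define B where "B = (2 * v ^ 3) ^ (3 ^ k)"
  define C where "C = A\<^sup>2 + A * B + B\<^sup>2"
  have "\<not> 3 dvd tr v" unfolding v_def tr_mult_int using Q(2) t(1) by (simp add: prime_dvd_mult_iff)
  note nC = norm_not_cong_1[OF cop this u_def A_def B_def C_def]
  have nC0: "nm C \<noteq> 0" using nC(2) by auto
  define J where "J = ideal_adjoin J0 C"
  have J: "is_ideal J" "finite_index J" "index J = nat \<bar>nm C\<bar>"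
    unfolding J_def by (simp_all add: is_ideal_adjoin J0_ideal finite_index_adjoin nC0 index_eq_norm)
  have "\<not> [index J = 1] (mod 3 ^ Suc (Suc k))"
  proof
    assume "[index J = 1] (mod 3 ^ Suc (Suc k))"
    then have "[int (index J) = int 1] (mod int (3 ^ Suc (Suc k)))" by (simp only: cong_int_iff)
    then have d: "3 ^ Suc (Suc k) dvd \<bar>nm C\<bar> - 1" by (simp add: J(3) cong_iff_dvd_diff del: power_Suc)
    show False
    proof (cases "nm C \<ge> 0")
      case True
      then show False using d nC(1) by simp
    next
      \<comment> \<open>The index only sees the absolute value. A negative norm congruent to 1
        modulo 3 has absolute value 2 modulo 3, so it cannot become 1.\<close>
      case False
      have "3 dvd \<bar>nm C\<bar> - 1" by (rule dvd_trans[OF _ d]) simp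
      then show False using False nC(2) by presburger
    qed
  qed
  then obtain P where P: "prime_ideal P" "J \<subseteq> P" "finite_index P" "\<not> [index P = 1] (mod 3 ^ Suc (Suc k))"
    using index_cong_1[OF J(1,2)] by blast
  have I: "is_ideal P" and pr: "\<And>x y. x * y \<in> P \<Longrightarrow> x \<in> P \<or> y \<in> P" and one: "1 \<notin> P"
    using P(1) by (auto simp: prime_ideal_def)
  note sg = is_ideal_subgroup[OF I]
  have J0P: "J0 \<subseteq> P" using P(2) subset_ideal_adjoin unfolding J_def by blast
  have CP: "C \<in> P" using P(2) in_ideal_adjoin[OF J0_ideal] unfolding J_def by blast
  have P3: "3 \<notin> P"
  proof
    assume 3: "3 \<in> P"
    obtain c where c: "nm C - 1 = 3 * c" using nC(2) by blast
    then have "nm C - 3 * c = 1" by linarith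
    then have "(1 :: int poly) = of_int (nm C - 3 * c)" by (simp only: of_int_1)
    also have "\<dots> = of_int (nm C) - 3 * of_int c" by simp
    also have "\<dots> \<in> P" using nm_in_adjoin[of C] P(2) unfolding J_def
      by (intro add_subgroup_diff[OF sg] is_ideal_mult(2)[OF I 3]) auto
    finally show False using one by simp
  qed
  \<comment> \<open>If \<open>Q\<close> were in \<open>P\<close>, then modulo \<open>P\<close> both
    v and B would be 0 and A would be 1, whence C = 1.\<close>
  have PQ: "of_int Q \<notin> P"
  proof
    assume QP: "of_int Q \<in> P"
    then have vP: "v \<in> P" unfolding v_def by (rule is_ideal_mult(2)[OF I])
    have BP: "B \<in> P" unfolding B_def by (intro is_ideal_pow[OF I] is_ideal_mult(1)[OF I] vP) auto
    have "icong P u 1" using vP add_subgroup_uminus[OF sg] by (simp add: icong_def u_def)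
    then have "icong P A 1" unfolding A_def using icong_pow[OF I, of u 1] by simp
    then have A1: "A - 1 \<in> P" by (simp add: icong_def)
    have "C - (A + B) * B - (A + 1) * (A - 1) \<in> P"
      by (intro add_subgroup_diff[OF sg] CP is_ideal_mult(1)[OF I] BP A1)
    moreover have "C - (A + B) * B - (A + 1) * (A - 1) = 1" by (simp add: C_def power2_eq_square algebra_simps)
    ultimately show False using one by simp
  qed
  have XP: "of_int X \<notin> P"
  proof
    assume "of_int X \<in> P"
    then have "3 ^ multiplicity 3 X * of_int Q \<in> P" by (subst (asm) Q(1)) simp
    then show False using pr prime_ideal_pow[OF P(1)] P3 PQ by blast
  qed
  have dX: "of_int d \<notin> P" if "d dvd X" for d
  proof
    assume "of_int d \<in> P"
    obtain c where "X = d * c" using \<open>d dvd X\<close> by blast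
    then have "of_int X \<in> P" using is_ideal_mult(2)[OF I \<open>of_int d \<in> P\<close>, of "of_int c"] by simp
    then show False using XP by simp
  qed
  have "\<exists>p. prime p \<and> of_nat p \<in> P \<and> [p = 1] (mod 3 ^ Suc k) \<and> [p = 1] (mod m) \<and> \<not> (\<exists>x::int. [x ^ 3 = 2] (mod int p))"
  proof (rule noncube_from_ideal[OF P(1) J0P P(3) u_def A_def B_def CP[unfolded C_def] P(4) P3 _ PQ _ v_def])
    show "2 \<notin> P" using dX[of 2] by (simp add: X_def)
    show "of_nat m \<notin> P" using dX[of "int m"] by (simp add: X_def)
    fix s assume "s \<in> G" "s \<noteq> 1 mod m"
    then have "nm (subst_power s t - t) dvd \<delta>" unfolding \<delta>_def by (intro dvd_prodI) auto
    then show "of_int (nm (subst_power s t - t)) \<notin> P" by (intro dX) (simp add: X_def)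
  qed
  then obtain p where p: "prime p" "of_nat p \<in> P" "[p = 1] (mod 3 ^ Suc k)" "[p = 1] (mod m)"
    "\<not> (\<exists>x::int. [x ^ 3 = 2] (mod int p))" by blast
  have "p > p0"
  proof (rule ccontr)
    assume "\<not> p > p0"
    then have "p dvd fact p0" using p(1) by (intro dvd_fact) (auto simp: prime_gt_0_nat Suc_le_eq)
    then have "int p dvd int (fact p0)" by (simp only: int_dvd_int_iff)
    then have "int p dvd X" by (simp add: X_def)
    then show False using dX[of "int p"] p(2) by simp
  qed
  moreover have "[p = 1] (mod N)"
  proof -
    have "[p = 1] (mod 3 ^ k)" by (rule cong_dvd_modulus_nat[OF p(3)]) simp
    then show ?thesis unfolding m(1) using p(4) cop by (intro coprime_cong_mult_nat) auto
  qed
  moreover have "[p = 1] (mod 3)" by (rule cong_dvd_modulus_nat[OF p(3)]) simp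
  ultimately show ?thesis using p by blast
qed

text \<open>Modulo a prime ideal containing 1 - 2 v^3, the number 2 is the inverse of a cube. To
  bring the cube root down to the prime field one needs Frobenius to fix v. It preserves v^3, so it
  multiplies v by a cube root of unity, and the integer factor of v excludes every combination of
  conjugation and twist except the trivial one.\<close>

theorem cube_primes:
  assumes N: "N > 0"
  shows "\<exists>p>p0. prime p \<and> [p = 1] (mod N) \<and> [p = 1] (mod 3) \<and> (\<exists>x::int. [x ^ 3 = 2] (mod int p))"
proof -
  \<comment> \<open>The factor 3 puts a primitive cube root of unity, the value of X^N, into the
    ring, and it makes p = 1 modulo \<open>m\<close> imply p = 1 modulo 3.\<close>
  define m where "m = 3 * N"
  interpret cyclotomic m using N by unfold_locales (simp add: m_def)
  have m1: "1 mod m = 1" using N by (simp add: m_def)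
  \<comment> \<open>The constant 2 dominates the root of unity. For a nontrivial cube root of unity
    w the number 2 (1 - w) has absolute value 2 sqrt 3 > 2, too large to be a difference of two
    roots of unity, so no conjugate of \<open>t\<close> is w times \<open>t\<close>.\<close>
  define t :: "int poly" where "t = [:2, 1:]"
  define \<omega> :: "int poly" where "\<omega> = monom 1 N"
  have evt: "ev z t = 2 + z" for z by (simp add: t_def)
  have ev\<omega>: "ev z \<omega> = z ^ N" for z by (simp add: \<omega>_def)
  have w3: "((\<rho> ^ s) ^ N) ^ 3 = 1" for s
  proof -
    have "((\<rho> ^ s) ^ N) ^ 3 = (\<rho> ^ m) ^ s" by (simp only: m_def power_mult[symmetric] ac_simps)
    then show ?thesis by simp
  qed
  have w1: "(\<rho> ^ s) ^ N \<noteq> 1" if "s \<in> G" for s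
  proof
    assume "(\<rho> ^ s) ^ N = 1"
    then have "\<rho> ^ (s * N) = \<rho> ^ 0" by (simp add: power_mult)
    then have "(s * N) mod m = 0" by (simp only: unity_root_power_eq_iff[OF m_pos] mod_0)
    then have "3 * N dvd s * N" by (simp add: m_def dvd_eq_mod_eq_0)
    then have "3 dvd s" using N by simp
    moreover have "coprime s 3" using G_coprime[OF that] by (simp add: m_def)
    ultimately show False using coprime_common_divisor[of s 3 3] by simp
  qed
  have w2: "1 + (\<rho> ^ s) ^ N + ((\<rho> ^ s) ^ N)\<^sup>2 = 0" if "s \<in> G" for s
  proof -
    have "((\<rho> ^ s) ^ N - 1) * (1 + (\<rho> ^ s) ^ N + ((\<rho> ^ s) ^ N)\<^sup>2) = 0"
      using w3[of s] by (simp add: algebra_simps power2_eq_square power3_eq_cube)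
    then show ?thesis using w1[OF that] by simp
  qed
  let ?E = "\<lambda>s j. subst_power s t - \<omega> ^ j * t"
  have nz: "nm (?E s j) \<noteq> 0" if sj: "s \<in> G" "j < 3" "s \<noteq> 1 \<or> j \<noteq> 0" for s j
    unfolding nm_nz_iff
  proof
    fix x assume x: "x \<in> G"
    define w where "w = ((\<rho> ^ x) ^ N) ^ j"
    have ev: "ev (\<rho> ^ x) (?E s j) = 2 + \<rho> ^ (x * s) - w * (2 + \<rho> ^ x)"
      by (simp add: evt ev\<omega> w_def power_mult)
    have nw: "norm w = 1" by (simp add: w_def norm_power)
    show "ev (\<rho> ^ x) (?E s j) \<noteq> 0"
    proof
      assume "ev (\<rho> ^ x) (?E s j) = 0"
      then have eq: "2 * (1 - w) = w * \<rho> ^ x - \<rho> ^ (x * s)" unfolding ev by (simp add: algebra_simps)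
      show False
      proof (cases "j = 0")
        case True
        then have "\<rho> ^ x = \<rho> ^ (x * s)" using eq by (simp add: w_def)
        then have "[x * 1 = x * s] (mod m)" by (simp add: unity_root_power_eq_iff[OF m_pos] cong_def)
        then have "[1 = s] (mod m)" using G_coprime[OF x] by (simp only: cong_mult_lcancel_nat)
        then have "s = 1" using sj(1) m1 by (simp add: cong_def reduced_residues_def)
        then show False using sj True by simp
      next
        case False
        have w2': "1 + w + w\<^sup>2 = 0"
        proof -
          have "j = 1 \<or> j = 2" using False sj by auto
          then show ?thesis
          proof
            assume "j = 1" then show ?thesis using w2[OF x] by (simp add: w_def)
          next
            assume j: "j = 2"
            have "(z\<^sup>2)\<^sup>2 = z * z ^ 3" for z :: complex by (simp add: power2_eq_square power3_eq_cube)
            from this[of "(\<rho> ^ x) ^ N"] have "w\<^sup>2 = (\<rho> ^ x) ^ N" unfolding w3 by (simp only: w_def j mult_1_right)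
            then show ?thesis using w2[OF x] by (simp add: w_def j algebra_simps)
          qed
        qed
        have "(1 - w)\<^sup>2 = (1 + w + w\<^sup>2) - 3 * w" by (simp add: power2_eq_square algebra_simps)
        then have "norm ((1 - w)\<^sup>2) = norm (3 * w)" unfolding w2' by simp
        then have "(norm (1 - w))\<^sup>2 = 3" by (simp add: norm_power norm_mult nw)
        then have "(norm (2 * (1 - w)))\<^sup>2 = 12" unfolding norm_mult power_mult_distrib by simp
        moreover have "norm (2 * (1 - w)) \<le> 2"
          unfolding eq using norm_triangle_ineq4[of "w * \<rho> ^ x" "\<rho> ^ (x * s)"] by (simp add: norm_mult nw norm_power)
        then have "(norm (2 * (1 - w)))\<^sup>2 \<le> 2\<^sup>2" by (intro power_mono) auto
        ultimately show False by simp
      qed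
    qed
  qed
  define \<delta> where "\<delta> = (\<Prod>(s,j)\<in>G \<times> {..<3} - {(1,0)}. nm (?E s j))"
  \<comment> \<open>The factor from the pairs (s, j) other than (1, 0) rules out that Frobenius acts
    on \<open>t\<close> as a nontrivial conjugation or twist; the others rule out 2, the primes up
    to \<open>p0\<close> and those dividing \<open>m\<close>.\<close>
  define Q where "Q = 2 * fact p0 * int m * \<delta>"
  have "(case x of (s, j) \<Rightarrow> nm (?E s j)) \<noteq> 0" if "x \<in> G \<times> {..<3} - {(1,0)}" for x
    using that nz[of "fst x" "snd x"] by (cases x) auto
  then have "\<delta> \<noteq> 0" unfolding \<delta>_def by (simp only: prod_zero_iff finite_Diff finite_cartesian_product finite_reduced_residues finite_lessThan) blast
  then have Q0: "Q \<noteq> 0" using m_pos by (simp add: Q_def)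
  define v where "v = of_int Q * t"
  define \<beta> where "\<beta> = 1 - 2 * v ^ 3"
  \<comment> \<open>Every conjugate of 1 - 2 v^3 has absolute value at least 2, so its norm is not a
    unit and a prime ideal containing it exists.\<close>
  have ev\<beta>: "2 \<le> norm (ev (\<rho> ^ s) \<beta>)" for s
  proof -
    have "norm (ev (\<rho> ^ s) v) \<ge> 1"
    proof -
      have "1 \<le> norm (2 + \<rho> ^ s)" using norm_diff_ineq[of 2 "\<rho> ^ s"] by (simp add: norm_power)
      moreover have "(1::real) \<le> \<bar>of_int Q\<bar>" using Q0 by linarith
      ultimately have "1 * 1 \<le> \<bar>of_int Q\<bar> * norm (2 + \<rho> ^ s)" by (intro mult_mono) auto
      then show ?thesis by (simp add: v_def evt norm_mult)
    qed
    moreover have "norm (ev (\<rho> ^ s) v) \<ge> 2"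
    proof -
      have "1 \<le> norm (2 + \<rho> ^ s)" using norm_diff_ineq[of 2 "\<rho> ^ s"] by (simp add: norm_power)
      moreover have "(2::real) \<le> \<bar>of_int Q\<bar>"
      proof -
        have "2 dvd \<bar>Q\<bar>" by (simp add: Q_def)
        then have "2 \<le> \<bar>Q\<bar>" using Q0 by (intro zdvd_imp_le) auto
        then show ?thesis by linarith
      qed
      ultimately have "2 * 1 \<le> \<bar>of_int Q\<bar> * norm (2 + \<rho> ^ s)" by (intro mult_mono) auto
      then show ?thesis by (simp add: v_def evt norm_mult)
    qed
    then have "2 ^ 3 \<le> norm (ev (\<rho> ^ s) v) ^ 3" by (intro power_mono) auto
    then have "16 \<le> norm (2 * ev (\<rho> ^ s) v ^ 3)" by (simp add: norm_mult norm_power)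
    moreover have "norm (2 * ev (\<rho> ^ s) v ^ 3) - norm (1::complex) \<le> norm (2 * ev (\<rho> ^ s) v ^ 3 - 1)" by (rule norm_triangle_ineq2)
    moreover have "norm (2 * ev (\<rho> ^ s) v ^ 3 - 1) = norm (ev (\<rho> ^ s) \<beta>)" by (simp add: \<beta>_def norm_minus_commute)
    ultimately show ?thesis by simp
  qed
  have nm\<beta>: "nat \<bar>nm \<beta>\<bar> \<ge> 2"
  proof -
    have "(2::real) \<le> 2 ^ g" using g_pos by (metis one_le_numeral power_increasing power_one_right Suc_leI One_nat_def)
    also have "\<dots> = (\<Prod>s\<in>G. 2)" by simp
    also have "\<dots> \<le> (\<Prod>s\<in>G. norm (ev (\<rho> ^ s) \<beta>))" by (intro prod_mono) (use ev\<beta> in auto)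
    also have "\<dots> = norm (Nm \<beta>)" by (simp add: Nm_def prod_norm)
    also have "\<dots> = \<bar>of_int (nm \<beta>)\<bar>" by (simp flip: nm)
    finally have "2 \<le> \<bar>nm \<beta>\<bar>" by linarith
    then show ?thesis by linarith
  qed
  define J where "J = ideal_adjoin J0 \<beta>"
  have n0: "nm \<beta> \<noteq> 0" using nm\<beta> by auto
  have J: "is_ideal J" "finite_index J" "index J = nat \<bar>nm \<beta>\<bar>"
    unfolding J_def by (simp_all add: is_ideal_adjoin J0_ideal finite_index_adjoin n0 index_eq_norm)
  have "\<not> [index J = 1] (mod 0)" using nm\<beta> J(3) by (simp add: cong_def)
  then obtain P where P: "prime_ideal P" "J \<subseteq> P" "finite_index P"
    using index_cong_1[OF J(1,2)] by blast
  have I: "is_ideal P" and pr: "\<And>x y. x * y \<in> P \<Longrightarrow> x \<in> P \<or> y \<in> P" and one: "1 \<notin> P"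
    using P(1) by (auto simp: prime_ideal_def)
  note sg = is_ideal_subgroup[OF I]
  have J0P: "J0 \<subseteq> P" using P(2) subset_ideal_adjoin unfolding J_def by blast
  have \<beta>P: "\<beta> \<in> P" using P(2) in_ideal_adjoin[OF J0_ideal] unfolding J_def by blast
  have vP: "v \<notin> P"
  proof
    assume "v \<in> P"
    then have "\<beta> + 2 * v ^ 3 \<in> P" by (intro add_subgroup_add[OF sg] \<beta>P is_ideal_mult(1)[OF I] is_ideal_pow[OF I]) auto
    then show False using one by (simp add: \<beta>_def)
  qed
  have dQ: "of_int d \<notin> P" if "d dvd Q" for d
  proof
    assume d: "of_int d \<in> P"
    obtain c where "Q = d * c" using \<open>d dvd Q\<close> by blast
    then have "v = of_int d * (of_int c * t)" by (simp add: v_def mult.assoc)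
    then show False using vP is_ideal_mult(2)[OF I d] by simp
  qed
  obtain p e where p: "prime p" "\<And>n. of_int n \<in> P \<longleftrightarrow> int p dvd n" "index P = p ^ e"
    using prime_ideal_char[OF P(1,3)] by metis
  have pP: "of_nat p \<in> P" using p(2)[of "int p"] by simp
  have P2: "2 \<notin> P" using dQ[of 2] by (simp add: Q_def)
  have frobP: "icong P (x ^ p) (subst_power p x)" for x
  proof -
    obtain c where "x ^ p - subst_power p x = of_nat p * c" using frobenius_dvd[OF p(1), of x] by blast
    then show ?thesis using is_ideal_mult(2)[OF I pP] by (simp add: icong_def)
  qed
  have two: "icong P (2 ^ (p - 1)) 1"
  proof -
    have "int p dvd 2 ^ (p - 1) - 1" by (rule int_fermat_1[OF p(1)]) (use p(2)[of 2] P2 in simp)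
    then show ?thesis using p(2)[of "2 ^ (p - 1) - 1"] by (simp add: icong_def)
  qed
  have v3: "icong P (2 * v ^ 3) 1" using add_subgroup_uminus[OF sg \<beta>P] by (simp add: icong_def \<beta>_def)
  let ?w = "subst_power p v"
  \<comment> \<open>Raising 2 v^3 = 1 to the p-th power gives 2^p w^3 = 1 for the Frobenius image w
    of v; since 2^(p-1) = 1, this leaves w^3 = v^3.\<close>
  have w3v3: "?w ^ 3 - v ^ 3 \<in> P"
  proof -
    have f2: "icong P (2 * (2 ^ (p - 1) * ?w ^ 3)) (2 * v ^ 3)"
    proof -
      have "2 * 2 ^ (p - 1) = (2::int poly) ^ p" using prime_gt_0_nat[OF p(1)] by (simp add: power_eq_if)
      then have e1: "2 * (2 ^ (p - 1) * ?w ^ 3) = 2 ^ p * ?w ^ 3" by (simp only: mult.assoc[symmetric])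
      have e2: "icong P (2 ^ p * ?w ^ 3) (2 ^ p * (v ^ p) ^ 3)" by (intro icong_mult I icong_refl icong_pow icong_sym[OF I frobP])
      have e3: "2 ^ p * (v ^ p) ^ 3 = (2 * v ^ 3) ^ p" by (simp add: power_mult_distrib power_mult[symmetric] mult.commute)
      have e4: "icong P ((2 * v ^ 3) ^ p) (1 ^ p)" by (intro icong_pow I v3)
      have "icong P (2 * (2 ^ (p - 1) * ?w ^ 3)) 1" unfolding e1
        using icong_trans[OF I e2] e4 by (simp only: e3 power_one)
      then show ?thesis using icong_trans[OF I] icong_sym[OF I v3] by blast
    qed
    have f3: "icong P (2 * (2 ^ (p - 1) * ?w ^ 3)) (2 * (1 * ?w ^ 3))" by (intro icong_mult I icong_refl two)
    have "icong P (2 * ?w ^ 3) (2 * v ^ 3)" using icong_trans[OF I icong_sym[OF I f3] f2] by (simp only: mult_1)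
    then have "2 * (?w ^ 3 - v ^ 3) \<in> P" by (simp add: icong_def algebra_simps)
    then show ?thesis using pr P2 by blast
  qed
  have fac: "(?w - v) * ((?w - \<omega> * v) * (?w - \<omega>\<^sup>2 * v)) \<in> P"
  proof -
    have "(?w - v) * ((?w - \<omega> * v) * (?w - \<omega>\<^sup>2 * v)) - (?w ^ 3 - v ^ 3) \<in> J0"
    proof -
      have "(y - z) * ((y - w * z) * (y - w\<^sup>2 * z)) - (y ^ 3 - z ^ 3) = 0" if w: "1 + w + w\<^sup>2 = 0" for w y z :: complex
      proof -
        have "w ^ 3 = 1" using arg_cong[OF w, of "\<lambda>x. (w - 1) * x"] by (simp add: algebra_simps power2_eq_square power3_eq_cube)
        have "(y - z) * ((y - w * z) * (y - w\<^sup>2 * z)) - (y ^ 3 - z ^ 3) = - (1 + w + w\<^sup>2) * y\<^sup>2 * z + w * (1 + w + w\<^sup>2) * y * z\<^sup>2 + (1 - w ^ 3) * z ^ 3"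
          by (simp add: algebra_simps power2_eq_square power3_eq_cube)
        then show ?thesis using w \<open>w ^ 3 = 1\<close> by simp
      qed
      then show ?thesis using w2 by (simp add: J0_def ev\<omega>)
    qed
    then have "((?w - v) * ((?w - \<omega> * v) * (?w - \<omega>\<^sup>2 * v)) - (?w ^ 3 - v ^ 3)) + (?w ^ 3 - v ^ 3) \<in> P"
      using J0P w3v3 by (intro add_subgroup_add[OF sg]) auto
    then show ?thesis by simp
  qed
  then obtain j where j: "j < 3" "?w - \<omega> ^ j * v \<in> P"
  proof -
    consider "?w - v \<in> P" | "?w - \<omega> * v \<in> P" | "?w - \<omega>\<^sup>2 * v \<in> P" using fac pr by blast
    then show ?thesis
    proof cases
      case 1 then show ?thesis using that[of 0] by simp
    next
      case 2 then show ?thesis using that[of 1] by simp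
    next
      case 3 then show ?thesis using that[of 2] by simp
    qed
  qed
  have "of_int Q * (subst_power p t - \<omega> ^ j * t) \<in> P" using j(2) by (simp add: v_def subst_power_mult algebra_simps)
  then have pt: "subst_power p t - \<omega> ^ j * t \<in> P" using pr[of "of_int Q"] dQ[of Q] by auto
  have "\<not> p dvd m"
  proof
    assume "p dvd m"
    then have "int p dvd int m" by (simp only: int_dvd_int_iff)
    then have "of_int (int m) \<in> P" using p(2) by blast
    then show False using dQ[of "int m"] by (simp add: Q_def)
  qed
  then have cop: "coprime p m" using p(1) by (simp add: prime_imp_coprime)
  have pG: "p mod m \<in> G" by (rule mod_in_G[OF cop])
  have "subst_power (p mod m) t - subst_power p t \<in> J0"
  proof -
    have "(\<rho> ^ s) ^ (p mod m) = (\<rho> ^ s) ^ p" for s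
      unfolding power_mult[symmetric] unity_root_power_eq_iff[OF m_pos] by (simp only: mod_mult_right_eq)
    then show ?thesis by (simp add: J0_def)
  qed
  then have "(subst_power (p mod m) t - subst_power p t) + (subst_power p t - \<omega> ^ j * t) \<in> P"
    using J0P pt by (intro add_subgroup_add[OF sg]) auto
  then have e: "?E (p mod m) j \<in> P" by simp
  have "p mod m = 1 \<and> j = 0"
  proof (rule ccontr)
    assume "\<not> (p mod m = 1 \<and> j = 0)"
    then have "(\<lambda>(s, j). nm (?E s j)) (p mod m, j) dvd \<delta>" unfolding \<delta>_def
      using pG j(1) by (intro dvd_prodI) auto
    then have "nm (?E (p mod m) j) dvd Q" by (simp add: Q_def)
    then have "of_int (nm (?E (p mod m) j)) \<notin> P" by (rule dQ)
    moreover obtain h where h: "h * ?E (p mod m) j - of_int (nm (?E (p mod m) j)) \<in> J0"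
      using nm_cofactor by blast
    have "h * ?E (p mod m) j - (h * ?E (p mod m) j - of_int (nm (?E (p mod m) j))) \<in> P"
      by (intro add_subgroup_diff[OF sg] is_ideal_mult(1)[OF I] e subsetD[OF J0P] h)
    then have "of_int (nm (?E (p mod m) j)) \<in> P" by simp
    ultimately show False by blast
  qed
  then have pm: "[p = 1] (mod m)" and "j = 0" using m1 by (auto simp: cong_def)
  have "[p = 1] (mod N)" "[p = 1] (mod 3)"
    by (rule cong_dvd_modulus_nat[OF pm], simp add: m_def)+
  have "3 dvd p - 1" using \<open>[p = 1] (mod 3)\<close> prime_gt_0_nat[OF p(1)] by (metis One_nat_def Suc_leI cong_altdef_nat cong_sym)
  then obtain n where n: "p - 1 = 3 * n" by blast
  \<comment> \<open>With trivial twist, v lies in the prime field modulo \<open>P\<close>, so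
    v^(p-1) = 1. Raising 2 v^3 = 1 to the power n = (p - 1) / 3 then yields 2^n = 1.\<close>
  have "icong P (v ^ p) v"
    using icong_trans[OF I frobP, of v v] j(2) \<open>j = 0\<close> by (simp add: icong_def)
  moreover have "v ^ p = v * v ^ (p - 1)" using prime_gt_0_nat[OF p(1)] by (simp add: power_eq_if)
  ultimately have "v * (v ^ (p - 1) - 1) \<in> P" by (simp add: icong_def algebra_simps)
  then have vp: "icong P (v ^ (p - 1)) 1" using pr vP by (auto simp: icong_def)
  have w1n: "icong P ((2 * v ^ 3) ^ n) (1 ^ n)" by (intro icong_pow I v3)
  have vn: "(2 * v ^ 3) ^ n = 2 ^ n * v ^ (p - 1)" unfolding n power_mult power_mult_distrib ..
  have "icong P (2 ^ n * v ^ (p - 1)) (2 ^ n * 1)" by (intro icong_mult I icong_refl vp)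
  from icong_trans[OF I icong_sym[OF I this] w1n[unfolded vn]] have "icong P (2 ^ n) 1"
    by (simp only: mult_1_right power_one)
  then have "int p dvd 2 ^ n - 1" using p(2)[of "2 ^ n - 1"] by (simp add: icong_def)
  then have "[int (2 ^ n) = int 1] (mod int p)" by (simp add: cong_iff_dvd_diff)
  then have "[2 ^ n = (1::nat)] (mod p)" by (simp only: cong_int_iff)
  then have "\<exists>x::int. [x ^ 3 = 2] (mod int p)" by (rule cube_root_two_if_power[OF p(1) n])
  moreover have "p > p0"
  proof (rule ccontr)
    assume "\<not> p > p0"
    then have "p dvd fact p0" using p(1) by (intro dvd_fact) (auto simp: prime_gt_0_nat Suc_le_eq)
    then have "int p dvd int (fact p0)" by (simp only: int_dvd_int_iff)
    then have "int p dvd Q" by (simp add: Q_def)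
    then show False using dQ[of "int p"] pP by simp
  qed
  ultimately show ?thesis using p(1) \<open>[p = 1] (mod N)\<close> \<open>[p = 1] (mod 3)\<close> by blast
qed

section \<open>Periodicity of the Legendre symbol\<close>

lemma Legendre_values: "Legendre a p \<in> {-1, 0, 1}"
  by (simp add: Legendre_def)

lemma Legendre_eq_if_cong:
  fixes p :: nat
  assumes "prime p" "2 < p" "[Legendre a p = c] (mod int p)" "c \<in> {-1, 0, 1}"
  shows "Legendre a p = c"
proof (rule ccontr)
  assume ne: "Legendre a p \<noteq> c"
  have "int p dvd Legendre a p - c" using assms(3) by (simp add: cong_iff_dvd_diff)
  then have "int p \<le> \<bar>Legendre a p - c\<bar>" using ne dvd_imp_le_int[of "Legendre a p - c" "int p"] by simp
  moreover have "\<bar>Legendre a p - c\<bar> \<le> 2" using Legendre_values[of a p] assms(4) by auto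
  ultimately show False using assms(2) by simp
qed

lemma Legendre_mult:
  fixes p :: nat
  assumes p: "prime p" "2 < p" shows "Legendre (a * b) p = Legendre a p * Legendre b p"
proof (rule Legendre_eq_if_cong[OF p])
  have "[Legendre a p * Legendre b p = a ^ ((p - 1) div 2) * b ^ ((p - 1) div 2)] (mod int p)"
    by (intro cong_mult euler_criterion p)
  then have "[a ^ ((p - 1) div 2) * b ^ ((p - 1) div 2) = Legendre a p * Legendre b p] (mod int p)" by (rule cong_sym)
  then show "[Legendre (a * b) p = Legendre a p * Legendre b p] (mod int p)"
    using cong_trans[OF euler_criterion[OF p, of "a * b"]] by (simp only: power_mult_distrib)
  show "Legendre a p * Legendre b p \<in> {- 1, 0, 1}" using Legendre_values[of a p] Legendre_values[of b p] by auto
qed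

lemma half_cong: 
  assumes "[p = q] (mod 4)" "2 < p" "2 < q" shows "even ((p - 1) div 2) \<longleftrightarrow> even ((q - 1) div (2::nat))"
  using assms unfolding cong_def by presburger

lemma Legendre_neg_1_cong:
  fixes p q :: nat
  assumes "prime p" "2 < p" "prime q" "2 < q" "[p = q] (mod 4)"
  shows "Legendre (- 1) p = Legendre (- 1) q"
proof -
  have L: "Legendre (- 1) r = (- 1) ^ ((r - 1) div 2)" if "prime r" "2 < r" for r :: nat
    by (rule Legendre_eq_if_cong[OF that euler_criterion[OF that]]) (cases "even ((r - 1) div 2)", auto)
  show ?thesis unfolding L[OF assms(1,2)] L[OF assms(3,4)] using half_cong[OF assms(5,2,4)]
    by (cases "even ((p - 1) div 2)") simp_all
qed

text \<open>Gauss's lemma: among the numbers 2 y with y up to (p - 1) / 2, those exceeding (p - 1) /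
  2 are the ones with y > (p - 1) / 4, so the exponent is the length of an interval.\<close>

lemma Legendre_2:
  fixes p :: nat
  assumes p: "prime p" "2 < p" shows "Legendre 2 p = (- 1) ^ ((p - 1) div 2 - (p - 1) div 4)"
proof -
  have "\<not> int p dvd 2" using p by (auto dest: zdvd_imp_le)
  then interpret GAUSS p 2 using p by unfold_locales (simp_all add: cong_0_iff)
  have op: "odd p" using p prime_odd_nat by auto
  define h where "h = (p - 1) div 2"
  have ph: "p = 2 * h + 1" using op unfolding h_def by presburger
  have "E = (\<lambda>y. 2 * int y) ` {(p - 1) div 4<..h}"
  proof -
    have A: "A = int ` {0<..h}" 
    proof (intro equalityI subsetI)
      fix x assume "x \<in> A"
      then have "x = int (nat x)" "nat x \<in> {0<..h}" unfolding A_def using ph by auto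
      then show "x \<in> int ` {0<..h}" by blast
    next
      fix x assume "x \<in> int ` {0<..h}"
      then show "x \<in> A" unfolding A_def using ph by auto
    qed
    have "C = (\<lambda>y. 2 * int y) ` {0<..h}"
      unfolding C_def B_def A image_image by (rule image_cong[OF refl]) (use ph in auto)
    moreover have "(int p - 1) div 2 < 2 * int y \<longleftrightarrow> (p - 1) div 4 < y" for y
    proof -
      have "(int p - 1) div 2 = int h" "p - 1 = h * 2" using ph by simp_all
      moreover have "h * 2 div 4 = h div 2" by linarith
      ultimately have "(int p - 1) div 2 = int h" "(p - 1) div 4 = h div 2" by (simp_all only:)
      then show ?thesis by linarith
    qed
    ultimately show ?thesis unfolding E_def by (auto simp: image_iff)
  qed
  then have "card E = card {(p - 1) div 4<..h}" by (simp add: card_image inj_on_def)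
  then show ?thesis using gauss_lemma by (simp add: h_def)
qed

lemma half_minus_quarter_even:
  assumes "odd p" shows "even ((p - 1) div 2 - (p - 1) div (4::nat)) \<longleftrightarrow> p mod 8 = 1 \<or> p mod 8 = 7"
proof -
  define a where "a = p div 8"
  have p: "p = 8 * a + p mod 8" by (simp add: a_def)
  have "odd (p mod 8)" using assms by (simp add: dvd_mod_iff)
  moreover have "p mod 8 < 8" by simp
  ultimately have "p mod 8 \<in> {1, 3, 5, 7}" by auto presburger
  then consider "p = 8 * a + 1" | "p = 8 * a + 3" | "p = 8 * a + 5" | "p = 8 * a + 7" using p by auto
  then show ?thesis
  proof cases
    case 1
    then have "(p - 1) div 2 = 4 * a" "(p - 1) div 4 = 2 * a" and m: "p mod 8 = 1" by presburger+
    then have "(p - 1) div 2 - (p - 1) div 4 = 2 * a" by linarith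
    then have "even ((p - 1) div 2 - (p - 1) div 4)" by simp
    then show ?thesis unfolding m by simp
  next
    case 2
    then have "(p - 1) div 2 = 4 * a + 1" "(p - 1) div 4 = 2 * a" and m: "p mod 8 = 3" by presburger+
    then have "(p - 1) div 2 - (p - 1) div 4 = 2 * a + 1" by linarith
    then have "odd ((p - 1) div 2 - (p - 1) div 4)" by simp
    then show ?thesis unfolding m by simp
  next
    case 3
    then have "(p - 1) div 2 = 4 * a + 2" "(p - 1) div 4 = 2 * a + 1" and m: "p mod 8 = 5" by presburger+
    then have "(p - 1) div 2 - (p - 1) div 4 = 2 * a + 1" by linarith
    then have "odd ((p - 1) div 2 - (p - 1) div 4)" by simp
    then show ?thesis unfolding m by simp
  next
    case 4
    then have "(p - 1) div 2 = 4 * a + 3" "(p - 1) div 4 = 2 * a + 1" and m: "p mod 8 = 7" by presburger+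
    then have "(p - 1) div 2 - (p - 1) div 4 = 2 * a + 2" by linarith
    then have "even ((p - 1) div 2 - (p - 1) div 4)" by simp
    then show ?thesis unfolding m by simp
  qed
qed

lemma Legendre_2_cong:
  fixes p q :: nat
  assumes "prime p" "2 < p" "prime q" "2 < q" "[p = q] (mod 8)"
  shows "Legendre 2 p = Legendre 2 q"
proof -
  have "even ((p - 1) div 2 - (p - 1) div 4) \<longleftrightarrow> even ((q - 1) div 2 - (q - 1) div 4)"
    using assms(5) half_minus_quarter_even[OF prime_odd_nat[OF assms(1,2)]] half_minus_quarter_even[OF prime_odd_nat[OF assms(3,4)]]
    unfolding cong_def by simp
  then show ?thesis unfolding Legendre_2[OF assms(1,2)] Legendre_2[OF assms(3,4)]
    by (cases "even ((p - 1) div 2 - (p - 1) div 4)") simp_all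
qed

text \<open>Reciprocity moves the varying prime to the upper argument, where only its residue modulo
  \<open>l\<close> matters; the sign depends on its residue modulo 4.\<close>

lemma Legendre_prime_cong:
  fixes l p q :: nat
  assumes l: "prime l" "2 < l" and p: "prime p" "2 < p" "p \<noteq> l" and q: "prime q" "2 < q" "q \<noteq> l"
    and pq: "[p = q] (mod (4 * l))"
  shows "Legendre (int l) (int p) = Legendre (int l) (int q)"
proof -
  have L: "Legendre (int l) (int r) = (- 1) ^ ((r - 1) div 2 * ((l - 1) div 2)) * Legendre (int r) (int l)"
    if r: "prime r" "2 < r" "r \<noteq> l" for r :: nat
  proof -
    have Q: "Legendre (int r) (int l) * Legendre (int l) (int r) = (- 1) ^ ((r - 1) div 2 * ((l - 1) div 2))"
      using Quadratic_Reciprocity[OF r(1,2) l] r(3) by simp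
    have "Legendre (int r) (int l) \<noteq> 0" using Q by (metis mult_zero_left power_not_zero neg_equal_0_iff_equal zero_neq_one)
    then have "Legendre (int r) (int l) * Legendre (int r) (int l) = 1" using Legendre_values[of "int r" "int l"] by auto
    then show ?thesis unfolding Q[symmetric] by (simp add: mult.assoc mult.left_commute)
  qed
  have c4: "[p = q] (mod 4)" and cl: "[p = q] (mod l)"
    using pq by (auto intro: cong_dvd_modulus_nat)
  have "[int p = int q] (mod int l)" using cl by (simp only: cong_int_iff)
  then have "Legendre (int p) (int l) = Legendre (int q) (int l)"
    unfolding Legendre_def QuadRes_def cong_def by simp
  moreover have "(- 1 :: int) ^ ((p - 1) div 2 * ((l - 1) div 2)) = (- 1) ^ ((q - 1) div 2 * ((l - 1) div 2))"
    using half_cong[OF c4 p(2) q(2)] unfolding power_mult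
    by (cases "even ((p - 1) div 2)") simp_all
  ultimately show ?thesis unfolding L[OF p] L[OF q] by simp
qed

text \<open>Multiplicativity reduces \<open>D\<close> to a sign and prime factors, which have
  periods dividing 4, 8 or 4 l; the product of the moduli serves for \<open>D\<close>. Primes
  dividing \<open>D\<close> are left out because their symbol is 0.\<close>

lemma Legendre_periodic:
  fixes D :: int
  assumes "D \<noteq> 0"
  shows "\<exists>N>0. \<forall>p q :: nat. prime p \<longrightarrow> 2 < p \<longrightarrow> \<not> int p dvd D \<longrightarrow> prime q \<longrightarrow> 2 < q \<longrightarrow> \<not> int q dvd D \<longrightarrow>
    [p = q] (mod N) \<longrightarrow> Legendre D p = Legendre D q"
  using assms
proof (induction D rule: prime_divisors_induct)
  case zero
  then show ?case by simp
next
  case (unit u)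
  then have "u = 1 \<or> u = - 1" by auto
  then show ?case
  proof
    assume u: "u = 1"
    have "Legendre 1 (int p) = 1" if "2 < p" for p :: nat
    proof -
      have "\<not> [1 = 0] (mod int p)" using that by (simp add: cong_0_iff)
      moreover have "QuadRes (int p) 1" unfolding QuadRes_def by (intro exI[of _ 1]) simp
      ultimately show ?thesis by (simp add: Legendre_def)
    qed
    then show ?thesis unfolding u by (intro exI[of _ 1]) simp
  next
    assume u: "u = - 1"
    show ?thesis unfolding u by (intro exI[of _ 4]) (auto intro: Legendre_neg_1_cong)
  qed
next
  case (factor l D)
  then have l: "prime l" and D: "D \<noteq> 0" by auto
  from factor D obtain N where N: "N > 0" "\<And>p q :: nat. prime p \<Longrightarrow> 2 < p \<Longrightarrow> \<not> int p dvd D \<Longrightarrow> prime q \<Longrightarrow> 2 < q \<Longrightarrow> \<not> int q dvd D \<Longrightarrow>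
    [p = q] (mod N) \<Longrightarrow> Legendre D p = Legendre D q" by blast
  define k where "k = nat l"
  have "l = int k" using prime_ge_0_int[OF l] by (simp add: k_def)
  then have k: "prime k" "l = int k" using l by simp_all
  show ?case
  proof (intro exI[of _ "8 * k * N"] conjI allI impI)
    show "8 * k * N > 0" using N(1) prime_gt_0_nat[OF k(1)] by simp
    fix p q :: nat assume p: "prime p" "2 < p" "\<not> int p dvd l * D" and q: "prime q" "2 < q" "\<not> int q dvd l * D"
      and pq: "[p = q] (mod (8 * k * N))"
    have D: "Legendre D p = Legendre D q"
    proof (rule N(2)[OF p(1,2) _ q(1,2)])
      show "\<not> int p dvd D" using p(3) by (blast intro: dvd_mult)
      show "\<not> int q dvd D" using q(3) by (blast intro: dvd_mult)
      show "[p = q] (mod N)" using pq by (rule cong_dvd_modulus_nat) simp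
    qed
    have "Legendre l p = Legendre l q"
    proof (cases "k = 2")
      case True
      have "[p = q] (mod 8)" using pq by (rule cong_dvd_modulus_nat) simp
      then show ?thesis using Legendre_2_cong[OF p(1,2) q(1,2)] k True by simp
    next
      case False
      then have "2 < k" using prime_ge_2_nat[OF k(1)] by simp
      moreover have "p \<noteq> k" "q \<noteq> k" using p(3) q(3) k by auto
      moreover have "[p = q] (mod (4 * k))" using pq by (rule cong_dvd_modulus_nat) simp
      ultimately show ?thesis using Legendre_prime_cong[OF k(1) _ p(1,2) _ q(1,2)] k by simp
    qed
    then show "Legendre (l * D) p = Legendre (l * D) q"
      unfolding Legendre_mult[OF p(1,2)] Legendre_mult[OF q(1,2)] D by simp
  qed
qed

section \<open>Modules and Lie algebras over prime fields\<close>

context Module.module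
begin

definition lincomb :: "'c set \<Rightarrow> ('c \<Rightarrow> 'a) \<Rightarrow> 'c" where
  "lincomb B c = (\<Oplus>\<^bsub>M\<^esub>b\<in>B. c b \<odot>\<^bsub>M\<^esub> b)"

lemma lincomb_closed: "B \<subseteq> carrier M \<Longrightarrow> c \<in> B \<rightarrow> carrier R \<Longrightarrow> lincomb B c \<in> carrier M"
  unfolding lincomb_def by (rule M.finsum_closed) auto

lemma lincomb_insert:
  assumes "finite B" "x \<notin> B" "insert x B \<subseteq> carrier M" "c \<in> insert x B \<rightarrow> carrier R"
  shows "lincomb (insert x B) c = c x \<odot>\<^bsub>M\<^esub> x \<oplus>\<^bsub>M\<^esub> lincomb B c"
  unfolding lincomb_def by (rule M.finsum_insert) (use assms in auto)

lemma lincomb_cong: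
  assumes "B \<subseteq> carrier M" "c \<in> B \<rightarrow> carrier R" "\<And>b. b \<in> B \<Longrightarrow> c b = c' b"
  shows "lincomb B c = lincomb B c'"
  unfolding lincomb_def
proof (rule M.finsum_cong'[OF refl])
  show "(\<lambda>b. c' b \<odot>\<^bsub>M\<^esub> b) \<in> B \<rightarrow> carrier M"
  proof
    fix b assume b: "b \<in> B"
    then have "c' b \<in> carrier R" using assms(3)[OF b] funcset_mem[OF assms(2) b] by simp
    then show "c' b \<odot>\<^bsub>M\<^esub> b \<in> carrier M" using assms(1) b by blast
  qed
qed (simp add: assms(3))

lemma lincomb_add:
  assumes "B \<subseteq> carrier M" "c \<in> B \<rightarrow> carrier R" "c' \<in> B \<rightarrow> carrier R"
  shows "lincomb B (\<lambda>b. c b \<oplus> c' b) = lincomb B c \<oplus>\<^bsub>M\<^esub> lincomb B c'"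
proof -
  have "lincomb B (\<lambda>b. c b \<oplus> c' b) = (\<Oplus>\<^bsub>M\<^esub>b\<in>B. c b \<odot>\<^bsub>M\<^esub> b \<oplus>\<^bsub>M\<^esub> c' b \<odot>\<^bsub>M\<^esub> b)"
    unfolding lincomb_def
  proof (rule M.finsum_cong'[OF refl])
    show "(\<lambda>b. c b \<odot>\<^bsub>M\<^esub> b \<oplus>\<^bsub>M\<^esub> c' b \<odot>\<^bsub>M\<^esub> b) \<in> B \<rightarrow> carrier M"
      using assms by (intro funcsetI M.a_closed smult_closed) (auto intro: funcset_mem)
  qed (use assms in \<open>auto intro!: smult_l_distr intro: funcset_mem\<close>)
  also have "\<dots> = lincomb B c \<oplus>\<^bsub>M\<^esub> lincomb B c'"
    unfolding lincomb_def by (rule M.finsum_addf) (use assms in auto)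
  finally show ?thesis .
qed

lemma lincomb_smult:
  assumes "finite B" "B \<subseteq> carrier M" "c \<in> B \<rightarrow> carrier R" "a \<in> carrier R"
  shows "lincomb B (\<lambda>b. a \<otimes> c b) = a \<odot>\<^bsub>M\<^esub> lincomb B c"
proof -
  have "lincomb B (\<lambda>b. a \<otimes> c b) = (\<Oplus>\<^bsub>M\<^esub>b\<in>B. a \<odot>\<^bsub>M\<^esub> (c b \<odot>\<^bsub>M\<^esub> b))"
    unfolding lincomb_def by (rule M.finsum_cong') (use assms in \<open>auto intro!: smult_assoc1\<close>)
  also have "\<dots> = a \<odot>\<^bsub>M\<^esub> lincomb B c"
    unfolding lincomb_def
    by (rule finsum_smult_ldistr[OF assms(1,4), symmetric]) (use assms in \<open>auto intro: funcset_mem\<close>)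
  finally show ?thesis .
qed

lemma is_basis_iff:
  "is_basis R M B \<longleftrightarrow> finite B \<and> B \<subseteq> carrier M \<and> bij_betw (lincomb B) (B \<rightarrow>\<^sub>E carrier R) (carrier M)"
proof -
  have "(\<forall>x\<in>carrier M. \<exists>!c. c \<in> B \<rightarrow>\<^sub>E carrier R \<and> x = lincomb B c) \<longleftrightarrow> bij_betw (lincomb B) (B \<rightarrow>\<^sub>E carrier R) (carrier M)"
    if B: "B \<subseteq> carrier M"
  proof
    assume *: "\<forall>x\<in>carrier M. \<exists>!c. c \<in> B \<rightarrow>\<^sub>E carrier R \<and> x = lincomb B c"
    have cl: "lincomb B c \<in> carrier M" if "c \<in> B \<rightarrow>\<^sub>E carrier R" for c
      using lincomb_closed[OF B] that by (auto simp: PiE_def)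
    show "bij_betw (lincomb B) (B \<rightarrow>\<^sub>E carrier R) (carrier M)"
    proof (rule bij_betw_imageI)
      show "inj_on (lincomb B) (B \<rightarrow>\<^sub>E carrier R)" 
      proof (rule inj_onI)
        fix c c' assume "c \<in> B \<rightarrow>\<^sub>E carrier R" "c' \<in> B \<rightarrow>\<^sub>E carrier R" "lincomb B c = lincomb B c'"
        then show "c = c'" using *[rule_format, OF cl[of c]] by blast
      qed
      show "lincomb B ` (B \<rightarrow>\<^sub>E carrier R) = carrier M" using * cl by blast
    qed
  next
    assume bij: "bij_betw (lincomb B) (B \<rightarrow>\<^sub>E carrier R) (carrier M)"
    show "\<forall>x\<in>carrier M. \<exists>!c. c \<in> B \<rightarrow>\<^sub>E carrier R \<and> x = lincomb B c"
    proof
      fix x assume "x \<in> carrier M"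
      then obtain c where c: "c \<in> B \<rightarrow>\<^sub>E carrier R" "x = lincomb B c" using bij unfolding bij_betw_def by blast
      show "\<exists>!c. c \<in> B \<rightarrow>\<^sub>E carrier R \<and> x = lincomb B c"
      proof (rule ex1I[of _ c])
        show "c \<in> B \<rightarrow>\<^sub>E carrier R \<and> x = lincomb B c" using c by (rule conjI)
        fix c' assume c': "c' \<in> B \<rightarrow>\<^sub>E carrier R \<and> x = lincomb B c'"
        show "c' = c"
          by (rule inj_onD[OF bij_betw_imp_inj_on[OF bij] trans[OF conjunct2[OF c', symmetric] c(2)] conjunct1[OF c'] c(1)])
      qed
    qed
  qed
  then show ?thesis unfolding is_basis_def lincomb_def[symmetric] by blast
qed

lemma card_is_basis: 
  assumes "is_basis R M B" shows "card (carrier M) = card (carrier R) ^ card B"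
proof -
  have B: "finite B" and bij: "bij_betw (lincomb B) (B \<rightarrow>\<^sub>E carrier R) (carrier M)"
    using assms unfolding is_basis_iff by simp_all
  show ?thesis using bij_betw_same_card[OF bij] card_PiE[OF B, of "\<lambda>_. carrier R"] by simp
qed

text \<open>An independent set of largest size spans. An element \<open>x\<close> outside the span
  could be adjoined: in a coincidence of two combinations with different coefficients at
  \<open>x\<close>, their difference is invertible and \<open>x\<close> could be solved for.\<close>

lemma exists_basis:
  assumes R: "field R" and fin: "finite (carrier M)"
  shows "\<exists>B. is_basis R M B"
proof -
  interpret F: field R by (rule R)
  let ?P = "\<lambda>B. B \<subseteq> carrier M \<and> inj_on (lincomb B) (B \<rightarrow>\<^sub>E carrier R)"
  have "?P {}" by (simp add: inj_on_def)
  moreover have "\<forall>B. ?P B \<longrightarrow> card B < Suc (card (carrier M))" using card_mono[OF fin] by (simp add: less_Suc_eq_le)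
  ultimately obtain B where B: "?P B" and max: "\<And>B'. ?P B' \<Longrightarrow> card B' \<le> card B"
    using ex_has_greatest_nat[of ?P "{}" card "Suc (card (carrier M))"] by blast
  have finB: "finite B" using B fin finite_subset by blast
  have BM: "B \<subseteq> carrier M" using B by simp
  have "carrier M \<subseteq> lincomb B ` (B \<rightarrow>\<^sub>E carrier R)"
  proof
    fix x assume x: "x \<in> carrier M"
    show "x \<in> lincomb B ` (B \<rightarrow>\<^sub>E carrier R)"
    proof (rule ccontr)
      assume nx: "x \<notin> lincomb B ` (B \<rightarrow>\<^sub>E carrier R)"
      have nspan: "x \<noteq> lincomb B c" if c: "c \<in> B \<rightarrow> carrier R" for c
      proof
        assume "x = lincomb B c"
        also have "\<dots> = lincomb B (restrict c B)" by (rule lincomb_cong[OF BM c]) simp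
        finally have "x = lincomb B (restrict c B)" .
        moreover have "restrict c B \<in> B \<rightarrow>\<^sub>E carrier R" using c by simp
        ultimately show False using nx by blast
      qed
      have xB: "x \<notin> B"
      proof
        assume "x \<in> B"
        let ?c = "\<lambda>b. if b = x then \<one> else \<zero>"
        have "lincomb B ?c = (\<Oplus>\<^bsub>M\<^esub>b\<in>B. if x = b then b else \<zero>\<^bsub>M\<^esub>)"
          unfolding lincomb_def by (rule M.finsum_cong') (use BM in auto)
        also have "\<dots> = x" by (rule M.finsum_singleton) (use \<open>x \<in> B\<close> finB BM in auto)
        finally show False using nspan[of ?c] by auto
      qed
      have "?P (insert x B)"
      proof
        show "inj_on (lincomb (insert x B)) (insert x B \<rightarrow>\<^sub>E carrier R)"
        proof (rule inj_onI)
          fix c d assume c: "c \<in> insert x B \<rightarrow>\<^sub>E carrier R" and d: "d \<in> insert x B \<rightarrow>\<^sub>E carrier R"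
            and eq: "lincomb (insert x B) c = lincomb (insert x B) d"
          have cB: "c \<in> B \<rightarrow> carrier R" "c x \<in> carrier R" and dB: "d \<in> B \<rightarrow> carrier R" "d x \<in> carrier R"
            using c d by (auto simp: PiE_def Pi_def)
          note lc = lincomb_closed[OF BM cB(1)] and ld = lincomb_closed[OF BM dB(1)]
          have eq': "c x \<odot>\<^bsub>M\<^esub> x \<oplus>\<^bsub>M\<^esub> lincomb B c = d x \<odot>\<^bsub>M\<^esub> x \<oplus>\<^bsub>M\<^esub> lincomb B d"
            using eq lincomb_insert[OF finB xB] x BM cB dB by auto
          show "c = d"
          proof (cases "c x = d x")
            case True
            then have "lincomb B c = lincomb B d" using eq' x cB lc ld by simp
            then have "lincomb B (restrict c B) = lincomb B (restrict d B)"
              using lincomb_cong[OF BM cB(1), of "restrict c B"] lincomb_cong[OF BM dB(1), of "restrict d B"] by simp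
            then have r: "restrict c B = restrict d B" using B cB dB by (auto dest!: inj_onD)
            show ?thesis
            proof (rule PiE_ext[OF c d])
              fix b assume "b \<in> insert x B"
              then show "c b = d b" using True fun_cong[OF r, of b] by auto
            qed
          next
            case False
            define a where "a = c x \<ominus> d x"
            have a: "a \<in> carrier R" "a \<noteq> \<zero>" using False cB dB by (auto simp: a_def)
            then have ia: "inv a \<in> carrier R" "inv a \<otimes> a = \<one>" using F.field_Units R.Units_l_inv[of a] R.Units_inv_closed[of a] by auto
            define f where "f = (\<lambda>b. d b \<oplus> \<ominus> \<one> \<otimes> c b)"
            have f: "f \<in> B \<rightarrow> carrier R" using cB dB by (auto simp: f_def)
            have lf: "lincomb B f = lincomb B d \<oplus>\<^bsub>M\<^esub> \<ominus> \<one> \<odot>\<^bsub>M\<^esub> lincomb B c"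
              unfolding f_def using lincomb_add[OF BM dB(1), of "\<lambda>b. \<ominus> \<one> \<otimes> c b"] lincomb_smult[OF finB BM cB(1), of "\<ominus> \<one>"] cB by auto
            have neg: "\<ominus> \<one> \<odot>\<^bsub>M\<^esub> y = \<ominus>\<^bsub>M\<^esub> y" if "y \<in> carrier M" for y using that smult_l_minus[of \<one> y] by simp
            have "a \<odot>\<^bsub>M\<^esub> x = c x \<odot>\<^bsub>M\<^esub> x \<oplus>\<^bsub>M\<^esub> \<ominus>\<^bsub>M\<^esub> (d x \<odot>\<^bsub>M\<^esub> x)"
              unfolding a_def a_minus_def using cB dB x by (simp add: smult_l_distr smult_l_minus)
            also have "\<dots> = lincomb B d \<oplus>\<^bsub>M\<^esub> \<ominus>\<^bsub>M\<^esub> lincomb B c"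
            proof -
              have "c x \<odot>\<^bsub>M\<^esub> x = (d x \<odot>\<^bsub>M\<^esub> x \<oplus>\<^bsub>M\<^esub> lincomb B d) \<oplus>\<^bsub>M\<^esub> \<ominus>\<^bsub>M\<^esub> lincomb B c"
                unfolding eq'[symmetric] using x cB lc by (simp add: M.a_assoc M.r_neg)
              then have "c x \<odot>\<^bsub>M\<^esub> x = (lincomb B d \<oplus>\<^bsub>M\<^esub> \<ominus>\<^bsub>M\<^esub> lincomb B c) \<oplus>\<^bsub>M\<^esub> d x \<odot>\<^bsub>M\<^esub> x"
                using x dB lc ld by (simp add: M.a_ac)
              then show ?thesis using x dB lc ld by (simp add: M.a_assoc M.r_neg)
            qed
            also have "\<dots> = lincomb B f" using lf neg lc by simp
            finally have "inv a \<odot>\<^bsub>M\<^esub> (a \<odot>\<^bsub>M\<^esub> x) = lincomb B (\<lambda>b. inv a \<otimes> f b)"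
              using lincomb_smult[OF finB BM f ia(1)] by simp
            moreover have "inv a \<odot>\<^bsub>M\<^esub> (a \<odot>\<^bsub>M\<^esub> x) = x" using smult_assoc1[OF ia(1) a(1) x] ia x by simp
            ultimately have "x = lincomb B (\<lambda>b. inv a \<otimes> f b)" by simp
            moreover have "(\<lambda>b. inv a \<otimes> f b) \<in> B \<rightarrow> carrier R" using f ia(1) by auto
            ultimately show ?thesis using nspan by blast
          qed
        qed
      qed (use x BM in auto)
      then have "card (insert x B) \<le> card B" by (rule max)
      then show False using xB finB by simp
    qed
  qed
  then have "lincomb B ` (B \<rightarrow>\<^sub>E carrier R) = carrier M" using lincomb_closed[OF BM] by (auto simp: PiE_def)
  then have "is_basis R M B" unfolding is_basis_iff using B finB by (simp add: bij_betw_def)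
  then show ?thesis by blast
qed

text \<open>Counting elements shows that all bases have the same size, so the definite description
  in \<open>module_rank\<close> denotes.\<close>

lemma card_carrier_module_rank:
  assumes R: "field R" "finite (carrier R)" and fin: "finite (carrier M)"
  shows "card (carrier M) = card (carrier R) ^ module_rank R M"
proof -
  interpret F: field R by (rule R(1))
  have "{\<zero>, \<one>} \<subseteq> carrier R" by simp
  then have "card {\<zero>, \<one>} \<le> card (carrier R)" by (rule card_mono[OF R(2)])
  then have q: "card (carrier R) \<ge> 2" by simp
  obtain B where B: "is_basis R M B" using exists_basis[OF R(1) fin] by blast
  have "module_rank R M = card B" unfolding module_rank_def
  proof (rule the_equality)
    show "\<exists>B'. is_basis R M B' \<and> card B' = card B" using B by blast
    fix n assume "\<exists>B. is_basis R M B \<and> card B = n"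
    then have "card (carrier R) ^ n = card (carrier R) ^ card B" using card_is_basis B by metis
    then show "n = card B" using q by simp
  qed
  then show ?thesis using card_is_basis[OF B] by simp
qed

end

section \<open>Substructures over the prime field as sublattices\<close>

primrec star_closed :: "substructure \<Rightarrow> ('v \<Rightarrow> 'v \<Rightarrow> 'v) \<Rightarrow> 'v set \<Rightarrow> bool" where
  "star_closed Subalgebras br K \<longleftrightarrow> (\<forall>x\<in>K. \<forall>y\<in>K. br x y \<in> K)"
| "star_closed Ideals br K \<longleftrightarrow> (\<forall>x. \<forall>y\<in>K. br x y \<in> K)"

text \<open>Substructures of an algebra \<open>T\<close> over the prime field are handled through their preimages under an
  additive surjection \<open>J\<close> from a lattice \<open>'v\<close> (with integer scaling \<open>sc\<close>) whose kernel consists of the \<open>p\<close>-multiples.\<close>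

locale fp_model =
  fixes p :: nat and T :: "(int, 't) lie_alg" and J :: "'v::ab_group_add \<Rightarrow> 't"
    and sc :: "int \<Rightarrow> 'v \<Rightarrow> 'v" and br :: "'v \<Rightarrow> 'v \<Rightarrow> 'v"
  assumes p: "prime p"
    and carrier_T: "carrier T = range J"
    and zero_T: "\<zero>\<^bsub>T\<^esub> = J 0"
    and add_T: "J x \<oplus>\<^bsub>T\<^esub> J y = J (x + y)"
    and smult_T: "a \<in> {0..<int p} \<Longrightarrow> a \<odot>\<^bsub>T\<^esub> J x = J (sc a x)"
    and bracket_T: "bracket T (J x) (J y) = J (br x y)"
    and kernel_J: "J x = J y \<longleftrightarrow> (\<exists>z. x - y = sc (int p) z)"
    and sc_add: "sc (a + b) x = sc a x + sc b x"
    and sc_mult: "sc (a * b) x = sc a (sc b x)"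
    and sc_dist: "sc a (x + y) = sc a x + sc a y"
    and sc_one: "sc 1 x = x"
    and finite_T: "finite (range J)"
begin

abbreviation R where "R \<equiv> residue_ring (int p)"

lemma sc_zero: "sc 0 x = 0"
  using sc_add[of 0 0 x] by simp

lemma sc_in_subgroup: "add_subgroup K \<Longrightarrow> x \<in> K \<Longrightarrow> sc a x \<in> K"
proof -
  assume K: "add_subgroup K" and x: "x \<in> K"
  have nat: "sc (int n) x \<in> K" for n
    by (induction n) (auto simp: sc_zero sc_add sc_one add_subgroup_zero[OF K] intro: add_subgroup_add[OF K] x)
  show "sc a x \<in> K"
  proof (cases "a \<ge> 0")
    case True
    then show ?thesis using nat[of "nat a"] by simp
  next
    case False
    have "sc a x + sc (- a) x = 0" using sc_add[of a "- a" x] by (simp add: sc_zero)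
    then have "sc a x = - sc (- a) x" by (simp add: eq_neg_iff_add_eq_0)
    then show ?thesis using add_subgroup_uminus[OF K nat[of "nat (- a)"]] False by simp
  qed
qed

lemma field_R: "field R"
  using residues_prime.is_field[of p] p by (simp add: residues_prime_def)

lemma carrier_R: "carrier R = {0..<int p}"
  by (auto simp: residue_ring_def)

lemma J_mod: "J (sc (a mod int p) x) = J (sc a x)"
proof -
  have "a mod int p - a = int p * (- (a div int p))" by (simp add: minus_mult_div_eq_mod[symmetric] algebra_simps)
  then have "a mod int p = a + int p * (- (a div int p))" by linarith
  then have "sc (a mod int p) x = sc (a + int p * (- (a div int p))) x" by (simp only:)
  then have "sc (a mod int p) x - sc a x = sc (int p) (sc (- (a div int p)) x)" by (simp only: sc_add sc_mult) simp
  then show ?thesis unfolding kernel_J by blast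
qed

lemma module_T: "module R T"
proof (rule moduleI)
  show "cring R" using field_R by (simp add: field_def domain_def)
  show "abelian_group T"
  proof (rule abelian_groupI)
    fix x assume "x \<in> carrier T"
    then obtain v where "x = J v" unfolding carrier_T by blast
    then have "J (- v) \<oplus>\<^bsub>T\<^esub> x = \<zero>\<^bsub>T\<^esub>" by (simp add: add_T zero_T)
    then show "\<exists>y\<in>carrier T. y \<oplus>\<^bsub>T\<^esub> x = \<zero>\<^bsub>T\<^esub>" unfolding carrier_T by blast
  qed (auto simp: carrier_T add_T zero_T ac_simps)
  have bnd: "(a * b) mod int p \<in> {0..<int p}" "(a + b) mod int p \<in> {0..<int p}" for a b
    using prime_gt_0_nat[OF p] by simp_all
  fix a b x y assume a: "a \<in> carrier R" and b: "b \<in> carrier R" and "x \<in> carrier T" and "y \<in> carrier T"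
  then obtain v w where x: "x = J v" and y: "y = J w" unfolding carrier_T by blast
  have a': "a \<in> {0..<int p}" and b': "b \<in> {0..<int p}" using a b carrier_R by auto
  show "a \<odot>\<^bsub>T\<^esub> x \<in> carrier T" unfolding x smult_T[OF a'] carrier_T by simp
  show "a \<odot>\<^bsub>T\<^esub> (x \<oplus>\<^bsub>T\<^esub> y) = a \<odot>\<^bsub>T\<^esub> x \<oplus>\<^bsub>T\<^esub> a \<odot>\<^bsub>T\<^esub> y"
    unfolding x y add_T smult_T[OF a'] sc_dist ..
  have "a \<oplus>\<^bsub>R\<^esub> b = (a + b) mod int p" "a \<otimes>\<^bsub>R\<^esub> b = (a * b) mod int p" by (simp_all add: residue_ring_def)
  then show "(a \<oplus>\<^bsub>R\<^esub> b) \<odot>\<^bsub>T\<^esub> x = a \<odot>\<^bsub>T\<^esub> x \<oplus>\<^bsub>T\<^esub> b \<odot>\<^bsub>T\<^esub> x" "(a \<otimes>\<^bsub>R\<^esub> b) \<odot>\<^bsub>T\<^esub> x = a \<odot>\<^bsub>T\<^esub> (b \<odot>\<^bsub>T\<^esub> x)"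
    unfolding x by (simp_all only: smult_T[OF a'] smult_T[OF b'] smult_T[OF bnd(1)] smult_T[OF bnd(2)] add_T J_mod sc_add sc_mult)
next
  fix x assume "x \<in> carrier T"
  then obtain v where x: "x = J v" unfolding carrier_T by blast
  have "\<one>\<^bsub>R\<^esub> = 1" "1 \<in> {0..<int p}" using prime_gt_1_nat[OF p] by (simp_all add: residue_ring_def)
  then show "\<one>\<^bsub>R\<^esub> \<odot>\<^bsub>T\<^esub> x = x" unfolding x by (simp only: smult_T sc_one)
qed

text \<open>The candidates for preimages of subspaces: additive subgroups between the p-multiples,
  which form the kernel of \<open>J\<close>, and the whole lattice.\<close>

definition lattices :: "'v set set" where
  "lattices = {K. add_subgroup K \<and> (\<forall>z. sc (int p) z \<in> K)}"

lemma J_mem_iff: "K \<in> lattices \<Longrightarrow> J x \<in> J ` K \<longleftrightarrow> x \<in> K"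
proof
  assume K: "K \<in> lattices" and "J x \<in> J ` K"
  then obtain y z where y: "y \<in> K" "x - y = sc (int p) z" unfolding image_iff kernel_J by blast
  then have "(x - y) + y \<in> K" using K unfolding lattices_def by (intro add_subgroup_add) auto
  then show "x \<in> K" by simp
qed simp

lemma inj_on_image_J: "inj_on ((`) J) lattices"
proof (rule inj_onI)
  fix K K' assume "K \<in> lattices" "K' \<in> lattices" "J ` K = J ` K'"
  then show "K = K'" using J_mem_iff by (metis subsetI subset_antisym)
qed

text \<open>Scalars of the prime field act as integers, that is, by repeated addition, so a
  submodule is no more than an additive subgroup, and its preimage is one containing the kernel of
  \<open>J\<close>.\<close>

lemma submodule_iff: "submodule H R T \<longleftrightarrow> H \<in> (`) J ` lattices"
proof
  assume H: "submodule H R T"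
  interpret M: Module.module R T by (rule module_T)
  define K where "K = {x. J x \<in> H}"
  note Hs = M.submoduleE[OF H]
  have HT: "H \<subseteq> range J" using Hs(1) carrier_T by simp
  have z: "\<zero>\<^bsub>T\<^esub> \<in> H" using submodule.axioms(1)[OF H] subgroup.one_closed[of H "add_monoid T"] by simp
  have "add_subgroup K"
  proof (rule add_subgroupI)
    show "0 \<in> K" using z zero_T by (simp add: K_def)
    fix x y assume "x \<in> K" "y \<in> K"
    then have xy: "J x \<in> H" "J y \<in> H" by (simp_all add: K_def)
    have "\<ominus>\<^bsub>T\<^esub> J y = J (- y)" by (rule M.M.minus_equality) (simp_all add: add_T zero_T carrier_T)
    then have "J (- y) \<in> H" using Hs(3)[OF xy(2)] by simp
    then have "J x \<oplus>\<^bsub>T\<^esub> J (- y) \<in> H" using Hs(5)[OF xy(1)] by simp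
    then show "x - y \<in> K" by (simp add: K_def add_T)
  qed
  moreover have "sc (int p) z \<in> K" for z
  proof -
    have "J (sc (int p) z) = J 0" unfolding kernel_J by auto
    then show ?thesis using z zero_T by (simp add: K_def)
  qed
  moreover have "H = J ` K" using HT by (auto simp: K_def)
  ultimately show "H \<in> (`) J ` lattices" unfolding lattices_def by blast
next
  assume "H \<in> (`) J ` lattices"
  then obtain K where K: "K \<in> lattices" and H: "H = J ` K" by blast
  have sg: "add_subgroup K" using K by (simp add: lattices_def)
  interpret M: Module.module R T by (rule module_T)
  show "submodule H R T"
  proof (rule M.submoduleI)
    show "H \<subseteq> carrier T" unfolding H carrier_T by blast
    show "\<zero>\<^bsub>T\<^esub> \<in> H" unfolding H zero_T using add_subgroup_zero[OF sg] by blast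
  next
    fix a assume "a \<in> H"
    then obtain x where x: "x \<in> K" "a = J x" unfolding H by blast
    have "\<ominus>\<^bsub>T\<^esub> J x = J (- x)" by (rule M.M.minus_equality) (simp_all add: add_T zero_T carrier_T)
    then show "\<ominus>\<^bsub>T\<^esub> a \<in> H" unfolding H x(2) using add_subgroup_uminus[OF sg x(1)] by blast
    fix b assume "b \<in> H"
    then obtain y where y: "y \<in> K" "b = J y" unfolding H by blast
    show "a \<oplus>\<^bsub>T\<^esub> b \<in> H" unfolding x(2) y(2) add_T H using add_subgroup_add[OF sg x(1) y(1)] by blast
  next
    fix a x assume a: "a \<in> carrier R" and "x \<in> H"
    then obtain v where v: "v \<in> K" "x = J v" unfolding H by blast
    have "a \<in> {0..<int p}" using a carrier_R by simp
    then show "a \<odot>\<^bsub>T\<^esub> x \<in> H" unfolding v(2) H using sc_in_subgroup[OF sg v(1)] by (simp add: smult_T)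
  qed
qed

lemma is_substructure_iff:
  assumes K: "K \<in> lattices" shows "is_substructure star R T (J ` K) \<longleftrightarrow> star_closed star br K"
proof -
  have sub: "submodule (J ` K) R T" using K submodule_iff by blast
  show ?thesis
  proof (cases star)
    case Subalgebras
    then show ?thesis using sub by (auto simp: lie_subalgebra_def bracket_T J_mem_iff[OF K])
  next
    case Ideals
    then show ?thesis using sub by (auto simp: lie_ideal_def bracket_T J_mem_iff[OF K] carrier_T)
  qed
qed

lemma card_submodule:
  assumes "K \<in> lattices" shows "card (J ` K) = p ^ module_rank R (T\<lparr>carrier := J ` K\<rparr>)"
proof -
  have "submodule (J ` K) R T" using assms submodule_iff by blast
  then have "module R (T\<lparr>carrier := J ` K\<rparr>)" by (rule submodule.submodule_is_module[OF _ module_T])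
  from module.card_carrier_module_rank[OF this field_R]
  show ?thesis using finite_subset[OF _ finite_T, of "J ` K"] carrier_R by (simp add: image_mono)
qed

lemma card_T: "card (range J) = p ^ module_rank R T"
  using module.card_carrier_module_rank[OF module_T field_R] finite_T carrier_R by (simp add: carrier_T)

text \<open>The dimension is the exponent of \<open>p\<close> in the cardinality, so codimension
  becomes a quotient of cardinalities and bases of the subspaces disappear from the count.\<close>

theorem count_codim_eq:
  "count_codim star R T i = card {K \<in> lattices. star_closed star br K \<and> card (J ` K) * p ^ i = card (range J)}"
proof -
  have p1: "p > 1" using prime_gt_1_nat[OF p] .
  have cod: "has_codim R T (J ` K) i \<longleftrightarrow> card (J ` K) * p ^ i = card (range J)" if "K \<in> lattices" for K
    unfolding has_codim_def card_submodule[OF that] card_T power_add[symmetric] using p1 by auto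
  have "{H. is_substructure star R T H \<and> has_codim R T H i}
      = (`) J ` {K \<in> lattices. star_closed star br K \<and> card (J ` K) * p ^ i = card (range J)}" (is "?A = ?B")
  proof (intro equalityI subsetI)
    fix H assume H: "H \<in> ?A"
    then have "submodule H R T" by (cases star) (auto simp: lie_subalgebra_def lie_ideal_def)
    then obtain K where "K \<in> lattices" "H = J ` K" using submodule_iff by blast
    then show "H \<in> ?B" using H cod is_substructure_iff by auto
  next
    fix H assume "H \<in> ?B"
    then show "H \<in> ?A" using cod is_substructure_iff by auto
  qed
  then show ?thesis unfolding count_codim_def
    by (simp only:) (rule card_image, rule inj_on_subset[OF inj_on_image_J], blast)
qed

end

section \<open>Reduction of a Lie ring modulo a prime\<close>

text \<open>Replaces the carrier of \<open>L\<close> by a type \<open>'v\<close> with its own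
  addition. The condition \<open>separated\<close>, that additive functionals detect divisibility by
  integers, is the form in which freeness enters the computation of the tensor product.\<close>

locale lie_coords =
  fixes L :: "(int, 'b, 'm) lie_alg_scheme" and \<phi> :: "'v::ab_group_add \<Rightarrow> 'b"
    and sc :: "int \<Rightarrow> 'v \<Rightarrow> 'v" and br :: "'v \<Rightarrow> 'v \<Rightarrow> 'v"
  assumes lie: "lie_algebra \<Z> L"
    and \<phi>_bij: "bij_betw \<phi> UNIV (carrier L)"
    and \<phi>_add: "\<phi> (x + y) = \<phi> x \<oplus>\<^bsub>L\<^esub> \<phi> y"
    and \<phi>_sc: "\<phi> (sc k x) = k \<odot>\<^bsub>L\<^esub> \<phi> x"
    and \<phi>_br: "\<phi> (br x y) = bracket L (\<phi> x) (\<phi> y)"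
    and separated: "\<And>k x. (\<And>h. (\<And>x y. h (x + y) = h x + h y) \<Longrightarrow> k dvd (h x :: int)) \<Longrightarrow> \<exists>z. x = sc k z"
begin

sublocale L: lie_algebra \<Z> L by (rule lie)

lemma \<phi>_closed [simp]: "\<phi> x \<in> carrier L"
  using \<phi>_bij by (auto simp: bij_betw_def)

lemma \<phi>_eq_iff: "\<phi> x = \<phi> y \<longleftrightarrow> x = y"
  using \<phi>_bij by (auto simp: bij_betw_def inj_on_def)

lemma \<phi>_surj: "y \<in> carrier L \<Longrightarrow> \<exists>x. y = \<phi> x"
  using \<phi>_bij by (auto simp: bij_betw_def)

lemma sc_add: "sc (a + b) x = sc a x + sc b x"
  using L.smult_l_distr[of a b "\<phi> x"] by (simp add: \<phi>_eq_iff[symmetric] \<phi>_add \<phi>_sc)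

lemma sc_mult: "sc (a * b) x = sc a (sc b x)"
  using L.smult_assoc1[of a b "\<phi> x"] by (simp add: \<phi>_eq_iff[symmetric] \<phi>_sc)

lemma sc_dist: "sc a (x + y) = sc a x + sc a y"
  using L.smult_r_distr[of a "\<phi> x" "\<phi> y"] by (simp add: \<phi>_eq_iff[symmetric] \<phi>_add \<phi>_sc)

lemma sc_one: "sc 1 x = x"
  using L.smult_one[of "\<phi> x"] by (simp add: \<phi>_eq_iff[symmetric] \<phi>_sc)

lemma sc_zero: "sc 0 x = 0"
  using sc_add[of 0 0 x] by simp

lemma br_add_left: "br (x + y) z = br x z + br y z"
  by (simp add: \<phi>_eq_iff[symmetric] \<phi>_add \<phi>_br L.bracket_add_left)

lemma br_add_right: "br x (y + z) = br x y + br x z"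
  by (simp add: \<phi>_eq_iff[symmetric] \<phi>_add \<phi>_br L.bracket_add_right)

lemma br_sc_left: "br (sc k x) y = sc k (br x y)"
  using L.bracket_smult_left[of k "\<phi> x" "\<phi> y"] by (simp add: \<phi>_eq_iff[symmetric] \<phi>_sc \<phi>_br)

lemma br_sc_right: "br x (sc k y) = sc k (br x y)"
  using L.bracket_smult_right[of k "\<phi> x" "\<phi> y"] by (simp add: \<phi>_eq_iff[symmetric] \<phi>_sc \<phi>_br)

lemma \<phi>_zero: "\<phi> 0 = \<zero>\<^bsub>L\<^esub>"
proof -
  have "\<phi> 0 \<oplus>\<^bsub>L\<^esub> \<phi> 0 = \<phi> 0" using \<phi>_add[of 0 0] by simp
  then show ?thesis by (metis L.M.add.r_cancel_one' \<phi>_closed)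
qed

lemma br_self: "br x x = 0"
  by (simp add: \<phi>_eq_iff[symmetric] \<phi>_zero \<phi>_br L.bracket_self)

lemma br_jacobi: "br x (br y z) + br y (br z x) + br z (br x y) = 0"
  by (simp add: \<phi>_eq_iff[symmetric] \<phi>_zero \<phi>_add \<phi>_br L.jacobi)

end

section \<open>The tensor product with the prime field in coordinates\<close>

locale lie_coords_mod = lie_coords L \<phi> sc br
  for L :: "(int, 'b, 'm) lie_alg_scheme" and \<phi> :: "'v::ab_group_add \<Rightarrow> 'b" and sc br +
  fixes p :: nat
  assumes p: "prime p"
begin

abbreviation S where "S \<equiv> residue_ring (int p)"

abbreviation F where "F \<equiv> tensor_free L S"

abbreviation K where "K \<equiv> tensor_rel L S"

lemma p_gt_1: "1 < int p" using prime_gt_1_nat[OF p] by simp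

lemma S_simps: "carrier S = {0..<int p}" "a \<oplus>\<^bsub>S\<^esub> b = (a + b) mod int p" "a \<otimes>\<^bsub>S\<^esub> b = (a * b) mod int p"
  by (auto simp: residue_ring_def)

lemma S_closed: "(a + b) mod int p \<in> carrier S" "(a * b) mod int p \<in> carrier S" "1 \<in> carrier S" "0 \<in> carrier S"
  using p_gt_1 by (simp_all add: S_simps)

lemma F_simps: "x \<otimes>\<^bsub>F\<^esub> y = x + y" "\<one>\<^bsub>F\<^esub> = 0" "u \<in> carrier F \<longleftrightarrow> Poly_Mapping.keys u \<subseteq> carrier L \<times> carrier S"
  by (simp_all add: tensor_free_def)

lemma F_comm_group: "comm_group F"
  unfolding tensor_free_def by (rule abelian_free_Abelian_group)

lemma frag_of_F: "x \<in> carrier L \<Longrightarrow> a \<in> carrier S \<Longrightarrow> frag_of (x, a) \<in> carrier F"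
  by (simp add: tensor_free_def)

definition gens where
  "gens = {frag_of (x \<oplus>\<^bsub>L\<^esub> y, a) - frag_of (x, a) - frag_of (y, a) | x y a.
         x \<in> carrier L \<and> y \<in> carrier L \<and> a \<in> carrier S}
      \<union> {frag_of (x, a \<oplus>\<^bsub>S\<^esub> b) - frag_of (x, a) - frag_of (x, b) | x a b.
         x \<in> carrier L \<and> a \<in> carrier S \<and> b \<in> carrier S}"

lemma F_closed: "u \<in> carrier F \<Longrightarrow> v \<in> carrier F \<Longrightarrow> u + v \<in> carrier F" "u \<in> carrier F \<Longrightarrow> v \<in> carrier F \<Longrightarrow> u - v \<in> carrier F"
  "0 \<in> carrier F"
proof -
  interpret G: comm_group F by (rule F_comm_group)
  assume u: "u \<in> carrier F" and v: "v \<in> carrier F"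
  show "u + v \<in> carrier F" using G.m_closed[OF u v] by (simp only: F_simps(1))
  show "u - v \<in> carrier F" using keys_diff[of u v] u v by (auto simp: F_simps)
qed (simp add: F_simps)

lemma gens_F: "gens \<subseteq> carrier F"
proof
  fix g assume "g \<in> gens"
  then show "g \<in> carrier F" unfolding gens_def
  proof (elim UnE CollectE exE conjE)
    fix x y a assume "g = frag_of (x \<oplus>\<^bsub>L\<^esub> y, a) - frag_of (x, a) - frag_of (y, a)" "x \<in> carrier L" "y \<in> carrier L" "a \<in> carrier S"
    then show ?thesis by (simp only:) (intro F_closed frag_of_F L.M.a_closed)
  next
    fix x a b assume g: "g = frag_of (x, a \<oplus>\<^bsub>S\<^esub> b) - frag_of (x, a) - frag_of (x, b)" and "x \<in> carrier L" "a \<in> carrier S" "b \<in> carrier S"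
    then show ?thesis unfolding g S_simps(2) by (intro F_closed(2) frag_of_F S_closed)
  qed
qed

lemma K_def': "K = generate F gens"
  unfolding tensor_rel_def gens_def ..

lemma K_subgroup: "subgroup K F"
  unfolding K_def' by (rule group.generate_is_subgroup[OF comm_group.axioms(2)[OF F_comm_group] gens_F])

lemma K_F: "u \<in> K \<Longrightarrow> u \<in> carrier F"
  using subgroup.subset[OF K_subgroup] by blast

lemma K_zero: "0 \<in> K" using subgroup.one_closed[OF K_subgroup] by (simp add: F_simps)

lemma K_add: "u \<in> K \<Longrightarrow> v \<in> K \<Longrightarrow> u + v \<in> K"
  using subgroup.m_closed[OF K_subgroup] by (simp add: F_simps)

lemma K_uminus: "u \<in> K \<Longrightarrow> - u \<in> K"
  using subgroup.m_inv_closed[OF K_subgroup, of u] K_F[of u] by (simp add: tensor_free_def)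

lemma K_diff: "u \<in> K \<Longrightarrow> v \<in> K \<Longrightarrow> u - v \<in> K"
  using K_add[of u "- v"] K_uminus[of v] by simp

lemma K_gen: "g \<in> gens \<Longrightarrow> g \<in> K"
  unfolding K_def' by (rule generate.incl)

lemma K_induct [consumes 1, case_names gen zero diff]:
  assumes u: "u \<in> K" and gen: "\<And>g. g \<in> gens \<Longrightarrow> P g" and zero: "P 0" and diff: "\<And>u v. P u \<Longrightarrow> P v \<Longrightarrow> P (u - v)"
  shows "P u"
  using u unfolding K_def'
proof (induction u rule: generate.induct)
  case one
  then show ?case using zero by (simp add: F_simps)
next
  case (incl h)
  then show ?case by (rule gen)
next
  case (inv h)
  then have "inv\<^bsub>F\<^esub> h = - h" using gens_F by (auto simp: tensor_free_def)
  then show ?case using diff[OF zero gen[OF inv]] by simp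
next
  case (eng h1 h2)
  then show ?case using diff[OF eng(3) diff[OF zero eng(4)]] by (simp add: F_simps)
qed

definition cl where "cl u = K #>\<^bsub>F\<^esub> u"

lemma cl_eq: "cl u = {k + u | k. k \<in> K}"
  unfolding cl_def r_coset_def by (auto simp: F_simps)

lemma cl_eq_iff: "cl u = cl v \<longleftrightarrow> u - v \<in> K"
proof
  assume "cl u = cl v"
  moreover have "0 + u \<in> cl u" unfolding cl_eq using K_zero by blast
  ultimately obtain k where "u = k + v" "k \<in> K" unfolding cl_eq by auto
  then show "u - v \<in> K" by simp
next
  assume uv: "u - v \<in> K"
  show "cl u = cl v"
  proof (intro equalityI subsetI)
    fix w assume "w \<in> cl u"
    then obtain k where "k \<in> K" "w = k + u" unfolding cl_eq by blast
    then have "w = (k + (u - v)) + v" "k + (u - v) \<in> K" using K_add uv by auto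
    then show "w \<in> cl v" unfolding cl_eq by blast
  next
    fix w assume "w \<in> cl v"
    then obtain k where "k \<in> K" "w = k + v" unfolding cl_eq by blast
    then have "w = (k - (u - v)) + u" "k - (u - v) \<in> K" using K_diff uv by auto
    then show "w \<in> cl u" unfolding cl_eq by blast
  qed
qed

text \<open>The operations on the quotient are unions over representatives of a coset. Such a union
  is a single coset once its members do not depend on the representative.\<close>

lemma Union_cl:
  assumes "\<And>k. k \<in> K \<Longrightarrow> cl (f (k + u)) = C" shows "(\<Union>w\<in>cl u. cl (f w)) = C"
  unfolding cl_eq[of u] using assms K_zero by auto

lemma rel1: "\<lbrakk>x \<in> carrier L; y \<in> carrier L; a \<in> carrier S\<rbrakk> \<Longrightarrow> frag_of (x \<oplus>\<^bsub>L\<^esub> y, a) - frag_of (x, a) - frag_of (y, a) \<in> K"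
  by (rule K_gen) (unfold gens_def, blast)

lemma rel2: "\<lbrakk>x \<in> carrier L; a \<in> carrier S; b \<in> carrier S\<rbrakk> \<Longrightarrow> frag_of (x, (a + b) mod int p) - frag_of (x, a) - frag_of (x, b) \<in> K"
  unfolding S_simps(2)[symmetric] by (rule K_gen) (unfold gens_def, blast)

text \<open>The elementary tensor of a vector with 1. Every class of the tensor product turns out to
  have a representative of this form, so \<open>t\<close> followed by the quotient map is the
  reduction modulo \<open>p\<close>.\<close>

definition t :: "'v \<Rightarrow> ('b \<times> int \<Rightarrow>\<^sub>0 int)" where "t v = frag_of (\<phi> v, 1)"

lemma t_F: "t v \<in> carrier F" unfolding t_def by (rule frag_of_F) (simp_all add: S_closed)

lemma t_add: "t (v + w) - t v - t w \<in> K"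
  unfolding t_def \<phi>_add by (rule rel1) (simp_all add: S_closed)

lemma t_diff: "t (v - w) - (t v - t w) \<in> K"
  using K_uminus[OF t_add[of "v - w" w]] by (simp add: algebra_simps)

text \<open>Additivity in the second factor unrolls \<open>a\<close> into summands 1. The bound a <
  p keeps the reduction modulo \<open>p\<close> from interfering.\<close>

lemma t_scale:
  assumes "a < p" shows "frag_of (\<phi> v, int a) - t (sc (int a) v) \<in> K"
  using assms
proof (induction a)
  case 0
  have "frag_of (\<phi> v, (0 + 0) mod int p) - frag_of (\<phi> v, 0) - frag_of (\<phi> v, 0) \<in> K" by (rule rel2) (simp_all add: S_closed)
  then have "- frag_of (\<phi> v, 0) \<in> K" by simp
  from K_uminus[OF this] have 1: "frag_of (\<phi> v, 0) \<in> K" by simp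
  have "t (0 + 0) - t 0 - t 0 \<in> K" by (rule t_add)
  then have "- t 0 \<in> K" by simp
  from K_add[OF 1 this] show ?case by (simp add: sc_zero)
next
  case (Suc a)
  have "frag_of (\<phi> v, (int a + 1) mod int p) - frag_of (\<phi> v, int a) - frag_of (\<phi> v, 1) \<in> K"
    by (rule rel2) (use Suc.prems in \<open>simp_all add: S_closed, simp add: S_simps\<close>)
  moreover have "(int a + 1) mod int p = int (Suc a)" using Suc.prems by simp
  ultimately have 1: "frag_of (\<phi> v, int (Suc a)) - frag_of (\<phi> v, int a) - t v \<in> K" by (simp add: t_def)
  have 2: "frag_of (\<phi> v, int a) - t (sc (int a) v) \<in> K" using Suc by simp
  have "t (sc (int a) v + v) - t (sc (int a) v) - t v \<in> K" by (rule t_add)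
  then have 3: "t (sc (int (Suc a)) v) - t (sc (int a) v) - t v \<in> K" by (simp add: sc_add sc_one add.commute)
  show ?case using K_diff[OF K_add[OF 1 2] 3] by simp
qed

text \<open>Here the reduction does interfere: one step beyond p - 1 wraps around to 0, and a tensor
  with 0 is trivial.\<close>

lemma t_p_multiple: "t (sc (int p) v) \<in> K"
proof -
  obtain a where a: "p = Suc a" using p_gt_1 by (cases p) auto
  have aS: "int a \<in> carrier S" unfolding S_simps using a by simp
  have "frag_of (\<phi> v, (int a + 1) mod int p) - frag_of (\<phi> v, int a) - frag_of (\<phi> v, 1) \<in> K"
    by (rule rel2[OF \<phi>_closed aS S_closed(3)])
  moreover have "int a + 1 = int p" using a by simp
  then have "(int a + 1) mod int p = 0" by simp
  ultimately have 1: "frag_of (\<phi> v, 0) - frag_of (\<phi> v, int a) - t v \<in> K" by (simp add: t_def)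
  have 2: "frag_of (\<phi> v, int a) - t (sc (int a) v) \<in> K" by (rule t_scale) (simp add: a)
  have "t (sc (int a) v + v) - t (sc (int a) v) - t v \<in> K" by (rule t_add)
  then have 3: "t (sc (int p) v) - t (sc (int a) v) - t v \<in> K" by (simp add: a sc_add sc_one add.commute)
  have 4: "frag_of (\<phi> v, int 0) - t (sc (int 0) v) \<in> K" by (rule t_scale) (simp add: a)
  have "- (t 0) \<in> K" using t_add[of 0 0] by simp
  then have 5: "frag_of (\<phi> v, 0) \<in> K" using K_diff[OF 4, of "- t 0"] by (simp add: sc_zero)
  show ?thesis using K_add[OF K_diff[OF 3 K_add[OF 1 2]] 5] by simp
qed

lemma t_surj: "u \<in> carrier F \<Longrightarrow> \<exists>v. u - t v \<in> K"
proof -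
  assume "u \<in> carrier F"
  then have "Poly_Mapping.keys u \<subseteq> carrier L \<times> carrier S" by (simp add: F_simps)
  then show ?thesis
  proof (induction u rule: frag_induction)
    case zero
    have "- t 0 \<in> K" using t_add[of 0 0] by simp
    then show ?case by (intro exI[of _ 0]) simp
  next
    case (one z)
    then obtain x a where z: "z = (x, a)" "x \<in> carrier L" "a \<in> carrier S" by blast
    obtain v where v: "x = \<phi> v" using \<phi>_surj z by blast
    have "frag_of (\<phi> v, int (nat a)) - t (sc (int (nat a)) v) \<in> K"
      by (rule t_scale) (use z in \<open>auto simp: S_simps nat_less_iff\<close>)
    then show ?case using z v by (auto simp: S_simps)
  next
    case (diff u w)
    then obtain x y where xy: "u - t x \<in> K" "w - t y \<in> K" by blast
    have "(u - w) - t (x - y) = ((u - t x) - (w - t y)) - (t (x - y) - (t x - t y))" by simp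
    also have "\<dots> \<in> K" by (intro K_diff xy t_diff)
    finally show ?case by blast
  qed
qed

definition J :: "'v \<Rightarrow> ('b \<times> int \<Rightarrow>\<^sub>0 int) set" where "J v = cl (t v)"

text \<open>The map sending the pair (x, a) to a h(x) takes every defining relation to a multiple of
  \<open>p\<close>. This gives lower bounds on the tensor product: a vector with h(v) prime to
  \<open>p\<close> does not become 0.\<close>

lemma kernel_functional:
  assumes h: "\<And>x y. h (x + y) = h x + h y" and v: "t v \<in> K" shows "int p dvd (h v :: int)"
proof -
  define c where "c = (\<lambda>x. h (inv_into UNIV \<phi> x))"
  have c: "c (\<phi> x) = h x" for x
    unfolding c_def using \<phi>_bij by (simp add: bij_betw_def)
  \<comment> \<open>The free abelian group on the one-element type stands for the integers, so that
    \<open>frag_extend\<close> can be used; \<open>lookup\<close> reads off the integer.\<close>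
  define \<Theta> where "\<Theta> u = poly_mapping.lookup (frag_extend (\<lambda>(x, a). frag_cmul (a * c x) (frag_of ())) u) ()" for u :: "'b \<times> int \<Rightarrow>\<^sub>0 int"
  have \<Theta>_diff: "\<Theta> (u - w) = \<Theta> u - \<Theta> w" for u w by (simp add: \<Theta>_def frag_extend_diff lookup_minus)
  have \<Theta>_add: "\<Theta> (u + w) = \<Theta> u + \<Theta> w" for u w by (simp add: \<Theta>_def frag_extend_add lookup_add)
  have \<Theta>_of: "\<Theta> (frag_of (x, a)) = a * c x" for x a by (simp add: \<Theta>_def)
  have "int p dvd \<Theta> u" if "u \<in> K" for u
    using that
  proof (induction rule: K_induct)
    case (gen g)
    then show ?case unfolding gens_def
    proof (elim UnE CollectE exE conjE)
      fix x y a assume g: "g = frag_of (x \<oplus>\<^bsub>L\<^esub> y, a) - frag_of (x, a) - frag_of (y, a)" and "x \<in> carrier L" "y \<in> carrier L"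
      then obtain v w where "x = \<phi> v" "y = \<phi> w" using \<phi>_surj by blast
      then have "c (x \<oplus>\<^bsub>L\<^esub> y) = c x + c y" using c h by (simp add: \<phi>_add[symmetric])
      then show ?thesis unfolding g by (simp add: \<Theta>_diff \<Theta>_add \<Theta>_of algebra_simps)
    next
      fix x a b assume g: "g = frag_of (x, a \<oplus>\<^bsub>S\<^esub> b) - frag_of (x, a) - frag_of (x, b)"
      have m: "(a + b) mod int p = (a + b) - int p * ((a + b) div int p)" by (simp add: minus_mult_div_eq_mod)
      have "\<Theta> g = ((a + b) mod int p) * c x - a * c x - b * c x" unfolding g S_simps by (simp only: \<Theta>_diff \<Theta>_of)
      also have "\<dots> = int p * (- ((a + b) div int p) * c x)" unfolding m by (simp add: algebra_simps)
      finally show ?thesis by simp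
    qed
  next
    case zero
    show ?case by (simp add: \<Theta>_def)
  next
    case (diff u w)
    then show ?case by (simp add: \<Theta>_diff)
  qed
  from this[OF v] show ?thesis by (simp add: t_def \<Theta>_of c)
qed

lemma smult_K: "u \<in> K \<Longrightarrow> c \<in> carrier S \<Longrightarrow> tensor_free_smult S c u \<in> K"
proof (induction rule: K_induct)
  case (gen g)
  then show ?case unfolding gens_def
  proof (elim UnE CollectE exE conjE)
    fix x y a assume g: "g = frag_of (x \<oplus>\<^bsub>L\<^esub> y, a) - frag_of (x, a) - frag_of (y, a)" and *: "x \<in> carrier L" "y \<in> carrier L" "a \<in> carrier S"
    show ?thesis unfolding g tensor_free_smult_def
      by (simp add: frag_extend_diff) (rule rel1[OF *(1,2)], simp add: S_simps(3) S_closed)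
  next
    fix x a b assume g: "g = frag_of (x, a \<oplus>\<^bsub>S\<^esub> b) - frag_of (x, a) - frag_of (x, b)" and *: "x \<in> carrier L"
    have "c \<otimes>\<^bsub>S\<^esub> (a \<oplus>\<^bsub>S\<^esub> b) = ((c * a) mod int p + (c * b) mod int p) mod int p"
      by (simp add: S_simps mod_mult_right_eq mod_add_eq distrib_left)
    then show ?thesis unfolding g tensor_free_smult_def
      by (simp add: frag_extend_diff S_simps(3)) (rule rel2[OF * S_closed(2) S_closed(2)])
  qed
next
  case zero
  show ?case by (simp add: tensor_free_smult_def K_zero)
next
  case (diff u v)
  then show ?case by (simp add: tensor_free_smult_def frag_extend_diff K_diff)
qed

lemma tb_diff_left: "tensor_free_bracket L S (u - u') v = tensor_free_bracket L S u v - tensor_free_bracket L S u' v"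
  by (simp add: tensor_free_bracket_def frag_extend_diff)

lemma tb_diff_right: "tensor_free_bracket L S u (v - v') = tensor_free_bracket L S u v - tensor_free_bracket L S u v'"
proof -
  have *: "(\<lambda>(x, a). frag_extend (f x a) (v - v')) = (\<lambda>(x, a). frag_extend (f x a) v - frag_extend (f x a) v')"
    for f :: "'b \<Rightarrow> int \<Rightarrow> 'b \<times> int \<Rightarrow> 'b \<times> int \<Rightarrow>\<^sub>0 int" by (auto simp: frag_extend_diff)
  have "frag_extend (\<lambda>z. F z - G z) u = frag_extend F u - frag_extend G u" for F G :: "'b \<times> int \<Rightarrow> 'b \<times> int \<Rightarrow>\<^sub>0 int"
    by (simp add: frag_extend_def frag_cmul_sum sum_subtractf[symmetric]) (rule sum.cong[OF refl], metis add_diff_cancel_right' diff_add_cancel frag_cmul_distrib2)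
  then show ?thesis unfolding tensor_free_bracket_def by (simp add: case_prod_unfold frag_extend_diff)
qed

lemma tb_of: "tensor_free_bracket L S (frag_of (x, a)) (frag_of (y, b)) = frag_of (bracket L x y, (a * b) mod int p)"
  by (simp add: tensor_free_bracket_def S_simps)

lemma tb_zero: "tensor_free_bracket L S 0 v = 0" "tensor_free_bracket L S u 0 = 0"
  using tb_diff_left[of u u v] tb_diff_right[of u v v] by simp_all

lemma bracket_K_left: "u \<in> K \<Longrightarrow> v \<in> carrier F \<Longrightarrow> tensor_free_bracket L S u v \<in> K"
proof -
  assume u: "u \<in> K" and "v \<in> carrier F"
  then have "Poly_Mapping.keys v \<subseteq> carrier L \<times> carrier S" by (simp add: F_simps)
  then show ?thesis
  proof (induction v rule: frag_induction)
    case (one z)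
    then obtain y b where z: "z = (y, b)" and y: "y \<in> carrier L" and b: "b \<in> carrier S" by blast
    from u show ?case
    proof (induction rule: K_induct)
      case (gen g)
      then show ?case unfolding gens_def
      proof (elim UnE CollectE exE conjE)
        fix x x' a assume g: "g = frag_of (x \<oplus>\<^bsub>L\<^esub> x', a) - frag_of (x, a) - frag_of (x', a)" and *: "x \<in> carrier L" "x' \<in> carrier L" "a \<in> carrier S"
        show ?thesis unfolding g z tb_diff_left tb_of L.bracket_add_left[OF *(1,2) y]
          by (rule rel1) (simp_all add: L.bracket_closed * y S_closed)
      next
        fix x a a' assume g: "g = frag_of (x, a \<oplus>\<^bsub>S\<^esub> a') - frag_of (x, a) - frag_of (x, a')" and *: "x \<in> carrier L"
        have "((a + a') mod int p * b) mod int p = ((a * b) mod int p + (a' * b) mod int p) mod int p"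
          by (simp add: mod_mult_left_eq mod_add_eq distrib_right)
        then show ?thesis unfolding g z tb_diff_left tb_of S_simps(2)
          by (simp only:) (rule rel2[OF L.bracket_closed[OF * y] S_closed(2) S_closed(2)])
      qed
    next
      case zero
      show ?case by (simp add: tb_zero K_zero)
    next
      case (diff u v)
      then show ?case by (simp add: tb_diff_left K_diff)
    qed
  qed (simp_all add: tb_zero K_zero tb_diff_right K_diff)
qed

lemma bracket_K_right: "v \<in> K \<Longrightarrow> u \<in> carrier F \<Longrightarrow> tensor_free_bracket L S u v \<in> K"
proof -
  assume v: "v \<in> K" and "u \<in> carrier F"
  then have "Poly_Mapping.keys u \<subseteq> carrier L \<times> carrier S" by (simp add: F_simps)
  then show ?thesis
  proof (induction u rule: frag_induction)
    case (one z)
    then obtain y b where z: "z = (y, b)" and y: "y \<in> carrier L" and b: "b \<in> carrier S" by blast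
    from v show ?case
    proof (induction rule: K_induct)
      case (gen g)
      then show ?case unfolding gens_def
      proof (elim UnE CollectE exE conjE)
        fix x x' a assume g: "g = frag_of (x \<oplus>\<^bsub>L\<^esub> x', a) - frag_of (x, a) - frag_of (x', a)" and *: "x \<in> carrier L" "x' \<in> carrier L" "a \<in> carrier S"
        show ?thesis unfolding g z tb_diff_right tb_of L.bracket_add_right[OF y *(1,2)]
          by (rule rel1) (simp_all add: L.bracket_closed * y S_closed)
      next
        fix x a a' assume g: "g = frag_of (x, a \<oplus>\<^bsub>S\<^esub> a') - frag_of (x, a) - frag_of (x, a')" and *: "x \<in> carrier L"
        have "(b * ((a + a') mod int p)) mod int p = ((b * a) mod int p + (b * a') mod int p) mod int p"
          by (simp add: mod_mult_right_eq mod_add_eq distrib_left)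
        then show ?thesis unfolding g z tb_diff_right tb_of S_simps(2)
          by (simp only:) (rule rel2[OF L.bracket_closed[OF y *] S_closed(2) S_closed(2)])
      qed
    next
      case zero
      show ?case by (simp add: tb_zero K_zero)
    next
      case (diff u v)
      then show ?case by (simp add: tb_diff_right K_diff)
    qed
  qed (simp_all add: tb_zero K_zero tb_diff_left K_diff)
qed

abbreviation T where "T \<equiv> lie_tensor L S"

lemma T_simps: "carrier T = rcosets\<^bsub>F\<^esub> K" "\<zero>\<^bsub>T\<^esub> = K" "X \<oplus>\<^bsub>T\<^esub> Y = X <#>\<^bsub>F\<^esub> Y"
  "c \<odot>\<^bsub>T\<^esub> X = (\<Union>u\<in>X. cl (tensor_free_smult S c u))"
  "bracket T X Y = (\<Union>u\<in>X. \<Union>v\<in>Y. cl (tensor_free_bracket L S u v))"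
  by (simp_all add: lie_tensor_def FactGroup_def Let_def cl_def)

text \<open>Multiples of \<open>p\<close> vanish by \<open>t_p_multiple\<close>. Conversely a
  vanishing class is divisible by \<open>p\<close> under all functionals, and
  \<open>separated\<close> turns this into divisibility of the vector.\<close>

lemma J_eq_iff: "J x = J y \<longleftrightarrow> (\<exists>z. x - y = sc (int p) z)"
proof
  assume "J x = J y"
  then have "t x - t y \<in> K" by (simp add: J_def cl_eq_iff)
  from K_add[OF t_diff[of x y] this] have "t (x - y) \<in> K" by simp
  then have "int p dvd h (x - y)" if "\<And>x y. h (x + y) = h x + h y" for h using kernel_functional that by blast
  then show "\<exists>z. x - y = sc (int p) z" by (rule separated)
next
  assume "\<exists>z. x - y = sc (int p) z"
  then have "t (x - y) \<in> K" using t_p_multiple by auto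
  then have "t (x - y) - (t (x - y) - (t x - t y)) \<in> K" by (rule K_diff[OF _ t_diff])
  then show "J x = J y" by (simp add: J_def cl_eq_iff)
qed

theorem fp_model:
  assumes fin: "finite (range J)"
  shows "fp_model p T J sc br"
proof
  show "prime p" by (rule p)
  show "carrier T = range J"
  proof -
    have "rcosets\<^bsub>F\<^esub> K = cl ` carrier F" unfolding RCOSETS_def cl_def by blast
    also have "\<dots> = range J"
    proof (intro equalityI subsetI)
      fix c assume "c \<in> cl ` carrier F"
      then obtain u where "u \<in> carrier F" "c = cl u" by blast
      then show "c \<in> range J" using t_surj[of u] unfolding J_def by (auto simp: cl_eq_iff[symmetric])
    next
      fix c assume "c \<in> range J"
      then show "c \<in> cl ` carrier F" unfolding J_def using t_F by blast
    qed
    finally show ?thesis unfolding T_simps .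
  qed
  have t0: "t 0 \<in> K" using K_uminus[OF t_add[of 0 0]] by simp
  show "\<zero>\<^bsub>T\<^esub> = J 0"
  proof -
    have "cl 0 = K" unfolding cl_eq by simp
    moreover have "cl (t 0) = cl 0" using t0 by (simp add: cl_eq_iff)
    ultimately show ?thesis unfolding T_simps J_def by simp
  qed
  fix x y
  show "J x \<oplus>\<^bsub>T\<^esub> J y = J (x + y)"
  proof -
    interpret G: comm_group F by (rule F_comm_group)
    have "K \<lhd> F" using G.subgroup_imp_normal[OF K_subgroup] .
    then have "cl (t x) <#>\<^bsub>F\<^esub> cl (t y) = cl (t x + t y)"
      unfolding cl_def using normal.rcos_sum[of K F "t x" "t y"] t_F by (simp add: F_simps(1))
    also have "\<dots> = cl (t (x + y))" unfolding cl_eq_iff using K_uminus[OF t_add[of x y]] by (simp add: algebra_simps)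
    finally show ?thesis unfolding T_simps J_def .
  qed
  show "a \<odot>\<^bsub>T\<^esub> J x = J (sc a x)" if a: "a \<in> {0..<int p}" for a
  proof -
    have aS: "a \<in> carrier S" using a by (simp add: S_simps)
    show ?thesis unfolding T_simps J_def
    proof (rule Union_cl)
      fix k assume k: "k \<in> K"
      have "tensor_free_smult S a (k + t x) = tensor_free_smult S a k + frag_of (\<phi> x, a)"
        using a by (simp add: tensor_free_smult_def frag_extend_add t_def S_simps)
      moreover have "frag_of (\<phi> x, int (nat a)) - t (sc (int (nat a)) x) \<in> K"
        by (rule t_scale) (use a in auto)
      ultimately have "tensor_free_smult S a (k + t x) - t (sc a x) \<in> K"
        using K_add[OF smult_K[OF k aS], of "frag_of (\<phi> x, a) - t (sc a x)"] a by (simp add: add_diff_eq)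
      then show "cl (tensor_free_smult S a (k + t x)) = cl (t (sc a x))" by (simp add: cl_eq_iff)
    qed
  qed
  show "bracket T (J x) (J y) = J (br x y)"
    unfolding T_simps J_def
  \<comment> \<open>The double union collapses in two stages: for fixed \<open>u\<close> it does not
    depend on the representative of the second coset, and then the first representative is
    varied.\<close>
  proof (rule trans[OF SUP_cong[OF refl Union_cl]])
    show "cl (tensor_free_bracket L S u (k + t y)) = cl (tensor_free_bracket L S u (t y))" if "u \<in> cl (t x)" "k \<in> K" for u k
    proof -
      obtain k' where "k' \<in> K" "u = k' + t x" using \<open>u \<in> cl (t x)\<close> unfolding cl_eq by blast
      then have "u \<in> carrier F" using F_closed(1)[OF K_F t_F] by simp
      then have "tensor_free_bracket L S u k \<in> K" using bracket_K_right \<open>k \<in> K\<close> by blast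
      moreover have "tensor_free_bracket L S u (k + t y) - tensor_free_bracket L S u (t y) = tensor_free_bracket L S u k"
        using tb_diff_right[of u "k + t y" "t y"] by simp
      ultimately show ?thesis by (simp add: cl_eq_iff)
    qed
    show "(\<Union>u\<in>cl (t x). cl (tensor_free_bracket L S u (t y))) = cl (t (br x y))"
    proof (rule Union_cl)
      fix k assume k: "k \<in> K"
      have "tensor_free_bracket L S (k + t x) (t y) - tensor_free_bracket L S (t x) (t y) = tensor_free_bracket L S k (t y)"
        using tb_diff_left[of "k + t x" "t x" "t y"] by simp
      moreover have "tensor_free_bracket L S (t x) (t y) = t (br x y)" using p_gt_1 by (simp add: t_def tb_of \<phi>_br)
      ultimately show "cl (tensor_free_bracket L S (k + t x) (t y)) = cl (t (br x y))"
        using bracket_K_left[OF k t_F] by (simp add: cl_eq_iff)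
    qed
  qed
  show "J x = J y \<longleftrightarrow> (\<exists>z. x - y = sc (int p) z)" by (rule J_eq_iff)
qed (use fin in \<open>simp_all add: sc_add sc_mult sc_dist sc_one\<close>)

end

section \<open>Counting sublattices of prime index and lines\<close>

lemma card_fibers:
  assumes "finite A" "f ` A = B" "\<And>b. b \<in> B \<Longrightarrow> card {a \<in> A. f a = b} = k"
  shows "card A = card B * k"
proof -
  have "card A = (\<Sum>b\<in>f ` A. card {a \<in> A. f a = b})"
    using sum.group[of A "f ` A" f "\<lambda>_. 1::nat"] assms(1) by simp
  then show ?thesis using assms(2,3) by simp
qed

lemma finite_range_cong:
  assumes "\<And>x y. f x = f y \<longleftrightarrow> g x = g y" "finite (range g)"
  shows "finite (range f)"
proof -
  have "range f = (\<lambda>c. f (inv_into UNIV g c)) ` range g"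
  proof -
    have "f (inv_into UNIV g (g x)) = f x" for x using assms(1)[of "inv_into UNIV g (g x)" x] f_inv_into_f[of "g x" g UNIV] by simp
    then show ?thesis by (simp add: image_image)
  qed
  then show ?thesis using assms(2) by simp
qed

text \<open>A free abelian group of rank \<open>n\<close> with a unimodular symmetric pairing,
  described by what the counting uses: functionals modulo \<open>k\<close> are pairings with vectors
  (\<open>represent\<close>), and vectors on which all of them vanish modulo \<open>k\<close> are
  multiples of \<open>k\<close> (\<open>separated\<close>). These properties pass to products, which
  yields the lattices of higher rank used below.\<close>

locale zlattice =
  fixes sc :: "int \<Rightarrow> 'v::ab_group_add \<Rightarrow> 'v" and dot :: "'v \<Rightarrow> 'v \<Rightarrow> int" and n :: nat
  assumes sc_add: "sc (a + b) x = sc a x + sc b x"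
    and sc_mult: "sc (a * b) x = sc a (sc b x)"
    and sc_dist: "sc a (x + y) = sc a x + sc a y"
    and sc_one: "sc 1 x = x"
    and dot_add: "dot x (y + z) = dot x y + dot x z"
    and dot_sc: "dot x (sc k y) = k * dot x y"
    and dot_commute: "dot x y = dot y x"
    and separated: "\<And>k x. (\<And>y. k dvd dot y x) \<Longrightarrow> \<exists>z. x = sc k z"
    and represent: "\<And>k f. (\<And>x y. [f (x + y) = f x + f y] (mod k)) \<Longrightarrow> \<exists>y. \<forall>x. [f x = dot y x] (mod k)"
    and index_multiples: "k > 0 \<Longrightarrow> finite_index (range (sc k)) \<and> index (range (sc k)) = nat k ^ n"
begin

lemma dot_add_left: "dot (x + y) z = dot x z + dot y z"
  using dot_add[of z x y] by (simp add: dot_commute)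

lemma dot_sc_left: "dot (sc k x) y = k * dot x y"
  using dot_sc[of y k x] by (simp add: dot_commute)

lemma sc_zero: "sc 0 x = 0"
  using sc_add[of 0 0 x] by simp

lemma sc_zero_right: "sc a 0 = 0"
  using sc_dist[of a 0 0] by simp

lemma sc_minus: "sc (- a) x = - sc a x"
  using sc_add[of a "- a" x] by (simp add: sc_zero minus_unique)

lemma sc_minus_right: "sc a (- x) = - sc a x"
  using sc_dist[of a x "- x"] by (simp add: sc_zero_right minus_unique)

lemma sc_diff: "sc (a - b) x = sc a x - sc b x"
  using sc_add[of a "- b" x] by (simp add: sc_minus)

lemma sc_diff_right: "sc a (x - y) = sc a x - sc a y"
  using sc_dist[of a x "- y"] by (simp add: sc_minus_right)

lemma dot_zero: "dot x 0 = 0" "dot 0 x = 0"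
  using dot_add[of x 0 0] dot_add_left[of 0 0 x] by simp_all

lemma dot_minus: "dot x (- y) = - dot x y"
  using dot_add[of x y "- y"] by (simp add: dot_zero)

lemma dot_diff: "dot x (y - z) = dot x y - dot x z"
  using dot_add[of x y "- z"] by (simp add: dot_minus)

lemma multiples_subgroup: "add_subgroup (range (sc k))"
proof (rule add_subgroupI)
  show "0 \<in> range (sc k)" by (rule range_eqI[of _ _ 0]) (simp add: sc_zero_right)
  fix x y assume "x \<in> range (sc k)" "y \<in> range (sc k)"
  then obtain a b where "x = sc k a" "y = sc k b" by blast
  then have "x - y = sc k (a - b)" by (simp add: sc_diff_right)
  then show "x - y \<in> range (sc k)" by blast
qed

lemma sc_mem:
  assumes K: "add_subgroup K" and x: "x \<in> K" shows "sc a x \<in> K"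
proof -
  have nat: "sc (int n) x \<in> K" for n
    by (induction n) (auto simp: sc_zero sc_add sc_one add_subgroup_zero[OF K] intro: add_subgroup_add[OF K] x)
  show ?thesis
  proof (cases "a \<ge> 0")
    case True
    then show ?thesis using nat[of "nat a"] by simp
  next
    case False
    then show ?thesis using add_subgroup_uminus[OF K nat[of "nat (- a)"]] by (simp add: sc_minus)
  qed
qed

end

section \<open>Hyperplanes and lines modulo a prime\<close>

locale zlattice_mod = zlattice sc dot n for sc :: "int \<Rightarrow> 'v::ab_group_add \<Rightarrow> 'v" and dot n +
  fixes p :: nat
  assumes p: "prime p"
begin

definition K0 :: "'v set" where "K0 = range (sc (int p))"

definition p_lattices :: "'v set set" where "p_lattices = {K. add_subgroup K \<and> K0 \<subseteq> K}"

definition ker :: "'v \<Rightarrow> 'v set" where "ker y = {x. int p dvd dot y x}"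

definition line :: "'v \<Rightarrow> 'v set" where "line v = {x. \<exists>c. x - sc c v \<in> K0}"

lemma p_pos: "int p > 0" using prime_gt_0_nat[OF p] by simp

lemma K0_subgroup: "add_subgroup K0" unfolding K0_def by (rule multiples_subgroup)

lemma K0_index: "finite_index K0" "index K0 = p ^ n"
  unfolding K0_def using index_multiples[OF p_pos] by auto

lemma mem_K0_iff: "x \<in> K0 \<longleftrightarrow> (\<forall>y. int p dvd dot y x)"
  unfolding K0_def using separated[of "int p" x] by (auto simp: dot_sc)

lemma sc_p_K0: "int p dvd a \<Longrightarrow> sc a x \<in> K0"
  unfolding K0_def by (auto simp: sc_mult elim!: dvdE)

lemma lattice_subgroup: "K \<in> p_lattices \<Longrightarrow> add_subgroup K"
  by (simp add: p_lattices_def)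

lemma lattice_K0: "K \<in> p_lattices \<Longrightarrow> x \<in> K0 \<Longrightarrow> x \<in> K"
  by (auto simp: p_lattices_def)

lemma lattice_index: 
  assumes "K \<in> p_lattices" shows "finite_index K" "p ^ n = index K * card (add_coset K0 ` K)"
  using index_tower[OF K0_subgroup lattice_subgroup[OF assms] _ K0_index(1)] assms K0_index(2)
  by (auto simp: p_lattices_def)

lemma inverse_mod: "\<not> int p dvd a \<Longrightarrow> \<exists>b. [a * b = 1] (mod int p)"
proof -
  assume "\<not> int p dvd a"
  moreover have "prime (int p)" using p by simp
  ultimately have "coprime (int p) a" by (rule prime_imp_coprime[rotated])
  then have "coprime a (int p)" by (simp only: coprime_commute)
  then show "\<exists>b. [a * b = 1] (mod int p)" by (rule cong_solve_coprime_int)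
qed

lemma sc_cancel:
  assumes K: "K \<in> p_lattices" and a: "\<not> int p dvd a" and x: "sc a x \<in> K" shows "x \<in> K"
proof -
  obtain b where "[a * b = 1] (mod int p)" using inverse_mod[OF a] by blast
  then have "int p dvd b * a - 1" by (simp add: cong_iff_dvd_diff mult.commute)
  then have "sc (b * a - 1) x \<in> K" using sc_p_K0 lattice_K0[OF K] by blast
  moreover have "sc b (sc a x) \<in> K" using sc_mem[OF lattice_subgroup[OF K] x] .
  ultimately have "sc b (sc a x) - sc (b * a - 1) x \<in> K" by (rule add_subgroup_diff[OF lattice_subgroup[OF K], rotated])
  then show ?thesis by (simp add: sc_diff sc_mult sc_one)
qed

lemma K0_lattice: "K0 \<in> p_lattices" by (simp add: p_lattices_def K0_subgroup)

lemma add_coset_K0_eq: "add_coset K0 x = add_coset K0 y \<longleftrightarrow> x - y \<in> K0"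
  by (rule add_coset_eq_iff[OF K0_subgroup])

lemma sc_coset_eq_iff:
  assumes "v \<notin> K0" shows "add_coset K0 (sc a v) = add_coset K0 (sc b v) \<longleftrightarrow> a mod int p = b mod int p"
proof -
  have "sc a v - sc b v \<in> K0 \<longleftrightarrow> int p dvd a - b"
    using sc_p_K0[of "a - b" v] sc_cancel[OF K0_lattice, of "a - b" v] assms by (auto simp: sc_diff[symmetric])
  then show ?thesis unfolding add_coset_K0_eq by (simp add: mod_eq_dvd_iff)
qed

lemma card_multiples:
  assumes v: "v \<notin> K0" shows "card {add_coset K0 (sc c v) | c. \<not> int p dvd c} = p - 1"
proof -
  have "{add_coset K0 (sc c v) | c. \<not> int p dvd c} = (\<lambda>c. add_coset K0 (sc c v)) ` {1..<int p}"
  proof (intro equalityI subsetI)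
    fix X assume "X \<in> {add_coset K0 (sc c v) | c. \<not> int p dvd c}"
    then obtain c where c: "X = add_coset K0 (sc c v)" "\<not> int p dvd c" by blast
    then have "X = add_coset K0 (sc (c mod int p) v)" by (simp add: sc_coset_eq_iff[OF v])
    moreover have "c mod int p \<noteq> 0" using c(2) by (simp add: dvd_eq_mod_eq_0)
    then have "c mod int p \<in> {1..<int p}" using p_pos pos_mod_bound[of "int p" c] pos_mod_sign[of "int p" c] by auto
    ultimately show "X \<in> (\<lambda>c. add_coset K0 (sc c v)) ` {1..<int p}" by blast
  next
    fix X assume "X \<in> (\<lambda>c. add_coset K0 (sc c v)) ` {1..<int p}"
    then obtain c where "X = add_coset K0 (sc c v)" "1 \<le> c" "c < int p" by auto
    then show "X \<in> {add_coset K0 (sc c v) | c. \<not> int p dvd c}" using zdvd_imp_le[of "int p" c] by auto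
  qed
  moreover have "inj_on (\<lambda>c. add_coset K0 (sc c v)) {1..<int p}"
    by (rule inj_onI) (simp add: sc_coset_eq_iff[OF v])
  ultimately show ?thesis by (simp add: card_image)
qed

lemma ker_lattice: "ker y \<in> p_lattices"
  unfolding p_lattices_def ker_def K0_def
  by (auto intro!: add_subgroupI simp: dot_zero dot_diff dot_sc)

lemma exists_dual:
  assumes "y \<notin> K0" shows "\<exists>u. [dot y u = 1] (mod int p)"
proof -
  obtain z where "\<not> int p dvd dot z y" using assms mem_K0_iff by blast
  then obtain b where "[dot z y * b = 1] (mod int p)" using inverse_mod by blast
  then have "[dot y (sc b z) = 1] (mod int p)" by (simp add: dot_sc dot_commute[of y z] mult.commute)
  then show ?thesis by blast
qed

lemma index_ker:
  assumes "y \<notin> K0" shows "index (ker y) = p"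
proof -
  obtain u where u: "[dot y u = 1] (mod int p)" using exists_dual[OF assms] by blast
  have "add_coset (ker y) x = add_coset (ker y) x' \<longleftrightarrow> dot y x mod int p = dot y x' mod int p" for x x'
    unfolding add_coset_eq_iff[OF lattice_subgroup[OF ker_lattice]] by (simp add: ker_def dot_diff mod_eq_dvd_iff)
  then have "index (ker y) = card (range (\<lambda>x. dot y x mod int p))" unfolding index_def by (rule card_range_cong)
  also have "range (\<lambda>x. dot y x mod int p) = {0..<int p}"
  proof (intro equalityI subsetI)
    fix c assume "c \<in> {0..<int p}"
    moreover have "[dot y (sc c u) = c * 1] (mod int p)" unfolding dot_sc by (intro cong_mult cong_refl u)
    ultimately have "c = dot y (sc c u) mod int p" by (simp add: cong_def)
    then show "c \<in> range (\<lambda>x. dot y x mod int p)" by blast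
  qed (use p_pos in auto)
  finally show ?thesis by simp
qed

text \<open>A subgroup of prime index is maximal, so together with any \<open>a\<close> outside it
  generates the whole lattice.\<close>

lemma index_p_cosets:
  assumes K: "K \<in> p_lattices" and ix: "index K = p" and a: "a \<notin> K"
  shows "\<exists>c. x - sc c a \<in> K"
proof -
  note sg = lattice_subgroup[OF K]
  define K' where "K' = {x. \<exists>c. x - sc c a \<in> K}"
  have K': "add_subgroup K'"
  proof (rule add_subgroupI)
    have "0 - sc 0 a \<in> K" using add_subgroup_zero[OF sg] by (simp add: sc_zero)
    then show "0 \<in> K'" unfolding K'_def by blast
    fix x y assume "x \<in> K'" "y \<in> K'"
    then obtain c d where "x - sc c a \<in> K" "y - sc d a \<in> K" unfolding K'_def by blast
    then have "(x - sc c a) - (y - sc d a) \<in> K" by (rule add_subgroup_diff[OF sg])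
    then have "(x - y) - sc (c - d) a \<in> K" by (simp add: sc_diff algebra_simps)
    then show "x - y \<in> K'" unfolding K'_def by blast
  qed
  have sub: "K \<subseteq> K'"
  proof
    fix x assume "x \<in> K" then have "x - sc 0 a \<in> K" by (simp add: sc_zero)
    then show "x \<in> K'" unfolding K'_def by blast
  qed
  have "a - sc 1 a \<in> K" using add_subgroup_zero[OF sg] by (simp add: sc_one)
  then have aK': "a \<in> K'" unfolding K'_def by blast
  note t = index_tower[OF sg K' sub lattice_index(1)[OF K]]
  have "card (add_coset K ` K') \<noteq> 1"
  proof
    assume "card (add_coset K ` K') = 1"
    then obtain C where "add_coset K ` K' = {C}" by (rule card_1_singletonE)
    then have "add_coset K a = add_coset K 0" using aK' add_subgroup_zero[OF K'] by blast
    then show False using a by (simp add: add_coset_eq_iff[OF sg])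
  qed
  moreover have "card (add_coset K ` K') dvd p" using t(2) ix by simp
  ultimately have "card (add_coset K ` K') = p" using p by (auto simp: prime_nat_iff)
  then have "index K' = 1" using t(2) ix prime_gt_0_nat[OF p] by simp
  then have "K' = UNIV" by (rule index_eq_1[OF K'])
  then show ?thesis unfolding K'_def by blast
qed

text \<open>Fix \<open>a\<close> outside \<open>K\<close>. The multiple of \<open>a\<close>
  congruent to x modulo \<open>K\<close> has a coefficient that is unique modulo \<open>p\<close>
  and additive in x; it is therefore a functional modulo \<open>p\<close>, with kernel
  \<open>K\<close>.\<close>

lemma index_p_is_ker:
  assumes K: "K \<in> p_lattices" and ix: "index K = p"
  shows "\<exists>y. y \<notin> K0 \<and> K = ker y"
proof -
  note sg = lattice_subgroup[OF K]
  have "K \<noteq> UNIV" using ix index_UNIV(1)[where 'a='v] prime_gt_1_nat[OF p] by auto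
  then obtain a where a: "a \<notin> K" by blast
  define f where "f x = (SOME c. x - sc c a \<in> K)" for x
  have f: "x - sc (f x) a \<in> K" for x unfolding f_def by (rule someI_ex) (rule index_p_cosets[OF K ix a])
  have uniq: "int p dvd c" if "sc c a \<in> K" for c using sc_cancel[OF K, of c a] a that by blast
  have "[f (x + y) = f x + f y] (mod int p)" for x y
  proof -
    have "(x - sc (f x) a) + (y - sc (f y) a) - (x + y - sc (f (x + y)) a) \<in> K"
      by (intro add_subgroup_diff[OF sg] add_subgroup_add[OF sg] f)
    then have "sc (f (x + y) - (f x + f y)) a \<in> K" by (simp add: sc_diff sc_add algebra_simps)
    then show ?thesis using uniq by (simp add: cong_iff_dvd_diff)
  qed
  then obtain y where y: "\<And>x. [f x = dot y x] (mod int p)" using represent by blast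
  have "x \<in> K \<longleftrightarrow> int p dvd dot y x" for x
  proof -
    have "x \<in> K \<longleftrightarrow> sc (f x) a \<in> K"
      using add_subgroup_add[OF sg f[of x], of "sc (f x) a"] add_subgroup_diff[OF sg _ f[of x], of x] by auto
    also have "\<dots> \<longleftrightarrow> int p dvd f x" using uniq sc_p_K0 lattice_K0[OF K] by blast
    also have "\<dots> \<longleftrightarrow> int p dvd dot y x" by (rule cong_dvd_iff[OF y])
    finally show ?thesis .
  qed
  then have K_eq: "K = ker y" by (auto simp: ker_def)
  moreover have "y \<notin> K0"
  proof
    assume "y \<in> K0"
    then have "ker y = UNIV" using mem_K0_iff[of y] by (auto simp: ker_def dot_commute)
    then show False using K_eq \<open>K \<noteq> UNIV\<close> by simp
  qed
  ultimately show ?thesis by blast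
qed

text \<open>Take u on which \<open>y\<close> has value 1. Then x - y(x) u lies in the kernel of
  \<open>y\<close>, hence in that of \<open>z\<close>, so z(x) = z(u) y(x) modulo \<open>p\<close>:
  the scalar is z(u).\<close>

lemma ker_eq_iff:
  assumes y: "y \<notin> K0" shows "z \<notin> K0 \<and> ker z = ker y \<longleftrightarrow> (\<exists>c. \<not> int p dvd c \<and> z - sc c y \<in> K0)"
proof
  assume z: "z \<notin> K0 \<and> ker z = ker y"
  obtain u where u: "[dot y u = 1] (mod int p)" using exists_dual[OF y] by blast
  let ?c = "dot z u"
  have zc: "z - sc ?c y \<in> K0" unfolding mem_K0_iff
  proof
    fix x
    have "int p dvd dot y x * (1 - dot y u)" using u by (metis cong_iff_dvd_diff cong_sym dvd_mult)
    then have "x - sc (dot y x) u \<in> ker y" by (simp add: ker_def dot_diff dot_sc right_diff_distrib)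
    then have "int p dvd dot z (x - sc (dot y x) u)" using z by (auto simp: ker_def)
    then show "int p dvd dot x (z - sc ?c y)" by (simp add: dot_diff dot_sc dot_commute[of x] mult.commute)
  qed
  moreover have "\<not> int p dvd ?c"
  proof
    assume "int p dvd ?c"
    then have "z - sc ?c y + sc ?c y \<in> K0" by (intro add_subgroup_add[OF K0_subgroup] zc sc_p_K0)
    then show False using z by simp
  qed
  ultimately show "\<exists>c. \<not> int p dvd c \<and> z - sc c y \<in> K0" by blast
next
  assume "\<exists>c. \<not> int p dvd c \<and> z - sc c y \<in> K0"
  then obtain c where c: "\<not> int p dvd c" "z - sc c y \<in> K0" by blast
  have dz: "int p dvd dot z x \<longleftrightarrow> int p dvd dot y x" for x
  proof -
    have "int p dvd dot x (z - sc c y)" using c(2) mem_K0_iff by blast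
    then have "int p dvd dot z x - c * dot y x" by (simp add: dot_diff dot_sc dot_commute[of x])
    then have "int p dvd dot z x \<longleftrightarrow> int p dvd c * dot y x" by (metis dvd_diff_right_iff dvd_diff_left_iff)
    also have "\<dots> \<longleftrightarrow> int p dvd dot y x" using c(1) p by (simp add: prime_dvd_mult_iff)
    finally show ?thesis .
  qed
  then have "ker z = ker y" by (auto simp: ker_def)
  moreover have "z \<notin> K0" using y dz by (auto simp: mem_K0_iff dot_commute)
  ultimately show "z \<notin> K0 \<and> ker z = ker y" by blast
qed

text \<open>Hyperplanes are nonzero covectors modulo \<open>p\<close> up to the p - 1 nonzero
  scalars. Covectors modulo \<open>p\<close> appear as cosets of \<open>K0\<close>, and the factor p
  - 1 stays on the left so that no division occurs.\<close>

theorem count_index_p: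
  "card {K \<in> p_lattices. index K = p \<and> P K} * (p - 1) = card (add_coset K0 ` {y. y \<notin> K0 \<and> P (ker y)})"
proof -
  define f where "f c = ker (SOME y. c = add_coset K0 y)" for c
  have f: "f (add_coset K0 y) = ker y" if "y \<notin> K0" for y
  proof -
    define z where "z = (SOME z. add_coset K0 y = add_coset K0 z)"
    have "add_coset K0 y = add_coset K0 z" unfolding z_def by (rule someI) (rule refl)
    then have "z - sc 1 y \<in> K0" using add_subgroup_uminus[OF K0_subgroup, of "y - z"] by (simp add: add_coset_K0_eq sc_one)
    moreover have "\<not> int p dvd 1" using prime_gt_1_nat[OF p] by simp
    ultimately have "ker z = ker y" using ker_eq_iff[OF that] by blast
    then show ?thesis by (simp add: f_def z_def)
  qed
  let ?A = "add_coset K0 ` {y. y \<notin> K0 \<and> P (ker y)}"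
  have "card ?A = card {K \<in> p_lattices. index K = p \<and> P K} * (p - 1)"
  proof (rule card_fibers)
    show "finite ?A" using K0_index(1) unfolding finite_index_def by (rule finite_subset[rotated]) blast
    show "f ` ?A = {K \<in> p_lattices. index K = p \<and> P K}"
    proof (intro equalityI subsetI)
      fix K assume "K \<in> f ` ?A"
      then obtain y where "y \<notin> K0" "P (ker y)" "K = ker y" using f by auto
      then show "K \<in> {K \<in> p_lattices. index K = p \<and> P K}" using ker_lattice index_ker by simp
    next
      fix K assume "K \<in> {K \<in> p_lattices. index K = p \<and> P K}"
      then have "K \<in> p_lattices" "index K = p" and PK: "P K" by simp_all
      then obtain y where "y \<notin> K0" "K = ker y" using index_p_is_ker by blast
      then have "y \<notin> K0" "K = ker y" "P (ker y)" using PK by simp_all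
      then show "K \<in> f ` ?A" using f by force
    qed
    fix K assume K: "K \<in> {K \<in> p_lattices. index K = p \<and> P K}"
    then have "K \<in> p_lattices" "index K = p" and PK: "P K" by simp_all
    then obtain y where "y \<notin> K0" "K = ker y" using index_p_is_ker by blast
    then have y: "y \<notin> K0" "K = ker y" "P (ker y)" using PK by simp_all
    have "{c \<in> ?A. f c = K} = {add_coset K0 (sc c y) | c. \<not> int p dvd c}"
    proof (intro equalityI subsetI)
      fix X assume "X \<in> {c \<in> ?A. f c = K}"
      then obtain z where z: "X = add_coset K0 z" "z \<notin> K0" "f X = K" by auto
      then have "ker z = ker y" using f y by simp
      then obtain c where "\<not> int p dvd c" "z - sc c y \<in> K0" using ker_eq_iff[OF y(1)] z(2) by blast
      then show "X \<in> {add_coset K0 (sc c y) | c. \<not> int p dvd c}" using z(1) add_coset_K0_eq by blast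
    next
      fix X assume "X \<in> {add_coset K0 (sc c y) | c. \<not> int p dvd c}"
      then obtain c where c: "X = add_coset K0 (sc c y)" "\<not> int p dvd c" by blast
      have "sc c y - sc c y \<in> K0" using add_subgroup_zero[OF K0_subgroup] by simp
      then have "sc c y \<notin> K0 \<and> ker (sc c y) = ker y" using ker_eq_iff[OF y(1)] c(2) by blast
      then show "X \<in> {c \<in> ?A. f c = K}" using c(1) f y by auto
    qed
    then show "card {c \<in> ?A. f c = K} = p - 1" using card_multiples[OF y(1)] by simp
  qed
  then show ?thesis by simp
qed

lemma line_lattice: "line v \<in> p_lattices"
  unfolding p_lattices_def
proof (intro CollectI conjI add_subgroupI subsetI)
  have "0 - sc 0 v \<in> K0" using add_subgroup_zero[OF K0_subgroup] by (simp add: sc_zero)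
  then show "0 \<in> line v" unfolding line_def by blast
  fix x y assume "x \<in> line v" "y \<in> line v"
  then obtain c d where "x - sc c v \<in> K0" "y - sc d v \<in> K0" unfolding line_def by blast
  then have "(x - sc c v) - (y - sc d v) \<in> K0" by (rule add_subgroup_diff[OF K0_subgroup])
  then have "(x - y) - sc (c - d) v \<in> K0" by (simp add: sc_diff algebra_simps)
  then show "x - y \<in> line v" unfolding line_def by blast
next
  fix x assume "x \<in> K0"
  then have "x - sc 0 v \<in> K0" by (simp add: sc_zero)
  then show "x \<in> line v" unfolding line_def by blast
qed

lemma self_in_line: "v \<in> line v"
proof -
  have "v - sc 1 v \<in> K0" using add_subgroup_zero[OF K0_subgroup] by (simp add: sc_one)
  then show ?thesis unfolding line_def by blast
qed

lemma cosets_line: "add_coset K0 ` line v = insert (add_coset K0 0) {add_coset K0 (sc c v) | c. \<not> int p dvd c}"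
proof (intro equalityI subsetI)
  fix X assume "X \<in> add_coset K0 ` line v"
  then obtain c where c: "X = add_coset K0 (sc c v)" unfolding line_def using add_coset_K0_eq by blast
  show "X \<in> insert (add_coset K0 0) {add_coset K0 (sc c v) | c. \<not> int p dvd c}"
  proof (cases "int p dvd c")
    case True
    then have "X = add_coset K0 0" using c sc_p_K0[of c v] by (simp add: add_coset_K0_eq)
    then show ?thesis by simp
  qed (use c in blast)
next
  fix X assume "X \<in> insert (add_coset K0 0) {add_coset K0 (sc c v) | c. \<not> int p dvd c}"
  then obtain w where "w \<in> line v" "X = add_coset K0 w"
    using add_subgroup_zero[OF lattice_subgroup[OF line_lattice]] sc_mem[OF lattice_subgroup[OF line_lattice] self_in_line] by blast
  then show "X \<in> add_coset K0 ` line v" by blast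
qed

lemma index_line:
  assumes v: "v \<notin> K0" shows "index (line v) * p = p ^ n"
proof -
  have "add_coset K0 0 \<notin> {add_coset K0 (sc c v) | c. \<not> int p dvd c}"
  proof
    assume "add_coset K0 0 \<in> {add_coset K0 (sc c v) | c. \<not> int p dvd c}"
    then obtain c where "add_coset K0 (sc c v) = add_coset K0 0" "\<not> int p dvd c" by auto
    then have "sc c v \<in> K0" by (simp add: add_coset_K0_eq)
    then show False using sc_cancel[OF K0_lattice] \<open>\<not> int p dvd c\<close> v by blast
  qed
  moreover have "finite {add_coset K0 (sc c v) | c. \<not> int p dvd c}"
    using K0_index(1) unfolding finite_index_def by (rule finite_subset[rotated]) blast
  ultimately have "card (add_coset K0 ` line v) = p"
    unfolding cosets_line using card_multiples[OF v] prime_gt_0_nat[OF p] by simp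
  then show ?thesis using lattice_index(2)[OF line_lattice, of v] by simp
qed

text \<open>\<open>line v\<close> is contained in \<open>K\<close> and has the same index.\<close>

lemma line_unique:
  assumes K: "K \<in> p_lattices" and ix: "index K * p = p ^ n" and v: "v \<in> K" "v \<notin> K0"
  shows "K = line v"
proof -
  have sub: "line v \<subseteq> K"
  proof
    fix x assume "x \<in> line v"
    then obtain c where "x - sc c v \<in> K0" unfolding line_def by blast
    then have "x - sc c v + sc c v \<in> K"
      by (intro add_subgroup_add[OF lattice_subgroup[OF K]] lattice_K0[OF K] sc_mem[OF lattice_subgroup[OF K]] v)
    then show "x \<in> K" by simp
  qed
  note sgl = lattice_subgroup[OF line_lattice]
  have "index (line v) = index K * card (add_coset (line v) ` K)"
    by (rule index_tower(2)[OF sgl lattice_subgroup[OF K] sub lattice_index(1)[OF line_lattice]])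
  moreover have "index (line v) = index K" using ix index_line[OF v(2)] prime_gt_0_nat[OF p] by (metis mult_right_cancel neq0_conv)
  moreover have "index K > 0" by (rule index_pos[OF lattice_index(1)[OF K]])
  ultimately have "card (add_coset (line v) ` K) = 1" by simp
  then obtain C where C: "add_coset (line v) ` K = {C}" by (rule card_1_singletonE)
  have "x \<in> line v" if "x \<in> K" for x
  proof -
    have "add_coset (line v) x = add_coset (line v) 0" using C that add_subgroup_zero[OF lattice_subgroup[OF K]] by blast
    then show ?thesis by (simp add: add_coset_eq_iff[OF sgl])
  qed
  then show ?thesis using sub by blast
qed

text \<open>The dual of \<open>count_index_p\<close>: one-dimensional subspaces are nonzero vectors
  modulo \<open>p\<close> up to scalars.\<close>

theorem count_lines:
  "card {K \<in> p_lattices. index K * p = p ^ n \<and> P K} * (p - 1) = card (add_coset K0 ` {v. v \<notin> K0 \<and> P (line v)})"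
proof -
  define f where "f c = line (SOME y. c = add_coset K0 y)" for c
  have line_eq: "line z = line y" if "z \<notin> K0" "z \<in> line y" "y \<notin> K0" for y z
    using line_unique[OF line_lattice index_line[OF that(3)] that(2,1)] by simp
  have f: "f (add_coset K0 y) = line y" if "y \<notin> K0" for y
  proof -
    define z where "z = (SOME z. add_coset K0 y = add_coset K0 z)"
    have "add_coset K0 y = add_coset K0 z" unfolding z_def by (rule someI) (rule refl)
    then have zy: "z - sc 1 y \<in> K0" using add_subgroup_uminus[OF K0_subgroup, of "y - z"] by (simp add: add_coset_K0_eq sc_one)
    then have "z \<in> line y" unfolding line_def by blast
    moreover have "z \<notin> K0"
    proof
      assume "z \<in> K0"
      then have "z - (z - sc 1 y) \<in> K0" using zy by (rule add_subgroup_diff[OF K0_subgroup])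
      then show False using that by (simp add: sc_one)
    qed
    ultimately have "line z = line y" using line_eq that by blast
    then show ?thesis by (simp add: f_def z_def)
  qed
  let ?A = "add_coset K0 ` {y. y \<notin> K0 \<and> P (line y)}"
  have "card ?A = card {K \<in> p_lattices. index K * p = p ^ n \<and> P K} * (p - 1)"
  proof (rule card_fibers)
    show "finite ?A" using K0_index(1) unfolding finite_index_def by (rule finite_subset[rotated]) blast
    have ex: "\<exists>y. y \<notin> K0 \<and> K = line y" if K: "K \<in> p_lattices" "index K * p = p ^ n" for K
    proof -
      have "K \<noteq> K0" using K0_index(2) K(2) prime_gt_1_nat[OF p] by auto
      moreover have "K0 \<subseteq> K" using K(1) by (simp add: p_lattices_def)
      ultimately obtain y where "y \<in> K" "y \<notin> K0" by blast
      then show ?thesis using line_unique[OF K] by blast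
    qed
    show "f ` ?A = {K \<in> p_lattices. index K * p = p ^ n \<and> P K}"
    proof (intro equalityI subsetI)
      fix K assume "K \<in> f ` ?A"
      then obtain y where "y \<notin> K0" "P (line y)" "K = line y" using f by auto
      then show "K \<in> {K \<in> p_lattices. index K * p = p ^ n \<and> P K}" using line_lattice index_line by simp
    next
      fix K assume "K \<in> {K \<in> p_lattices. index K * p = p ^ n \<and> P K}"
      then have "K \<in> p_lattices" "index K * p = p ^ n" and PK: "P K" by simp_all
      then obtain y where "y \<notin> K0" "K = line y" using ex by blast
      then have "y \<notin> K0" "K = line y" "P (line y)" using PK by simp_all
      then show "K \<in> f ` ?A" using f by force
    qed
    fix K assume "K \<in> {K \<in> p_lattices. index K * p = p ^ n \<and> P K}"
    then have "K \<in> p_lattices" "index K * p = p ^ n" and PK: "P K" by simp_all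
    then obtain y where "y \<notin> K0" "K = line y" using ex by blast
    then have y: "y \<notin> K0" "K = line y" "P (line y)" using PK by simp_all
    have "{c \<in> ?A. f c = K} = {add_coset K0 (sc c y) | c. \<not> int p dvd c}"
    proof (intro equalityI subsetI)
      fix X assume "X \<in> {c \<in> ?A. f c = K}"
      then obtain z where z: "X = add_coset K0 z" "z \<notin> K0" "f X = K" by auto
      then have "z \<in> line y" using f y self_in_line[of z] by simp
      then obtain c where c: "z - sc c y \<in> K0" unfolding line_def by blast
      moreover have "\<not> int p dvd c"
      proof
        assume "int p dvd c"
        then have "z - sc c y + sc c y \<in> K0" by (intro add_subgroup_add[OF K0_subgroup] c sc_p_K0)
        then show False using z by simp
      qed
      ultimately show "X \<in> {add_coset K0 (sc c y) | c. \<not> int p dvd c}" using z(1) add_coset_K0_eq by blast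
    next
      fix X assume "X \<in> {add_coset K0 (sc c y) | c. \<not> int p dvd c}"
      then obtain c where c: "X = add_coset K0 (sc c y)" "\<not> int p dvd c" by blast
      have n: "sc c y \<notin> K0" using sc_cancel[OF K0_lattice c(2)] y(1) by blast
      have "sc c y \<in> line y" by (rule sc_mem[OF lattice_subgroup[OF line_lattice] self_in_line])
      then have "line (sc c y) = line y" using line_eq n y(1) by blast
      then show "X \<in> {c \<in> ?A. f c = K}" using c(1) f y n by auto
    qed
    then show "card {c \<in> ?A. f c = K} = p - 1" using card_multiples[OF y(1)] by simp
  qed
  then show ?thesis by simp
qed

lemma card_nonzero: "card (add_coset K0 ` {y. y \<notin> K0 \<and> P y}) = card (add_coset K0 ` {y. P y}) - 1"
  if "P 0" for P
proof -
  have "add_coset K0 ` {y. P y} = insert (add_coset K0 0) (add_coset K0 ` {y. y \<notin> K0 \<and> P y})"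
  proof (intro equalityI subsetI)
    fix X assume "X \<in> add_coset K0 ` {y. P y}"
    then obtain y where y: "P y" "X = add_coset K0 y" by blast
    show "X \<in> insert (add_coset K0 0) (add_coset K0 ` {y. y \<notin> K0 \<and> P y})"
    proof (cases "y \<in> K0")
      case True
      then have "add_coset K0 y = add_coset K0 0" by (simp add: add_coset_K0_eq)
      then show ?thesis using y by simp
    qed (use y in blast)
  qed (use that in blast)
  moreover have "add_coset K0 0 \<notin> add_coset K0 ` {y. y \<notin> K0 \<and> P y}"
  proof
    assume "add_coset K0 0 \<in> add_coset K0 ` {y. y \<notin> K0 \<and> P y}"
    then obtain y where "y \<notin> K0" "add_coset K0 y = add_coset K0 0" by auto
    then show False by (simp add: add_coset_K0_eq)
  qed
  moreover have "finite (add_coset K0 ` {y. y \<notin> K0 \<and> P y})"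
    using K0_index(1) unfolding finite_index_def by (rule finite_subset[rotated]) blast
  ultimately show ?thesis by simp
qed

text \<open>The quotient by an ideal of index \<open>p\<close> is spanned by the class of one
  element, whose bracket with itself vanishes. So the quotient is abelian and the ideal contains all
  brackets.\<close>

lemma ideal_index_p:
  assumes K: "K \<in> p_lattices" "index K = p"
    and br: "\<And>x y z. br (x + y) z = br x z + br y z" "\<And>x y z. br x (y + z) = br x y + br x z"
      "\<And>k x y. br (sc k x) y = sc k (br x y)" "\<And>k x y. br x (sc k y) = sc k (br x y)" "\<And>x. br x x = 0"
  shows "star_closed Ideals br K \<longleftrightarrow> (\<forall>x y. br x y \<in> K)"
proof
  assume *: "star_closed Ideals br K"
  note sg = lattice_subgroup[OF K(1)]
  have anti: "br x y = - br y x" for x y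
  proof -
    have "br (x + y) (x + y) = br x x + br y x + (br x y + br y y)" by (simp only: br(1) br(2))
    then have "br y x + br x y = 0" by (simp add: br(5))
    then have "br x y + br y x = 0" by (simp only: add.commute)
    then show ?thesis by (simp add: eq_neg_iff_add_eq_0)
  qed
  have right: "br x y \<in> K" if "y \<in> K" for x y using * that by simp
  have left: "br x y \<in> K" if "x \<in> K" for x y unfolding anti[of x y] by (intro add_subgroup_uminus[OF sg] right that)
  show "\<forall>x y. br x y \<in> K"
  proof (intro allI)
    fix x y
    have "K \<noteq> UNIV" using K(2) index_UNIV(1)[where 'a='v] prime_gt_1_nat[OF p] by auto
    then obtain a where a: "a \<notin> K" by blast
    obtain c d where c: "x - sc c a \<in> K" and d: "y - sc d a \<in> K" using index_p_cosets[OF K a] by blast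
    have "br x y = br ((x - sc c a) + sc c a) ((y - sc d a) + sc d a)" by simp
    also have "\<dots> = br (x - sc c a) ((y - sc d a) + sc d a) + br (sc c a) (y - sc d a)"
      unfolding br(1,2,3,4,5) by (simp add: sc_zero_right)
    also have "\<dots> \<in> K" by (intro add_subgroup_add[OF sg] left c right d)
    finally show "br x y \<in> K" .
  qed
qed simp

end

section \<open>Standard lattices in rank zero, in rank one, and as products\<close>

lemma zlattice_num1: "zlattice (\<lambda>_ (x::num1). x) (\<lambda>_ _. 0) 0" (is "zlattice ?sc _ _")
proof
  have sg: "add_subgroup (UNIV :: num1 set)" by (rule add_subgroupI) auto
  fix k :: int
  have eq: "range (?sc k) = UNIV" by simp
  show "0 < k \<Longrightarrow> finite_index (range (?sc k)) \<and> index (range (?sc k)) = nat k ^ 0"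
    unfolding eq index_UNIV(1) power_0 by (intro conjI refl index_UNIV(2))
next
  fix k :: int and f :: "num1 \<Rightarrow> int" assume f: "\<And>x y. [f (x + y) = f x + f y] (mod k)"
  have "[f 1 = f 1 + f 1] (mod k)" using f[of 1 1] unfolding num1_eqI[of "1 + 1" 1] .
  then show "\<exists>y::num1. \<forall>x. [f x = 0] (mod k)" by (simp add: cong_iff_dvd_diff)
qed (simp_all add: num1_eq_iff)

lemma zlattice_int: "zlattice (*) (*) 1"
proof
  fix k :: int and f :: "int \<Rightarrow> int" assume f: "\<And>x y. [f (x + y) = f x + f y] (mod k)"
  have f0: "[f 0 = 0] (mod k)" using f[of 0 0] by (simp add: cong_iff_dvd_diff)
  have nat: "[f (int m) = f 1 * int m] (mod k)" for m
  proof (induction m)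
    case (Suc m)
    have "[f (int m + 1) = f 1 * int m + f 1] (mod k)" by (rule cong_trans[OF f cong_add[OF Suc cong_refl]])
    then show ?case by (simp add: algebra_simps)
  qed (use f0 in simp)
  have "[f x = f 1 * x] (mod k)" for x
  proof (cases "x \<ge> 0")
    case True
    then show ?thesis using nat[of "nat x"] by simp
  next
    case False
    have "[0 = f x + f (- x)] (mod k)" using cong_trans[OF cong_sym[OF f0] , of "f x + f (- x)"] f[of x "- x"] by simp
    moreover have "[f x + f (- x) = f x + f 1 * (- x)] (mod k)"
      using nat[of "nat (- x)"] False by (intro cong_add) auto
    ultimately have "[0 = f x + f 1 * (- x)] (mod k)" by (rule cong_trans)
    then show ?thesis by (simp add: cong_iff_dvd_diff dvd_diff_commute)
  qed
  then show "\<exists>y. \<forall>x. [f x = y * x] (mod k)" by blast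
next
  fix k :: int assume k: "k > 0"
  have sg: "add_subgroup (range ((*) k))"
    by (rule add_subgroupI) (auto simp: right_diff_distrib[symmetric])
  have "add_coset (range ((*) k)) x = add_coset (range ((*) k)) y \<longleftrightarrow> x mod k = y mod k" for x y
    unfolding add_coset_eq_iff[OF sg] mod_eq_dvd_iff by (auto simp: dvd_def)
  note * = this
  have r: "range (\<lambda>x. x mod k) = {0..<k}"
  proof (intro equalityI subsetI)
    fix c assume "c \<in> {0..<k}"
    then show "c \<in> range (\<lambda>x. x mod k)" by (intro range_eqI[of _ _ c]) simp
  qed (use k in auto)
  show "finite_index (range ((*) k)) \<and> index (range ((*) k)) = nat k ^ 1"
    unfolding finite_index_def index_def
    using finite_range_cong[of "add_coset (range ((*) k))" "\<lambda>x. x mod k", OF *] card_range_cong[of "add_coset (range ((*) k))" "\<lambda>x. x mod k", OF *]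
    by (simp add: r)
next
  fix k x :: int assume "\<And>y. k dvd y * x"
  from this[of 1] show "\<exists>z. x = k * z" by (auto simp: dvd_def)
qed (simp_all add: algebra_simps)

definition prod_sc :: "(int \<Rightarrow> 'u \<Rightarrow> 'u) \<Rightarrow> (int \<Rightarrow> 'v \<Rightarrow> 'v) \<Rightarrow> int \<Rightarrow> 'u \<times> 'v \<Rightarrow> 'u \<times> 'v" where
  "prod_sc s t k x = (s k (fst x), t k (snd x))"

definition prod_dot :: "('u \<Rightarrow> 'u \<Rightarrow> int) \<Rightarrow> ('v \<Rightarrow> 'v \<Rightarrow> int) \<Rightarrow> 'u \<times> 'v \<Rightarrow> 'u \<times> 'v \<Rightarrow> int" where
  "prod_dot d e x y = d (fst x) (fst y) + e (snd x) (snd y)"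

lemma range_prod_sc: "range (prod_sc s t k) = range (s k) \<times> range (t k)"
proof (intro equalityI subsetI)
  fix x assume "x \<in> range (s k) \<times> range (t k)"
  then obtain a b where "x = (s k a, t k b)" by blast
  then have "x = prod_sc s t k (a, b)" by (simp add: prod_sc_def)
  then show "x \<in> range (prod_sc s t k)" by blast
qed (auto simp: prod_sc_def)

lemma card_coset_prod:
  assumes A: "add_subgroup A" and B: "add_subgroup B"
  shows "card (add_coset (A \<times> B) ` (X \<times> Y)) = card (add_coset A ` X) * card (add_coset B ` Y)"
    and "finite_index A \<Longrightarrow> finite_index B \<Longrightarrow> finite_index (A \<times> B)"
proof -
  have "add_subgroup (A \<times> B)"
    using A B by (auto intro!: add_subgroupI simp: add_subgroup_zero add_subgroup_diff zero_prod_def)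
  then have eq: "add_coset (A \<times> B) x = add_coset (A \<times> B) y \<longleftrightarrow>
      (add_coset A (fst x), add_coset B (snd x)) = (add_coset A (fst y), add_coset B (snd y))" for x y
    by (simp add: add_coset_eq_iff A B mem_Times_iff)
  define h where "h C = (let x = (SOME x. C = add_coset (A \<times> B) x) in (add_coset A (fst x), add_coset B (snd x)))" for C
  have h: "h (add_coset (A \<times> B) x) = (add_coset A (fst x), add_coset B (snd x))" for x
  proof -
    have "add_coset (A \<times> B) x = add_coset (A \<times> B) (SOME y. add_coset (A \<times> B) x = add_coset (A \<times> B) y)"
      by (rule someI) (rule refl)
    then show ?thesis unfolding h_def Let_def eq by simp
  qed
  have inj: "inj_on h (range (add_coset (A \<times> B)))"
  proof (rule inj_onI)
    fix C D assume "C \<in> range (add_coset (A \<times> B))" "D \<in> range (add_coset (A \<times> B))" and CD: "h C = h D"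
    then obtain x y where C: "C = add_coset (A \<times> B) x" and D: "D = add_coset (A \<times> B) y" by blast
    show "C = D" using CD unfolding C D h eq .
  qed
  have img: "h ` add_coset (A \<times> B) ` (X \<times> Y) = (add_coset A ` X) \<times> (add_coset B ` Y)" for X Y
    unfolding image_image h by force
  have "card (h ` add_coset (A \<times> B) ` (X \<times> Y)) = card (add_coset (A \<times> B) ` (X \<times> Y))"
    by (rule card_image, rule inj_on_subset[OF inj]) blast
  then show "card (add_coset (A \<times> B) ` (X \<times> Y)) = card (add_coset A ` X) * card (add_coset B ` Y)"
    unfolding img card_cartesian_product by simp
  assume "finite_index A" "finite_index B"
  then have "finite (h ` range (add_coset (A \<times> B)))"
    using img[of UNIV UNIV] by (simp add: finite_index_def)
  then show "finite_index (A \<times> B)" unfolding finite_index_def using inj by (rule finite_imageD)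
qed

lemma zlattice_prod:
  fixes s :: "int \<Rightarrow> 'a::ab_group_add \<Rightarrow> 'a" and t :: "int \<Rightarrow> 'b::ab_group_add \<Rightarrow> 'b"
  assumes "zlattice s d n" "zlattice t e m"
  shows "zlattice (prod_sc s t) (prod_dot d e) (n + m)"
proof -
  interpret U: zlattice s d n by fact
  interpret V: zlattice t e m by fact
  show ?thesis
  proof
    fix k :: int and x assume *: "\<And>y. k dvd prod_dot d e y x"
    have "k dvd d y (fst x)" for y using *[of "(y, 0)"] by (simp add: prod_dot_def V.dot_zero)
    then obtain a where a: "fst x = s k a" using U.separated by blast
    have "k dvd e y (snd x)" for y using *[of "(0, y)"] by (simp add: prod_dot_def U.dot_zero)
    then obtain b where b: "snd x = t k b" using V.separated by blast
    have "x = prod_sc s t k (a, b)" by (simp add: prod_sc_def a[symmetric] b[symmetric])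
    then show "\<exists>z. x = prod_sc s t k z" by blast
  next
    fix k :: int and f :: "'a \<times> 'b \<Rightarrow> int" assume f: "\<And>x y. [f (x + y) = f x + f y] (mod k)"
    have "[f (x + y, 0) = f (x, 0) + f (y, 0)] (mod k)" for x y using f[of "(x, 0)" "(y, 0)"] by simp
    then obtain a where a: "\<And>x. [f (x, 0) = d a x] (mod k)" using U.represent[of "\<lambda>x. f (x, 0)"] by blast
    have "[f (0, x + y) = f (0, x) + f (0, y)] (mod k)" for x y using f[of "(0, x)" "(0, y)"] by simp
    then obtain b where b: "\<And>x. [f (0, x) = e b x] (mod k)" using V.represent[of "\<lambda>x. f (0, x)"] by blast
    have "[f x = prod_dot d e (a, b) x] (mod k)" for x
      using cong_trans[OF f[of "(fst x, 0)" "(0, snd x)"] cong_add[OF a[of "fst x"] b[of "snd x"]]] by (simp add: prod_dot_def)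
    then show "\<exists>y. \<forall>x. [f x = prod_dot d e y x] (mod k)" by blast
  next
    fix k :: int assume k: "k > 0"
    show "finite_index (range (prod_sc s t k)) \<and> index (range (prod_sc s t k)) = nat k ^ (n + m)"
      using card_coset_prod(1)[OF U.multiples_subgroup[of k] V.multiples_subgroup[of k], of UNIV UNIV]
        card_coset_prod(2)[OF U.multiples_subgroup[of k] V.multiples_subgroup[of k]]
        U.index_multiples[OF k] V.index_multiples[OF k]
      unfolding UNIV_Times_UNIV range_prod_sc index_def power_add by simp
  qed (auto simp: prod_sc_def prod_dot_def U.sc_add U.sc_mult U.sc_dist U.sc_one U.dot_add U.dot_sc V.sc_add V.sc_mult V.sc_dist V.sc_one V.dot_add V.dot_sc
      algebra_simps U.dot_commute V.dot_commute)
qed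

text \<open>The count freed from the tensor product: it refers only to the bracket in coordinates,
  and index p^i stands for codimension i.\<close>

definition count_lattices :: "substructure \<Rightarrow> (int \<Rightarrow> 'v::ab_group_add \<Rightarrow> 'v) \<Rightarrow> ('v \<Rightarrow> 'v \<Rightarrow> 'v) \<Rightarrow> nat \<Rightarrow> nat \<Rightarrow> nat" where
  "count_lattices star sc br p i =
     card {K. add_subgroup K \<and> range (sc (int p)) \<subseteq> K \<and> star_closed star br K \<and> index K = p ^ i}"

lemma card_image_cong_iff:
  assumes "\<And>x y. f x = f y \<longleftrightarrow> g x = g y"
  shows "card (f ` A) = card (g ` A)"
proof -
  define h where "h c = f (SOME x. c = g x)" for c
  have h: "h (g x) = f x" for x
  proof -
    have "g x = g (SOME y. g x = g y)" by (rule someI) (rule refl)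
    then show ?thesis unfolding h_def using assms by metis
  qed
  have "inj_on h (g ` A)" by (rule inj_onI) (auto simp: h assms)
  then have "card (h ` g ` A) = card (g ` A)" by (rule card_image)
  then show ?thesis by (simp add: image_image h)
qed

lemma fp_model_count:
  assumes fp: "fp_model p T J sc br" and z: "zlattice sc dot n" and i: "i \<le> n"
  shows "count_codim star (residue_ring (int p)) T i = count_lattices star sc br p i"
proof -
  interpret fp_model p T J sc br by fact
  interpret Z: zlattice_mod sc dot n p by (intro zlattice_mod.intro z zlattice_mod_axioms.intro p)
  have J_iff: "J x = J y \<longleftrightarrow> add_coset Z.K0 x = add_coset Z.K0 y" for x y
    unfolding kernel_J Z.add_coset_K0_eq by (auto simp: Z.K0_def)
  have card_J: "card (J ` A) = card (add_coset Z.K0 ` A)" for A by (rule card_image_cong_iff[OF J_iff])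
  have top: "card (range J) = p ^ n" unfolding card_J using Z.K0_index(2) by (simp add: index_def)
  have lat: "K \<in> lattices \<longleftrightarrow> K \<in> Z.p_lattices" for K
    by (auto simp: lattices_def Z.p_lattices_def Z.K0_def)
  have "card (J ` K) * p ^ i = card (range J) \<longleftrightarrow> index K = p ^ i" if "K \<in> Z.p_lattices" for K
  proof -
    have *: "p ^ n = index K * card (J ` K)" unfolding card_J by (rule Z.lattice_index(2)[OF that])
    then have "card (J ` K) \<noteq> 0" using prime_gt_0_nat[OF p] by (metis mult_0_right power_not_zero less_irrefl)
    then show ?thesis unfolding top * by (auto simp: mult.commute)
  qed
  then have "{K \<in> lattices. star_closed star br K \<and> card (J ` K) * p ^ i = card (range J)} =
      {K. add_subgroup K \<and> range (sc (int p)) \<subseteq> K \<and> star_closed star br K \<and> index K = p ^ i}"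
    unfolding lat by (auto simp: Z.p_lattices_def Z.K0_def)
  then show ?thesis unfolding count_codim_eq count_lattices_def by simp
qed

locale lie_coords_lattice = lie_coords L \<phi> sc br + Z: zlattice sc dot n
  for L :: "(int, 'b, 'm) lie_alg_scheme" and \<phi> :: "'v::ab_group_add \<Rightarrow> 'b" and sc br dot n
begin

lemma fp_model:
  assumes p: "prime p" 
  shows "\<exists>J. fp_model p (lie_tensor L (residue_ring (int p))) J sc br"
proof -
  interpret lie_coords_mod L \<phi> sc br p by standard fact
  interpret Zp: zlattice_mod sc dot n p by standard fact
  have "J x = J y \<longleftrightarrow> add_coset Zp.K0 x = add_coset Zp.K0 y" for x y
    unfolding J_eq_iff Zp.add_coset_K0_eq by (auto simp: Zp.K0_def)
  then have "finite (range J)" 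
    by (rule finite_range_cong) (use Zp.K0_index(1) in \<open>simp add: finite_index_def\<close>)
  then show ?thesis using fp_model by blast
qed

lemma count_codim_eq:
  assumes "prime p" "i \<le> n"
  shows "count_codim star (residue_ring (int p)) (lie_tensor L (residue_ring (int p))) i = count_lattices star sc br p i"
  using fp_model[OF assms(1)] fp_model_count[OF _ Z.zlattice_axioms assms(2)] by blast

end

text \<open>\<open>M\<close> embeds a sublattice of finite index, with inverse A / d. For
  \<open>p\<close> prime to \<open>d\<close> it is bijective modulo \<open>p\<close>, so the model
  can be pulled back along it; \<open>br'\<close> is the bracket of the sublattice in its own
  coordinates.\<close>

lemma fp_model_change:
  assumes fp: "fp_model p T J sc br" and z: "zlattice sc dot n"
    and M: "\<And>x y. M (x + y) = M x + M y" "\<And>k x. M (sc k x) = sc k (M x)"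
    and A: "\<And>x y. A (x + y) = A x + A y" "\<And>k x. A (sc k x) = sc k (A x)"
    and MA: "\<And>x. M (A x) = sc d x" "\<And>x. A (M x) = sc d x" and d: "\<not> int p dvd d"
    and br: "\<And>x y. M (br' x y) = br (M x) (M y)"
  shows "fp_model p T (J \<circ> M) sc br'"
proof -
  interpret fp_model p T J sc br by fact
  interpret Z: zlattice_mod sc dot n p by (intro zlattice_mod.intro z zlattice_mod_axioms.intro p)
  have M0: "M 0 = 0" using M(1)[of 0 0] by simp
  have diff: "M (x - y) = M x - M y" for x y using M(1)[of "x - y" y] by simp
  have MK: "M x \<in> Z.K0 \<longleftrightarrow> x \<in> Z.K0" for x
  proof
    assume "M x \<in> Z.K0"
    then obtain y where "M x = sc (int p) y" unfolding Z.K0_def by blast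
    then have "sc d x = sc (int p) (A y)" using MA(2)[of x] A(2) by simp
    then show "x \<in> Z.K0" using Z.sc_cancel[OF Z.K0_lattice d, of x] unfolding Z.K0_def by blast
  qed (auto simp: Z.K0_def M)
  obtain b where b: "[d * b = 1] (mod int p)" using Z.inverse_mod[OF d] by blast
  have ker: "J x = J y \<longleftrightarrow> x - y \<in> Z.K0" for x y unfolding kernel_J Z.K0_def by blast
  have surj: "\<exists>x. J y = J (M x)" for y
  proof -
    have "y - M (sc b (A y)) = sc (1 - b * d) y" by (simp add: M MA Z.sc_diff sc_mult sc_one)
    moreover have "int p dvd 1 - b * d" using b by (simp add: cong_iff_dvd_diff dvd_diff_commute mult.commute)
    ultimately show ?thesis unfolding ker using Z.sc_p_K0 by metis
  qed
  have range: "range (J \<circ> M) = range J" using surj by (auto simp: image_iff)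
  show ?thesis
  proof
    fix x y
    show "(J \<circ> M) x = (J \<circ> M) y \<longleftrightarrow> (\<exists>z. x - y = sc (int p) z)"
      using MK[of "x - y"] by (auto simp: ker diff Z.K0_def)
    show "bracket T ((J \<circ> M) x) ((J \<circ> M) y) = (J \<circ> M) (br' x y)" by (simp add: bracket_T br)
    show "a \<odot>\<^bsub>T\<^esub> (J \<circ> M) x = (J \<circ> M) (sc a x)" if "a \<in> {0..<int p}" for a using smult_T[OF that] by (simp add: M)
  qed (use range finite_T in \<open>simp_all add: p carrier_T zero_T add_T M M0 sc_add sc_mult sc_dist sc_one\<close>)
qed

lemma count_lattices_change:
  assumes fp: "\<exists>J. fp_model p T J sc br" and z: "zlattice sc dot n"
    and M: "\<And>x y. M (x + y) = M x + M y" "\<And>k x. M (sc k x) = sc k (M x)"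
    and A: "\<And>x y. A (x + y) = A x + A y" "\<And>k x. A (sc k x) = sc k (A x)"
    and MA: "\<And>x. M (A x) = sc d x" "\<And>x. A (M x) = sc d x" and d: "\<not> int p dvd d"
    and br: "\<And>x y. M (br' x y) = br (M x) (M y)" and i: "i \<le> n"
  shows "count_lattices star sc br p i = count_lattices star sc br' p i"
proof -
  obtain J where J: "fp_model p T J sc br" using fp by blast
  show ?thesis
    using fp_model_count[OF J z i, of star] fp_model_count[OF fp_model_change[where J=J and M=M and A=A and d=d and br=br and br'=br' and sc=sc and dot=dot, OF J z M A MA d br] z i, of star] by simp
qed

context zlattice_mod
begin

lemma count_lattices_0: "count_lattices star sc br p 0 = 1"
proof -
  have "{K. add_subgroup K \<and> range (sc (int p)) \<subseteq> K \<and> star_closed star br K \<and> index K = p ^ 0} = {UNIV}"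
    using index_eq_1 index_UNIV(1)[where 'a='v] by (cases star) (auto simp: add_subgroup_def)
  then show ?thesis by (simp add: count_lattices_def)
qed

lemma count_lattices_top:
  assumes br: "\<And>k x y. br x (sc k y) = sc k (br x y)"
  shows "count_lattices star sc br p n = 1"
proof -
  have "K = K0" if K: "K \<in> p_lattices" "index K = p ^ n" for K
  proof -
    have "card (add_coset K0 ` K) = 1" using lattice_index(2)[OF K(1)] K(2) prime_gt_0_nat[OF p] by simp
    then obtain C where C: "add_coset K0 ` K = {C}" by (rule card_1_singletonE)
    have "x \<in> K0" if "x \<in> K" for x
    proof -
      have "add_coset K0 x = add_coset K0 0" using C that add_subgroup_zero[OF lattice_subgroup[OF K(1)]] by blast
      then show ?thesis by (simp add: add_coset_K0_eq)
    qed
    then show ?thesis using K(1) by (auto simp: p_lattices_def)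
  qed
  moreover have "star_closed star br K0" by (cases star) (auto simp: K0_def br)
  ultimately have "{K. add_subgroup K \<and> range (sc (int p)) \<subseteq> K \<and> star_closed star br K \<and> index K = p ^ n} = {K0}"
    using K0_subgroup K0_index(2) by (auto simp: p_lattices_def K0_def)
  then show ?thesis by (simp add: count_lattices_def)
qed

lemma count_lattices_eq: "count_lattices star sc br p i = card {K \<in> p_lattices. index K = p ^ i \<and> star_closed star br K}"
  unfolding count_lattices_def p_lattices_def K0_def by (rule arg_cong[where f=card]) auto

end

section \<open>Counting functions that are polynomial on residue classes\<close>

text \<open>Only large primes are constrained. The finitely many exceptions are absorbed afterwards
  by a modulus that isolates each of them in its own residue class.\<close>

definition porc_count :: "(nat \<Rightarrow> nat) \<Rightarrow> bool" where
  "porc_count f \<longleftrightarrow> (\<exists>N>0. \<exists>P. \<exists>w :: nat \<Rightarrow> rat poly. \<forall>p>P. prime p \<longrightarrow> of_nat (f p) = poly (w (p mod N)) (of_nat p))"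

lemma porc_count_poly:
  fixes q :: "rat poly"
  assumes "\<And>p. prime p \<Longrightarrow> p > P \<Longrightarrow> of_nat (f p) = poly q (of_nat p)"
  shows "porc_count f"
proof -
  define w :: "nat \<Rightarrow> rat poly" where "w = (\<lambda>_. q)"
  have w: "\<forall>p>P. prime p \<longrightarrow> of_nat (f p) = poly (w (p mod 1)) (of_nat p)" using assms by (simp add: w_def)
  show ?thesis unfolding porc_count_def by (rule exI, rule conjI[OF zero_less_one], rule exI, rule exI, rule w)
qed

lemma porc_count_cong:
  assumes "porc_count g" "\<And>p. prime p \<Longrightarrow> p > P \<Longrightarrow> f p = g p"
  shows "porc_count f"
proof -
  obtain N Q w where N: "N > 0" and w: "\<forall>p>Q. prime p \<longrightarrow> of_nat (g p) = poly (w (p mod N) :: rat poly) (of_nat p)"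
    using assms(1) unfolding porc_count_def by blast
  show ?thesis unfolding porc_count_def
    by (intro exI[of _ N] conjI N exI[of _ "max P Q"] exI[of _ w]) (use w assms(2) in auto)
qed

lemma porc_count_Legendre:
  assumes D: "D \<noteq> 0" and f: "porc_count f" and g: "porc_count g"
  shows "porc_count (\<lambda>p. if Legendre D p = 1 then f p else g p)"
proof -
  obtain N where N: "N > 0" and per: "\<And>p q::nat. prime p \<Longrightarrow> 2 < p \<Longrightarrow> \<not> int p dvd D \<Longrightarrow> prime q \<Longrightarrow> 2 < q \<Longrightarrow>
      \<not> int q dvd D \<Longrightarrow> [p = q] (mod N) \<Longrightarrow> Legendre D p = Legendre D q"
    using Legendre_periodic[OF D] by blast
  obtain N1 P1 w1 where N1: "N1 > 0" and w1: "\<And>p. p > P1 \<Longrightarrow> prime p \<Longrightarrow> of_nat (f p) = poly (w1 (p mod N1) :: rat poly) (of_nat p)"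
    using f unfolding porc_count_def by blast
  obtain N2 P2 w2 where N2: "N2 > 0" and w2: "\<And>p. p > P2 \<Longrightarrow> prime p \<Longrightarrow> of_nat (g p) = poly (w2 (p mod N2) :: rat poly) (of_nat p)"
    using g unfolding porc_count_def by blast
  define P where "P = P1 + P2 + 2 + nat \<bar>D\<bar>"
  define N' where "N' = N * N1 * N2"
  have mods: "p mod N' mod N = p mod N" "p mod N' mod N1 = p mod N1" "p mod N' mod N2 = p mod N2" for p
    by (simp_all add: N'_def mod_mod_cancel)
  have ndvd: "\<not> int p dvd D" if "p > P" for p
    using D dvd_imp_le_int[of D "int p"] that by (auto simp: P_def)
  \<comment> \<open>A class gets the polynomial of \<open>f\<close> if some large prime in it has
    symbol 1. By periodicity all large primes of the class then have symbol 1, so the choice is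
    consistent.\<close>
  define w where "w i = (if \<exists>q>P. prime q \<and> q mod N' = i \<and> Legendre D q = 1 then w1 (i mod N1) else w2 (i mod N2))" for i
  have "of_nat (if Legendre D p = 1 then f p else g p) = poly (w (p mod N')) (of_nat p)" if p: "p > P" "prime p" for p
  proof (cases "Legendre D p = 1")
    case True
    then show ?thesis using p w1[of p] unfolding w_def mods by (auto simp: P_def)
  next
    case False
    have "\<not> (\<exists>q>P. prime q \<and> q mod N' = p mod N' \<and> Legendre D q = 1)"
    proof
      assume "\<exists>q>P. prime q \<and> q mod N' = p mod N' \<and> Legendre D q = 1"
      then obtain q where q: "q > P" "prime q" "q mod N' = p mod N'" "Legendre D q = 1" by blast
      have "[p = q] (mod N)" using q(3) mods(1) unfolding cong_def by metis
      moreover have "2 < p" "2 < q" using p q by (simp_all add: P_def)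
      ultimately have "Legendre D p = Legendre D q" using per p q ndvd by blast
      then show False using q(4) False by simp
    qed
    then have "w (p mod N') = w2 (p mod N2)" unfolding w_def mods by (rule if_not_P)
    then show ?thesis using p w2[of p] False by (simp add: P_def)
  qed
  then show ?thesis unfolding porc_count_def using N N1 N2
    by (intro exI[of _ N'] conjI exI[of _ P] exI[of _ w]) (auto simp: N'_def)
qed

section \<open>From counts to the zeta function and back\<close>

lemma poly_map_of_rat: "poly (map_poly of_rat q) (of_nat m :: complex) = of_rat (poly q (of_nat m))"
  by (induction q) (simp_all add: map_poly_pCons of_rat_add of_rat_mult)

lemma poly_eq_sum:
  fixes q :: "'a::comm_ring_1 poly"
  assumes "degree q \<le> n" shows "poly q x = (\<Sum>i\<le>n. coeff q i * x ^ i)"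
proof -
  have "(\<Sum>i\<le>n. coeff q i * x ^ i) = (\<Sum>i\<le>degree q. coeff q i * x ^ i)"
    by (rule sum.mono_neutral_right) (use assms in \<open>auto simp: coeff_eq_0\<close>)
  then show ?thesis by (simp add: poly_altdef)
qed

lemma zeta_Fp_eq:
  assumes p: "prime p"
  shows "zeta_Fp star L p s = (\<Sum>i\<le>module_rank \<Z> L.
    of_nat (count_codim star (residue_ring (int p)) (lie_tensor L (residue_ring (int p))) i) * (of_nat p powr (- s)) ^ i)"
proof -
  have "of_nat p powr (- (of_nat i * s)) = (of_nat p powr (- s) :: complex) ^ i" for i
    using prime_gt_0_nat[OF p] by (simp add: powr_def mult.assoc flip: exp_of_nat_mult) 
  then show ?thesis by (simp add: zeta_Fp_def)
qed

theorem PORC_I: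
  fixes L :: "(int, 'b, 'm) lie_alg_scheme"
  assumes count: "\<And>i. i \<le> module_rank \<Z> L \<Longrightarrow>
    porc_count (\<lambda>p. count_codim star (residue_ring (int p)) (lie_tensor L (residue_ring (int p))) i)"
  shows "PORC star L"
proof -
  define c where "c i p = count_codim star (residue_ring (int p)) (lie_tensor L (residue_ring (int p))) i" for i and p :: nat
  let ?n = "module_rank \<Z> L"
  have "\<exists>N P w. N > 0 \<and> (\<forall>p>P. prime p \<longrightarrow> of_nat (c i p) = poly (w (p mod N) :: rat poly) (of_nat p))" if "i \<le> ?n" for i
    using count[OF that] unfolding porc_count_def c_def by blast
  then obtain M Q w where M: "\<And>i. i \<le> ?n \<Longrightarrow> M i > (0::nat)" 
    and w: "\<And>i p. i \<le> ?n \<Longrightarrow> p > Q i \<Longrightarrow> prime p \<Longrightarrow> of_nat (c i p) = poly (w i (p mod M i) :: rat poly) (of_nat p)"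
    by metis
  define P where "P = (\<Sum>i\<le>?n. Q i)"
  have QP: "Q i \<le> P" if "i \<le> ?n" for i unfolding P_def by (rule member_le_sum) (use that in auto)
  \<comment> \<open>The factorial makes every prime up to \<open>P\<close> a divisor of
    \<open>N\<close> and hence the only prime in its residue class, where a constant polynomial can
    prescribe its count. It also makes \<open>N\<close> exceed \<open>P\<close>.\<close>
  define N where "N = (\<Prod>i\<le>?n. M i) * fact (Suc P)"
  have N: "N > 0" unfolding N_def using M by (auto intro!: prod_pos)
  have MN: "M i dvd N" if "i \<le> ?n" for i unfolding N_def by (rule dvd_mult2, rule dvd_prodI) (use that in auto)
  have PN: "P < N"
  proof -
    have "P < Suc P" by simp
    also have "Suc P \<le> fact (Suc P)" by (rule fact_ge_self)
    also have "fact (Suc P) \<le> N" by (rule dvd_imp_le[OF _ N]) (simp add: N_def)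
    finally show ?thesis .
  qed
  define W where "W i = (\<Sum>j\<le>?n. monom (if prime i \<and> i \<le> P then [:of_nat (c j i):] else w j (i mod M j)) j)" for i
  have coeff_W: "coeff (W i) j = (if prime i \<and> i \<le> P then [:of_nat (c j i):] else w j (i mod M j))" if "j \<le> ?n" for i j
    unfolding W_def using that by (simp add: coeff_sum)
  have deg_W: "degree (W i) \<le> ?n" for i
    unfolding W_def by (intro degree_sum_le) (auto intro: order.trans[OF degree_monom_le])
  have "zeta_Fp star L p s = eval_XY (W i) (of_nat p) (of_nat p powr (- s))"
    if p: "prime p" and i: "i < N" "[p = i] (mod N)" for p i s
  proof -
    have eq: "poly (coeff (W i) j) (of_nat p) = of_nat (c j p)" if j: "j \<le> ?n" for j
    proof (cases "prime i \<and> i \<le> P")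
      case True
      have "i dvd fact (Suc P)" using True prime_gt_0_nat[of i] by (intro dvd_fact) auto
      then have "i dvd N" unfolding N_def by simp
      then have "i dvd p" using cong_dvd_modulus_nat[OF i(2), of i] by (simp add: cong_dvd_iff)
      then have "i = p" using p True by (simp add: primes_dvd_imp_eq)
      then show ?thesis using True by (simp add: coeff_W[OF j])
    next
      case False
      have "p > P"
      proof (rule ccontr)
        assume "\<not> p > P"
        then have "p = i" using cong_less_modulus_unique_nat[OF i(2)] PN i(1) by simp
        then show False using False p \<open>\<not> p > P\<close> by simp
      qed
      then have "of_nat (c j p) = poly (w j (p mod M j)) (of_nat p)" using w[OF j] QP[OF j] p by simp
      moreover have "p mod M j = i mod M j" using cong_dvd_modulus_nat[OF i(2) MN[OF j]] by (simp add: cong_def)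
      ultimately show ?thesis unfolding coeff_W[OF j] if_not_P[OF False] by simp
    qed
    have "eval_XY (W i) (of_nat p) y = (\<Sum>j\<le>?n. poly (map_poly of_rat (coeff (W i) j)) (of_nat p) * y ^ j)" for y
    proof -
      have d: "degree (map_poly (\<lambda>q. poly (map_poly of_rat q) (of_nat p :: complex)) (W i)) \<le> ?n"
        by (rule degree_le) (use deg_W[of i] in \<open>auto simp: coeff_map_poly coeff_eq_0\<close>)
      then show ?thesis unfolding eval_XY_def poly_eq_sum[OF d] by (simp add: coeff_map_poly)
    qed
    also have "\<dots> y = (\<Sum>j\<le>?n. of_nat (c j p) * y ^ j)" for y
      by (rule sum.cong) (simp_all add: poly_map_of_rat eq)
    finally show ?thesis unfolding zeta_Fp_eq[OF p] c_def by simp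
  qed
  then show ?thesis unfolding PORC_def using N by blast
qed

text \<open>For fixed \<open>p\<close> the values p^(-s) run through all nonzero complex numbers, so
  the identity in s is an identity of polynomials in Y and coefficients may be compared.\<close>

theorem PORC_D:
  fixes L :: "(int, 'b, 'm) lie_alg_scheme"
  assumes "PORC star L" "i \<le> module_rank \<Z> L"
  shows "\<exists>N>0. \<exists>w :: nat \<Rightarrow> rat poly. \<forall>p. prime p \<longrightarrow> of_nat (count_codim star (residue_ring (int p)) (lie_tensor L (residue_ring (int p))) i) = poly (w (p mod N)) (of_nat p)"
proof -
  let ?n = "module_rank \<Z> L"
  obtain N W where N: "N > 0" and W: "\<And>p j s. j < N \<Longrightarrow> prime p \<Longrightarrow> [p = j] (mod N) \<Longrightarrow>
      zeta_Fp star L p s = eval_XY (W j) (of_nat p) (of_nat p powr (- s))"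
    using assms(1) unfolding PORC_def by blast
  show ?thesis
  proof (intro exI[of _ N] exI[of _ "\<lambda>r. coeff (W r) i"] conjI N allI impI)
    fix p :: nat assume p: "prime p"
    define c where "c i = count_codim star (residue_ring (int p)) (lie_tensor L (residue_ring (int p))) i" for i
    define A where "A = (\<Sum>j\<le>?n. monom (of_nat (c j) :: complex) j)"
    define B where "B = map_poly (\<lambda>q. poly (map_poly of_rat q) (of_nat p :: complex)) (W (p mod N))"
    \<comment> \<open>The factor X covers y = 0, the one value that p^(-s) omits.\<close>
    have "poly ((A - B) * [:0, 1:]) y = 0" for y
    proof (cases "y = 0")
      case False
      define s where "s = - (Ln y / Ln (of_nat p))"
      have "Ln (of_nat p :: complex) \<noteq> 0"
        using prime_gt_1_nat[OF p] by (simp add: Ln_of_nat)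
      then have y: "of_nat p powr (- s) = y" using False prime_gt_0_nat[OF p] by (simp add: powr_def s_def)
      have "poly A y = zeta_Fp star L p s"
        unfolding zeta_Fp_eq[OF p] y A_def c_def by (simp add: poly_sum poly_monom)
      also have "\<dots> = poly B y" using W[of "p mod N" p s] N p unfolding y B_def eval_XY_def by (simp add: cong_def)
      finally show ?thesis by simp
    qed simp
    then have "(A - B) * [:0, 1:] = 0" by (simp only: poly_all_0_iff_0[symmetric]) simp
    then have "A = B" by simp
    then have "coeff A i = coeff B i" by simp
    then have "(of_nat (c i) :: complex) = of_rat (poly (coeff (W (p mod N)) i) (of_nat p))"
      using assms(2) unfolding A_def B_def by (simp add: coeff_sum coeff_map_poly poly_map_of_rat)
    then have "(of_rat (of_nat (c i)) :: complex) = of_rat (poly (coeff (W (p mod N)) i) (of_nat p))" by simp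
    then have "of_nat (c i) = poly (coeff (W (p mod N)) i) (of_nat p)" by (simp only: of_rat_eq_iff)
    then show "of_nat (count_codim star (residue_ring (int p)) (lie_tensor L (residue_ring (int p))) i) = poly (coeff (W (p mod N)) i) (of_nat p)"
      by (simp only: c_def)
  qed
qed

text \<open>The hypotheses are confined to p = 1 modulo 3 because cubing is bijective modulo a prime
  p = 2 modulo 3. Arbitrarily large noncube primes force the polynomial of the class of 1 to be the
  constant \<open>k\<close>; one cube prime contradicts it.\<close>

lemma not_PORC_I:
  fixes L :: "(int, 'b, 'm) lie_alg_scheme" and star and i
  defines "c \<equiv> \<lambda>p. count_codim star (residue_ring (int p)) (lie_tensor L (residue_ring (int p))) i"
  assumes i: "i \<le> module_rank \<Z> L"
    and noncube: "\<And>p. prime p \<Longrightarrow> p > P \<Longrightarrow> [p = 1] (mod 3) \<Longrightarrow> \<not> (\<exists>x::int. [x ^ 3 = 2] (mod int p)) \<Longrightarrow> c p = k"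
    and cube: "\<And>p. prime p \<Longrightarrow> p > P \<Longrightarrow> [p = 1] (mod 3) \<Longrightarrow> \<exists>x::int. [x ^ 3 = 2] (mod int p) \<Longrightarrow> c p \<noteq> k"
  shows "\<not> PORC star L"
proof
  assume "PORC star L"
  then obtain N w where N: "N > 0" and w: "\<And>p. prime p \<Longrightarrow> of_nat (c p) = poly (w (p mod N) :: rat poly) (of_nat p)"
    using PORC_D[OF _ i] unfolding c_def by blast
  define q where "q = w (1 mod N) - [:of_nat k:]"
  have q: "poly q (of_nat p) = of_nat (c p) - of_nat k" if "prime p" "[p = 1] (mod N)" for p
    using w[OF that(1)] that(2) by (simp add: q_def cong_def)
  have "q = 0"
  proof (rule ccontr)
    assume "q \<noteq> 0"
    then have "finite {x. poly q x = 0}" by (rule poly_roots_finite)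
    then have "finite (of_nat -` {x. poly q x = 0} :: nat set)" by (rule finite_vimageI) (simp add: inj_on_def)
    then obtain p0 where p0: "\<And>p. poly q (of_nat p) = 0 \<Longrightarrow> p \<le> p0"
      unfolding finite_nat_set_iff_bounded_le by auto
    obtain p where p: "p > p0 + P" "prime p" "[p = 1] (mod N)" "[p = 1] (mod 3)" "\<not> (\<exists>x::int. [x ^ 3 = 2] (mod int p))"
      using noncube_primes[OF N, of "p0 + P"] by blast
    then have "c p = k" using noncube[of p] by simp
    then have "p \<le> p0" using p0 q[OF p(2,3)] by simp
    then show False using p(1) by simp
  qed
  obtain p where p: "p > P" "prime p" "[p = 1] (mod N)" "[p = 1] (mod 3)" "\<exists>x::int. [x ^ 3 = 2] (mod int p)"
    using cube_primes[OF N, of P] by blast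
  then have "c p \<noteq> k" using cube by blast
  then show False using q[OF p(2,3)] \<open>q = 0\<close> by simp
qed

section \<open>Lie rings with an abelian ideal of corank one\<close>

text \<open>The semidirect product of a line with an abelian ideal: (1, 0) acts on the second
  component by \<open>D\<close>, and second components commute with each other.\<close>

definition semi_br :: "(int \<Rightarrow> 'v::ab_group_add \<Rightarrow> 'v) \<Rightarrow> ('v \<Rightarrow> 'v) \<Rightarrow> int \<times> 'v \<Rightarrow> int \<times> 'v \<Rightarrow> int \<times> 'v" where
  "semi_br sc D x y = (0, D (sc (fst x) (snd y) - sc (fst y) (snd x)))"

context zlattice_mod
begin

lemma card_cosets: "card (range (add_coset K0)) = p ^ n"
  using K0_index(2) by (simp add: index_def)

lemma card_cosets_ker:
  assumes "y \<notin> K0" shows "card (add_coset K0 ` ker y) * p = p ^ n"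
  using lattice_index(2)[OF ker_lattice, of y] index_ker[OF assms] by (simp add: mult.commute)

lemma card_cosets_K0: "card (add_coset K0 ` K0) = 1"
  using lattice_index(2)[OF K0_lattice] K0_index(2) prime_gt_0_nat[OF p] by simp

lemma finite_cosets: "finite (add_coset K0 ` A)"
  using K0_index(1) unfolding finite_index_def by (rule finite_subset[rotated]) blast

lemma sc_K0: "x \<in> K0 \<Longrightarrow> sc a x \<in> K0"
  by (rule sc_mem[OF K0_subgroup])

text \<open>Since the bracket is alternating, two multiples of one vector commute, so modulo
  \<open>p\<close> every line is a subalgebra.\<close>

lemma line_closed:
  assumes br: "\<And>x y z. br (x + y) z = br x z + br y z" "\<And>x y z. br x (y + z) = br x y + br x z"
      "\<And>k x y. br (sc k x) y = sc k (br x y)" "\<And>k x y. br x (sc k y) = sc k (br x y)" "\<And>x. br x x = 0"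
  shows "star_closed Subalgebras br (line v)"
proof -
  have "br x y \<in> K0" if xy: "x \<in> line v" "y \<in> line v" for x y
  proof -
    obtain c d where c: "x - sc c v \<in> K0" and d: "y - sc d v \<in> K0" using xy unfolding line_def by blast
    have l: "br k z \<in> K0" if "k \<in> K0" for k z using that by (auto simp: K0_def br(3))
    have r: "br z k \<in> K0" if "k \<in> K0" for k z using that by (auto simp: K0_def br(4))
    have "br x y = br ((x - sc c v) + sc c v) ((y - sc d v) + sc d v)" by simp
    also have "\<dots> = br (x - sc c v) ((y - sc d v) + sc d v) + br (sc c v) (y - sc d v)"
      unfolding br(1,2,3,4,5) by (simp add: sc_zero_right)
    also have "\<dots> \<in> K0" by (intro add_subgroup_add[OF K0_subgroup] l c r d)
    finally show ?thesis .
  qed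
  then show ?thesis using lattice_K0[OF line_lattice] by simp
qed

end

section \<open>Subalgebras and ideals of a semidirect product modulo p\<close>

locale semi = zlattice_mod sc dot n p for sc :: "int \<Rightarrow> 'v::ab_group_add \<Rightarrow> 'v" and dot n p +
  fixes D :: "'v \<Rightarrow> 'v"
  assumes D_add: "D (x + y) = D x + D y" and D_sc: "D (sc k x) = sc k (D x)"
begin

abbreviation SC where "SC \<equiv> prod_sc (*) sc"

abbreviation br where "br \<equiv> semi_br sc D"

sublocale W: zlattice_mod SC "prod_dot (*) dot" "1 + n" p
  by (intro zlattice_mod.intro zlattice_prod zlattice_int zlattice_axioms zlattice_mod_axioms.intro p)

lemma D_zero: "D 0 = 0" using D_add[of 0 0] by simp

lemma D_minus: "D (- x) = - D x" using D_add[of x "- x"] by (simp add: D_zero minus_unique)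

lemma D_diff: "D (x - y) = D x - D y" using D_add[of x "- y"] by (simp add: D_minus)

lemma D_K0: "x \<in> K0 \<Longrightarrow> D x \<in> K0" by (auto simp: K0_def D_sc)

lemma W_K0: "W.K0 = range ((*) (int p)) \<times> K0" unfolding W.K0_def K0_def by (rule range_prod_sc)

lemma mem_W_K0: "x \<in> W.K0 \<longleftrightarrow> int p dvd fst x \<and> snd x \<in> K0"
  unfolding W_K0 by (cases x) (auto simp: dvd_def)

lemma sc_left_commute: "sc a (sc b x) = sc b (sc a x)"
  unfolding sc_mult[symmetric] by (simp only: mult.commute)

lemma br_bilinear: "br (x + y) z = br x z + br y z" "br x (y + z) = br x y + br x z"
    "br (SC k x) y = SC k (br x y)" "br x (SC k y) = SC k (br x y)" "br x x = 0"
  by (simp_all add: semi_br_def prod_sc_def sc_add sc_dist sc_mult D_add D_diff D_sc sc_diff_right zero_prod_def D_zero sc_left_commute)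

text \<open>The kernel of the covector modulo \<open>p\<close> is stable under \<open>D\<close>: the
  covector is zero or an eigenvector of the transpose of \<open>D\<close> modulo
  \<open>p\<close>.\<close>

definition eigen_functional where "eigen_functional \<eta> \<longleftrightarrow> (\<forall>u. int p dvd dot \<eta> u \<longrightarrow> int p dvd dot \<eta> (D u))"

text \<open>If the second part of the covector is nonzero, the hyperplane contains an element with
  first component 1, and closure under bracketing with it says that \<open>D\<close> preserves the
  kernel of that part. Conversely, for x and y in the hyperplane the vector to which
  \<open>semi_br\<close> applies \<open>D\<close> already lies in this kernel.\<close>

lemma closed_ker: "star_closed Subalgebras br (W.ker (a, \<eta>)) \<longleftrightarrow> eigen_functional \<eta>"
proof (cases "\<eta> \<in> K0")
  case True
  then have "int p dvd dot \<eta> u" for u using mem_K0_iff[of \<eta>] dot_commute[of \<eta> u] by metis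
  then show ?thesis by (auto simp: eigen_functional_def W.ker_def prod_dot_def semi_br_def)
next
  case False
  have "eigen_functional \<eta>" if *: "star_closed Subalgebras br (W.ker (a, \<eta>))"
    unfolding eigen_functional_def
  proof (intro allI impI)
    fix u assume u: "int p dvd dot \<eta> u"
    obtain w where w: "[dot \<eta> w = 1] (mod int p)" using exists_dual[OF False] by blast
    \<comment> \<open>The multiple of \<open>w\<close> is chosen so that (1, - a w) lies in the
      hyperplane.\<close>
    have "int p dvd a * 1 + dot \<eta> (sc (- a) w)"
    proof -
      have "int p dvd a * (1 - dot \<eta> w)" using w by (metis cong_iff_dvd_diff cong_sym dvd_mult)
      then show ?thesis by (simp add: dot_sc algebra_simps)
    qed
    then have "(1, sc (- a) w) \<in> W.ker (a, \<eta>)" by (simp add: W.ker_def prod_dot_def)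
    moreover have "(0, u) \<in> W.ker (a, \<eta>)" using u by (simp add: W.ker_def prod_dot_def)
    ultimately have "br (1, sc (- a) w) (0, u) \<in> W.ker (a, \<eta>)" using * by simp
    then show "int p dvd dot \<eta> (D u)" by (simp add: semi_br_def W.ker_def prod_dot_def sc_one sc_zero)
  qed
  moreover have "br x y \<in> W.ker (a, \<eta>)" if e: "eigen_functional \<eta>" and x: "x \<in> W.ker (a, \<eta>)" and y: "y \<in> W.ker (a, \<eta>)" for x y
  proof -
    have "int p dvd fst x * (a * fst y + dot \<eta> (snd y)) - fst y * (a * fst x + dot \<eta> (snd x))"
      using x y by (auto simp: W.ker_def prod_dot_def intro: dvd_diff dvd_mult)
    then have "int p dvd dot \<eta> (sc (fst x) (snd y) - sc (fst y) (snd x))" by (simp add: dot_diff dot_sc algebra_simps)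
    then have "int p dvd dot \<eta> (D (sc (fst x) (snd y) - sc (fst y) (snd x)))" using e unfolding eigen_functional_def by blast
    then show ?thesis by (simp add: W.ker_def prod_dot_def semi_br_def)
  qed
  ultimately show ?thesis by auto
qed

lemma ideal_ker:
  assumes "y \<notin> W.K0"
  shows "star_closed Ideals br (W.ker y) \<longleftrightarrow> (\<forall>u. int p dvd dot (snd y) (D u))"
proof -
  have "star_closed Ideals br (W.ker y) \<longleftrightarrow> (\<forall>x z. br x z \<in> W.ker y)"
    by (rule W.ideal_index_p[OF W.ker_lattice W.index_ker[OF assms] br_bilinear])
  also have "\<dots> \<longleftrightarrow> (\<forall>u. int p dvd dot (snd y) (D u))"
  proof
    assume *: "\<forall>x z. br x z \<in> W.ker y"
    show "\<forall>u. int p dvd dot (snd y) (D u)"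
    proof
      fix u
      have "br (1, 0) (0, u) \<in> W.ker y" using * by blast
      then show "int p dvd dot (snd y) (D u)" by (simp add: semi_br_def W.ker_def prod_dot_def sc_one sc_zero)
    qed
  qed (simp add: semi_br_def W.ker_def prod_dot_def)
  finally show ?thesis .
qed

text \<open>Brackets have first component 0. If \<open>a\<close> is nonzero modulo \<open>p\<close>,
  the only such vector on the line is 0, and bracketing with (0, u) forces D u = 0 for all u.
  Otherwise the line lies in the abelian ideal and must be an eigenline of \<open>D\<close>.\<close>

lemma ideal_line: "star_closed Ideals br (W.line (a, v)) \<longleftrightarrow> int p dvd a \<and> D v \<in> line v \<or> (\<forall>u. D u \<in> K0)"
proof
  assume *: "star_closed Ideals br (W.line (a, v))"
  show "int p dvd a \<and> D v \<in> line v \<or> (\<forall>u. D u \<in> K0)"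
  proof (cases "int p dvd a")
    case True
    have "br (1, 0) (a, v) \<in> W.line (a, v)" using * W.self_in_line[of "(a, v)"] by simp
    then obtain c where "D v - sc c v \<in> K0"
      unfolding W.line_def by (auto simp: semi_br_def prod_sc_def sc_one sc_zero_right mem_W_K0)
    then show ?thesis using True unfolding line_def by blast
  next
    case False
    have "D u \<in> K0" for u
    proof -
      have "br (0, u) (a, v) \<in> W.line (a, v)" using * W.self_in_line[of "(a, v)"] by simp
      then obtain c where "int p dvd c * a" "D (- sc a u) - sc c v \<in> K0"
        unfolding W.line_def by (auto simp: semi_br_def prod_sc_def sc_zero mem_W_K0)
      moreover from this(1) have "int p dvd c" using False p by (simp add: prime_dvd_mult_iff)
      ultimately have "D (- sc a u) - sc c v + sc c v \<in> K0" by (intro add_subgroup_add[OF K0_subgroup] sc_p_K0)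
      then have "- sc a (D u) \<in> K0" by (simp add: D_minus D_sc)
      then have "- (- sc a (D u)) \<in> K0" by (rule add_subgroup_uminus[OF K0_subgroup])
      then show ?thesis using sc_cancel[OF K0_lattice False] by simp
    qed
    then show ?thesis by blast
  qed
next
  assume *: "int p dvd a \<and> D v \<in> line v \<or> (\<forall>u. D u \<in> K0)"
  have "br x y \<in> W.line (a, v)" if y: "y \<in> W.line (a, v)" for x y
  proof -
    obtain c where c: "int p dvd fst y - c * a" "snd y - sc c v \<in> K0"
      using y unfolding W.line_def by (auto simp: prod_sc_def mem_W_K0)
    from * show ?thesis
    proof
      assume a: "int p dvd a \<and> D v \<in> line v"
      then have "int p dvd fst y - c * a + c * a" using c by (intro dvd_add dvd_mult) auto
      then have y1: "int p dvd fst y" by simp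
      obtain d where d: "D v - sc d v \<in> K0" using a unfolding line_def by blast
      let ?e = "fst x * (c * d)"
      have "sc (fst x) (D (snd y - sc c v)) - D (sc (fst y) (snd x)) + sc (fst x) (sc c (D v - sc d v)) \<in> K0"
        by (intro add_subgroup_add[OF K0_subgroup] add_subgroup_diff[OF K0_subgroup] sc_K0 D_K0 c(2) d sc_p_K0 y1)
      then have "D (sc (fst x) (snd y) - sc (fst y) (snd x)) - sc ?e v \<in> K0"
        by (simp add: D_diff D_sc sc_diff_right sc_mult[symmetric] algebra_simps)
      then have "br x y - SC ?e (a, v) \<in> W.K0" using a by (simp add: mem_W_K0 semi_br_def prod_sc_def)
      then show ?thesis unfolding W.line_def by blast
    next
      assume "\<forall>u. D u \<in> K0"
      then have "br x y \<in> W.K0" by (simp add: mem_W_K0 semi_br_def)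
      then show ?thesis using W.lattice_K0[OF W.line_lattice] by blast
    qed
  qed
  then show "star_closed Ideals br (W.line (a, v))" by simp
qed

lemma card_cosets_snd: "card (add_coset W.K0 ` {y. P (snd y)}) = p * card (add_coset K0 ` {v. P v})"
proof -
  have eq: "{y. P (snd y)} = UNIV \<times> {v. P v}" by auto
  have c: "card (range (add_coset (range ((*) (int p))))) = p"
    using zlattice.index_multiples[OF zlattice_int p_pos] by (simp add: index_def)
  show ?thesis
    unfolding W_K0 eq card_coset_prod(1)[OF zlattice.multiples_subgroup[OF zlattice_int] K0_subgroup] c by simp
qed

lemma card_cosets_dvd: "card (add_coset W.K0 ` {y. int p dvd fst y \<and> P (snd y)}) = card (add_coset K0 ` {v. P v})"
proof -
  interpret Z: zlattice_mod "(*)" "(*)" 1 p by (intro zlattice_mod.intro zlattice_int zlattice_mod_axioms.intro p)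
  have eq: "{y. int p dvd fst y \<and> P (snd y)} = range ((*) (int p)) \<times> {v. P v}" by (auto simp: dvd_def)
  have c: "card (add_coset (range ((*) (int p))) ` range ((*) (int p))) = 1" using Z.card_cosets_K0 by (simp add: Z.K0_def)
  show ?thesis
    unfolding W_K0 eq card_coset_prod(1)[OF zlattice.multiples_subgroup[OF zlattice_int] K0_subgroup] c by simp
qed

text \<open>The first component of the covector is free, which gives the factor \<open>p\<close>;
  the zero covector is then subtracted.\<close>

theorem subalgebras_index_p:
  "count_lattices Subalgebras SC br p 1 * (p - 1) = p * card (add_coset K0 ` {\<eta>. eigen_functional \<eta>}) - 1"
proof -
  have "count_lattices Subalgebras SC br p 1 * (p - 1) = card (add_coset W.K0 ` {y. y \<notin> W.K0 \<and> star_closed Subalgebras br (W.ker y)})"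
    unfolding W.count_lattices_eq power_one_right by (rule W.count_index_p)
  also have "{y. y \<notin> W.K0 \<and> star_closed Subalgebras br (W.ker y)} = {y. y \<notin> W.K0 \<and> eigen_functional (snd y)}"
    using closed_ker[of "fst y" "snd y" for y, unfolded prod.collapse] by blast
  also have "card (add_coset W.K0 ` \<dots>) = card (add_coset W.K0 ` {y. eigen_functional (snd y)}) - 1"
    by (rule W.card_nonzero) (simp add: eigen_functional_def dot_zero)
  finally show ?thesis unfolding card_cosets_snd .
qed

theorem ideals_index_p:
  "count_lattices Ideals SC br p 1 * (p - 1) = p * card (add_coset K0 ` {\<eta>. \<forall>u. int p dvd dot \<eta> (D u)}) - 1"
proof -
  have "count_lattices Ideals SC br p 1 * (p - 1) = card (add_coset W.K0 ` {y. y \<notin> W.K0 \<and> star_closed Ideals br (W.ker y)})"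
    unfolding W.count_lattices_eq power_one_right by (rule W.count_index_p)
  also have "{y. y \<notin> W.K0 \<and> star_closed Ideals br (W.ker y)} = {y. y \<notin> W.K0 \<and> (\<forall>u. int p dvd dot (snd y) (D u))}"
    using ideal_ker by blast
  also have "card (add_coset W.K0 ` \<dots>) = card (add_coset W.K0 ` {y. \<forall>u. int p dvd dot (snd y) (D u)}) - 1"
    by (rule W.card_nonzero) (simp add: dot_zero)
  finally show ?thesis unfolding card_cosets_snd[of "\<lambda>\<eta>. \<forall>u. int p dvd dot \<eta> (D u)"] .
qed

lemma count_lines': "count_lattices star SC br p n * (p - 1) = card (add_coset W.K0 ` {v. v \<notin> W.K0 \<and> star_closed star br (W.line v)})"
proof -
  have *: "index K * p = p ^ (1 + n) \<longleftrightarrow> index K = p ^ n" for K :: "(int \<times> 'v) set" using prime_gt_0_nat[OF p] by (simp add: mult.commute)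
  show ?thesis unfolding W.count_lattices_eq *[symmetric] by (rule W.count_lines)
qed

theorem subalgebras_lines: "count_lattices Subalgebras SC br p n * (p - 1) = p ^ (1 + n) - 1"
proof -
  have "{v. v \<notin> W.K0 \<and> star_closed Subalgebras br (W.line v)} = {v. v \<notin> W.K0 \<and> True}" using W.line_closed[OF br_bilinear] by blast
  then show ?thesis unfolding count_lines' using W.card_nonzero[of "\<lambda>_. True"] W.card_cosets by simp
qed

theorem ideals_lines_trivial:
  assumes "\<And>u. D u \<in> K0" shows "count_lattices Ideals SC br p n * (p - 1) = p ^ (1 + n) - 1"
proof -
  have "{v. v \<notin> W.K0 \<and> star_closed Ideals br (W.line v)} = {v. v \<notin> W.K0 \<and> True}" using ideal_line assms by auto
  then show ?thesis unfolding count_lines' using W.card_nonzero[of "\<lambda>_. True"] W.card_cosets by simp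
qed

theorem ideals_lines:
  assumes "D u \<notin> K0" shows "count_lattices Ideals SC br p n * (p - 1) = card (add_coset K0 ` {v. D v \<in> line v}) - 1"
proof -
  have "{v. v \<notin> W.K0 \<and> star_closed Ideals br (W.line v)} = {v. v \<notin> W.K0 \<and> (int p dvd fst v \<and> D (snd v) \<in> line (snd v))}"
    using ideal_line[of "fst v" "snd v" for v, unfolded prod.collapse] assms by blast
  also have "card (add_coset W.K0 ` \<dots>) = card (add_coset W.K0 ` {v. int p dvd fst v \<and> D (snd v) \<in> line (snd v)}) - 1"
    by (rule W.card_nonzero) (simp add: D_zero add_subgroup_zero[OF lattice_subgroup[OF line_lattice]])
  finally show ?thesis unfolding count_lines' card_cosets_dvd[of "\<lambda>v. D v \<in> line v"] .
qed

end

section \<open>Zeros of binary quadratic forms modulo p\<close>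

abbreviation sc2 :: "int \<Rightarrow> int \<times> int \<Rightarrow> int \<times> int" where "sc2 \<equiv> prod_sc (*) (*)"

abbreviation dot2 :: "int \<times> int \<Rightarrow> int \<times> int \<Rightarrow> int" where "dot2 \<equiv> prod_dot (*) (*)"

lemma zlattice_2: "zlattice sc2 dot2 2"
  using zlattice_prod[OF zlattice_int zlattice_int] by (simp add: numeral_2_eq_2)

text \<open>The zeros of the form over the prime field, as cosets; the zero vector is
  included.\<close>

definition form_zeros :: "int \<Rightarrow> int \<Rightarrow> int \<Rightarrow> nat \<Rightarrow> nat" where
  "form_zeros A B C p = card (add_coset (range (sc2 (int p))) ` {v. int p dvd A * (fst v)\<^sup>2 + B * fst v * snd v + C * (snd v)\<^sup>2})"

lemma Legendre_eq_1_iff: "\<not> int p dvd D \<Longrightarrow> Legendre D (int p) = 1 \<longleftrightarrow> (\<exists>s. [s\<^sup>2 = D] (mod int p))"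
  by (auto simp: Legendre_def QuadRes_def cong_0_iff)

lemma prime_quot_eq: "prime p \<Longrightarrow> k * (p - 1) = m \<Longrightarrow> k = m div (p - 1)" for p :: nat
  using prime_gt_1_nat[of p] by auto

locale plane_mod =
  fixes p :: nat
  assumes prime_p: "prime p"
begin

sublocale P: zlattice_mod sc2 dot2 2 p
  by (intro zlattice_mod.intro zlattice_2 zlattice_mod_axioms.intro prime_p)

lemma mem_K0: "v \<in> P.K0 \<longleftrightarrow> int p dvd fst v \<and> int p dvd snd v"
  unfolding P.K0_def range_prod_sc by (cases v) (auto simp: dvd_def)

lemma p_dvd_mult: "int p dvd a * b \<longleftrightarrow> int p dvd a \<or> int p dvd b"
  using prime_p by (intro prime_dvd_mult_iff) simp

lemma mem_ker: "v \<in> P.ker (a, b) \<longleftrightarrow> int p dvd a * fst v + b * snd v"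
  by (simp add: P.ker_def prod_dot_def)

lemma card_ker: "y \<notin> P.K0 \<Longrightarrow> card (add_coset P.K0 ` P.ker y) = p"
  using P.card_cosets_ker[of y] prime_gt_0_nat[OF prime_p] by (simp add: power2_eq_square)

text \<open>Two distinct lines through the origin of the plane over the prime field: the origin is
  counted once.\<close>

lemma card_union_ker:
  assumes y: "y \<notin> P.K0" and z: "z \<notin> P.K0" and int: "P.ker y \<inter> P.ker z \<subseteq> P.K0"
  shows "card (add_coset P.K0 ` (P.ker y \<union> P.ker z)) = 2 * p - 1"
proof -
  have "add_coset P.K0 ` P.ker y \<inter> add_coset P.K0 ` P.ker z = add_coset P.K0 ` P.K0"
  proof (intro equalityI subsetI)
    fix C assume "C \<in> add_coset P.K0 ` P.ker y \<inter> add_coset P.K0 ` P.ker z"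
    then obtain u w where u: "u \<in> P.ker y" "C = add_coset P.K0 u" and w: "w \<in> P.ker z" "C = add_coset P.K0 w" by blast
    then have "u - w \<in> P.ker z" using P.add_coset_K0_eq[of u w] P.lattice_K0[OF P.ker_lattice] by blast
    then have "(u - w) + w \<in> P.ker z" using w(1) by (rule add_subgroup_add[OF P.lattice_subgroup[OF P.ker_lattice]])
    then have "u \<in> P.K0" using u(1) int by auto
    then show "C \<in> add_coset P.K0 ` P.K0" using u(2) by blast
  qed (use P.lattice_K0[OF P.ker_lattice] in blast)
  then have "card (add_coset P.K0 ` P.ker y \<union> add_coset P.K0 ` P.ker z) + 1 = p + p"
    using card_Un_Int[OF P.finite_cosets P.finite_cosets, of "P.ker y" "P.ker z"] card_ker[OF y] card_ker[OF z] P.card_cosets_K0 by simp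
  then show ?thesis by (simp add: image_Un)
qed

text \<open>The hypotheses say that \<open>p\<close> is large enough for coefficients and
  discriminant to vanish modulo \<open>p\<close> only if they are 0. For nonzero \<open>A\<close>,
  completing the square writes 4 A times the form as (2 A x + B y)^2 minus the discriminant times
  y^2; for A = 0 the form is y (B x + C y). The zero set is the plane, a line, two lines or the
  origin.\<close>

lemma form_zeros_eq:
  assumes p2: "p > 2" and A: "int p dvd A \<Longrightarrow> A = 0" and B: "int p dvd B \<Longrightarrow> B = 0" and C: "int p dvd C \<Longrightarrow> C = 0"
    and \<Delta>: "int p dvd B\<^sup>2 - 4 * A * C \<Longrightarrow> B\<^sup>2 - 4 * A * C = 0"
  shows "form_zeros A B C p = (if A = 0 \<and> B = 0 \<and> C = 0 then p\<^sup>2 else if B\<^sup>2 - 4 * A * C = 0 then p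
      else if Legendre (B\<^sup>2 - 4 * A * C) (int p) = 1 then 2 * p - 1 else 1)"
proof -
  let ?S = "{v. int p dvd A * (fst v)\<^sup>2 + B * fst v * snd v + C * (snd v)\<^sup>2}" and ?D = "B\<^sup>2 - 4 * A * C"
  have Z: "form_zeros A B C p = card (add_coset P.K0 ` ?S)" by (simp add: form_zeros_def P.K0_def)
  have two: "\<not> int p dvd 2" "\<not> int p dvd 4" 
  proof -
    show two: "\<not> int p dvd 2" using p2 zdvd_imp_le[of "int p" 2] by auto
    have "\<not> int p dvd 2 * 2" using two unfolding p_dvd_mult by blast
    then show "\<not> int p dvd 4" by simp
  qed
  have e01: "(0, 1) \<notin> P.K0" using prime_gt_1_nat[OF prime_p] by (simp add: mem_K0)
  show ?thesis
  proof (cases "A = 0")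
    case A0: True
    show ?thesis
    proof (cases "B = 0")
      case True
      show ?thesis
      proof (cases "C = 0")
        case True
        then have "?S = UNIV" using A0 \<open>B = 0\<close> by simp
        then show ?thesis unfolding Z using A0 \<open>B = 0\<close> True P.card_cosets by simp
      next
        case False
        then have "?S = P.ker (0, 1)" using A0 \<open>B = 0\<close> C by (auto simp: mem_ker p_dvd_mult power2_eq_square)
        then show ?thesis unfolding Z using A0 \<open>B = 0\<close> False card_ker[OF e01] by simp
      qed
    next
      case False
      have pB: "\<not> int p dvd B" using B False by blast
      then have "\<not> int p dvd B\<^sup>2" by (simp add: power2_eq_square p_dvd_mult)
      then have "Legendre (B\<^sup>2) (int p) = 1" using Legendre_eq_1_iff cong_refl by blast
      moreover have "?S = P.ker (0, 1) \<union> P.ker (B, C)"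
      proof -
        have "A * x\<^sup>2 + B * x * y + C * y\<^sup>2 = y * (B * x + C * y)" for x y using A0 by (simp add: algebra_simps power2_eq_square)
        then show ?thesis by (auto simp: mem_ker p_dvd_mult)
      qed
      moreover have "card (add_coset P.K0 ` (P.ker (0, 1) \<union> P.ker (B, C))) = 2 * p - 1"
      proof (rule card_union_ker[OF e01])
        show "(B, C) \<notin> P.K0" using pB by (simp add: mem_K0)
        show "P.ker (0, 1) \<inter> P.ker (B, C) \<subseteq> P.K0"
        proof
          fix v assume "v \<in> P.ker (0, 1) \<inter> P.ker (B, C)"
          then have v: "int p dvd snd v" "int p dvd B * fst v + C * snd v" by (simp_all add: mem_ker)
          then have "int p dvd (B * fst v + C * snd v) - C * snd v" by (intro dvd_diff dvd_mult)
          then show "v \<in> P.K0" using v(1) pB by (simp add: mem_K0 p_dvd_mult)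
        qed
      qed
      ultimately show ?thesis unfolding Z using A0 False by simp
    qed
  next
    case A0: False
    have pA: "\<not> int p dvd A" using A A0 by blast
    then have p2A: "\<not> int p dvd 2 * A" using two by (simp add: p_dvd_mult)
    have k: "(2 * A, b) \<notin> P.K0" for b using p2A by (simp add: mem_K0)
    have S: "v \<in> ?S \<longleftrightarrow> int p dvd (2 * A * fst v + B * snd v)\<^sup>2 - ?D * (snd v)\<^sup>2" for v
    proof -
      have "(2 * A * fst v + B * snd v)\<^sup>2 - ?D * (snd v)\<^sup>2 = 4 * A * (A * (fst v)\<^sup>2 + B * fst v * snd v + C * (snd v)\<^sup>2)"
        by (simp add: algebra_simps power2_eq_square)
      then show ?thesis using two pA by (simp only: p_dvd_mult mem_Collect_eq) simp
    qed
    show ?thesis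
    proof (cases "?D = 0")
      case True
      then have "?S = P.ker (2 * A, B)" using S by (auto simp: mem_ker power2_eq_square p_dvd_mult)
      then show ?thesis unfolding Z using True A0 card_ker[OF k] by simp
    next
      case False
      have pD: "\<not> int p dvd ?D" using \<Delta> False by blast
      show ?thesis
      proof (cases "Legendre ?D (int p) = 1")
        case True
        then obtain s where s: "[s\<^sup>2 = ?D] (mod int p)" using Legendre_eq_1_iff[OF pD] by blast
        have ps: "\<not> int p dvd s"
        proof
          assume "int p dvd s"
          then have "int p dvd s\<^sup>2" by (simp add: power2_eq_square)
          then show False using pD cong_dvd_iff[OF s] by blast
        qed
        have "v \<in> ?S \<longleftrightarrow> v \<in> P.ker (2 * A, B - s) \<union> P.ker (2 * A, B + s)" for v
        proof -
          have "[(2 * A * fst v + B * snd v)\<^sup>2 - ?D * (snd v)\<^sup>2 = (2 * A * fst v + B * snd v)\<^sup>2 - s\<^sup>2 * (snd v)\<^sup>2] (mod int p)"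
            by (intro cong_diff cong_mult cong_refl cong_sym[OF s])
          moreover have "(2 * A * fst v + B * snd v)\<^sup>2 - s\<^sup>2 * (snd v)\<^sup>2 =
              (2 * A * fst v + (B - s) * snd v) * (2 * A * fst v + (B + s) * snd v)" by (simp add: algebra_simps power2_eq_square)
          ultimately show ?thesis unfolding S by (simp add: cong_dvd_iff mem_ker p_dvd_mult)
        qed
        then have "?S = P.ker (2 * A, B - s) \<union> P.ker (2 * A, B + s)" by blast
        moreover have "card (add_coset P.K0 ` (P.ker (2 * A, B - s) \<union> P.ker (2 * A, B + s))) = 2 * p - 1"
        proof (rule card_union_ker[OF k k], rule subsetI)
          fix v assume "v \<in> P.ker (2 * A, B - s) \<inter> P.ker (2 * A, B + s)"
          then have v: "int p dvd 2 * A * fst v + (B - s) * snd v" "int p dvd 2 * A * fst v + (B + s) * snd v" by (simp_all add: mem_ker)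
          from dvd_diff[OF v(2,1)] have "int p dvd 2 * (s * snd v)" by (simp add: algebra_simps)
          then have y: "int p dvd snd v" using two ps by (simp add: p_dvd_mult)
          then have "int p dvd (2 * A * fst v + (B - s) * snd v) - (B - s) * snd v" by (intro dvd_diff v dvd_mult)
          then have "int p dvd 2 * A * fst v" by simp
          then have "int p dvd fst v" using p2A by (metis p_dvd_mult)
          then show "v \<in> P.K0" using y by (simp add: mem_K0)
        qed
        ultimately show ?thesis unfolding Z using A0 False True by simp
      next
        case nres: False
        have "?S = P.K0"
        proof (intro equalityI subsetI)
          fix v assume v: "v \<in> ?S"
          have y: "int p dvd snd v"
          proof (rule ccontr)
            assume "\<not> int p dvd snd v"
            then obtain b where b: "[snd v * b = 1] (mod int p)" using P.inverse_mod by blast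
            \<comment> \<open>A zero with invertible second coordinate y would exhibit the
              discriminant as the square of (2 A x + B y) / y.\<close>
            let ?X = "2 * A * fst v + B * snd v"
            have 1: "[?X\<^sup>2 * b\<^sup>2 = ?D * (snd v)\<^sup>2 * b\<^sup>2] (mod int p)"
              using v unfolding S by (intro cong_mult cong_refl) (simp add: cong_iff_dvd_diff)
            have 2: "?D * (snd v)\<^sup>2 * b\<^sup>2 = ?D * (snd v * b)\<^sup>2" by (simp add: power_mult_distrib)
            have 3: "[?D * (snd v * b)\<^sup>2 = ?D * 1\<^sup>2] (mod int p)" by (intro cong_mult cong_pow cong_refl b)
            have "[(?X * b)\<^sup>2 = ?D] (mod int p)" using cong_trans[OF 1[unfolded 2] 3] by (simp add: power_mult_distrib)
            then show False using nres Legendre_eq_1_iff[OF pD] by blast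
          qed
          then have "int p dvd ((2 * A * fst v + B * snd v)\<^sup>2 - ?D * (snd v)\<^sup>2) + ?D * (snd v)\<^sup>2"
            using v unfolding S by (intro dvd_add) (auto simp: power2_eq_square)
          then have "int p dvd 2 * A * fst v + B * snd v" by (simp add: power2_eq_square p_dvd_mult)
          then have "int p dvd (2 * A * fst v + B * snd v) - B * snd v" using y by (intro dvd_diff dvd_mult)
          then have "int p dvd 2 * A * fst v" by simp
          then have "int p dvd fst v" using p2A by (metis p_dvd_mult)
          then show "v \<in> P.K0" using y by (simp add: mem_K0)
        qed (auto simp: mem_K0 power2_eq_square)
        then show ?thesis unfolding Z using A0 False nres P.card_cosets_K0 by simp
      qed
    qed
  qed
qed

end

section \<open>Derivations given by integral 2x2 matrices\<close>

definition mat2 :: "int \<Rightarrow> int \<Rightarrow> int \<Rightarrow> int \<Rightarrow> int \<times> int \<Rightarrow> int \<times> int" where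
  "mat2 a b c d v = (a * fst v + b * snd v, c * fst v + d * snd v)"

locale plane_semi = plane_mod p for p + fixes a b c d :: int
begin

abbreviation D where "D \<equiv> mat2 a b c d"

sublocale S: semi sc2 dot2 2 p D
  by unfold_locales (simp_all add: mat2_def prod_sc_def algebra_simps)

text \<open>The kernel of the covector (x, y) is spanned by (-y, x), and the form is the value of
  the covector on the image of this vector. For the converse, x and y times the value at D u are
  combinations of the form and the value at u, and one of x, y can be cancelled.\<close>

lemma eigen_iff: "S.eigen_functional \<eta> \<longleftrightarrow> int p dvd b * (fst \<eta>)\<^sup>2 + (d - a) * fst \<eta> * snd \<eta> + - c * (snd \<eta>)\<^sup>2"
  (is "_ \<longleftrightarrow> int p dvd ?q")
proof
  let ?x = "fst \<eta>" and ?y = "snd \<eta>"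
  assume "S.eigen_functional \<eta>"
  then have "int p dvd dot2 \<eta> (- ?y, ?x) \<longrightarrow> int p dvd dot2 \<eta> (D (- ?y, ?x))" unfolding S.eigen_functional_def by blast
  then have "int p dvd dot2 \<eta> (D (- ?y, ?x))" by (simp add: prod_dot_def)
  also have "dot2 \<eta> (D (- ?y, ?x)) = ?q" by (simp add: prod_dot_def mat2_def algebra_simps power2_eq_square)
  finally show "int p dvd ?q" .
next
  let ?x = "fst \<eta>" and ?y = "snd \<eta>"
  assume q: "int p dvd ?q"
  show "S.eigen_functional \<eta>" unfolding S.eigen_functional_def
  proof (intro allI impI)
    fix u assume "int p dvd dot2 \<eta> u"
    then have u: "int p dvd ?x * fst u + ?y * snd u" by (simp add: prod_dot_def)
    let ?r = "dot2 \<eta> (D u)"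
    show "int p dvd ?r"
    proof (cases "int p dvd ?x \<and> int p dvd ?y")
      case True
      then show ?thesis by (simp add: prod_dot_def)
    next
      case False
      have "?x * ?r = (a * ?x + c * ?y) * (?x * fst u + ?y * snd u) + ?q * snd u"
        by (simp add: prod_dot_def mat2_def algebra_simps power2_eq_square)
      moreover have "?y * ?r = (b * ?x + d * ?y) * (?x * fst u + ?y * snd u) - ?q * fst u"
        by (simp add: prod_dot_def mat2_def algebra_simps power2_eq_square)
      ultimately have "int p dvd ?x * ?r" "int p dvd ?y * ?r" using q u by simp_all
      then show ?thesis using False unfolding p_dvd_mult by blast
    qed
  qed
qed

text \<open>The form is the determinant of v and D v. When it vanishes, the eigenvalue is found by
  dividing in a coordinate of v that is nonzero modulo \<open>p\<close>.\<close>

lemma line_iff: "D v \<in> P.line v \<longleftrightarrow> int p dvd c * (fst v)\<^sup>2 + (d - a) * fst v * snd v + - b * (snd v)\<^sup>2"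
  (is "_ \<longleftrightarrow> int p dvd ?q")
proof
  let ?x = "fst v" and ?y = "snd v"
  assume "D v \<in> P.line v"
  then obtain k where k: "int p dvd a * ?x + b * ?y - k * ?x" "int p dvd c * ?x + d * ?y - k * ?y"
    unfolding P.line_def by (auto simp: mem_K0 mat2_def prod_sc_def)
  have "?q = ?x * (c * ?x + d * ?y - k * ?y) - ?y * (a * ?x + b * ?y - k * ?x)"
    by (simp add: algebra_simps power2_eq_square)
  then show "int p dvd ?q" using k by (simp add: dvd_diff)
next
  let ?x = "fst v" and ?y = "snd v"
  assume q: "int p dvd ?q"
  have "\<exists>k. int p dvd a * ?x + b * ?y - k * ?x \<and> int p dvd c * ?x + d * ?y - k * ?y"
  proof (cases "int p dvd ?x")
    case x: False
    then obtain i where i: "[?x * i = 1] (mod int p)" using P.inverse_mod by blast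
    define k where "k = i * (a * ?x + b * ?y)"
    have i': "int p dvd 1 - ?x * i" using i by (metis cong_iff_dvd_diff cong_sym)
    have "a * ?x + b * ?y - k * ?x = (a * ?x + b * ?y) * (1 - ?x * i)" by (simp add: k_def algebra_simps)
    then have 1: "int p dvd a * ?x + b * ?y - k * ?x" using i' by simp
    have "?x * (c * ?x + d * ?y - k * ?y) = ?q + ?y * (a * ?x + b * ?y - k * ?x)" by (simp add: algebra_simps power2_eq_square)
    then have "int p dvd ?x * (c * ?x + d * ?y - k * ?y)" using q 1 by simp
    then have "int p dvd c * ?x + d * ?y - k * ?y" using x unfolding p_dvd_mult by blast
    then show ?thesis using 1 by blast
  next
    case x: True
    show ?thesis
    proof (cases "int p dvd ?y")
      case True
      then show ?thesis using x by (intro exI[of _ 0]) simp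
    next
      case y: False
      then obtain i where i: "[?y * i = 1] (mod int p)" using P.inverse_mod by blast
      define k where "k = i * (c * ?x + d * ?y)"
      have i': "int p dvd 1 - ?y * i" using i by (metis cong_iff_dvd_diff cong_sym)
      have "c * ?x + d * ?y - k * ?y = (c * ?x + d * ?y) * (1 - ?y * i)" by (simp add: k_def algebra_simps)
      then have 1: "int p dvd c * ?x + d * ?y - k * ?y" using i' by simp
      have "?y * (a * ?x + b * ?y - k * ?x) = ?x * (c * ?x + d * ?y - k * ?y) - ?q" by (simp add: algebra_simps power2_eq_square)
      then have "int p dvd ?y * (a * ?x + b * ?y - k * ?x)" using q 1 by (simp add: dvd_diff)
      then have "int p dvd a * ?x + b * ?y - k * ?x" using y unfolding p_dvd_mult by blast
      then show ?thesis using 1 by blast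
    qed
  qed
  then obtain k where "D v - sc2 k v \<in> P.K0" by (auto simp: mem_K0 mat2_def prod_sc_def)
  then show "D v \<in> P.line v" unfolding P.line_def by blast
qed

text \<open>These covectors form the kernel of the transpose of \<open>D\<close> modulo
  \<open>p\<close>, so the count is p^2, p or 1 according to the rank. In rank 1 the conditions from
  the two columns are proportional, and one nonzero column cuts out the kernel.\<close>

lemma card_annihilators:
  assumes "int p dvd a \<Longrightarrow> a = 0" "int p dvd b \<Longrightarrow> b = 0" "int p dvd c \<Longrightarrow> c = 0" "int p dvd d \<Longrightarrow> d = 0"
    and det: "int p dvd a * d - b * c \<Longrightarrow> a * d - b * c = 0"
  shows "card (add_coset P.K0 ` {\<eta>. \<forall>u. int p dvd dot2 \<eta> (D u)}) =
    (if a = 0 \<and> b = 0 \<and> c = 0 \<and> d = 0 then p\<^sup>2 else if a * d - b * c = 0 then p else 1)"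
proof -
  have S: "{\<eta>. \<forall>u. int p dvd dot2 \<eta> (D u)} = P.ker (a, c) \<inter> P.ker (b, d)"
  proof (intro equalityI subsetI CollectI allI)
    fix \<eta> assume "\<eta> \<in> {\<eta>. \<forall>u. int p dvd dot2 \<eta> (D u)}"
    then have "int p dvd dot2 \<eta> (D (1, 0))" "int p dvd dot2 \<eta> (D (0, 1))" by blast+
    then show "\<eta> \<in> P.ker (a, c) \<inter> P.ker (b, d)" by (simp add: prod_dot_def mat2_def mem_ker mult.commute)
  next
    fix \<eta> u assume "\<eta> \<in> P.ker (a, c) \<inter> P.ker (b, d)"
    moreover have "dot2 \<eta> (D u) = fst u * (a * fst \<eta> + c * snd \<eta>) + snd u * (b * fst \<eta> + d * snd \<eta>)"
      by (simp add: prod_dot_def mat2_def algebra_simps)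
    ultimately show "int p dvd dot2 \<eta> (D u)" by (simp add: mem_ker)
  qed
  show ?thesis
  proof (cases "a = 0 \<and> b = 0 \<and> c = 0 \<and> d = 0")
    case True
    then have "P.ker (a, c) \<inter> P.ker (b, d) = UNIV" by (auto simp: mem_ker)
    then show ?thesis unfolding S using True P.card_cosets by simp
  next
    case nz: False
    show ?thesis
    proof (cases "a * d - b * c = 0")
      case True
      then have ad: "a * d = b * c" by simp
      have "\<exists>r. r \<notin> P.K0 \<and> P.ker (a, c) \<inter> P.ker (b, d) = P.ker r"
      proof (cases "a = 0 \<and> c = 0")
        case True
        then have "P.ker (a, c) = UNIV" by (auto simp: mem_ker)
        moreover have "(b, d) \<notin> P.K0" using nz True assms by (auto simp: mem_K0)
        ultimately show ?thesis by auto
      next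
        case False
        then have ac: "\<not> (int p dvd a \<and> int p dvd c)" using assms by blast
        have "v \<in> P.ker (b, d)" if "v \<in> P.ker (a, c)" for v
        proof -
          have "a * (b * fst v + d * snd v) = b * a * fst v + (a * d) * snd v" by (simp add: algebra_simps)
          also have "\<dots> = b * (a * fst v + c * snd v)" unfolding ad by (simp add: algebra_simps)
          finally have "a * (b * fst v + d * snd v) = b * (a * fst v + c * snd v)" .
          moreover have "c * (b * fst v + d * snd v) = d * (a * fst v + c * snd v)"
          proof -
            have "d * (a * fst v + c * snd v) = (a * d) * fst v + d * c * snd v" by (simp add: algebra_simps)
            also have "\<dots> = c * (b * fst v + d * snd v)" unfolding ad by (simp add: algebra_simps)
            finally show ?thesis ..
          qed
          ultimately have "int p dvd a * (b * fst v + d * snd v)" "int p dvd c * (b * fst v + d * snd v)"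
            using that by (simp_all add: mem_ker)
          then show ?thesis using ac unfolding p_dvd_mult mem_ker by blast
        qed
        moreover have "(a, c) \<notin> P.K0" using ac by (simp add: mem_K0)
        ultimately show ?thesis by blast
      qed
      then obtain r where "r \<notin> P.K0" "P.ker (a, c) \<inter> P.ker (b, d) = P.ker r" by blast
      then show ?thesis unfolding S if_not_P[OF nz] if_P[OF True] using card_ker by simp
    next
      case False
      have pdet: "\<not> int p dvd a * d - b * c" using det False by blast
      have "P.ker (a, c) \<inter> P.ker (b, d) = P.K0"
      proof (intro equalityI subsetI)
        fix v assume "v \<in> P.ker (a, c) \<inter> P.ker (b, d)"
        then have 1: "int p dvd a * fst v + c * snd v" "int p dvd b * fst v + d * snd v" by (simp_all add: mem_ker)
        have eq: "(a * d - b * c) * fst v = d * (a * fst v + c * snd v) - c * (b * fst v + d * snd v)"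
          "(a * d - b * c) * snd v = a * (b * fst v + d * snd v) - b * (a * fst v + c * snd v)" by (simp_all add: algebra_simps)
        have "int p dvd (a * d - b * c) * fst v" "int p dvd (a * d - b * c) * snd v" unfolding eq by (intro dvd_diff dvd_mult 1)+
        then show "v \<in> P.K0" using pdet unfolding p_dvd_mult mem_K0 by blast
      qed (auto simp: mem_K0 mem_ker)
      then show ?thesis unfolding S if_not_P[OF nz] if_not_P[OF False] using P.card_cosets_K0 by simp
    qed
  qed
qed

lemma subalgebras_1: "count_lattices Subalgebras S.SC S.br p 1 = (p * form_zeros b (d - a) (- c) p - 1) div (p - 1)"
proof -
  have "form_zeros b (d - a) (- c) p = card (add_coset P.K0 ` {\<eta>. S.eigen_functional \<eta>})"
    unfolding eigen_iff form_zeros_def P.K0_def ..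
  then show ?thesis using prime_quot_eq[OF prime_p S.subalgebras_index_p] by simp
qed

lemma subalgebras_2: "count_lattices Subalgebras S.SC S.br p 2 = (p ^ 3 - 1) div (p - 1)"
  using prime_quot_eq[OF prime_p S.subalgebras_lines] by (simp add: power3_eq_cube mult.assoc)

lemma ideals_1: "count_lattices Ideals S.SC S.br p 1 = (p * card (add_coset P.K0 ` {\<eta>. \<forall>u. int p dvd dot2 \<eta> (D u)}) - 1) div (p - 1)"
  by (rule prime_quot_eq[OF prime_p S.ideals_index_p])

lemma ideals_2:
  assumes "int p dvd a \<Longrightarrow> a = 0" "int p dvd b \<Longrightarrow> b = 0" "int p dvd c \<Longrightarrow> c = 0" "int p dvd d \<Longrightarrow> d = 0"
  shows "count_lattices Ideals S.SC S.br p 2 =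
    (if a = 0 \<and> b = 0 \<and> c = 0 \<and> d = 0 then p ^ 3 - 1 else form_zeros c (d - a) (- b) p - 1) div (p - 1)"
proof (cases "a = 0 \<and> b = 0 \<and> c = 0 \<and> d = 0")
  case True
  then have "D u \<in> P.K0" for u by (simp add: mem_K0 mat2_def)
  then show ?thesis using prime_quot_eq[OF prime_p S.ideals_lines_trivial] True by (simp add: power3_eq_cube mult.assoc)
next
  case False
  have "\<exists>u. D u \<notin> P.K0"
  proof (rule ccontr)
    assume "\<not> (\<exists>u. D u \<notin> P.K0)"
    then have "D (1, 0) \<in> P.K0" "D (0, 1) \<in> P.K0" by blast+
    then show False using False assms by (simp add: mem_K0 mat2_def)
  qed
  then obtain u where "D u \<notin> P.K0" ..
  then have "count_lattices Ideals S.SC S.br p 2 = (card (add_coset P.K0 ` {v. D v \<in> P.line v}) - 1) div (p - 1)"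
    by (rule prime_quot_eq[OF prime_p S.ideals_lines])
  also have "card (add_coset P.K0 ` {v. D v \<in> P.line v}) = form_zeros c (d - a) (- b) p"
    unfolding line_iff form_zeros_def P.K0_def ..
  finally show ?thesis using False by auto
qed

end

lemma large_prime_dvd: "int p dvd x \<Longrightarrow> nat \<bar>x\<bar> < p \<Longrightarrow> x = 0"
  using dvd_imp_le_int[of x "int p"] by linarith

text \<open>The function \<open>F\<close> stands for the passage from the number of zeros of a binary form to the number of
  sublattices that it parametrises.\<close>

lemma porc_count_form_zeros:
  assumes "porc_count (\<lambda>p. F p (p\<^sup>2))" "porc_count (\<lambda>p. F p p)" "porc_count (\<lambda>p. F p (2 * p - 1))" "porc_count (\<lambda>p. F p 1)"
  shows "porc_count (\<lambda>p. F p (form_zeros A B C p))"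
proof -
  define g where "g p = (if A = 0 \<and> B = 0 \<and> C = 0 then F p (p\<^sup>2) else if B\<^sup>2 - 4 * A * C = 0 then F p p
      else if Legendre (B\<^sup>2 - 4 * A * C) (int p) = 1 then F p (2 * p - 1) else F p 1)" for p
  have "porc_count g"
  proof (cases "A = 0 \<and> B = 0 \<and> C = 0")
    case True
    then have "g = (\<lambda>p. F p (p\<^sup>2))" unfolding g_def[abs_def] by simp
    then show ?thesis using assms(1) by simp
  next
    case nz: False
    show ?thesis
    proof (cases "B\<^sup>2 - 4 * A * C = 0")
      case True
      then have "g = (\<lambda>p. F p p)" unfolding g_def[abs_def] using nz by auto
      then show ?thesis using assms(2) by simp
    next
      case False
      have "g = (\<lambda>p. if Legendre (B\<^sup>2 - 4 * A * C) (int p) = 1 then F p (2 * p - 1) else F p 1)"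
        unfolding g_def[abs_def] if_not_P[OF nz] if_not_P[OF False] ..
      then show ?thesis using porc_count_Legendre[OF False assms(3,4)] by simp
    qed
  qed
  then show ?thesis
  proof (rule porc_count_cong)
    fix p assume p: "prime p" "p > 2 + nat \<bar>A\<bar> + nat \<bar>B\<bar> + nat \<bar>C\<bar> + nat \<bar>B\<^sup>2 - 4 * A * C\<bar>"
    interpret plane_mod p by standard (rule p)
    note large = large_prime_dvd[of p]
    have "form_zeros A B C p = (if A = 0 \<and> B = 0 \<and> C = 0 then p\<^sup>2 else if B\<^sup>2 - 4 * A * C = 0 then p
      else if Legendre (B\<^sup>2 - 4 * A * C) (int p) = 1 then 2 * p - 1 else 1)"
      by (rule form_zeros_eq) (use p in \<open>auto dest: large\<close>)
    then show "F p (form_zeros A B C p) = g p" unfolding g_def by auto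
  qed
qed

lemma porc_count_quot:
  fixes q :: "rat poly"
  assumes "\<And>p. p > 1 \<Longrightarrow> f p = k p * (p - 1)" and "\<And>p. of_nat (k p) = poly q (of_nat p)"
  shows "porc_count (\<lambda>p. f p div (p - 1))"
proof (rule porc_count_poly)
  fix p :: nat assume p: "p > 1"
  then show "rat_of_nat (f p div (p - 1)) = poly q (of_nat p)" using assms by simp
qed

text \<open>The four possible numbers e = p^2, p, 2 p - 1, 1 of zeros, inserted into (p e - 1) / (p
  - 1) for hyperplanes and (e - 1) / (p - 1) for lines, and the number of points of the projective
  plane.\<close>

lemma porc_count_quots:
  "porc_count (\<lambda>p. (p * p\<^sup>2 - 1) div (p - 1))" "porc_count (\<lambda>p. (p * p - 1) div (p - 1))"
  "porc_count (\<lambda>p. (p * (2 * p - 1) - 1) div (p - 1))" "porc_count (\<lambda>p. (p * 1 - 1) div (p - 1))"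
  "porc_count (\<lambda>p. (p\<^sup>2 - 1) div (p - 1))" "porc_count (\<lambda>p. (p - 1) div (p - 1))"
  "porc_count (\<lambda>p. (2 * p - 1 - 1) div (p - 1))" "porc_count (\<lambda>p. (1 - 1) div (p - 1))"
  "porc_count (\<lambda>p. (p ^ 3 - 1) div (p - 1))"
proof -
  have eq: "p * p\<^sup>2 - 1 = (p\<^sup>2 + p + 1) * (p - 1)" "p * p - 1 = (p + 1) * (p - 1)" "p * (2 * p - 1) - 1 = (2 * p + 1) * (p - 1)"
    "p\<^sup>2 - 1 = (p + 1) * (p - 1)" "2 * p - 1 - 1 = 2 * (p - 1)" "p ^ 3 - 1 = (p\<^sup>2 + p + 1) * (p - 1)"
    if p: "p > 1" for p :: nat
  proof -
    obtain m where "p = Suc m" using p by (cases p) auto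
    then show "p * p\<^sup>2 - 1 = (p\<^sup>2 + p + 1) * (p - 1)" "p * p - 1 = (p + 1) * (p - 1)" "p * (2 * p - 1) - 1 = (2 * p + 1) * (p - 1)"
      "p\<^sup>2 - 1 = (p + 1) * (p - 1)" "2 * p - 1 - 1 = 2 * (p - 1)" "p ^ 3 - 1 = (p\<^sup>2 + p + 1) * (p - 1)"
      by (simp_all add: algebra_simps power2_eq_square power3_eq_cube)
  qed
  note q = porc_count_quot
  show "porc_count (\<lambda>p. (p * p\<^sup>2 - 1) div (p - 1))"
    by (rule q[where k = "\<lambda>p. p\<^sup>2 + p + 1" and q = "[:1, 1, 1:]"], rule eq) (simp_all add: algebra_simps power2_eq_square)
  show "porc_count (\<lambda>p. (p ^ 3 - 1) div (p - 1))"
    by (rule q[where k = "\<lambda>p. p\<^sup>2 + p + 1" and q = "[:1, 1, 1:]"], rule eq) (simp_all add: algebra_simps power2_eq_square)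
  show "porc_count (\<lambda>p. (p * p - 1) div (p - 1))"
    by (rule q[where k = "\<lambda>p. p + 1" and q = "[:1, 1:]"], rule eq) simp_all
  show "porc_count (\<lambda>p. (p\<^sup>2 - 1) div (p - 1))"
    by (rule q[where k = "\<lambda>p. p + 1" and q = "[:1, 1:]"], rule eq) simp_all
  show "porc_count (\<lambda>p. (p * (2 * p - 1) - 1) div (p - 1))"
    by (rule q[where k = "\<lambda>p. 2 * p + 1" and q = "[:1, 2:]"], rule eq) simp_all
  show "porc_count (\<lambda>p. (2 * p - 1 - 1) div (p - 1))"
    by (rule q[where k = "\<lambda>p. 2" and q = "[:2:]"], rule eq) simp_all
  show "porc_count (\<lambda>p. (p * 1 - 1) div (p - 1))"
    by (rule q[where k = "\<lambda>p. 1" and q = "[:1:]"]) simp_all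
  show "porc_count (\<lambda>p. (p - 1) div (p - 1))"
    by (rule q[where k = "\<lambda>p. 1" and q = "[:1:]"]) simp_all
  show "porc_count (\<lambda>p. (1 - 1) div (p - 1))"
    by (rule q[where k = "\<lambda>p. 0" and q = "0"]) simp_all
qed

lemma porc_count_const: "porc_count (\<lambda>p. k)"
  by (rule porc_count_poly[of _ _ "[:of_nat k:]"]) simp

theorem porc_semi_3:
  assumes "i \<le> 3"
  shows "porc_count (\<lambda>p. count_lattices star (prod_sc (*) sc2) (semi_br sc2 (mat2 a b c d)) p i)"
proof -
  let ?f = "\<lambda>p. count_lattices star (prod_sc (*) sc2) (semi_br sc2 (mat2 a b c d)) p i"
  have loc: "plane_semi p" if "prime p" for p using that by (intro plane_semi.intro plane_mod.intro)
  consider "i = 0" | "i = 3" | "i = 1" "star = Subalgebras" | "i = 1" "star = Ideals" | "i = 2" "star = Subalgebras" | "i = 2" "star = Ideals"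
  proof -
    have "i = 0 \<or> i = 1 \<or> i = 2 \<or> i = 3" using assms by linarith
    then show ?thesis using that by (cases star) blast+
  qed
  then show ?thesis
  proof cases
    case 1
    have "?f p = 1" if "prime p" for p
    proof -
      interpret plane_semi p a b c d by (rule loc[OF that])
      show ?thesis using S.W.count_lattices_0 1 by simp
    qed
    then show ?thesis using porc_count_cong[OF porc_count_const[of 1], of 0] by simp
  next
    case 2
    have "?f p = 1" if "prime p" for p
    proof -
      interpret plane_semi p a b c d by (rule loc[OF that])
      show ?thesis using S.W.count_lattices_top[where br = S.br, OF S.br_bilinear(4)] 2 by (simp add: numeral_3_eq_3)
    qed
    then show ?thesis using porc_count_cong[OF porc_count_const[of 1], of 0] by simp
  next
    case 3
    show ?thesis
    proof (rule porc_count_cong[OF porc_count_form_zeros[of "\<lambda>p e. (p * e - 1) div (p - 1)" b "d - a" "- c", OF porc_count_quots(1-4)]])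
      fix p :: nat assume "prime p"
      then interpret plane_semi p a b c d by (rule loc)
      show "?f p = (p * form_zeros b (d - a) (- c) p - 1) div (p - 1)" using subalgebras_1 3 by simp
    qed
  next
    case 4
    define e where "e p = (if a = 0 \<and> b = 0 \<and> c = 0 \<and> d = 0 then p\<^sup>2 else if a * d - b * c = 0 then p else 1)" for p :: nat
    have "porc_count (\<lambda>p. (p * e p - 1) div (p - 1))"
      using porc_count_quots(1,2,4) unfolding e_def
      by (cases "a = 0 \<and> b = 0 \<and> c = 0 \<and> d = 0"; cases "a * d - b * c = 0") (simp_all only: if_True if_False simp_thms)
    then show ?thesis
    proof (rule porc_count_cong)
      fix p assume p: "prime p" "p > nat \<bar>a\<bar> + nat \<bar>b\<bar> + nat \<bar>c\<bar> + nat \<bar>d\<bar> + nat \<bar>a * d - b * c\<bar>"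
      interpret plane_semi p a b c d by (rule loc[OF p(1)])
      have "card (add_coset P.K0 ` {\<eta>. \<forall>u. int p dvd dot2 \<eta> (D u)}) = e p"
        unfolding e_def by (rule card_annihilators) (use p in \<open>auto dest: large_prime_dvd[of p]\<close>)
      then show "?f p = (p * e p - 1) div (p - 1)" using ideals_1 4 by simp
    qed
  next
    case 5
    show ?thesis
    proof (rule porc_count_cong[OF porc_count_quots(9)])
      fix p :: nat assume "prime p"
      then interpret plane_semi p a b c d by (rule loc)
      show "?f p = (p ^ 3 - 1) div (p - 1)" using subalgebras_2 5 by simp
    qed
  next
    case 6
    define g where "g p = (if a = 0 \<and> b = 0 \<and> c = 0 \<and> d = 0 then p ^ 3 - 1 else form_zeros c (d - a) (- b) p - 1) div (p - 1)" for p
    have "porc_count g"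
      using porc_count_quots(9) porc_count_form_zeros[of "\<lambda>p e. (e - 1) div (p - 1)" c "d - a" "- b", OF porc_count_quots(5-8)]
      unfolding g_def[abs_def] by (cases "a = 0 \<and> b = 0 \<and> c = 0 \<and> d = 0") (simp_all only: if_True if_False simp_thms)
    then show ?thesis
    proof (rule porc_count_cong)
      fix p assume p: "prime p" "p > nat \<bar>a\<bar> + nat \<bar>b\<bar> + nat \<bar>c\<bar> + nat \<bar>d\<bar>"
      interpret plane_semi p a b c d by (rule loc[OF p(1)])
      have "count_lattices Ideals S.SC S.br p 2 = g p"
        unfolding g_def by (rule ideals_2) (use p in \<open>auto dest: large_prime_dvd[of p]\<close>)
      then show "?f p = g p" using 6 by simp
    qed
  qed
qed

text \<open>On an ideal of rank one the derivation is a scalar. Every hyperplane is then a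
  subalgebra, and for ideals it matters only whether the scalar is 0.\<close>

theorem porc_semi_2:
  assumes "i \<le> 2"
  shows "porc_count (\<lambda>p. count_lattices star (prod_sc (*) (*)) (semi_br (*) ((*) \<delta>)) p i)"
proof -
  let ?f = "\<lambda>p. count_lattices star (prod_sc (*) (*)) (semi_br (*) ((*) \<delta>)) p i"
  have loc: "semi (*) (*) 1 p ((*) \<delta>)" if "prime p" for p
    using that by (intro semi.intro zlattice_mod.intro zlattice_int zlattice_mod_axioms.intro semi_axioms.intro) (simp_all add: algebra_simps)
  consider "i = 0" | "i = 2" | "i = 1" "star = Subalgebras" | "i = 1" "star = Ideals"
  proof -
    have "i = 0 \<or> i = 1 \<or> i = 2" using assms by linarith
    then show ?thesis using that by (cases star) blast+
  qed
  then show ?thesis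
  proof cases
    case 1
    have "?f p = 1" if "prime p" for p
    proof -
      interpret semi "(*)" "(*)" 1 p "(*) \<delta>" by (rule loc[OF that])
      show ?thesis using W.count_lattices_0 1 by simp
    qed
    then show ?thesis using porc_count_cong[OF porc_count_const[of 1], of 0] by simp
  next
    case 2
    have "?f p = 1" if "prime p" for p
    proof -
      interpret semi "(*)" "(*)" 1 p "(*) \<delta>" by (rule loc[OF that])
      show ?thesis using W.count_lattices_top[where br = br, OF br_bilinear(4)] 2 by (simp add: numeral_2_eq_2)
    qed
    then show ?thesis using porc_count_cong[OF porc_count_const[of 1], of 0] by simp
  next
    case 3
    show ?thesis
    proof (rule porc_count_cong[OF porc_count_quots(2)])
      fix p :: nat assume p: "prime p"
      interpret semi "(*)" "(*)" 1 p "(*) \<delta>" by (rule loc[OF p])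
      have "{\<eta>. eigen_functional \<eta>} = UNIV" by (auto simp: eigen_functional_def mult.left_commute[of _ \<delta>])
      then have "?f p * (p - 1) = p * p - 1" using subalgebras_index_p card_cosets 3 by simp
      then show "?f p = (p * p - 1) div (p - 1)" by (rule prime_quot_eq[OF p])
    qed
  next
    case 4
    define e where "e p = (if \<delta> = 0 then p else 1)" for p :: nat
    have "porc_count (\<lambda>p. (p * e p - 1) div (p - 1))"
      using porc_count_quots(2,4) unfolding e_def by (cases "\<delta> = 0") (simp_all only: if_True if_False simp_thms)
    then show ?thesis
    proof (rule porc_count_cong)
      fix p assume pr: "prime p" "p > nat \<bar>\<delta>\<bar>"
      interpret semi "(*)" "(*)" 1 p "(*) \<delta>" by (rule loc[OF pr(1)])
      have "card (add_coset K0 ` {\<eta>. \<forall>u. int p dvd \<eta> * (\<delta> * u)}) = e p"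
      proof (cases "\<delta> = 0")
        case True
        then show ?thesis using card_cosets by (simp add: e_def)
      next
        case False
        then have d: "\<not> int p dvd \<delta>" using large_prime_dvd pr(2) by blast
        have "(\<forall>u. int p dvd \<eta> * (\<delta> * u)) \<longleftrightarrow> int p dvd \<eta>" for \<eta>
        proof
          assume "\<forall>u. int p dvd \<eta> * (\<delta> * u)"
          then have "int p dvd \<eta> * (\<delta> * 1)" by blast
          then show "int p dvd \<eta>" using d pr(1) by (simp add: prime_dvd_mult_iff)
        qed simp
        then have "{\<eta>. \<forall>u. int p dvd \<eta> * (\<delta> * u)} = {\<eta>. int p dvd \<eta>}" by (rule Collect_cong)
        also have "\<dots> = K0" by (auto simp: K0_def dvd_def)
        finally show ?thesis using False card_cosets_K0 by (simp only: e_def if_False)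
      qed
      then have "?f p * (p - 1) = p * e p - 1" using ideals_index_p 4 by simp
      then show "?f p = (p * e p - 1) div (p - 1)" by (rule prime_quot_eq[OF pr(1)])
    qed
  qed
qed

section \<open>Coordinates\<close>

text \<open>Coordinates of a concrete lattice type indexed by a basis of the Lie ring; the functions
  are extensional to match the coefficient families in \<open>is_basis\<close>.\<close>

definition coeffs :: "(int \<Rightarrow> 'v \<Rightarrow> 'v) \<Rightarrow> 'b set \<Rightarrow> ('v::ab_group_add \<Rightarrow> 'b \<Rightarrow> int) \<Rightarrow> bool" where
  "coeffs sc B c \<longleftrightarrow> finite B \<and> bij_betw c UNIV (B \<rightarrow>\<^sub>E UNIV) \<and>
    (\<forall>x y. \<forall>b\<in>B. c (x + y) b = c x b + c y b) \<and> (\<forall>k x. \<forall>b\<in>B. c (sc k x) b = k * c x b)"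

lemma coeffs_empty: "coeffs (\<lambda>_ (x::num1). x) {} (\<lambda>_ _. undefined)"
  by (auto simp: coeffs_def bij_betw_def inj_on_def num1_eq_iff)

lemma coeffs_singleton: "coeffs (*) {b} (\<lambda>k. \<lambda>x\<in>{b}. k)"
proof -
  have "bij_betw (\<lambda>k. \<lambda>x\<in>{b}. k) (UNIV :: int set) ({b} \<rightarrow>\<^sub>E UNIV)"
    by (rule bij_betwI[where g = "\<lambda>f. f b"]) (auto simp: fun_eq_iff PiE_def extensional_def)
  then show ?thesis by (simp add: coeffs_def)
qed

lemma coeffs_insert:
  assumes c: "coeffs sc B c" and b: "b \<notin> B"
  shows "coeffs (prod_sc (*) sc) (insert b B) (\<lambda>x. (c (snd x))(b := fst x))"
proof -
  have bij: "bij_betw c UNIV (B \<rightarrow>\<^sub>E UNIV)" using c by (simp add: coeffs_def)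
  have ext: "c v \<in> B \<rightarrow>\<^sub>E UNIV" for v using bij by (auto simp: bij_betw_def)
  have inv: "inv_into UNIV c (c v) = v" for v using bij by (simp add: bij_betw_def inv_into_f_f)
  have "bij_betw (\<lambda>x. (c (snd x))(b := fst x)) UNIV (insert b B \<rightarrow>\<^sub>E UNIV)"
  proof (rule bij_betwI[where g = "\<lambda>f. (f b, inv_into UNIV c (restrict f B))"])
    show "(\<lambda>x. (c (snd x))(b := fst x)) \<in> UNIV \<rightarrow> (insert b B \<rightarrow>\<^sub>E UNIV)"
      using ext by (auto simp: PiE_def extensional_def)
    fix x :: "int \<times> 'a"
    have "restrict ((c (snd x))(b := fst x)) B = c (snd x)"
      using ext[of "snd x"] b by (auto simp: fun_eq_iff PiE_def extensional_def)
    then show "(((c (snd x))(b := fst x)) b, inv_into UNIV c (restrict ((c (snd x))(b := fst x)) B)) = x"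
      by (simp add: inv)
  next
    fix f :: "'b \<Rightarrow> int" assume f: "f \<in> insert b B \<rightarrow>\<^sub>E UNIV"
    have "restrict f B \<in> c ` UNIV" using bij by (simp add: bij_betw_def)
    then have "c (inv_into UNIV c (restrict f B)) = restrict f B" by (rule f_inv_into_f)
    then show "(c (snd (f b, inv_into UNIV c (restrict f B))))(b := fst (f b, inv_into UNIV c (restrict f B))) = f"
      using f by (auto simp: fun_eq_iff PiE_def extensional_def)
  qed simp
  then show ?thesis using c b by (auto simp: coeffs_def prod_sc_def)
qed

lemma card_image_cong_on:
  assumes "\<And>x y. x \<in> A \<Longrightarrow> y \<in> A \<Longrightarrow> f x = f y \<longleftrightarrow> g x = g y"
  shows "card (f ` A) = card (g ` A)"
proof -
  define h where "h c = f (SOME x. x \<in> A \<and> c = g x)" for c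
  have h: "h (g x) = f x" if "x \<in> A" for x
  proof -
    have "(SOME y. y \<in> A \<and> g x = g y) \<in> A \<and> g x = g (SOME y. y \<in> A \<and> g x = g y)"
      by (rule someI[of _ x]) (simp add: that)
    then show ?thesis unfolding h_def using assms that by metis
  qed
  have "inj_on h (g ` A)" by (rule inj_onI) (auto simp: h assms)
  then have "card (h ` g ` A) = card (g ` A)" by (rule card_image)
  moreover have "h ` g ` A = f ` A" unfolding image_image using h by (rule image_cong[OF refl])
  ultimately show ?thesis by simp
qed

text \<open>The parities of the coordinates separate the classes of L modulo 2 L. This relation does
  not mention the basis, so the number 2^(card B) of classes is an invariant, from which the rank is
  well defined.\<close>

lemma basis_parity:
  fixes L :: "(int, 'b, 'm) lie_alg_scheme"
  assumes L: "Module.module \<Z> L" and B: "is_basis \<Z> L B"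
  shows "\<exists>m :: 'b \<Rightarrow> 'b \<Rightarrow> int. (\<forall>x\<in>carrier L. \<forall>y\<in>carrier L. m x = m y \<longleftrightarrow> (\<exists>z\<in>carrier L. x = y \<oplus>\<^bsub>L\<^esub> 2 \<odot>\<^bsub>L\<^esub> z)) \<and>
    card (m ` carrier L) = 2 ^ card B"
proof -
  interpret M: Module.module \<Z> L by (rule L)
  have fin: "finite B" and sub: "B \<subseteq> carrier L" and bij: "bij_betw (M.lincomb B) (B \<rightarrow>\<^sub>E UNIV) (carrier L)"
    using B unfolding M.is_basis_iff by simp_all
  have cong: "M.lincomb B c = M.lincomb B d" if "\<And>b. b \<in> B \<Longrightarrow> c b = d b" for c d
    by (rule M.lincomb_cong[OF sub]) (use that in auto)
  have cl: "M.lincomb B c \<in> carrier L" for c by (rule M.lincomb_closed[OF sub]) simp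
  have lin: "M.lincomb B c \<oplus>\<^bsub>L\<^esub> 2 \<odot>\<^bsub>L\<^esub> M.lincomb B d = M.lincomb B (\<lambda>b. c b + 2 * d b)" for c d
    using M.lincomb_add[OF sub, of c "\<lambda>b. 2 * d b"] M.lincomb_smult[OF fin sub, of d 2] by simp
  define cf where "cf = inv_into (B \<rightarrow>\<^sub>E UNIV) (M.lincomb B)"
  have cf: "M.lincomb B (cf x) = x" if "x \<in> carrier L" for x
    unfolding cf_def using f_inv_into_f[of x "M.lincomb B" "B \<rightarrow>\<^sub>E UNIV"] bij that by (simp add: bij_betw_def)
  have cfl: "cf (M.lincomb B c) b = c b" if "b \<in> B" for c b
  proof -
    have "cf (M.lincomb B (restrict c B)) = restrict c B"
      unfolding cf_def by (rule inv_into_f_f) (use bij in \<open>simp_all add: bij_betw_def\<close>)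
    moreover have "M.lincomb B (restrict c B) = M.lincomb B c" by (rule cong) simp
    ultimately show ?thesis using that by simp
  qed
  define m where "m x = (\<lambda>b\<in>B. cf x b mod 2)" for x
  have 1: "m x = m y \<longleftrightarrow> (\<exists>z\<in>carrier L. x = y \<oplus>\<^bsub>L\<^esub> 2 \<odot>\<^bsub>L\<^esub> z)" if x: "x \<in> carrier L" and y: "y \<in> carrier L" for x y
  proof
    assume eq: "m x = m y"
    let ?z = "M.lincomb B (\<lambda>b. (cf x b - cf y b) div 2)"
    have "y \<oplus>\<^bsub>L\<^esub> 2 \<odot>\<^bsub>L\<^esub> ?z = M.lincomb B (\<lambda>b. cf y b + 2 * ((cf x b - cf y b) div 2))"
      using lin[of "cf y"] cf[OF y] by simp
    also have "\<dots> = M.lincomb B (cf x)"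
    proof (rule cong)
      fix b assume "b \<in> B"
      then have "cf x b mod 2 = cf y b mod 2" using fun_cong[OF eq, of b] by (simp add: m_def)
      then show "cf y b + 2 * ((cf x b - cf y b) div 2) = cf x b" by presburger
    qed
    finally show "\<exists>z\<in>carrier L. x = y \<oplus>\<^bsub>L\<^esub> 2 \<odot>\<^bsub>L\<^esub> z" using cl cf[OF x] by metis
  next
    assume "\<exists>z\<in>carrier L. x = y \<oplus>\<^bsub>L\<^esub> 2 \<odot>\<^bsub>L\<^esub> z"
    then obtain z where z: "z \<in> carrier L" "x = y \<oplus>\<^bsub>L\<^esub> 2 \<odot>\<^bsub>L\<^esub> z" by blast
    then have "x = M.lincomb B (\<lambda>b. cf y b + 2 * cf z b)" using lin[of "cf y" "cf z"] cf y by simp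
    then have "cf x b = cf y b + 2 * cf z b" if "b \<in> B" for b using cfl[OF that] by simp
    then show "m x = m y" by (auto simp: m_def fun_eq_iff)
  qed
  have "m ` carrier L = B \<rightarrow>\<^sub>E {0, 1}"
  proof (intro equalityI subsetI)
    fix f assume "f \<in> m ` carrier L"
    then show "f \<in> B \<rightarrow>\<^sub>E {0, 1}" by (auto simp: m_def)
  next
    fix f assume f: "f \<in> B \<rightarrow>\<^sub>E {0, 1 :: int}"
    have "m (M.lincomb B f) = f"
    proof
      fix b show "m (M.lincomb B f) b = f b"
        using f PiE_mem[OF f, of b] PiE_arb[OF f, of b] by (cases "b \<in> B") (auto simp: m_def cfl)
    qed
    then show "f \<in> m ` carrier L" using cl by (metis image_eqI)
  qed
  then have "card (m ` carrier L) = 2 ^ card B" using fin by (simp add: card_PiE numeral_2_eq_2)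
  then show ?thesis using 1 by (intro exI[of _ m] conjI ballI)
qed

lemma module_rank_eq:
  fixes L :: "(int, 'b, 'm) lie_alg_scheme"
  assumes L: "Module.module \<Z> L" and B: "is_basis \<Z> L B"
  shows "module_rank \<Z> L = card B"
  unfolding module_rank_def
proof (rule the_equality)
  show "\<exists>B'. is_basis \<Z> L B' \<and> card B' = card B" using B by blast
  fix n assume "\<exists>B'. is_basis \<Z> L B' \<and> card B' = n"
  then obtain B' where B': "is_basis \<Z> L B'" "card B' = n" by blast
  obtain m :: "'b \<Rightarrow> 'b \<Rightarrow> int" where
    m: "\<forall>x\<in>carrier L. \<forall>y\<in>carrier L. m x = m y \<longleftrightarrow> (\<exists>z\<in>carrier L. x = y \<oplus>\<^bsub>L\<^esub> 2 \<odot>\<^bsub>L\<^esub> z)" "card (m ` carrier L) = 2 ^ card B"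
    using basis_parity[OF L B] by (elim exE conjE)
  obtain m' :: "'b \<Rightarrow> 'b \<Rightarrow> int" where
    m': "\<forall>x\<in>carrier L. \<forall>y\<in>carrier L. m' x = m' y \<longleftrightarrow> (\<exists>z\<in>carrier L. x = y \<oplus>\<^bsub>L\<^esub> 2 \<odot>\<^bsub>L\<^esub> z)" "card (m' ` carrier L) = 2 ^ card B'"
    using basis_parity[OF L B'(1)] by (elim exE conjE)
  have "card (m ` carrier L) = card (m' ` carrier L)" by (rule card_image_cong_on) (simp only: m(1)[rule_format] m'(1)[rule_format])
  then show "n = card B" using m(2) m'(2) B'(2) by simp
qed

lemma lie_coords_exists:
  fixes L :: "(int, 'b, 'm) lie_alg_scheme" and c :: "'v::ab_group_add \<Rightarrow> 'b \<Rightarrow> int"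
  assumes L: "lie_algebra \<Z> L" and B: "is_basis \<Z> L B" and c: "coeffs sc B c" and z: "zlattice sc dot n"
  shows "\<exists>\<phi> br. lie_coords_lattice L \<phi> sc br dot n"
proof -
  interpret M: lie_algebra \<Z> L by (rule L)
  have fin: "finite B" and sub: "B \<subseteq> carrier L" and bij: "bij_betw (M.lincomb B) (B \<rightarrow>\<^sub>E UNIV) (carrier L)"
    using B unfolding M.is_basis_iff by simp_all
  have cong: "M.lincomb B c = M.lincomb B d" if "\<And>b. b \<in> B \<Longrightarrow> c b = d b" for c d
    by (rule M.lincomb_cong[OF sub]) (use that in auto)
  define \<phi> where "\<phi> x = M.lincomb B (c x)" for x
  have c': "bij_betw c UNIV (B \<rightarrow>\<^sub>E UNIV)" "\<And>x y b. b \<in> B \<Longrightarrow> c (x + y) b = c x b + c y b" "\<And>k x b. b \<in> B \<Longrightarrow> c (sc k x) b = k * c x b"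
    using c by (auto simp: coeffs_def)
  have \<phi>: "bij_betw \<phi> UNIV (carrier L)" using bij_betw_trans[OF c'(1) bij] by (simp add: \<phi>_def[abs_def] comp_def)
  define br where "br x y = inv_into UNIV \<phi> (bracket L (\<phi> x) (\<phi> y))" for x y
  have cl: "\<phi> x \<in> carrier L" for x using \<phi> by (auto simp: bij_betw_def)
  have "lie_coords L \<phi> sc br"
  proof (rule lie_coords.intro)
    show "lie_algebra \<Z> L" by (rule L)
    show "bij_betw \<phi> UNIV (carrier L)" by (rule \<phi>)
    fix x y k
    show "\<phi> (x + y) = \<phi> x \<oplus>\<^bsub>L\<^esub> \<phi> y"
      using M.lincomb_add[OF sub, of "c x" "c y"] cong[of "c (x + y)" "\<lambda>b. c x b + c y b"] c'(2) by (simp add: \<phi>_def)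
    show "\<phi> (sc k x) = k \<odot>\<^bsub>L\<^esub> \<phi> x"
      using M.lincomb_smult[OF fin sub, of "c x" k] cong[of "c (sc k x)" "\<lambda>b. k * c x b"] c'(3) by (simp add: \<phi>_def)
    show "\<phi> (br x y) = bracket L (\<phi> x) (\<phi> y)"
      unfolding br_def by (rule f_inv_into_f) (use \<phi> M.bracket_closed[OF cl cl] in \<open>simp add: bij_betw_def\<close>)
    assume "\<And>h :: 'v \<Rightarrow> int. (\<And>x y. h (x + y) = h x + h y) \<Longrightarrow> k dvd h x"
    then have "k dvd dot y x" for y using zlattice.dot_add[OF z] by blast
    then show "\<exists>z. x = sc k z" by (rule zlattice.separated[OF z])
  qed
  then show ?thesis using z lie_coords_lattice.intro by blast
qed

context lie_coords_lattice
begin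

lemma PORC_by_counts:
  assumes "module_rank \<Z> L = n" "\<And>i. i \<le> n \<Longrightarrow> porc_count (\<lambda>p. count_lattices star sc br p i)"
  shows "PORC star L"
proof (rule PORC_I)
  fix i assume "i \<le> module_rank \<Z> L"
  then show "porc_count (\<lambda>p. count_codim star (residue_ring (int p)) (lie_tensor L (residue_ring (int p))) i)"
    using porc_count_cong[OF assms(2)[of i], of 0] count_codim_eq assms(1) by simp
qed

lemma porc_extreme:
  assumes "i = 0 \<or> i = n" shows "porc_count (\<lambda>p. count_lattices star sc br p i)"
proof (rule porc_count_cong[OF porc_count_const[of 1]])
  fix p :: nat assume "prime p"
  then interpret P: zlattice_mod sc dot n p by (intro zlattice_mod.intro Z.zlattice_axioms zlattice_mod_axioms.intro)
  show "count_lattices star sc br p i = 1"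
    using assms P.count_lattices_0 P.count_lattices_top[where br = br, OF br_sc_right] by auto
qed

text \<open>Passing to a sublattice of finite index affects the counts only at the primes dividing
  \<open>d\<close>, which \<open>porc_count\<close> ignores.\<close>

lemma porc_change:
  assumes M: "\<And>x y. M (x + y) = M x + M y" "\<And>k x. M (sc k x) = sc k (M x)"
    and A: "\<And>x y. A (x + y) = A x + A y" "\<And>k x. A (sc k x) = sc k (A x)"
    and MA: "\<And>x. M (A x) = sc d x" "\<And>x. A (M x) = sc d x" and d: "d \<noteq> 0"
    and br': "\<And>x y. M (br' x y) = br (M x) (M y)"
    and count: "porc_count (\<lambda>p. count_lattices star sc br' p i)" and i: "i \<le> n"
  shows "porc_count (\<lambda>p. count_lattices star sc br p i)"
proof (rule porc_count_cong[OF count])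
  fix p assume p: "prime p" "p > nat \<bar>d\<bar>"
  then have "\<not> int p dvd d" using large_prime_dvd d by blast
  then show "count_lattices star sc br p i = count_lattices star sc br' p i"
    using count_lattices_change[where M = M and A = A and d = d and br = br and br' = br' and sc = sc and dot = dot,
      OF fp_model[OF p(1)] Z.zlattice_axioms M A MA _ br' i] by blast
qed

end

lemma PORC_rank_2:
  fixes L :: "(int, 'b, 'm) lie_alg_scheme"
  assumes co: "lie_coords_lattice L \<phi> sc2 br dot2 2" and rank: "module_rank \<Z> L = 2"
  shows "PORC star L"
proof -
  interpret lie_coords_lattice L \<phi> sc2 br dot2 2 by (rule co)
  define w where "w = br (1, 0) (0, 1)"
  define w1 where "w1 = fst w"
  define w2 where "w2 = snd w"
  have br_eq: "br x y = sc2 (fst x * snd y - fst y * snd x) w" for x y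
  proof -
    have anti: "br (0, 1) (1, 0) = - w"
    proof -
      have "br ((1, 0) + (0, 1)) ((1, 0) + (0, 1)) = br (1, 0) (1, 0) + br (0, 1) (1, 0) + (br (1, 0) (0, 1) + br (0, 1) (0, 1))"
        by (simp only: br_add_left br_add_right)
      then have "br (0, 1) (1, 0) + w = 0" by (simp only: br_self w_def add_0_left add_0_right)
      then show ?thesis by (simp only: eq_neg_iff_add_eq_0)
    qed
    have e: "x = sc2 (fst x) (1, 0) + sc2 (snd x) (0, 1)" for x by (simp add: prod_sc_def)
    have "br x y = br (sc2 (fst x) (1, 0) + sc2 (snd x) (0, 1)) (sc2 (fst y) (1, 0) + sc2 (snd y) (0, 1))"
      using e[of x] e[of y] by simp
    also have "\<dots> = sc2 (fst x * snd y - fst y * snd x) w"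
      by (simp only: br_add_left br_add_right br_sc_left br_sc_right br_self anti w_def[symmetric])
        (simp add: prod_eq_iff prod_sc_def algebra_simps)
    finally show ?thesis .
  qed
  have "porc_count (\<lambda>p. count_lattices star sc2 br p i)" if i: "i \<le> 2" for i
  proof (cases "w = 0")
    case True
    have "semi_br (*) ((*) 0) = br" by (auto simp: fun_eq_iff semi_br_def br_eq True prod_sc_def zero_prod_def)
    then show ?thesis using porc_semi_2[OF i, of star 0] by simp
  next
    case False
    define \<delta> where "\<delta> = w1\<^sup>2 + w2\<^sup>2"
    have \<delta>: "\<delta> \<noteq> 0" using False unfolding \<delta>_def w1_def w2_def by (simp add: sum_power2_eq_zero_iff prod_eq_iff)
    \<comment> \<open>The new basis consists of (w2, - w1) and \<open>w\<close>. Its determinant is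
      w1^2 + w2^2, so the bracket of the two vectors is \<open>w\<close> times this integer, and
      \<open>?A\<close> is the adjugate.\<close>
    let ?M = "\<lambda>x. (fst x * w2 + snd x * w1, - fst x * w1 + snd x * w2)"
    let ?A = "\<lambda>y. (fst y * w2 - snd y * w1, fst y * w1 + snd y * w2)"
    show ?thesis
    proof (rule porc_change[where M = ?M and A = ?A and d = \<delta> and br' = "semi_br (*) ((*) \<delta>)"])
      show "porc_count (\<lambda>p. count_lattices star sc2 (semi_br (*) ((*) \<delta>)) p i)" by (rule porc_semi_2[OF i])
    qed (use \<delta> i in \<open>simp_all add: br_eq prod_sc_def semi_br_def prod_eq_iff w1_def[symmetric] w2_def[symmetric] \<delta>_def algebra_simps power2_eq_square\<close>)
  qed
  then show ?thesis by (rule PORC_by_counts[OF rank])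
qed

section \<open>Normal form of a solvable Lie ring of rank three\<close>

abbreviation sc3 :: "int \<Rightarrow> int \<times> int \<times> int \<Rightarrow> int \<times> int \<times> int" where "sc3 \<equiv> prod_sc (*) sc2"

abbreviation dot3 :: "int \<times> int \<times> int \<Rightarrow> int \<times> int \<times> int \<Rightarrow> int" where "dot3 \<equiv> prod_dot (*) dot2"

lemma zlattice_3: "zlattice sc3 dot3 3"
  using zlattice_prod[OF zlattice_int zlattice_2] by (simp add: numeral_3_eq_3)

interpretation Z3: zlattice sc3 dot3 3 by (rule zlattice_3)

section \<open>Integral vector algebra in dimension three\<close>

definition cross :: "int \<times> int \<times> int \<Rightarrow> int \<times> int \<times> int \<Rightarrow> int \<times> int \<times> int" where
  "cross = (\<lambda>(x1, x2, x3) (y1, y2, y3). (x2 * y3 - x3 * y2, x3 * y1 - x1 * y3, x1 * y2 - x2 * y1))"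

lemma sc3_simp: "sc3 k (x, y, z) = (k * x, k * y, k * z)"
  by (simp add: prod_sc_def)

lemma dot3_simp: "dot3 (x, y, z) (u, v, w) = x * u + y * v + z * w"
  by (simp add: prod_dot_def)

lemma cross_simp: "cross (x1, x2, x3) (y1, y2, y3) = (x2 * y3 - x3 * y2, x3 * y1 - x1 * y3, x1 * y2 - x2 * y1)"
  by (simp add: cross_def)

lemmas v3_simps = sc3_simp dot3_simp cross_simp

lemma dot_cross_self:
  fixes x y :: "int \<times> int \<times> int"
  shows "dot3 x (cross x y) = 0" "dot3 y (cross x y) = 0" "dot3 (cross x y) x = 0" "dot3 (cross x y) y = 0"
  by (cases x; cases y; simp add: v3_simps algebra_simps)+

lemma cross_cross: "cross (cross x y) y = sc3 (dot3 x y) y - sc3 (dot3 y y) x"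
  by (cases x; cases y) (simp add: v3_simps algebra_simps)

lemma cross_swap: "cross y x = - cross x y"
  by (cases x; cases y) (simp add: v3_simps)

lemma dot_cross_cross: "dot3 (cross a b) (cross c d) = dot3 a c * dot3 b d - dot3 a d * dot3 b c"
  by (cases a; cases b; cases c; cases d) (simp add: v3_simps algebra_simps)

lemma dot3_self_eq_0: "dot3 x x = 0 \<longleftrightarrow> x = 0"
proof -
  have "a = 0 \<and> b = 0 \<and> c = 0" if "a * a + b * b + c * c = 0" for a b c :: int
  proof -
    have "0 \<le> a * a" "0 \<le> b * b" "0 \<le> c * c" by simp_all
    then have "a * a = 0 \<and> b * b = 0 \<and> c * c = 0" using that by linarith
    then show ?thesis by simp
  qed
  note sq = this
  obtain a b c where x: "x = (a, b, c)" by (cases x)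
  show ?thesis unfolding x v3_simps zero_prod_def prod.inject using sq[of a b c] by auto
qed

text \<open>Expansion of \<open>y\<close> in the frame \<open>u\<close>, \<open>w\<close>,
  \<open>cross u w\<close>, with the Gram determinant of u and w as common denominator so that all
  coefficients are integers.\<close>

lemma frame_expansion:
  "sc3 (dot3 u u * dot3 w w - dot3 u w * dot3 u w) y = sc3 (dot3 (cross u w) y) (cross u w)
    + (sc3 (dot3 w w * dot3 u y - dot3 u w * dot3 w y) u + sc3 (dot3 u u * dot3 w y - dot3 u w * dot3 u y) w)"
  by (cases u; cases w; cases y) (simp add: v3_simps algebra_simps)

lemma cramer:
  "sc3 (dot3 a (cross b c)) v = sc3 (dot3 v (cross b c)) a + (sc3 (dot3 v (cross c a)) b + sc3 (dot3 v (cross a b)) c)"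
  by (cases a; cases b; cases c; cases v) (simp add: v3_simps algebra_simps)

lemma cross_eq_0_dot:
  assumes "cross c b = 0" "dot3 \<psi> b = 0" "b \<noteq> 0" shows "dot3 \<psi> c = 0"
proof -
  have "dot3 \<psi> c * dot3 b b = 0" using dot_cross_cross[of \<psi> b c b] assms by (simp add: Z3.dot_zero)
  then show ?thesis using assms(3) dot3_self_eq_0 by simp
qed

lemma exists_orthogonal: "\<exists>\<psi>. \<psi> \<noteq> 0 \<and> dot3 \<psi> b = 0"
proof -
  obtain x y z where b: "b = (x, y, z)" by (cases b)
  show ?thesis
  proof (cases "x = 0 \<and> y = 0")
    case True
    then have "dot3 (1, 0, 0) b = 0" by (simp add: b v3_simps)
    then show ?thesis by (intro exI[of _ "(1, 0, 0)"]) (simp add: zero_prod_def)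
  next
    case False
    have "dot3 (y, - x, 0) b = 0" by (simp add: b v3_simps)
    then show ?thesis using False by (intro exI[of _ "(y, - x, 0)"]) (auto simp: zero_prod_def)
  qed
qed

text \<open>A nonzero cross product of two of the vectors is orthogonal to all three. If all cross
  products vanish, the vectors are parallel, and anything orthogonal to a nonzero one among them
  will do.\<close>

lemma det_zero_functional:
  assumes det: "dot3 a (cross b c) = 0"
  shows "\<exists>\<psi>. \<psi> \<noteq> 0 \<and> dot3 \<psi> a = 0 \<and> dot3 \<psi> b = 0 \<and> dot3 \<psi> c = 0"
proof -
  have det': "dot3 b (cross c a) = 0" "dot3 c (cross a b) = 0"
    using det by (cases a; cases b; cases c; simp add: v3_simps algebra_simps)+
  consider "cross b c \<noteq> 0" | "cross c a \<noteq> 0" | "cross a b \<noteq> 0" | "cross b c = 0" "cross c a = 0" "cross a b = 0" by blast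
  then show ?thesis
  proof cases
    case 1
    then show ?thesis using det dot_cross_self[where x = "b" and y = "c"] Z3.dot_commute[of a "cross b c"] by (intro exI[of _ "cross b c"]) simp
  next
    case 2
    then show ?thesis using det' dot_cross_self[where x = "c" and y = "a"] Z3.dot_commute[of b "cross c a"] by (intro exI[of _ "cross c a"]) simp
  next
    case 3
    then show ?thesis using det' dot_cross_self[where x = "a" and y = "b"] Z3.dot_commute[of c "cross a b"] by (intro exI[of _ "cross a b"]) simp
  next
    case 4
    then have swap: "cross c b = 0" "cross a c = 0" "cross b a = 0" using cross_swap[of c b] cross_swap[of a c] cross_swap[of b a] by simp_all
    have self: "cross x x = 0" for x by (cases x) (simp add: v3_simps zero_prod_def)
    show ?thesis
    proof (cases "a = 0 \<and> b = 0 \<and> c = 0")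
      case True
      obtain \<psi> where "\<psi> \<noteq> 0" "dot3 \<psi> 0 = 0" using exists_orthogonal by blast
      then show ?thesis using True by (intro exI[of _ \<psi>]) simp
    next
      case False
      then have "\<exists>e\<in>{a, b, c}. e \<noteq> 0" by blast
      then obtain e where e: "e \<in> {a, b, c}" "e \<noteq> 0" by blast
      obtain \<psi> where \<psi>: "\<psi> \<noteq> 0" "dot3 \<psi> e = 0" using exists_orthogonal by blast
      have "cross a e = 0" "cross b e = 0" "cross c e = 0" using e(1) 4 swap self[of a] self[of b] self[of c] by (auto simp del: split_paired_All)
      then show ?thesis using \<psi> e(2) cross_eq_0_dot by blast
    qed
  qed
qed

section \<open>Alternating brackets and Lie rings of rank three\<close>

locale bilinear_3 =
  fixes br :: "int \<times> int \<times> int \<Rightarrow> int \<times> int \<times> int \<Rightarrow> int \<times> int \<times> int"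
  assumes add_left: "br (x + y) z = br x z + br y z" and add_right: "br x (y + z) = br x y + br x z"
    and sc_left: "br (sc3 k x) y = sc3 k (br x y)" and sc_right: "br x (sc3 k y) = sc3 k (br x y)" and self: "br x x = 0"
begin

lemma anti: "br y x = - br x y"
proof -
  have "br (x + y) (x + y) = br x x + br y x + (br x y + br y y)" by (simp only: add_left add_right)
  then have "br y x + br x y = 0" by (simp only: self add_0_left add_0_right)
  then show ?thesis by (simp only: eq_neg_iff_add_eq_0)
qed

lemma expand: "br (sc3 x1 a + (sc3 x2 b + sc3 x3 c)) (sc3 y1 a + (sc3 y2 b + sc3 y3 c)) =
    sc3 (x2 * y3 - x3 * y2) (br b c) + (sc3 (x1 * y3 - x3 * y1) (br a c) + sc3 (x1 * y2 - x2 * y1) (br a b))"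
proof -
  obtain p1 p2 p3 q1 q2 q3 r1 r2 r3 where v: "br a b = (p1, p2, p3)" "br a c = (q1, q2, q3)" "br b c = (r1, r2, r3)"
    by (metis prod.exhaust)
  have "br b a = - (p1, p2, p3)" "br c a = - (q1, q2, q3)" "br c b = - (r1, r2, r3)"
    using anti[of b a] anti[of c a] anti[of c b] v by simp_all
  then show ?thesis
    by (simp only: add_left add_right sc_left sc_right self v) (simp add: v3_simps algebra_simps zero_prod_def)
qed

text \<open>An alternating bilinear map in dimension three factors through the cross product.
  \<open>N\<close> is the linear factor; its columns are the brackets of the basis vectors in cyclic
  order.\<close>

definition N where "N v = sc3 (fst v) (br (0, 1, 0) (0, 0, 1)) + (sc3 (fst (snd v)) (br (0, 0, 1) (1, 0, 0)) + sc3 (snd (snd v)) (br (1, 0, 0) (0, 1, 0)))"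

lemma br_eq_N: "br x y = N (cross x y)"
proof -
  have e: "x = sc3 (fst x) (1, 0, 0) + (sc3 (fst (snd x)) (0, 1, 0) + sc3 (snd (snd x)) (0, 0, 1))" for x
    by (cases x) (simp add: v3_simps)
  obtain x1 x2 x3 y1 y2 y3 where xy: "x = (x1, x2, x3)" "y = (y1, y2, y3)" by (metis prod.exhaust)
  obtain q1 q2 q3 where q: "br (1, 0, 0) (0, 0, 1) = (q1, q2, q3)" by (metis prod.exhaust)
  have "br x y = sc3 (x2 * y3 - x3 * y2) (br (0, 1, 0) (0, 0, 1)) + (sc3 (x1 * y3 - x3 * y1) (br (1, 0, 0) (0, 0, 1)) + sc3 (x1 * y2 - x2 * y1) (br (1, 0, 0) (0, 1, 0)))"
    using expand[of x1 "(1, 0, 0)" x2 "(0, 1, 0)" x3 "(0, 0, 1)" y1 y2 y3] e[of x] e[of y] by (simp add: xy)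
  then show ?thesis unfolding N_def xy cross_simp anti[of "(0, 0, 1)" "(1, 0, 0)"] q
    by (simp add: v3_simps algebra_simps)
qed

lemma N_linear: "N (x + y) = N x + N y" "N (sc3 k x) = sc3 k (N x)" "N (- x) = - N x" "N (x - y) = N x - N y"
  by (simp_all add: N_def prod_eq_iff prod_sc_def algebra_simps)

end

locale lie_3 = bilinear_3 +
  assumes jacobi: "br x (br y z) + br y (br z x) + br z (br x y) = 0"
begin

text \<open>All brackets lie in the plane orthogonal to \<open>\<psi>\<close>, and the cross product
  of two vectors of that plane is parallel to \<open>\<psi>\<close>. So the plane is abelian exactly
  when \<open>N \<psi>\<close> vanishes, and then \<open>\<psi>\<close> acts on it. Otherwise the
  plane is the nonabelian algebra of rank two, and an abelian ideal is obtained from N psi and a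
  corrected multiple of \<open>\<psi>\<close>.\<close>

lemma normal_form:
  assumes \<psi>: "\<psi> \<noteq> 0" and \<psi>_br: "\<And>x y. dot3 \<psi> (br x y) = 0"
  obtains M A d a b c e where "d \<noteq> 0" "\<And>x y. M (x + y) = M x + M y" "\<And>k x. M (sc3 k x) = sc3 k (M x)"
    "\<And>x y. A (x + y) = A x + A y" "\<And>k x. A (sc3 k x) = sc3 k (A x)"
    "\<And>x. M (A x) = sc3 d x" "\<And>x. A (M x) = sc3 d x"
    "\<And>x y. M (semi_br sc2 (mat2 a b c e) x y) = br (M x) (M y)"
proof -
  let ?N0 = "dot3 \<psi> \<psi>"
  have N0: "?N0 \<noteq> 0" using \<psi> dot3_self_eq_0 by blast
  have frame: "sc3 (?N0 * dot3 w w) y = sc3 (dot3 (cross \<psi> w) y) (cross \<psi> w) + (sc3 (dot3 w w * dot3 \<psi> y) \<psi> + sc3 (?N0 * dot3 w y) w)"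
    if "dot3 \<psi> w = 0" for w y using frame_expansion[of \<psi> w y] that by simp
  have comb: "br (sc3 (fst x) p + (sc3 (fst (snd x)) q + sc3 (snd (snd x)) r)) (sc3 (fst y) p + (sc3 (fst (snd y)) q + sc3 (snd (snd y)) r)) =
      sc3 (fst x * snd (snd y) - snd (snd x) * fst y) (br p r) + sc3 (fst x * fst (snd y) - fst (snd x) * fst y) (br p q)"
    if "br q r = 0" for p q r x y using expand[of "fst x" p "fst (snd x)" q "snd (snd x)" r "fst y" "fst (snd y)" "snd (snd y)"] that
    by (simp add: Z3.sc_zero_right)
  show ?thesis
  proof (cases "N \<psi> = 0")
    case True
    obtain h where h: "cross \<psi> h \<noteq> 0"
    proof -
      obtain p1 p2 p3 where p: "\<psi> = (p1, p2, p3)" by (cases \<psi>)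
      have "cross \<psi> (1, 0, 0) \<noteq> 0 \<or> cross \<psi> (0, 1, 0) \<noteq> 0" using \<psi> by (auto simp: p v3_simps zero_prod_def)
      then show ?thesis using that by blast
    qed
    define w where "w = cross \<psi> h"
    define g where "g = cross \<psi> w"
    let ?W = "dot3 w w"
    have W: "?W \<noteq> 0" using h dot3_self_eq_0 unfolding w_def by blast
    have \<psi>w: "dot3 \<psi> w = 0" "dot3 w \<psi> = 0" using dot_cross_self[where x = "\<psi>" and y = "h"] by (simp_all add: w_def)
    have orth: "dot3 \<psi> g = 0" "dot3 g \<psi> = 0" "dot3 w g = 0" "dot3 g w = 0" "dot3 g g = ?N0 * ?W"
      using dot_cross_self[where x = "\<psi>" and y = "w"] dot_cross_cross[of \<psi> w \<psi> w] \<psi>w by (simp_all add: g_def)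
    have wg: "br w g = 0"
    proof -
      have "cross w g = sc3 ?W \<psi>" unfolding g_def using cross_swap[of w "cross \<psi> w"] cross_cross[of \<psi> w] \<psi>w by (simp add: Z3.sc_zero)
      then show ?thesis using True by (simp add: br_eq_N N_linear Z3.sc_zero_right)
    qed
    let ?k = "?N0 * ?W"
    define P where "P = br \<psi> w"
    define Q where "Q = br \<psi> g"
    have fP: "sc3 ?k P = sc3 (dot3 g P) g + sc3 (?N0 * dot3 w P) w" "sc3 ?k Q = sc3 (dot3 g Q) g + sc3 (?N0 * dot3 w Q) w"
      using frame[OF \<psi>w(1), of P] frame[OF \<psi>w(1), of Q] \<psi>_br unfolding P_def Q_def g_def[symmetric] by (simp_all add: Z3.sc_zero)
    \<comment> \<open>The first basis vector is psi scaled by the Gram determinant \<open>?k\<close>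
      of psi and w, so that its brackets with w and g have integral coordinates in w and g, as
      \<open>fP\<close> shows.\<close>
    define M where "M x = sc3 (fst x) (sc3 ?k \<psi>) + (sc3 (fst (snd x)) w + sc3 (snd (snd x)) g)" for x
    define A where "A y = (dot3 \<psi> y, ?N0 * ?N0 * dot3 w y, ?N0 * dot3 g y)" for y
    show ?thesis
    proof (rule that[of "?N0 * ?k" M A "?N0 * dot3 w P" "?N0 * dot3 w Q" "dot3 g P" "dot3 g Q"])
      show "?N0 * ?k \<noteq> 0" using N0 W by simp
      show "M (x + y) = M x + M y" "M (sc3 k x) = sc3 k (M x)" for x y k
        by (simp_all add: M_def prod_eq_iff prod_sc_def algebra_simps)
      show "A (x + y) = A x + A y" "A (sc3 k x) = sc3 k (A x)" for x y k
        by (simp_all add: A_def Z3.dot_add Z3.dot_sc v3_simps algebra_simps)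
      show "M (A x) = sc3 (?N0 * ?k) x" for x
      proof -
        have "sc3 (?N0 * ?k) x = sc3 ?N0 (sc3 ?k x)" by (rule Z3.sc_mult)
        also have "\<dots> = M (A x)" unfolding frame[OF \<psi>w(1), of x] g_def[symmetric] M_def A_def
          by (simp add: prod_eq_iff prod_sc_def algebra_simps)
        finally show ?thesis ..
      qed
      show "A (M x) = sc3 (?N0 * ?k) x" for x
        by (cases x) (simp add: M_def A_def Z3.dot_add Z3.dot_sc orth \<psi>w v3_simps)
      show "M (semi_br sc2 (mat2 (?N0 * dot3 w P) (?N0 * dot3 w Q) (dot3 g P) (dot3 g Q)) x y) = br (M x) (M y)" for x y
      proof -
        have "br (M x) (M y) = sc3 (fst x * snd (snd y) - snd (snd x) * fst y) (sc3 ?k Q) + sc3 (fst x * fst (snd y) - fst (snd x) * fst y) (sc3 ?k P)"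
          unfolding M_def comb[OF wg] sc_left P_def Q_def ..
        then show ?thesis unfolding fP M_def
          by (simp add: semi_br_def mat2_def prod_eq_iff prod_sc_def algebra_simps)
      qed
    qed
  next
    case False
    \<comment> \<open>Now the plane is not abelian: \<open>w\<close> lies in it, and [g, w] is - W
      times w, so w spans its derived algebra rationally.\<close>
    define w where "w = N \<psi>"
    define g where "g = cross \<psi> w"
    let ?W = "dot3 w w"
    have W: "?W \<noteq> 0" using False dot3_self_eq_0 unfolding w_def by blast
    have \<psi>w: "dot3 \<psi> w = 0" "dot3 w \<psi> = 0"
      using \<psi>_br unfolding w_def N_def by (simp_all add: Z3.dot_add Z3.dot_sc Z3.dot_add_left Z3.dot_sc_left Z3.dot_commute[of _ \<psi>])
    have orth: "dot3 \<psi> g = 0" "dot3 g \<psi> = 0" "dot3 w g = 0" "dot3 g w = 0" "dot3 g g = ?N0 * ?W"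
      using dot_cross_self[where x = "\<psi>" and y = "w"] dot_cross_cross[of \<psi> w \<psi> w] \<psi>w by (simp_all add: g_def)
    have gw: "br g w = sc3 (- ?W) w"
    proof -
      have "cross g w = sc3 (- ?W) \<psi>" unfolding g_def using cross_cross[of \<psi> w] \<psi>w by (simp add: Z3.sc_zero Z3.sc_minus)
      then show ?thesis by (simp add: br_eq_N N_linear w_def)
    qed
    let ?k = "?N0 * ?W"
    have k: "?k \<noteq> 0" using N0 W by simp
    define P where "P = br \<psi> w"
    define Q where "Q = br \<psi> g"
    define \<beta> where "\<beta> = dot3 g P"
    define \<delta> where "\<delta> = ?N0 * dot3 w P"
    define \<alpha> where "\<alpha> = dot3 g Q"
    define \<gamma> where "\<gamma> = ?N0 * dot3 w Q"
    have fP: "sc3 ?k P = sc3 \<beta> g + sc3 \<delta> w" "sc3 ?k Q = sc3 \<alpha> g + sc3 \<gamma> w"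
      using frame[OF \<psi>w(1), of P] frame[OF \<psi>w(1), of Q] \<psi>_br unfolding P_def Q_def g_def[symmetric] \<alpha>_def \<beta>_def \<gamma>_def \<delta>_def
      by (simp_all add: Z3.sc_zero)
    \<comment> \<open>A derivation of the nonabelian algebra of rank two has its image in the
      derived algebra. Explicitly, the Jacobi identity for psi, g and w makes the g-components of
      [psi, w] and [psi, g] vanish.\<close>
    have zero: "\<beta> = 0 \<and> \<alpha> = 0"
    proof -
      have "sc3 ?k (br \<psi> (br g w) + br g (br w \<psi>) + br w (br \<psi> g)) = 0" unfolding jacobi by (rule Z3.sc_zero_right)
      moreover have "sc3 ?k (br \<psi> (br g w)) = sc3 (- ?W) (sc3 ?k P)"
        unfolding gw sc_right P_def by (simp only: Z3.sc_mult[symmetric] mult.commute)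
      moreover have "sc3 ?k (br g (br w \<psi>)) = - br g (sc3 ?k P)" unfolding anti[of w \<psi>] P_def
        using sc_right[of g "-1" "br \<psi> w"] sc_right[of g ?k "br \<psi> w"] by (simp add: Z3.sc_minus Z3.sc_one Z3.sc_minus_right)
      moreover have "sc3 ?k (br w (br \<psi> g)) = br w (sc3 ?k Q)" unfolding Q_def sc_right ..
      ultimately have "sc3 (- ?W) (sc3 \<beta> g + sc3 \<delta> w) - br g (sc3 \<beta> g + sc3 \<delta> w) + br w (sc3 \<alpha> g + sc3 \<gamma> w) = 0"
        by (simp add: Z3.sc_dist fP)
      moreover have "br w g = sc3 ?W w" using anti[of w g] gw by (simp add: Z3.sc_minus)
      ultimately have z: "sc3 (- ?W * \<beta>) g + sc3 (\<alpha> * ?W) w = 0"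
        by (simp add: add_right sc_right self gw Z3.sc_zero_right Z3.sc_minus Z3.sc_dist Z3.sc_minus_right Z3.sc_mult[symmetric] mult.commute)
      have "dot3 g (sc3 (- ?W * \<beta>) g + sc3 (\<alpha> * ?W) w) = 0" "dot3 w (sc3 (- ?W * \<beta>) g + sc3 (\<alpha> * ?W) w) = 0"
        unfolding z by (simp_all add: Z3.dot_zero)
      then show ?thesis using N0 W unfolding Z3.dot_add Z3.dot_sc orth by simp
    qed
    have fP': "sc3 ?k P = sc3 \<delta> w" "sc3 ?k Q = sc3 \<gamma> w" using fP zero by (simp_all add: Z3.sc_zero)
    \<comment> \<open>Both psi and g act on \<open>w\<close> by scalars; this combination cancels
      them. So z and w commute, and g maps both into multiples of w, which accounts for the zero
      first row of the matrix below.\<close>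
    define z where "z = sc3 (?k * ?W) \<psi> + sc3 \<delta> g"
    have zw: "br z w = 0"
    proof -
      have "br z w = sc3 (?k * ?W) P + sc3 \<delta> (sc3 (- ?W) w)" unfolding z_def add_left sc_left gw P_def ..
      also have "sc3 (?k * ?W) P = sc3 ?W (sc3 ?k P)" by (simp only: Z3.sc_mult[symmetric] mult.commute)
      finally show ?thesis unfolding fP' by (simp add: Z3.sc_mult[symmetric] Z3.sc_minus Z3.sc_minus_right mult.commute)
    qed
    have gz: "br g z = sc3 (- ?W * \<gamma>) w"
    proof -
      have "br g z = sc3 (?k * ?W) (- Q)" unfolding z_def add_right sc_right self anti[of g \<psi>] Q_def by (simp add: Z3.sc_zero_right)
      also have "\<dots> = - sc3 ?W (sc3 ?k Q)" by (simp only: Z3.sc_mult[symmetric] Z3.sc_minus_right mult.commute)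
      finally show ?thesis unfolding fP' by (simp add: Z3.sc_mult[symmetric] Z3.sc_minus)
    qed
    define M where "M x = sc3 (fst x) g + (sc3 (fst (snd x)) z + sc3 (snd (snd x)) w)" for x
    define A where "A y = (?k * dot3 g y - \<delta> * dot3 \<psi> y, dot3 \<psi> y, ?k * ?N0 * dot3 w y)" for y
    show ?thesis
    proof (rule that[of "?k * ?k" M A 0 0 "- ?W * \<gamma>" "- ?W"])
      show "?k * ?k \<noteq> 0" using k by simp
      show "M (x + y) = M x + M y" "M (sc3 k x) = sc3 k (M x)" for x y k
        by (simp_all add: M_def prod_eq_iff prod_sc_def algebra_simps)
      show "A (x + y) = A x + A y" "A (sc3 k x) = sc3 k (A x)" for x y k
        by (simp_all add: A_def Z3.dot_add Z3.dot_sc v3_simps algebra_simps)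
      show "M (A x) = sc3 (?k * ?k) x" for x
      proof -
        have "sc3 (?k * ?k) x = sc3 ?k (sc3 ?k x)" by (rule Z3.sc_mult)
        also have "\<dots> = M (A x)" unfolding frame[OF \<psi>w(1), of x] g_def[symmetric] M_def A_def z_def
          by (simp add: prod_eq_iff prod_sc_def algebra_simps)
        finally show ?thesis ..
      qed
      show "A (M x) = sc3 (?k * ?k) x" for x
        by (cases x) (simp add: M_def A_def z_def Z3.dot_add Z3.dot_sc orth \<psi>w v3_simps algebra_simps)
      show "M (semi_br sc2 (mat2 0 0 (- ?W * \<gamma>) (- ?W)) x y) = br (M x) (M y)" for x y
      proof -
        have "br (M x) (M y) = sc3 (fst x * snd (snd y) - snd (snd x) * fst y) (sc3 (- ?W) w) + sc3 (fst x * fst (snd y) - fst (snd x) * fst y) (sc3 (- ?W * \<gamma>) w)"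
          unfolding M_def comb[OF zw] gz gw ..
        then show ?thesis unfolding M_def
          by (simp add: semi_br_def mat2_def prod_eq_iff prod_sc_def algebra_simps)
      qed
    qed
  qed
qed

end

text \<open>The brackets a, b, c of basis vectors are the columns of the linear map behind the
  bracket. If they were independent, Cramer's rule would show by induction that every term of the
  derived series contains m times the whole lattice for some nonzero m, each step replacing m by m^2
  times the determinant.\<close>

lemma solvable_functional:
  assumes co: "lie_coords_lattice L \<phi> sc3 br dot3 3" and sol: "lie_solvable \<Z> L"
  shows "\<exists>\<psi>. \<psi> \<noteq> 0 \<and> (\<forall>x y. dot3 \<psi> (br x y) = 0)"
proof -
  interpret lie_coords_lattice L \<phi> sc3 br dot3 3 by (rule co)
  interpret B: bilinear_3 br
    by (intro bilinear_3.intro br_add_left br_add_right br_sc_left br_sc_right br_self)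
  define a where "a = br (0, 1, 0) (0, 0, 1)"
  define b where "b = br (0, 0, 1) (1, 0, 0)"
  define c where "c = br (1, 0, 0) (0, 1, 0)"
  let ?d = "dot3 a (cross b c)"
  have "?d = 0"
  proof (rule ccontr)
    assume d: "?d \<noteq> 0"
    have "\<exists>m. m \<noteq> 0 \<and> (\<forall>v. \<phi> (sc3 m v) \<in> derived_series \<Z> L k)" for k
    proof (induction k)
      case 0
      show ?case by (intro exI[of _ 1]) simp
    next
      case (Suc k)
      then obtain m where m: "m \<noteq> 0" "\<And>v. \<phi> (sc3 m v) \<in> derived_series \<Z> L k" by blast
      have "\<phi> (sc3 (m * m * ?d) v) \<in> derived_series \<Z> L (Suc k)" for v
        unfolding derived_series.simps commutator_submodule_def
      proof (rule InterI)
        fix H assume "H \<in> {H. submodule H \<Z> L \<and> (\<forall>x\<in>derived_series \<Z> L k. \<forall>y\<in>derived_series \<Z> L k. bracket L x y \<in> H)}"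
        then have H: "submodule H \<Z> L" and br: "\<And>x y. x \<in> derived_series \<Z> L k \<Longrightarrow> y \<in> derived_series \<Z> L k \<Longrightarrow> bracket L x y \<in> H"
          by blast+
        have smult: "k \<odot>\<^bsub>L\<^esub> x \<in> H" if "x \<in> H" for k x using L.submoduleE(4)[OF H _ that] by simp
        have brH: "\<phi> (sc3 (m * m) (br x y)) \<in> H" for x y
          using br[OF m(2)[of x] m(2)[of y]] by (simp add: \<phi>_br[symmetric] br_sc_left br_sc_right sc_mult)
        have "sc3 (m * m * ?d) v = sc3 (m * m) (sc3 ?d v)" by (rule sc_mult)
        also have "\<dots> = sc3 (m * m) (sc3 (dot3 v (cross b c)) a + (sc3 (dot3 v (cross c a)) b + sc3 (dot3 v (cross a b)) c))"
          by (rule arg_cong[OF cramer])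
        also have "\<dots> = sc3 (dot3 v (cross b c)) (sc3 (m * m) a) + (sc3 (dot3 v (cross c a)) (sc3 (m * m) b) + sc3 (dot3 v (cross a b)) (sc3 (m * m) c))"
          by (simp only: sc_dist sc_mult[symmetric] mult.commute)
        finally have "\<phi> (sc3 (m * m * ?d) v) = dot3 v (cross b c) \<odot>\<^bsub>L\<^esub> \<phi> (sc3 (m * m) a) \<oplus>\<^bsub>L\<^esub>
            (dot3 v (cross c a) \<odot>\<^bsub>L\<^esub> \<phi> (sc3 (m * m) b) \<oplus>\<^bsub>L\<^esub> dot3 v (cross a b) \<odot>\<^bsub>L\<^esub> \<phi> (sc3 (m * m) c))"
          by (simp only: \<phi>_add \<phi>_sc)
        also have "\<dots> \<in> H" unfolding a_def b_def c_def by (intro L.submoduleE(5)[OF H] smult brH)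
        finally show "\<phi> (sc3 (m * m * ?d) v) \<in> H" .
      qed
      then show ?case using m(1) d by (intro exI[of _ "m * m * ?d"]) simp
    qed
    moreover obtain k where "derived_series \<Z> L k = {\<zero>\<^bsub>L\<^esub>}" using sol by (auto simp: lie_solvable_def)
    ultimately obtain m where "m \<noteq> 0" "\<phi> (sc3 m (1, 0, 0)) = \<zero>\<^bsub>L\<^esub>" by blast
    then show False unfolding \<phi>_zero[symmetric] \<phi>_eq_iff by (simp add: v3_simps zero_prod_def)
  qed
  then obtain \<psi> where \<psi>: "\<psi> \<noteq> 0" "dot3 \<psi> a = 0" "dot3 \<psi> b = 0" "dot3 \<psi> c = 0" using det_zero_functional by blast
  have "dot3 \<psi> (B.N v) = 0" for v
    unfolding B.N_def a_def[symmetric] b_def[symmetric] c_def[symmetric] by (simp add: Z3.dot_add Z3.dot_sc \<psi>)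
  then have "dot3 \<psi> (br x y) = 0" for x y by (simp only: B.br_eq_N)
  then show ?thesis using \<psi>(1) by blast
qed

lemma PORC_rank_3:
  assumes co: "lie_coords_lattice L \<phi> sc3 br dot3 3" and rank: "module_rank \<Z> L = 3" and sol: "lie_solvable \<Z> L"
  shows "PORC star L"
proof -
  interpret lie_coords_lattice L \<phi> sc3 br dot3 3 by (rule co)
  interpret B: lie_3 br
    by (intro lie_3.intro bilinear_3.intro lie_3_axioms.intro br_add_left br_add_right br_sc_left br_sc_right br_self br_jacobi)
  obtain \<psi> where \<psi>: "\<psi> \<noteq> 0" "\<And>x y. dot3 \<psi> (br x y) = 0" using solvable_functional[OF co sol] by blast
  show ?thesis
  proof (rule B.normal_form[OF \<psi>])
    fix M A d a b c e
    assume d: "d \<noteq> 0" and M: "\<And>x y. M (x + y) = M x + M y" "\<And>k x. M (sc3 k x) = sc3 k (M x)"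
      and A: "\<And>x y. A (x + y) = A x + A y" "\<And>k x. A (sc3 k x) = sc3 k (A x)"
      and MA: "\<And>x. M (A x) = sc3 d x" "\<And>x. A (M x) = sc3 d x"
      and br': "\<And>x y. M (semi_br sc2 (mat2 a b c e) x y) = br (M x) (M y)"
    have "porc_count (\<lambda>p. count_lattices star sc3 br p i)" if i: "i \<le> 3" for i
      by (rule porc_change[where M = M and A = A and d = d and br' = "semi_br sc2 (mat2 a b c e)", OF M A MA d br' porc_semi_3[OF i] i])
    then show "PORC star L" by (rule PORC_by_counts[OF rank])
  qed
qed

theorem PORC_rank_le_3:
  fixes L :: "(int, 'b) lie_alg"
  assumes L: "Z_lie_algebra L" and sol: "lie_solvable \<Z> L" and rank: "module_rank \<Z> L \<le> 3"
  shows "PORC star L"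
proof -
  have lie: "lie_algebra \<Z> L" using L by (simp add: Z_lie_algebra_def)
  obtain B where B: "is_basis \<Z> L B" using L by (auto simp: Z_lie_algebra_def)
  have rank_B: "module_rank \<Z> L = card B" by (rule module_rank_eq[OF lie_algebra.axioms(1)[OF lie] B])
  have fin: "finite B" using B by (simp add: is_basis_def)
  note ex = lie_coords_exists[OF lie B]
  consider "card B = 0" | "card B = 1" | "card B = 2" | "card B = 3" using rank rank_B by linarith
  then show ?thesis
  proof cases
    case 1
    then have "B = {}" using fin by simp
    then have "coeffs (\<lambda>_ (x::num1). x) B (\<lambda>_ _. undefined)" using coeffs_empty by simp
    then obtain \<phi> br where co: "lie_coords_lattice L \<phi> (\<lambda>_ (x::num1). x) br (\<lambda>_ _. 0) 0" using ex[OF _ zlattice_num1] by blast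
    show ?thesis
    proof (rule lie_coords_lattice.PORC_by_counts[OF co])
      fix i :: nat assume "i \<le> 0"
      then have "i = 0 \<or> i = 0" by simp
      then show "porc_count (\<lambda>p. count_lattices star (\<lambda>_ x. x) br p i)" by (rule lie_coords_lattice.porc_extreme[OF co])
    qed (use rank_B 1 in simp)
  next
    case 2
    then obtain b where "B = {b}" by (rule card_1_singletonE)
    then have "coeffs (*) B (\<lambda>k. \<lambda>x\<in>{b}. k)" using coeffs_singleton[of b] by simp
    then obtain \<phi> br where co: "lie_coords_lattice L \<phi> (*) br (*) 1" using ex[OF _ zlattice_int] by blast
    show ?thesis
    proof (rule lie_coords_lattice.PORC_by_counts[OF co])
      fix i :: nat assume "i \<le> 1"
      then have "i = 0 \<or> i = 1" by linarith
      then show "porc_count (\<lambda>p. count_lattices star (*) br p i)" by (rule lie_coords_lattice.porc_extreme[OF co])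
    qed (use rank_B 2 in simp)
  next
    case 3
    then obtain b b' where B': "B = {b, b'}" "b \<noteq> b'" by (meson card_2_iff)
    have "b \<notin> {b'}" using B' by simp
    note c = coeffs_insert[OF coeffs_singleton[of b'] this, folded B'(1)]
    obtain \<phi> br where "lie_coords_lattice L \<phi> sc2 br dot2 2" using ex[OF c zlattice_2] by blast
    then show ?thesis by (rule PORC_rank_2) (use rank_B 3 in simp)
  next
    case 4
    then obtain b b' b'' where B': "B = {b, b', b''}" "b \<noteq> b'" "b \<noteq> b''" "b' \<noteq> b''" by (auto simp: card_3_iff)
    have b1: "b' \<notin> {b''}" and b2: "b \<notin> {b', b''}" using B' by auto
    note c = coeffs_insert[OF coeffs_insert[OF coeffs_singleton[of b''] b1] b2, folded B'(1)]
    obtain \<phi> br where "lie_coords_lattice L \<phi> sc3 br dot3 3" using ex[OF c zlattice_3] by blast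
    then show ?thesis by (rule PORC_rank_3) (use rank_B 4 sol in simp_all)
  qed
qed

section \<open>A solvable Lie ring of rank four\<close>

text \<open>Multiplication by a cube root theta of 2 in the basis 1, theta, theta^2.\<close>

definition cyc2 :: "int \<times> int \<times> int \<Rightarrow> int \<times> int \<times> int" where
  "cyc2 v = (2 * snd (snd v), fst v, fst (snd v))"

abbreviation sc4 :: "int \<Rightarrow> int \<times> int \<times> int \<times> int \<Rightarrow> int \<times> int \<times> int \<times> int" where "sc4 \<equiv> prod_sc (*) sc3"

abbreviation dot4 :: "int \<times> int \<times> int \<times> int \<Rightarrow> int \<times> int \<times> int \<times> int \<Rightarrow> int" where "dot4 \<equiv> prod_dot (*) dot3"

abbreviation br4 :: "int \<times> int \<times> int \<times> int \<Rightarrow> int \<times> int \<times> int \<times> int \<Rightarrow> int \<times> int \<times> int \<times> int" where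
  "br4 \<equiv> semi_br sc3 cyc2"

definition L4 :: "(int, int \<times> int \<times> int \<times> int) lie_alg" where
  "L4 = \<lparr>carrier = UNIV, monoid.mult = undefined, one = undefined, ring.zero = 0, ring.add = (+),
    module.smult = sc4, bracket = br4\<rparr>"

lemma L4_simps: "carrier L4 = UNIV" "\<zero>\<^bsub>L4\<^esub> = 0" "x \<oplus>\<^bsub>L4\<^esub> y = x + y" "k \<odot>\<^bsub>L4\<^esub> x = sc4 k x" "bracket L4 x y = br4 x y"
  by (simp_all add: L4_def)

lemma zlattice_4: "zlattice sc4 dot4 (1 + 3)"
  by (rule zlattice_prod[OF zlattice_int zlattice_3])

interpretation Z4: zlattice sc4 dot4 "1 + 3" by (rule zlattice_4)

lemma cyc2_linear: "cyc2 (x + y) = cyc2 x + cyc2 y" "cyc2 (sc3 k x) = sc3 k (cyc2 x)"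
  by (simp_all add: cyc2_def prod_sc_def)

lemmas br4_simps = semi_br_def cyc2_def prod_sc_def

lemma L4_lie: "lie_algebra \<Z> L4"
proof -
  have "abelian_group L4"
  proof (rule abelian_groupI)
    show "\<exists>y\<in>carrier L4. y \<oplus>\<^bsub>L4\<^esub> x = \<zero>\<^bsub>L4\<^esub>" for x
      by (rule bexI[of _ "- x"]) (simp_all add: L4_simps)
  qed (simp_all add: L4_simps ac_simps)
  then have "Module.module \<Z> L4"
    by (intro moduleI int_is_cring) (simp_all add: L4_simps Z4.sc_add Z4.sc_mult Z4.sc_dist Z4.sc_one)
  then show ?thesis
    by (intro lie_algebra.intro lie_algebra_axioms.intro)
      (simp_all add: L4_simps br4_simps prod_eq_iff algebra_simps)
qed

interpretation L4: lie_algebra \<Z> L4 by (rule L4_lie)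

lemma L4_basis: "is_basis \<Z> L4 {(1, 0, 0, 0), (0, 1, 0, 0), (0, 0, 1, 0), (0, 0, 0, 1)}" (is "is_basis _ _ ?B")
proof -
  have emp: "L4.lincomb {} c = 0" for c by (simp add: L4.lincomb_def L4_simps)
  have lin: "L4.lincomb ?B c = (c (1, 0, 0, 0), c (0, 1, 0, 0), c (0, 0, 1, 0), c (0, 0, 0, 1))" for c
    by (simp add: L4.lincomb_insert emp L4_simps prod_sc_def)
  define g where "g x = (\<lambda>b\<in>?B. dot4 b x)" for x
  have "bij_betw (L4.lincomb ?B) (?B \<rightarrow>\<^sub>E UNIV) UNIV"
  proof (rule bij_betwI[where g = g])
    show "g (L4.lincomb ?B c) = c" if c: "c \<in> ?B \<rightarrow>\<^sub>E UNIV" for c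
    proof
      fix b show "g (L4.lincomb ?B c) b = c b"
        using PiE_arb[OF c, of b] by (cases "b \<in> ?B") (auto simp: g_def lin prod_dot_def)
    qed
    show "L4.lincomb ?B (g x) = x" for x by (cases x) (simp add: lin g_def prod_dot_def)
  qed (auto simp: g_def)
  then show ?thesis unfolding L4.is_basis_iff by (simp add: L4_simps)
qed

lemma L4_rank: "module_rank \<Z> L4 = 4"
  using module_rank_eq[OF lie_algebra.axioms(1)[OF L4_lie] L4_basis] by simp

lemma L4_solvable: "lie_solvable \<Z> L4"
proof -
  have inv: "\<ominus>\<^bsub>L4\<^esub> x = - x" for x
    using L4.M.minus_equality[of "- x" x] by (simp add: L4_simps)
  let ?H = "{x :: int \<times> int \<times> int \<times> int. fst x = 0}"
  have "submodule ?H \<Z> L4"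
    by (rule L4.submoduleI) (auto simp: L4_simps inv prod_sc_def)
  moreover have "bracket L4 x y \<in> ?H" for x y by (simp add: L4_simps semi_br_def)
  ultimately have D1: "derived_series \<Z> L4 1 \<subseteq> ?H" by (auto simp: commutator_submodule_def)
  have "submodule {0} \<Z> L4"
    by (rule L4.submoduleI) (auto simp: L4_simps inv prod_sc_def zero_prod_def)
  moreover have "bracket L4 x y \<in> {0}" if "x \<in> derived_series \<Z> L4 1" "y \<in> derived_series \<Z> L4 1" for x y
  proof -
    have "fst x = 0" "fst y = 0" using D1 that by blast+
    then show ?thesis by (simp add: L4_simps br4_simps zero_prod_def)
  qed
  ultimately have D2: "derived_series \<Z> L4 2 \<subseteq> {0}" by (auto simp: commutator_submodule_def numeral_2_eq_2)
  have "0 \<in> commutator_submodule \<Z> L4 A B" for A B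
    unfolding commutator_submodule_def
  proof (rule InterI)
    fix H assume "H \<in> {H. submodule H \<Z> L4 \<and> (\<forall>x\<in>A. \<forall>y\<in>B. bracket L4 x y \<in> H)}"
    then show "0 \<in> H" using subgroup.one_closed[of H "add_monoid L4"] by (auto simp: submodule_def L4_simps)
  qed
  then have "0 \<in> derived_series \<Z> L4 2" by (simp add: numeral_2_eq_2)
  then have "derived_series \<Z> L4 2 = {\<zero>\<^bsub>L4\<^esub>}" using D2 by (auto simp: L4_simps)
  then show ?thesis unfolding lie_solvable_def by blast
qed

lemma L4_coords: "lie_coords_lattice L4 id sc4 br4 dot4 (1 + 3)"
proof (intro lie_coords_lattice.intro lie_coords.intro L4_lie zlattice_4)
  fix k x assume "\<And>h :: int \<times> int \<times> int \<times> int \<Rightarrow> int. (\<And>x y. h (x + y) = h x + h y) \<Longrightarrow> k dvd h x"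
  then have "k dvd dot4 y x" for y using Z4.dot_add by blast
  then show "\<exists>z. x = sc4 k z" by (rule Z4.separated)
qed (simp_all add: L4_simps)

section \<open>Eigenvectors modulo p and cube roots of 2\<close>

locale cyc2_mod =
  fixes p :: nat
  assumes prime_p: "prime p"
begin

sublocale semi sc3 dot3 3 p cyc2
  by (intro semi.intro zlattice_mod.intro zlattice_3 zlattice_mod_axioms.intro semi_axioms.intro prime_p cyc2_linear)

definition cube :: bool where "cube \<longleftrightarrow> (\<exists>k::int. [k ^ 3 = 2] (mod int p))"

lemma mem_K0: "v \<in> K0 \<longleftrightarrow> int p dvd fst v \<and> int p dvd fst (snd v) \<and> int p dvd snd (snd v)"
  unfolding K0_def range_prod_sc by (cases v) (auto simp: dvd_def)

lemma p_dvd_mult: "int p dvd a * b \<longleftrightarrow> int p dvd a \<or> int p dvd b"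
  using prime_p by (intro prime_dvd_mult_iff) simp

text \<open>Going once around the chain multiplies by k^3 and closes up with the factor 2, so 2 -
  k^3 kills x; and x = 0 would make y and z vanish too. The eigenvector equations of
  \<open>cyc2\<close> and of its transpose both have this form.\<close>

lemma cube_from_chain:
  assumes "int p dvd 2 * x - k * z" "int p dvd z - k * y" "int p dvd y - k * x" "\<not> (int p dvd x \<and> int p dvd y \<and> int p dvd z)"
  shows cube
proof -
  have "(2 - k ^ 3) * x = (2 * x - k * z) + k * (z - k * y) + (k * k) * (y - k * x)" by (simp add: algebra_simps power3_eq_cube)
  then have *: "int p dvd (2 - k ^ 3) * x" using assms(1-3) by simp
  have "\<not> int p dvd x"
  proof
    assume x: "int p dvd x"
    then have "int p dvd (y - k * x) + k * x" using assms(3) by (intro dvd_add dvd_mult)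
    then have y: "int p dvd y" by simp
    then have "int p dvd (z - k * y) + k * y" using assms(2) by (intro dvd_add dvd_mult)
    then show False using x y assms(4) by simp
  qed
  then have "int p dvd 2 - k ^ 3" using * unfolding p_dvd_mult by blast
  then have "[2 = k ^ 3] (mod int p)" by (simp add: cong_iff_dvd_diff)
  then show ?thesis unfolding cube_def using cong_sym by blast
qed

lemma eigen_iff: "(\<exists>\<eta>. \<eta> \<notin> K0 \<and> eigen_functional \<eta>) \<longleftrightarrow> cube"
proof
  assume "\<exists>\<eta>. \<eta> \<notin> K0 \<and> eigen_functional \<eta>"
  then obtain \<eta> where \<eta>: "\<eta> \<notin> K0" "eigen_functional \<eta>" by blast
  obtain u where u: "[dot3 \<eta> u = 1] (mod int p)" using exists_dual[OF \<eta>(1)] by blast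
  \<comment> \<open>Since \<open>u\<close> has value 1 under the covector, the value at its image is
    the eigenvalue.\<close>
  define k where "k = dot3 \<eta> (cyc2 u)"
  have *: "int p dvd dot3 \<eta> (cyc2 v) - k * dot3 \<eta> v" for v
  proof -
    have "int p dvd dot3 \<eta> v * (1 - dot3 \<eta> u)" using u by (metis cong_iff_dvd_diff cong_sym dvd_mult)
    then have "int p dvd dot3 \<eta> (v - sc3 (dot3 \<eta> v) u)" by (simp add: Z3.dot_diff Z3.dot_sc algebra_simps)
    then have "int p dvd dot3 \<eta> (cyc2 (v - sc3 (dot3 \<eta> v) u))" using \<eta>(2) unfolding eigen_functional_def by blast
    then show ?thesis by (simp add: D_diff D_sc Z3.dot_diff Z3.dot_sc k_def mult.commute)
  qed
  obtain x y z where xyz: "\<eta> = (x, y, z)" by (cases \<eta>)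
  show cube
    by (rule cube_from_chain[of x k z y])
      (use *[of "(1, 0, 0)"] *[of "(0, 1, 0)"] *[of "(0, 0, 1)"] \<eta>(1) in \<open>auto simp: xyz cyc2_def v3_simps mem_K0 mult.commute\<close>)
next
  assume cube
  then obtain k where k: "[k ^ 3 = 2] (mod int p)" unfolding cube_def by blast
  let ?\<eta> = "(1, k, k * k)"
  have "?\<eta> \<notin> K0" using prime_gt_1_nat[OF prime_p] by (simp add: mem_K0)
  moreover have "eigen_functional ?\<eta>" unfolding eigen_functional_def
  proof (intro allI impI)
    fix u assume u: "int p dvd dot3 ?\<eta> u"
    have "dot3 ?\<eta> (cyc2 u) = k * dot3 ?\<eta> u - (k ^ 3 - 2) * snd (snd u)"
      by (cases u) (simp add: v3_simps cyc2_def algebra_simps power3_eq_cube)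
    moreover have "int p dvd k ^ 3 - 2" using k by (simp add: cong_iff_dvd_diff)
    ultimately show "int p dvd dot3 ?\<eta> (cyc2 u)" using u by (simp add: dvd_diff)
  qed
  ultimately show "\<exists>\<eta>. \<eta> \<notin> K0 \<and> eigen_functional \<eta>" by blast
qed

lemma line_iff: "(\<exists>v. v \<notin> K0 \<and> cyc2 v \<in> line v) \<longleftrightarrow> cube"
proof
  assume "\<exists>v. v \<notin> K0 \<and> cyc2 v \<in> line v"
  then obtain v k where v: "v \<notin> K0" "cyc2 v - sc3 k v \<in> K0" unfolding line_def by blast
  obtain x y z where xyz: "v = (x, y, z)" by (cases v)
  show cube
    by (rule cube_from_chain[of z k x y]) (use v in \<open>auto simp: xyz mem_K0 cyc2_def v3_simps\<close>)
next
  assume cube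
  then obtain k where k: "[k ^ 3 = 2] (mod int p)" unfolding cube_def by blast
  let ?v = "(k * k, k, 1)"
  have "?v \<notin> K0" using prime_gt_1_nat[OF prime_p] by (simp add: mem_K0)
  moreover have "int p dvd 2 - k ^ 3" using cong_sym[OF k] by (simp add: cong_iff_dvd_diff)
  then have "cyc2 ?v - sc3 k ?v \<in> K0" by (simp add: mem_K0 cyc2_def v3_simps power3_eq_cube mult.assoc)
  then have "cyc2 ?v \<in> line ?v" unfolding line_def by blast
  ultimately show "\<exists>v. v \<notin> K0 \<and> cyc2 v \<in> line v" by blast
qed

lemma card_cosets_eq_1:
  assumes "\<And>v. v \<in> K0 \<Longrightarrow> P v" "\<not> (\<exists>v. v \<notin> K0 \<and> P v)" shows "card (add_coset K0 ` {v. P v}) = 1"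
proof -
  have "{v. P v} = K0" using assms by blast
  then show ?thesis using card_cosets_K0 by simp
qed

lemma card_cosets_ge_2:
  assumes "P 0" "\<exists>v. v \<notin> K0 \<and> P v" shows "card (add_coset K0 ` {v. P v}) \<ge> 2"
proof -
  obtain v where v: "v \<notin> K0" "P v" using assms(2) by blast
  have "add_coset K0 v \<noteq> add_coset K0 0" using v(1) by (simp add: add_coset_K0_eq)
  then have "card {add_coset K0 v, add_coset K0 0} = 2" by simp
  moreover have "{add_coset K0 v, add_coset K0 0} \<subseteq> add_coset K0 ` {v. P v}" using v(2) assms(1) by blast
  ultimately show ?thesis using card_mono[OF finite_cosets] by metis
qed

text \<open>The abelian ideal is always a subalgebra of codimension 1, coming from the covectors
  with zero second part. Any other one comes from a nonzero eigenvector of the transpose of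
  \<open>cyc2\<close>, which makes the count larger than 1.\<close>

lemma subalgebras_count: "count_lattices Subalgebras SC br p 1 = 1 \<longleftrightarrow> \<not> cube"
proof -
  let ?c = "count_lattices Subalgebras SC br p 1" and ?E = "card (add_coset K0 ` {\<eta>. eigen_functional \<eta>})"
  have eq: "?c * (p - 1) = p * ?E - 1" by (rule subalgebras_index_p)
  have p: "p > 1" by (rule prime_gt_1_nat[OF prime_p])
  have K0: "eigen_functional \<eta>" if "\<eta> \<in> K0" for \<eta>
  proof -
    have "int p dvd dot3 \<eta> u" for u using that mem_K0_iff[of \<eta>] Z3.dot_commute[of \<eta> u] by metis
    then show ?thesis unfolding eigen_functional_def by blast
  qed
  show ?thesis
  proof (cases cube)
    case True
    have "?E \<ge> 2" by (intro card_cosets_ge_2 K0 add_subgroup_zero[OF K0_subgroup]) (use eigen_iff True in blast)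
    then have "p * 2 \<le> p * ?E" by simp
    then have "?c * (p - 1) \<noteq> 1 * (p - 1)" using eq p by linarith
    then show ?thesis using True by auto
  next
    case False
    have "?E = 1" by (intro card_cosets_eq_1 K0; (assumption | (simp only: eigen_iff False not_False_eq_True)))
    then have "?c * (p - 1) = 1 * (p - 1)" using eq by simp
    then have "?c = 1" using p by simp
    then show ?thesis using False by simp
  qed
qed

text \<open>The ideals of codimension 3 are the eigenlines of \<open>cyc2\<close> in the abelian
  ideal, and an eigenvalue is a cube root of 2.\<close>

lemma ideals_count: "count_lattices Ideals SC br p 3 = 0 \<longleftrightarrow> \<not> cube"
proof -
  let ?c = "count_lattices Ideals SC br p 3" and ?E = "card (add_coset K0 ` {v. cyc2 v \<in> line v})"
  have p: "p > 1" by (rule prime_gt_1_nat[OF prime_p])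
  \<comment> \<open>The image (0, 1, 0) is nonzero modulo every prime, which puts the line count
    into its nontrivial case.\<close>
  have "cyc2 (1, 0, 0) \<notin> K0" using p by (simp add: cyc2_def mem_K0)
  then have eq: "?c * (p - 1) = ?E - 1" by (rule ideals_lines)
  have K0: "cyc2 v \<in> line v" if "v \<in> K0" for v using D_K0[OF that] lattice_K0[OF line_lattice] by blast
  show ?thesis
  proof (cases cube)
    case True
    have "?E \<ge> 2" by (intro card_cosets_ge_2 K0 add_subgroup_zero[OF K0_subgroup]) (use line_iff True in blast)
    then have "?c * (p - 1) \<noteq> 0" using eq by linarith
    then show ?thesis using True by auto
  next
    case False
    have "?E = 1" by (intro card_cosets_eq_1 K0; (assumption | (simp only: line_iff False not_False_eq_True)))
    then have "?c * (p - 1) = 0" using eq by simp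
    then have "?c = 0" using p by simp
    then show ?thesis using False by simp
  qed
qed

end

theorem L4_not_PORC: "\<not> PORC star L4"
proof -
  have count: "count_codim star (residue_ring (int p)) (lie_tensor L4 (residue_ring (int p))) i = count_lattices star sc4 br4 p i"
    if "prime p" "i \<le> 4" for p i star using lie_coords_lattice.count_codim_eq[OF L4_coords that(1)] that(2) by simp
  have count1: "count_codim star (residue_ring (int p)) (lie_tensor L4 (residue_ring (int p))) 1 = count_lattices star sc4 br4 p 1"
    and count3: "count_codim star (residue_ring (int p)) (lie_tensor L4 (residue_ring (int p))) 3 = count_lattices star sc4 br4 p 3"
    if "prime p" for p star using count[OF that] by simp_all
  have cube: "cyc2_mod.cube p \<longleftrightarrow> (\<exists>x::int. [x ^ 3 = 2] (mod int p))" if "prime p" for p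
    by (rule cyc2_mod.cube_def) (rule cyc2_mod.intro[OF that])
  have sub: "count_codim Subalgebras (residue_ring (int p)) (lie_tensor L4 (residue_ring (int p))) 1 = 1 \<longleftrightarrow>
      \<not> (\<exists>x::int. [x ^ 3 = 2] (mod int p))" if "prime p" for p
    unfolding cube[OF that, symmetric] count1[OF that] by (rule cyc2_mod.subalgebras_count[OF cyc2_mod.intro[OF that]])
  have ideal: "count_codim Ideals (residue_ring (int p)) (lie_tensor L4 (residue_ring (int p))) 3 = 0 \<longleftrightarrow>
      \<not> (\<exists>x::int. [x ^ 3 = 2] (mod int p))" if "prime p" for p
    unfolding cube[OF that, symmetric] count3[OF that] by (rule cyc2_mod.ideals_count[OF cyc2_mod.intro[OF that]])
  show ?thesis
  proof (cases star)
    case Subalgebras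
    have "\<not> PORC Subalgebras L4"
      by (rule not_PORC_I[where i = 1 and k = 1 and P = 0]) (use sub L4_rank in \<open>simp_all del: One_nat_def\<close>)
    then show ?thesis using Subalgebras by simp
  next
    case Ideals
    have "\<not> PORC Ideals L4"
      by (rule not_PORC_I[where i = 3 and k = 0 and P = 0]) (use ideal L4_rank in simp_all)
    then show ?thesis using Ideals by simp
  qed
qed

theorem theorem1p17:
  fixes star :: substructure
  shows "(\<forall>L :: (int, 'b) lie_alg.
            Z_lie_algebra L \<and> lie_solvable \<Z> L \<and> module_rank \<Z> L \<le> 3 \<longrightarrow> PORC star L)
       \<and> (\<exists>L :: (int, int \<times> int \<times> int \<times> int) lie_alg.
            Z_lie_algebra L \<and> lie_solvable \<Z> L \<and> module_rank \<Z> L = 4 \<and> \<not> PORC star L)"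
proof (intro conjI allI impI)
  fix L :: "(int, 'b) lie_alg" assume "Z_lie_algebra L \<and> lie_solvable \<Z> L \<and> module_rank \<Z> L \<le> 3"
  then show "PORC star L" by (intro PORC_rank_le_3) auto
next
  have "Z_lie_algebra L4" unfolding Z_lie_algebra_def using L4_lie L4_basis by blast
  then show "\<exists>L :: (int, int \<times> int \<times> int \<times> int) lie_alg.
            Z_lie_algebra L \<and> lie_solvable \<Z> L \<and> module_rank \<Z> L = 4 \<and> \<not> PORC star L"
    using L4_solvable L4_rank L4_not_PORC by blast
qed

end
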